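(* Let $A$ be a finite-dimensional commutative Frobenius algebra over a field $K$ of characteristic $0$ and let $(x_\alpha,y_\alpha,\omega_\alpha^{a-b})_{\alpha=1,\dots,r}$ be spectral curve data as in the context. The Frobenius algebra twisted topological recursion $$\begin{aligned} \mathcal W_{g,n}(z_1,\dots,z_n;v_1,\dots,v_n)=\frac{1}{2\pi i}\sum_{\alpha=1}^r\oint_{\partial U_\alpha}\sum_{a,b,k,\ell}&\frac{\omega_\alpha^{\sigma_\alpha(z)-z}(z_1)\,\eta(e_ke_\ell,v_1)\eta^{ka}\eta^{\ell b}}{\big(y_\alpha(\sigma_\alpha(z))-y_\alpha(z)\big)dx_\alpha(z)}\\ \times\Big[\mathcal W_{g-1,n+1}\big(z,\sigma_\alpha(z),z_2,\dots,z_n;e_a,e_b,v_2,\dots,v_n\big)&\\ +\sum_{\substack{g_1+g_2=g\\ I\sqcup J=\{2,\dots,n\}}}^{\text{No }(0,1)}\mathcal W_{g_1,|I|+1}(z,z_I;e_a,v_I)\,&\mathcal W_{g_2,|J|+1}\big(\sigma_\alpha(z),z_J;e_b,v_J\big)\Big],\qquad 2g-2+n>0, \end{aligned}$$ uniquely determines the $(A^{\otimes n})^*$-valued $n$-linear differential form $\mathcal W_{g,n}$ from the initial data $\mathcal W_{0,2}$. If the initial data is given by $$\mathcal W_{0,2}(z_1,z_2;v_1,v_2)=W_{0,2}(z_1,z_2)\cdot\eta(v_1,v_2)$$ for the $2$-form $W_{0,2}(z_1,z_2)=d_{z_1}\omega_\alpha^{z_1-b}(z_2)$ (for $z_1,z_2\in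 U_\alpha$), then there exist a solution $\{W_{g,n}\}$ of the topological recursion $$\begin{aligned}W_{g,n}(z_1,\dots,z_n)=\frac{1}{2\pi i}\sum_{\alpha=1}^r\oint_{\partial U_\alpha}&\frac{\omega_\alpha^{\sigma_\alpha(z)-z}(z_1)}{\big(y_\alpha(\sigma_\alpha(z))-y_\alpha(z)\big)dx_\alpha(z)}\Big[W_{g-1,n+1}\big(z,\sigma_\alpha(z),z_2,\dots,z_n\big)\\&+\sum_{\substack{g_1+g_2=g\\ I\sqcup J=\{2,\dots,n\}}}^{\text{No }(0,1)}W_{g_1,|I|+1}(z,z_I)W_{g_2,|J|+1}\big(\sigma_\alpha(z),z_J\big)\Big],\qquad 2g-2+n>0,\end{aligned}$$ and a two-dimensional topological quantum field theory $\{\omega_{g,n}\}$ such that $$\mathcal W_{g,n}(z_1,\dots,z_n;v_1,\dots,v_n)=W_{g,n}(z_1,\dots,z_n)\cdot\omega_{g,n}(v_1,\dots,v_n).$$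
   Context: Frobenius algebra: $A$ is a finite-dimensional unital associative commutative algebra over $K$ with a linear counit $\epsilon:A\to K$ such that the Frobenius form $\eta(u,v)=\epsilon(uv)$ is non-degenerate. For a $K$-basis $(e_i)$ of $A$, $\eta_{ij}=\eta(e_i,e_j)$ and $[\eta^{ij}]=[\eta_{ij}]^{-1}$; the indices $a,b,k,\ell$ run over the basis. Spectral curve: a disjoint union of $r$ copies $U_1,\dots,U_r$ of the unit disc $U$ centered at $0$ of the complex $z$-line. On $U_\alpha$ one has functions with Taylor expansions $x_\alpha(z)=z^2+\sum_{k\ge3}a_{\alpha,k}z^k$, $y_\alpha(z)=z+\sum_{k\ge2}b_{\alpha,k}z^k$; each $x_\alpha:U_\alpha\to\mathbb C$ is a $2:1$ map, so there is an involution $\sigma_\alpha:U_\alpha\to U_\alpha$ with $x_\alpha(\sigma_\alpha(z))=x_\alpha(z)$. There is also a meromorphic $1$-form (Cauchy kernel) $\omega_\alpha^{a-b}(z)=\frac{dz}{z-a}-\frac{dz}{z-b}+\omega_\alpha$ on $U_\alpha$, where $a,b\in U_\alpha$ and $\omega_\alpha$ is a holomorphic $1$-form on $U_\alpha$. In $W_{0,2}$ the constant $b\in U_\alpha$ plays no role. Forms: the $W_{g,n}$ are symmetric meromorphic $n$-differential forms defined on the disjoint union $U_1^n\sqcup\cdots\sqcup U_r^n$, and $\mathcal W_{g,n}=\mathcal W_{g,n}(z_1,\dots,z_n):A^{\otimes n}\to K$ is the corresponding $(A^{\otimes n})^*$-valued object, with value on $v_1\otimes\cdots\otimes v_n$ written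 $\mathcal W_{g,n}(z_1,\dots,z_n;v_1,\dots,v_n)$. The integration is in the variable $z\in\partial U_\alpha$. The factor $1/dx_\alpha(z)$ is contraction with the vector field $\frac{\partial z}{\partial x_\alpha}\frac{\partial}{\partial z}$ on $U_\alpha$, which turns the quadratic differential in $z$ in the bracket into a meromorphic $1$-form in $z$; multiplication by $\omega_\alpha^{\sigma_\alpha(z)-z}(z_1)$ is the symmetric tensor product with a $1$-form proportional to $dz_1$. Here $z_I=(z_i)_{i\in I}$, $v_I=(v_i)_{i\in I}$; "No $(0,1)$" means that $g_1=0,\ I=\emptyset$ and $g_2=0,\ J=\emptyset$ are not allowed. Terms with negative genus are zero. Two-dimensional TQFT: a system of $S_n$-invariant linear maps $\omega_{g,n}:A^{\otimes n}\to K$, $g\ge0$, $n\ge1$, with $\omega_{0,1}=\epsilon$, $\omega_{0,2}=\eta$, $\omega_{0,3}(v_1,v_2,v_3)=\eta(v_1v_2,v_3)$ and, in the stable range $2g-2+n>0$ for all indices, (1) $\omega_{g,n+1}(v_1,\dots,v_n,\mathbf 1)=\omega_{g,n}(v_1,\dots,v_n)$; (2) $\omega_{g,n}(v_1,\dots,v_n)=\sum_{a,b}\omega_{g-1,n+2}(v_1,\dots,v_n,e_a,e_b)\eta^{ab}$; (3) $\omega_{g_1+g_2,|I|+|J|}(v_I,v_J)=\sum_{a,b}\eta^{ab}\omega_{g_1,|I|+1}(v_I,e_a)\,\omega_{g_2,|J|+1}(v_J,e_b)$ for $I\sqcup J=\{1,\dots,n\}$. *)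

theory Defs
  imports "HOL-Complex_Analysis.Complex_Analysis" "HOL-Library.Multiset"
begin

section \<open>Frobenius algebras and two-dimensional TQFT\<close>

locale frobenius_algebra = finite_dimensional_vector_space smul B
  for smul :: "'k::field \<Rightarrow> 'a::comm_ring_1 \<Rightarrow> 'a" and B :: "'a set" +
  fixes eps :: "'a \<Rightarrow> 'k"
  assumes smul_mult_left: "smul c (u * v) = smul c u * v"
    and linear_eps: "Vector_Spaces.linear smul (*) eps"
    and nondegenerate: "(\<And>v. eps (u * v) = 0) \<Longrightarrow> u = 0"

definition frob_form :: "('a::comm_ring_1 \<Rightarrow> 'k) \<Rightarrow> 'a \<Rightarrow> 'a \<Rightarrow> 'k" where
  "frob_form eps u v = eps (u * v)"

text \<open>
  The matrix \<open>\<eta>\<^sup>a\<^sup>b\<close> inverse to the Gram matrix of the Frobenius form. Its rows and columns are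
  indexed by the elements of the basis themselves; only entries in \<open>B \<times> B\<close> are meaningful.
\<close>
definition frob_inv :: "'a set \<Rightarrow> ('a::comm_ring_1 \<Rightarrow> 'k::field) \<Rightarrow> 'a \<Rightarrow> 'a \<Rightarrow> 'k" where
  "frob_inv B eps = (SOME M. \<forall>a\<in>B. \<forall>b\<in>B.
      (\<Sum>c\<in>B. frob_form eps a c * M c b) = (if a = b then 1 else 0))"

text \<open>
  An element of the dual of the \<open>n\<close>-th tensor power is an \<open>n\<close>-linear form, given on lists of
  vectors of length \<open>n\<close>.
\<close>
definition multilinear_form ::
    "('k::field \<Rightarrow> 'a::ab_group_add \<Rightarrow> 'a) \<Rightarrow> ('k \<Rightarrow> 'l::ab_group_add \<Rightarrow> 'l) \<Rightarrow> nat \<Rightarrow> ('a list \<Rightarrow> 'l) \<Rightarrow> bool" where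
  "multilinear_form smul smul' n f \<longleftrightarrow>
     (\<forall>vs. length vs = n \<longrightarrow> (\<forall>i<n. Vector_Spaces.linear smul smul' (\<lambda>v. f (vs[i := v]))))"

definition stable :: "nat \<Rightarrow> nat \<Rightarrow> bool" where
  "stable g n \<longleftrightarrow> n \<ge> 1 \<and> 2 * int g - 2 + int n > 0"

definition tqft ::
    "('k::field \<Rightarrow> 'a::comm_ring_1 \<Rightarrow> 'a) \<Rightarrow> 'a set \<Rightarrow> ('a \<Rightarrow> 'k) \<Rightarrow> (nat \<Rightarrow> 'a list \<Rightarrow> 'k) \<Rightarrow> bool" where
  "tqft smul B eps \<omega> \<longleftrightarrow>
     (\<forall>g n. n \<ge> 1 \<longrightarrow> multilinear_form smul (*) n (\<omega> g)) \<and>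
     (\<forall>g us vs. us \<noteq> [] \<longrightarrow> mset us = mset vs \<longrightarrow> \<omega> g us = \<omega> g vs) \<and>
     (\<forall>v. \<omega> 0 [v] = eps v) \<and>
     (\<forall>u v. \<omega> 0 [u, v] = frob_form eps u v) \<and>
     (\<forall>u v w. \<omega> 0 [u, v, w] = frob_form eps (u * v) w) \<and>
     (\<forall>g vs. stable g (length vs) \<longrightarrow> \<omega> g (vs @ [1]) = \<omega> g vs) \<and>
     (\<forall>g vs. g \<ge> 1 \<longrightarrow> stable g (length vs) \<longrightarrow>
        \<omega> g vs = (\<Sum>a\<in>B. \<Sum>b\<in>B. \<omega> (g - 1) (vs @ [a, b]) * frob_inv B eps a b)) \<and>
     (\<forall>g1 g2 us vs. us @ vs \<noteq> [] \<longrightarrow> stable g1 (length us + 1) \<longrightarrow> stable g2 (length vs + 1) \<longrightarrow>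
        stable (g1 + g2) (length us + length vs) \<longrightarrow>
        \<omega> (g1 + g2) (us @ vs) =
          (\<Sum>a\<in>B. \<Sum>b\<in>B. frob_inv B eps a b * \<omega> g1 (us @ [a]) * \<omega> g2 (vs @ [b])))"


section \<open>The ring of coefficients\<close>

text \<open>
  Products of complex differential forms with \<open>K\<close>-valued linear forms take their values in a
  commutative ring \<open>L\<close> that receives ring homomorphisms \<open>emb\<close> from the complex numbers and
  \<open>\<iota>\<close> from \<open>K\<close>. This covers \<open>L = K\<close> if \<open>K\<close> contains the complex numbers, \<open>L = \<complex>\<close> if \<open>K\<close> is
  contained in them, and the tensor product of \<open>K\<close> and \<open>\<complex>\<close> over the rationals in general.
\<close>
definition is_ring_hom :: "('r::comm_ring_1 \<Rightarrow> 's::comm_ring_1) \<Rightarrow> bool" where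
  "is_ring_hom f \<longleftrightarrow> f 1 = 1 \<and> (\<forall>x y. f (x + y) = f x + f y) \<and> (\<forall>x y. f (x * y) = f x * f y)"

text \<open>
  Contour integrals of \<open>L\<close>-valued functions, for \<open>L\<close> a complex vector space through \<open>emb\<close>: the
  integral is tested against all complex linear functionals on \<open>L\<close>. These separate points, so the
  value is unique, and for functions \<open>z \<mapsto> \<Sum>j. emb (f\<^sub>j z) * c\<^sub>j\<close> it is the termwise integral.
\<close>
definition has_coeff_contour_integral ::
    "(complex \<Rightarrow> 'l::comm_ring_1) \<Rightarrow> (complex \<Rightarrow> 'l) \<Rightarrow> 'l \<Rightarrow> (real \<Rightarrow> complex) \<Rightarrow> bool" where
  "has_coeff_contour_integral emb F I \<gamma> \<longleftrightarrow>
     (\<forall>\<phi>. Vector_Spaces.linear (\<lambda>c l. emb c * l) (*) \<phi> \<longrightarrow>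
        ((\<lambda>z. \<phi> (F z)) has_contour_integral \<phi> I) \<gamma>)"


section \<open>Meromorphic functions of several variables\<close>

definition polydisc :: "complex list \<Rightarrow> real \<Rightarrow> complex list set" where
  "polydisc p e = {q. list_all2 (\<lambda>u v. dist u v < e) p q}"

definition disc_power :: "nat \<Rightarrow> complex list set" where
  "disc_power n = {zs. length zs = n \<and> set zs \<subseteq> ball 0 1}"

text \<open>Holomorphic in several variables: continuous, and holomorphic in each variable.\<close>
definition holomorphic_several :: "(complex list \<Rightarrow> complex) \<Rightarrow> complex list \<Rightarrow> real \<Rightarrow> bool" where
  "holomorphic_several f p e \<longleftrightarrow>
     (\<forall>q\<in>polydisc p e. \<forall>d>0. \<exists>c>0. \<forall>q'\<in>polydisc q c. dist (f q') (f q) < d) \<and>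
     (\<forall>q\<in>polydisc p e. \<forall>i<length q. (\<lambda>t. f (q[i := t])) field_differentiable at (q ! i))"

text \<open>
  \<open>L\<close>-valued holomorphic functions on the polydisc of radius \<open>e\<close> about \<open>p\<close>: finite sums of complex
  valued ones with coefficients in \<open>L\<close>. For \<open>emb\<close> the identity of the complex numbers this is
  \<^const>\<open>holomorphic_several\<close>.
\<close>
definition coeff_holomorphic ::
    "(complex \<Rightarrow> 'l::comm_ring_1) \<Rightarrow> (complex list \<Rightarrow> 'l) \<Rightarrow> complex list \<Rightarrow> real \<Rightarrow> bool" where
  "coeff_holomorphic emb f p e \<longleftrightarrow>
     (\<exists>m a c. (\<forall>j<m. holomorphic_several (a j) p e) \<and>
        (\<forall>q\<in>polydisc p e. f q = (\<Sum>j<(m::nat). emb (a j q) * c j)))"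

text \<open>
  Meromorphic functions on the \<open>n\<close>-th power of the unit disc: locally a quotient of holomorphic
  functions. As in \<^const>\<open>nicely_meromorphic_on\<close>, the values are normalised: \<open>f\<close> is holomorphic
  near every point to which it extends holomorphically, and takes the value 0 at all others (poles
  and points of indeterminacy). Hence two such functions are equal as meromorphic functions iff
  they are equal pointwise.
\<close>
definition meromorphic_several ::
    "(complex \<Rightarrow> 'l::comm_ring_1) \<Rightarrow> nat \<Rightarrow> (complex list \<Rightarrow> 'l) \<Rightarrow> bool" where
  "meromorphic_several emb n f \<longleftrightarrow>
     (\<forall>p\<in>disc_power n. \<exists>e>0. \<exists>a b.
        coeff_holomorphic emb a p e \<and> holomorphic_several b p e \<and>
        (\<exists>q\<in>polydisc p e. b q \<noteq> 0) \<and>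
        (\<forall>q\<in>polydisc p e. b q \<noteq> 0 \<longrightarrow> emb (b q) * f q = a q) \<and>
        ((\<exists>d>0. coeff_holomorphic emb f p d) \<or>
         f p = 0 \<and> \<not> (\<exists>d>0. \<exists>c. coeff_holomorphic emb c p d \<and>
                         (\<forall>q\<in>polydisc p d. b q \<noteq> 0 \<longrightarrow> f q = c q))))"

text \<open>
  Identities of meromorphic functions on the \<open>n\<close>-th power of the disc: the identity holds on a
  dense open set.
\<close>
definition generically :: "nat \<Rightarrow> (complex list \<Rightarrow> bool) \<Rightarrow> bool" where
  "generically n P \<longleftrightarrow>
     (\<exists>D\<subseteq>disc_power n. (\<forall>p\<in>D. \<exists>e>0. polydisc p e \<subseteq> D) \<and>
        (\<forall>p\<in>disc_power n. \<forall>e>0. polydisc p e \<inter> D \<noteq> {}) \<and> (\<forall>p\<in>D. P p))"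


section \<open>Spectral curves\<close>

text \<open>
  The discs are numbered by \<open>\<alpha> \<in> {1..r}\<close>; \<open>h \<alpha>\<close> is the coefficient of the holomorphic 1-form
  \<open>\<omega>\<^sub>\<alpha> = h \<alpha> z dz\<close> in the Cauchy kernel. The fibre of \<open>x \<alpha>\<close> through the ramification point 0 is
  exempt from having two elements.
\<close>
definition spectral_curve ::
    "nat \<Rightarrow> (nat \<Rightarrow> complex \<Rightarrow> complex) \<Rightarrow> (nat \<Rightarrow> complex \<Rightarrow> complex) \<Rightarrow> (nat \<Rightarrow> complex \<Rightarrow> complex) \<Rightarrow> bool" where
  "spectral_curve r x y h \<longleftrightarrow>
     (\<forall>\<alpha>\<in>{1..r}.
        (\<exists>a. \<forall>z\<in>ball 0 1. (\<lambda>k. a (k + 3) * z ^ (k + 3)) sums (x \<alpha> z - z ^ 2)) \<and>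
        (\<exists>b. \<forall>z\<in>ball 0 1. (\<lambda>k. b (k + 2) * z ^ (k + 2)) sums (y \<alpha> z - z)) \<and>
        (\<forall>z\<in>ball 0 1 - {0}. card {w \<in> ball 0 1. x \<alpha> w = x \<alpha> z} = 2) \<and>
        h \<alpha> holomorphic_on ball 0 1)"

text \<open>The involution of the disc exchanging the two points of each fibre of \<open>x\<close>.\<close>
definition deck :: "(complex \<Rightarrow> complex) \<Rightarrow> complex \<Rightarrow> complex" where
  "deck x z = (if z = 0 then 0 else (THE w. w \<in> ball 0 1 \<and> w \<noteq> z \<and> x w = x z))"

text \<open>Coefficient of \<open>dz\<close> in \<open>\<omega>\<^sub>\<alpha>\<^bsup>a-b\<^esup>(z)\<close>, for \<open>h\<close> the coefficient of \<open>\<omega>\<^sub>\<alpha>\<close>.\<close>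
definition cauchy_kernel :: "(complex \<Rightarrow> complex) \<Rightarrow> complex \<Rightarrow> complex \<Rightarrow> complex \<Rightarrow> complex" where
  "cauchy_kernel h a b z = 1 / (z - a) - 1 / (z - b) + h z"

text \<open>Coefficient of \<open>dz\<^sub>1 dz\<^sub>2\<close> in \<open>d\<^bsub>z\<^sub>1\<^esub> \<omega>\<^sub>\<alpha>\<^bsup>z\<^sub>1-b\<^esup>(z\<^sub>2)\<close>, off the diagonal.\<close>
definition W02 :: "(complex \<Rightarrow> complex) \<Rightarrow> complex \<Rightarrow> complex \<Rightarrow> complex \<Rightarrow> complex" where
  "W02 h b z1 z2 = deriv (\<lambda>a. cauchy_kernel h a b z2) z1"


section \<open>Topological recursion\<close>

text \<open>
  An \<open>n\<close>-differential form on the disjoint union of the \<open>U\<^sub>\<alpha>\<^sup>n\<close> is represented by its coefficient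
  \<open>W g \<alpha> [z\<^sub>1, \<dots>, z\<^sub>n]\<close> with respect to \<open>dz\<^sub>1 \<cdots> dz\<^sub>n\<close> on \<open>U\<^sub>\<alpha>\<^sup>n\<close>; the \<open>A\<close>-twisted forms take the list
  \<open>[v\<^sub>1, \<dots>, v\<^sub>n]\<close> as a further argument.

  The recursion expresses the form at \<open>z\<^sub>1, \<dots>, z\<^sub>n \<in> U\<^sub>\<beta>\<close> by a sum over all \<open>\<alpha>\<close>. The 1-form
  \<open>\<omega>\<^sub>\<alpha>\<^bsup>a-b\<^esup>\<close> lives on \<open>U\<^sub>\<alpha>\<close>, so it vanishes at \<open>z\<^sub>1 \<in> U\<^sub>\<beta>\<close> unless \<open>\<alpha> = \<beta>\<close>.

  The quadratic differential in the bracket of the recursion pulls a form back along the involution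
  \<open>\<sigma>\<close>, so its coefficient contains the factor \<open>\<sigma>'(z)\<close>; contraction with \<open>(1/x'(z)) \<partial>/\<partial>z\<close> divides
  it by \<open>x'(z)\<close>.
\<close>
definition recursion_kernel ::
    "(nat \<Rightarrow> complex \<Rightarrow> complex) \<Rightarrow> (nat \<Rightarrow> complex \<Rightarrow> complex) \<Rightarrow> (nat \<Rightarrow> complex \<Rightarrow> complex)
      \<Rightarrow> nat \<Rightarrow> nat \<Rightarrow> complex \<Rightarrow> complex \<Rightarrow> complex" where
  "recursion_kernel x y h \<alpha> \<beta> z z1 =
     (if \<alpha> = \<beta> then cauchy_kernel (h \<alpha>) (deck (x \<alpha>) z) z z1 else 0)
       / ((y \<alpha> (deck (x \<alpha>) z) - y \<alpha> z) * deriv (x \<alpha>) z)"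

text \<open>
  Pairs of a genus \<open>g\<^sub>1 \<le> g\<close> and a set \<open>I\<close> of positions in the list of the remaining \<open>m\<close> arguments;
  \<open>g\<^sub>2 = g - g\<^sub>1\<close>, and \<open>J\<close> is the complement of \<open>I\<close>.
\<close>
definition splittings :: "nat \<Rightarrow> nat \<Rightarrow> (nat \<times> nat set) set" where
  "splittings g m = {(g1, I). g1 \<le> g \<and> I \<subseteq> {..<m} \<and>
     \<not> (g1 = 0 \<and> I = {}) \<and> \<not> (g - g1 = 0 \<and> {..<m} - I = {})}"

definition bracket :: "(nat \<Rightarrow> complex list \<Rightarrow> complex) \<Rightarrow> nat \<Rightarrow> complex \<Rightarrow> complex \<Rightarrow> complex list \<Rightarrow> complex" where
  "bracket W g z s zs =
     (if g = 0 then 0 else W (g - 1) (z # s # zs)) +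
     (\<Sum>(g1, I)\<in>splittings g (length zs).
        W g1 (z # nths zs I) * W (g - g1) (s # nths zs ({..<length zs} - I)))"

definition twisted_bracket ::
    "(nat \<Rightarrow> complex list \<Rightarrow> 'a list \<Rightarrow> 'l::comm_ring_1) \<Rightarrow> nat
      \<Rightarrow> complex \<Rightarrow> complex \<Rightarrow> complex list \<Rightarrow> 'a \<Rightarrow> 'a \<Rightarrow> 'a list \<Rightarrow> 'l" where
  "twisted_bracket W g z s zs a b vs =
     (if g = 0 then 0 else W (g - 1) (z # s # zs) (a # b # vs)) +
     (\<Sum>(g1, I)\<in>splittings g (length zs).
        W g1 (z # nths zs I) (a # nths vs I) *
        W (g - g1) (s # nths zs ({..<length zs} - I)) (b # nths vs ({..<length zs} - I)))"

text \<open>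
  The contour \<open>\<partial>U\<^sub>\<alpha>\<close> is a positively oriented loop around the ramification point 0 with
  \<open>z\<^sub>1, \<dots>, z\<^sub>n\<close> outside, that is, a circle of any sufficiently small radius. The integrals are
  required to exist. The form of type (0,1) never enters, and the one of type (0,2) is unconstrained
  initial data.
\<close>
definition topological_recursion ::
    "nat \<Rightarrow> (nat \<Rightarrow> complex \<Rightarrow> complex) \<Rightarrow> (nat \<Rightarrow> complex \<Rightarrow> complex) \<Rightarrow> (nat \<Rightarrow> complex \<Rightarrow> complex)
      \<Rightarrow> (nat \<Rightarrow> nat \<Rightarrow> complex list \<Rightarrow> complex) \<Rightarrow> bool" where
  "topological_recursion r x y h W \<longleftrightarrow>
     (\<forall>g n. \<forall>\<beta>\<in>{1..r}. stable g n \<or> (g, n) = (0, 2) \<longrightarrow>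
        meromorphic_several (\<lambda>c. c) n (W g \<beta>)) \<and>
     (\<forall>g n. \<forall>\<beta>\<in>{1..r}. stable g n \<longrightarrow>
        generically n (\<lambda>zs. \<exists>I.
          (\<forall>\<alpha>\<in>{1..r}. \<forall>\<^sub>F \<rho> in at_right 0.
             ((\<lambda>z. recursion_kernel x y h \<alpha> \<beta> z (hd zs) *
                    (bracket (\<lambda>g. W g \<alpha>) g z (deck (x \<alpha>) z) (tl zs) * deriv (deck (x \<alpha>)) z))
               has_contour_integral I \<alpha>) (circlepath 0 \<rho>)) \<and>
          W g \<beta> zs = 1 / (2 * pi * \<i>) * (\<Sum>\<alpha>\<in>{1..r}. I \<alpha>)))"

definition twisted_topological_recursion ::
    "('k::field \<Rightarrow> 'a::comm_ring_1 \<Rightarrow> 'a) \<Rightarrow> 'a set \<Rightarrow> ('a \<Rightarrow> 'k)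
      \<Rightarrow> (complex \<Rightarrow> 'l::comm_ring_1) \<Rightarrow> ('k \<Rightarrow> 'l)
      \<Rightarrow> nat \<Rightarrow> (nat \<Rightarrow> complex \<Rightarrow> complex) \<Rightarrow> (nat \<Rightarrow> complex \<Rightarrow> complex) \<Rightarrow> (nat \<Rightarrow> complex \<Rightarrow> complex)
      \<Rightarrow> (nat \<Rightarrow> nat \<Rightarrow> complex list \<Rightarrow> 'a list \<Rightarrow> 'l) \<Rightarrow> bool" where
  "twisted_topological_recursion smul B eps emb \<iota> r x y h W \<longleftrightarrow>
     (\<forall>g n. \<forall>\<beta>\<in>{1..r}. stable g n \<or> (g, n) = (0, 2) \<longrightarrow>
        (\<forall>vs. length vs = n \<longrightarrow> meromorphic_several emb n (\<lambda>zs. W g \<beta> zs vs)) \<and>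
        (\<forall>zs\<in>disc_power n. multilinear_form smul (\<lambda>c l. \<iota> c * l) n (W g \<beta> zs))) \<and>
     (\<forall>g n. \<forall>\<beta>\<in>{1..r}. stable g n \<longrightarrow> (\<forall>vs. length vs = n \<longrightarrow>
        generically n (\<lambda>zs. \<exists>I.
          (\<forall>\<alpha>\<in>{1..r}. \<forall>\<^sub>F \<rho> in at_right 0.
             has_coeff_contour_integral emb
               (\<lambda>z. \<Sum>a\<in>B. \<Sum>b\<in>B. \<Sum>k\<in>B. \<Sum>l\<in>B.
                  emb (recursion_kernel x y h \<alpha> \<beta> z (hd zs)) *
                  \<iota> (frob_form eps (k * l) (hd vs) * frob_inv B eps k a * frob_inv B eps l b) *
                  (twisted_bracket (\<lambda>g. W g \<alpha>) g z (deck (x \<alpha>) z) (tl zs) a b (tl vs) *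
                   emb (deriv (deck (x \<alpha>)) z)))
               (I \<alpha>) (circlepath 0 \<rho>)) \<and>
          W g \<beta> zs vs = emb (1 / (2 * pi * \<i>)) * (\<Sum>\<alpha>\<in>{1..r}. I \<alpha>))))"

definition symmetric_forms :: "nat \<Rightarrow> (nat \<Rightarrow> nat \<Rightarrow> complex list \<Rightarrow> complex) \<Rightarrow> bool" where
  "symmetric_forms r W \<longleftrightarrow>
     (\<forall>g n. \<forall>\<beta>\<in>{1..r}. stable g n \<or> (g, n) = (0, 2) \<longrightarrow>
        (\<forall>zs\<in>disc_power n. \<forall>zs'. mset zs' = mset zs \<longrightarrow> W g \<beta> zs' = W g \<beta> zs))"

end

theory Submission
  imports Defs
begin

text \<open>
  In the coordinate \<open>\<zeta>\<close> with \<open>x = \<zeta>\<^sup>2\<close> on one disc, the kernel and the bracket of the recursion have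
  expansions of definite parity, so the holomorphic part of the Cauchy kernel does not contribute. The forms \<open>W\<^bsub>g,n\<^esub>\<close> are then
  the Taylor coefficients of order \<open>2g - 2 + n\<close> of the logarithm of a partition function \<open>Z\<close> with
  \<open>\<partial>\<^sub>k Z\<^sub>N\<^sub>+\<^sub>1 = - 2 \<Sum>\<^sub>m c\<^sub>m L\<^sub>k\<^sub>+\<^sub>m Z\<^sub>N\<close>, where \<open>c\<close> comes from the expansion of \<open>1 / (y(\<sigma> z) - y(z))\<close>. The
  commutation relations of the Virasoro operators \<open>L\<^sub>p\<close> make these equations compatible, so \<open>Z\<close> exists and
  the \<open>W\<^bsub>g,n\<^esub>\<close> are symmetric. Passing from \<open>\<zeta>\<close> to \<open>z\<close> is a heat flow \<open>exp (1/2 \<Sum> \<beta>\<^sub>i\<^sub>j \<partial>\<^sub>i \<partial>\<^sub>j)\<close> applied to \<open>Z\<close>.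

  With the handle element \<open>H = \<Sum> \<eta>\<^sup>a\<^sup>b e\<^sub>a e\<^sub>b\<close>, the forms \<open>\<omega>\<^bsub>g,n\<^esub>(v\<^sub>1, \<dots>, v\<^sub>n) = \<epsilon>(v\<^sub>1 \<cdots> v\<^sub>n H\<^sup>g)\<close> are a
  two-dimensional TQFT, and contracting any term of the twisted bracket with the structure constants gives
  the same factor \<open>\<omega>\<^bsub>g,n\<^esub>\<close>. Uniqueness is an induction on \<open>2g + n\<close>: complex linear functionals separate the
  points of the coefficient ring, so normalised meromorphic functions that agree on a dense open set agree.
\<close>

section \<open>Symmetric functions and Virasoro operators\<close>

text \<open>The recursion treats z_1 differently from the other points, so the symmetry of its
  output is the obstacle. In the basis of odd pole forms it prescribes the gradient of Z, and
  symmetry becomes integrability of that gradient. It holds because the L_n with n \<ge> -1 close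
  under commutators without a central term. This applies directly only if the part of dz dz'/(z -
  z')^2 that is regular and even in both local coordinates vanishes. In general its coefficients b
  turn the nonnegative modes (2a + 1) t_a of the field into (2a + 1)(t_a + \<Sum> \<beta>_aj
  \<partial>_j). This substitution is conjugation by the heat flow as soon as \<beta> is symmetric,
  which is a reciprocity of residues; hence the commutation relations are needed for b = 0 only. The
  constants come from the same form at the pair (\<zeta>, -\<zeta>), which starts with 1/(4
  \<zeta>^2) and has constant term b_00: the 1/4 is four times the constant 1/16 of L_0, and b_00 is
  the contraction of the zero mode of the field with itself. Everything up to the contour integrals
  is algebra on lists: weight bounds make all sums finite, and each cutoff K is chosen above such a
  bound.\<close>

text \<open>
  A function \<open>f\<close> on lists encodes the formal power series in \<open>t\<^sub>0, t\<^sub>1, \<dots>\<close> whose derivative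
  \<open>\<partial>\<^bsub>k\<^esub> \<partial>\<^bsub>l\<^esub> \<cdots>\<close> at 0 is \<open>f [k, l, \<dots>]\<close>. In this encoding \<open>D k\<close> is \<open>\<partial>\<^sub>k\<close>, \<open>mult_var k\<close> is multiplication by \<open>t\<^sub>k\<close>,
  and \<open>conv\<close> is the product.
\<close>
type_synonym list_fun = "nat list \<Rightarrow> complex"

abbreviation (input) D :: "'i \<Rightarrow> ('i list \<Rightarrow> 'r) \<Rightarrow> 'i list \<Rightarrow> 'r" where
  "D k f \<equiv> (\<lambda>ks. f (k # ks))"

definition symmetric_fun :: "('i list \<Rightarrow> 'r) \<Rightarrow> bool" where
  "symmetric_fun f \<longleftrightarrow> (\<forall>ks ks'. mset ks = mset ks' \<longrightarrow> f ks = f ks')"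

lemma symmetric_funD: "symmetric_fun f \<Longrightarrow> mset ks = mset ks' \<Longrightarrow> f ks = f ks'"
  unfolding symmetric_fun_def by blast

lemma symmetric_funI: "(\<And>ks ks'. mset ks = mset ks' \<Longrightarrow> f ks = f ks') \<Longrightarrow> symmetric_fun f"
  unfolding symmetric_fun_def by blast

lemma sym_D [intro, simp]: "symmetric_fun f \<Longrightarrow> symmetric_fun (D k f)"
  by (rule symmetric_funI) (erule symmetric_funD, simp)

lemma sym_swap: "symmetric_fun f \<Longrightarrow> f (i # j # ks) = f (j # i # ks)"
  by (erule symmetric_funD) simp

lemma sym_move: "symmetric_fun f \<Longrightarrow> f (i # j # k # ks) = f (k # i # j # ks)"
  by (erule symmetric_funD) simp

text \<open>Permutations of the tail and the exchange of the first two entries generate the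
  symmetric group. The length is fixed so that invariance under permutations of the tail can be an
  induction hypothesis.\<close>

lemma sym_length_Suc:
  assumes "\<And>k ks ks'. length ks = n \<Longrightarrow> mset ks = mset ks' \<Longrightarrow> f (k # ks) = f (k # ks')"
    and "\<And>i j ks. f (i # j # ks) = f (j # i # ks)"
    and "length ks = Suc n" and "mset ks = mset ks'"
  shows "f ks = f ks'"
proof -
  obtain k ts where ks: "ks = k # ts" using assms(3) by (cases ks) auto
  obtain k' ts' where ks': "ks' = k' # ts'" using assms(3,4) ks by (cases ks') auto
  have len: "length ts = n" "length ts' = n"
    using assms(3,4) ks ks' mset_eq_length by fastforce+
  show ?thesis
  proof (cases "k = k'")
    case True
    then show ?thesis using assms(1)[of ts ts' k] assms(4) ks ks' len by simp
  next
    case False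
    have "k' \<in># mset ts" "k \<in># mset ts'"
      using assms(4) False unfolding ks ks' by (metis insert_noteq_member mset.simps(2))+
    define us where "us = remove1 k' ts"
    have 1: "mset ts = mset (k' # us)" using \<open>k' \<in># mset ts\<close> by (simp add: us_def)
    have 2: "mset ts' = mset (k # us)"
      using assms(4) unfolding ks ks' mset.simps 1 by (metis add_mset_add_mset_same_iff add_mset_commute)
    have "f ks = f (k # k' # us)" unfolding ks using assms(1)[OF len(1) 1] .
    also have "\<dots> = f (k' # k # us)" by (rule assms(2))
    also have "\<dots> = f ks'" unfolding ks' using assms(1)[OF len(2) 2] by simp
    finally show ?thesis .
  qed
qed

lemma sym_headI:
  assumes "\<And>k. symmetric_fun (D k f)" and "\<And>i j ks. f (i # j # ks) = f (j # i # ks)"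
  shows "symmetric_fun f"
  unfolding symmetric_fun_def
proof (intro allI impI)
  fix ks ks' :: "'a list" assume m: "mset ks = mset ks'"
  show "f ks = f ks'"
  proof (cases ks)
    case Nil then show ?thesis using m by simp
  next
    case (Cons k ts)
    show ?thesis
    proof (rule sym_length_Suc[of "length ts" f])
      show "f (k # us) = f (k # us')" if "mset us = mset us'" for k us us'
        using symmetric_funD[OF assms(1) that] .
      show "f (i # j # us) = f (j # i # us)" for i j us by (rule assms(2))
      show "length ks = Suc (length ts)" using Cons by simp
    qed (rule m)
  qed
qed

text \<open>An operator preserves symmetry if its commutators with the derivatives do: the value on
  a list of length n + 1 is a value on a list of length n plus the symmetric remainder
  \<open>R\<close>.\<close>

lemma sym_operatorI:
  assumes "\<And>f k. symmetric_fun f \<Longrightarrow> \<exists>R. symmetric_fun R \<and> (\<forall>ks. T f (k # ks) = T (D k f) ks + (R ks :: complex))"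
    and "\<And>f i j ks. symmetric_fun f \<Longrightarrow> T f (i # j # ks) = T f (j # i # ks)"
    and "symmetric_fun f"
  shows "symmetric_fun (T f)"
proof -
  have "length ks = n \<Longrightarrow> mset ks = mset ks' \<Longrightarrow> T f ks = T f ks'" if "symmetric_fun f" for n ks ks' f
    using that
  proof (induction n arbitrary: f ks ks')
    case 0 then show ?case by auto
  next
    case (Suc n)
    show ?case
    proof (rule sym_length_Suc[of n "T f"])
      fix k and ts ts' :: "'a list" assume *: "length ts = n" "mset ts = mset ts'"
      obtain R where "symmetric_fun R" "\<forall>ks. T f (k # ks) = T (D k f) ks + R ks"
        using assms(1)[OF Suc.prems(3)] by blast
      then show "T f (k # ts) = T f (k # ts')"
        using Suc.IH[OF * sym_D[OF Suc.prems(3)], of k] symmetric_funD[OF \<open>symmetric_fun R\<close> *(2)] by simp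
    qed (use Suc.prems assms(2) in auto)
  qed
  then show ?thesis using assms(3) unfolding symmetric_fun_def by blast
qed

lemma sym_add: "symmetric_fun f \<Longrightarrow> symmetric_fun g \<Longrightarrow> symmetric_fun (\<lambda>ks. f ks + g ks :: complex)"
  by (rule symmetric_funI, rule arg_cong2[of _ _ _ _ "(+)"]; erule symmetric_funD)

lemma sym_cmult: "symmetric_fun f \<Longrightarrow> symmetric_fun (\<lambda>ks. c * f ks :: complex)"
  by (rule symmetric_funI, rule arg_cong[of _ _ "(*) c"]; erule symmetric_funD)

lemma sym_sum: "(\<And>i. i \<in> I \<Longrightarrow> symmetric_fun (F i)) \<Longrightarrow> symmetric_fun (\<lambda>ks. \<Sum>i\<in>I. F i ks :: complex)"
proof (rule symmetric_funI)
  fix ks ks' :: "'b list" assume "\<And>i. i \<in> I \<Longrightarrow> symmetric_fun (F i)" "mset ks = mset ks'"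
  then show "(\<Sum>i\<in>I. F i ks) = (\<Sum>i\<in>I. F i ks')"
    by (intro sum.cong refl) (rule symmetric_funD)
qed

lemma sym_if: "symmetric_fun f \<Longrightarrow> symmetric_fun (\<lambda>ks. if b then f ks else 0 :: complex)"
  by (cases b) (simp_all add: symmetric_funI)

lemma sym_zero: "symmetric_fun (\<lambda>ks. 0 :: complex)"
  by (simp add: symmetric_funI)

section \<open>Multiplication, Euler and pair operators\<close>

fun mult_var :: "nat \<Rightarrow> list_fun \<Rightarrow> list_fun" where
  "mult_var a f [] = 0"
| "mult_var a f (k # ks) = (if k = a then f ks else 0) + mult_var a (D k f) ks"

text \<open>The operator \<Sum>_k (2k + 1) t_k \<partial>_{k+p-1}, unfolded by the Leibniz rule. The
  summand with k + p = 0 would contain \<partial>_{-1}; it is dropped here, and the t_0^2 term of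
  \<open>virasoro 0\<close> takes its place.\<close>

fun euler_op :: "nat \<Rightarrow> list_fun \<Rightarrow> list_fun" where
  "euler_op p f [] = 0"
| "euler_op p f (k # ks) = (2 * of_nat k + 1) * (if k + p = 0 then 0 else f ((k + p - 1) # ks))
      + euler_op p (D k f) ks"

text \<open>The second-order part \<Sum> \<partial>_i \<partial>_j over i + j = p - 2. For p \<le> 1
  the truncated subtraction \<open>p - 1\<close> leaves an empty range.\<close>

definition pair_op :: "nat \<Rightarrow> list_fun \<Rightarrow> list_fun" where
  "pair_op p f ks = (\<Sum>i<p - 1. f (i # (p - 2 - i) # ks))"

text \<open>
  With \<open>p = n + 1\<close>, \<open>virasoro p\<close> is the mode \<open>L\<^sub>n\<close> of the twisted boson: \<open>mode (Suc k)\<close> is \<open>\<partial>\<^sub>k\<close>, i.e. the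
  oscillator \<open>J\<^sub>2\<^sub>k\<^sub>+\<^sub>1\<close>, and \<open>mode 0\<close> is \<open>J\<^sub>-\<^sub>1\<close>.
\<close>
definition virasoro :: "nat \<Rightarrow> list_fun \<Rightarrow> list_fun" where
  "virasoro p f ks = 1/2 * euler_op p f ks + 1/4 * pair_op p f ks
     + (if p = 0 then 1/4 * mult_var 0 (mult_var 0 f) ks else 0) + (if p = 1 then f ks / 16 else 0)"

fun mode :: "nat \<Rightarrow> list_fun \<Rightarrow> list_fun" where
  "mode 0 f = mult_var 0 f"
| "mode (Suc k) f = D k f"

lemma mult_var_add: "mult_var a (\<lambda>ks. f ks + g ks) ks = mult_var a f ks + mult_var a g ks"
  by (induction ks arbitrary: f g) (auto simp: algebra_simps)

lemma mult_var_cmult: "mult_var a (\<lambda>ks. c * f ks) ks = c * mult_var a f ks"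
  by (induction ks arbitrary: f) (auto simp: algebra_simps)

lemma mult_var_zero: "mult_var a (\<lambda>ks. 0) ks = 0"
  by (induction ks) auto

lemma euler_op_add: "euler_op p (\<lambda>ks. f ks + g ks) ks = euler_op p f ks + euler_op p g ks"
  by (induction ks arbitrary: f g) (auto simp: algebra_simps)

lemma euler_op_cmult: "euler_op p (\<lambda>ks. c * f ks) ks = c * euler_op p f ks"
  by (induction ks arbitrary: f) (auto simp: algebra_simps)

lemma pair_op_add: "pair_op p (\<lambda>ks. f ks + g ks) ks = pair_op p f ks + pair_op p g ks"
  by (simp add: pair_op_def sum.distrib)

lemma pair_op_cmult: "pair_op p (\<lambda>ks. c * f ks) ks = c * pair_op p f ks"
  by (simp add: pair_op_def sum_distrib_left)

lemmas mult_var_add_fun = ext[OF mult_var_add]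
  and mult_var_cmult_fun = ext[OF mult_var_cmult]

lemma virasoro_add: "virasoro p (\<lambda>ks. f ks + g ks) ks = virasoro p f ks + virasoro p g ks"
  by (simp add: virasoro_def euler_op_add pair_op_add mult_var_add mult_var_add_fun add_divide_distrib algebra_simps)

lemma virasoro_cmult: "virasoro p (\<lambda>ks. c * f ks) ks = c * virasoro p f ks"
  by (simp add: virasoro_def euler_op_cmult pair_op_cmult mult_var_cmult mult_var_cmult_fun algebra_simps)

lemma sym_mult_var: "symmetric_fun f \<Longrightarrow> symmetric_fun (mult_var a f)"
proof (rule sym_operatorI[of "mult_var a"])
  fix f :: list_fun and k assume "symmetric_fun f"
  then show "\<exists>R. symmetric_fun R \<and> (\<forall>ks. mult_var a f (k # ks) = mult_var a (D k f) ks + R ks)"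
    by (intro exI[of _ "\<lambda>ks. if k = a then f ks else 0"]) (auto intro!: symmetric_funI intro: symmetric_funD)
next
  fix f :: list_fun and i j ks assume "symmetric_fun f"
  then have "D j (D i f) = D i (D j f)" by (intro ext sym_swap)
  then show "mult_var a f (i # j # ks) = mult_var a f (j # i # ks)" by simp
qed

lemma sym_euler_op: "symmetric_fun f \<Longrightarrow> symmetric_fun (euler_op p f)"
proof (rule sym_operatorI[of "euler_op p"])
  fix f :: list_fun and k assume "symmetric_fun f"
  then have "symmetric_fun (\<lambda>ks. (2 * of_nat k + 1) * (if k + p = 0 then 0 else f ((k + p - 1) # ks)))"
    using sym_cmult[OF sym_D[of f "k + p - 1"]] sym_zero by (cases "k + p = 0") auto
  then show "\<exists>R. symmetric_fun R \<and> (\<forall>ks. euler_op p f (k # ks) = euler_op p (D k f) ks + R ks)"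
    by (intro exI conjI allI) (assumption, simp)
next
  fix f :: list_fun and i j ks assume f: "symmetric_fun f"
  then have "D j (D i f) = D i (D j f)" by (intro ext sym_swap)
  then show "euler_op p f (i # j # ks) = euler_op p f (j # i # ks)"
    using sym_swap[OF f, of "i+p-1" j ks] sym_swap[OF f, of "j+p-1" i ks]
    by (cases "i + p = 0"; cases "j + p = 0") (auto simp: algebra_simps)
qed

lemma sym_pair_op: "symmetric_fun f \<Longrightarrow> symmetric_fun (pair_op p f)"
  unfolding pair_op_def by (rule sym_sum, rule symmetric_funI, erule symmetric_funD, simp)

lemma sym_virasoro: "symmetric_fun f \<Longrightarrow> symmetric_fun (virasoro p f)"
  using sym_euler_op[of f p] sym_pair_op[of f p] sym_mult_var[OF sym_mult_var, of f 0 0]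
    sym_cmult[of f "1/16"]
  unfolding virasoro_def by (intro sym_add sym_cmult sym_if) simp_all

section \<open>Commutators with the oscillators\<close>

lemma mult_var_twice_D:
  "mult_var 0 (mult_var 0 f) (k # ks) = mult_var 0 (mult_var 0 (D k f)) ks + (if k = 0 then 2 * mult_var 0 f ks else 0)"
  by (simp add: mult_var_add mult_var_zero)

lemma pair_op_D: "symmetric_fun f \<Longrightarrow> pair_op p f (k # ks) = pair_op p (D k f) ks"
  unfolding pair_op_def by (intro sum.cong) (auto intro: sym_move)

text \<open>The commutator involves t_0 only for k + p = 0, where it is the derivative of t_0^2 / 4;
  the index shift in \<open>mode\<close> lets this case share the formula of the others.\<close>

lemma virasoro_D:
  assumes "symmetric_fun f"
  shows "virasoro p f (k # ks) = virasoro p (D k f) ks + (of_nat k + 1/2) * mode (k + p) f ks"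
proof (cases "k + p")
  case 0 then show ?thesis
    using mult_var_twice_D[of f 0 ks] by (simp add: virasoro_def pair_op_D[OF assms] field_simps del: mult_var.simps)
next
  case (Suc j)
  then show ?thesis using mult_var_twice_D[of f k ks]
    by (auto simp: virasoro_def pair_op_D[OF assms] field_simps simp del: mult_var.simps)
qed

lemma virasoro_Nil: "virasoro p f [] = 1/4 * pair_op p f [] + (if p = 1 then f [] / 16 else 0)"
  by (simp add: virasoro_def)

text \<open>Induction over the list, peeling off one derivative on both sides. What remains is the
  value at the origin, where \<partial>_i \<partial>_j (t_0 f) is nonzero only if i or j is
  0.\<close>

lemma mult_var_virasoro:
  assumes "symmetric_fun f" "q \<ge> 1"
  shows "mult_var 0 (virasoro q f) ks = virasoro q (mult_var 0 f) ks - 1/2 * mode (q - 1) f ks"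
  using assms(1)
proof (induction ks arbitrary: f)
  case Nil
  obtain r where q: "q = Suc r" using assms(2) by (cases q) auto
  have "pair_op q (mult_var 0 f) [] = (if r = 0 then 0 else 2 * f [r - 1])"
  proof (cases r)
    case (Suc s)
    have "pair_op q (mult_var 0 f) [] = (\<Sum>i<Suc s. (if i = 0 then f [s] else 0) + (if i = s then f [s] else 0))"
      unfolding pair_op_def q Suc by (intro sum.cong) auto
    also have "\<dots> = 2 * f [s]" by (simp only: sum.distrib) (simp add: sum.delta)
    finally show ?thesis using Suc by simp
  qed (simp add: pair_op_def q)
  then show ?case by (cases r) (auto simp: virasoro_Nil q)
next
  case (Cons k ks)
  note f = Cons.prems
  have 1: "mult_var 0 (D k (virasoro q f)) ks
     = mult_var 0 (virasoro q (D k f)) ks + (of_nat k + 1/2) * mult_var 0 (mode (k + q) f) ks"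
    by (simp add: virasoro_D[OF f] mult_var_add mult_var_cmult)
  have 2: "virasoro q (D k (mult_var 0 f)) ks = (if k = 0 then virasoro q f ks else 0) + virasoro q (mult_var 0 (D k f)) ks"
    using virasoro_add[of q "\<lambda>ks. if k = 0 then f ks else 0" "mult_var 0 (D k f)" ks]
      virasoro_cmult[of q 0 f ks] by auto
  have 3: "mult_var 0 (virasoro q (D k f)) ks = virasoro q (mult_var 0 (D k f)) ks - 1/2 * mode (q - 1) (D k f) ks"
    by (rule Cons.IH) (use f in simp)
  obtain r where q: "q = Suc r" using assms(2) by (cases q) auto
  have 4: "mode (k + q) (mult_var 0 f) ks = mult_var 0 (mode (k + q) f) ks + (if k + q = 1 then f ks else 0)"
    by (auto simp: q)
  have 5: "mode (q - 1) f (k # ks) = mode (q - 1) (D k f) ks + (if k + q = 1 then f ks else 0)"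
    using sym_swap[OF f] by (cases r) (auto simp: q)
  show ?case
    unfolding virasoro_D[OF sym_mult_var[OF f]] 5 mult_var.simps(2)[of 0 "virasoro q f"] 1 2 3 4
    by (auto simp: q algebra_simps)
qed

text \<open>For j = q = 0 the last term would be an oscillator below t_0; the second hypothesis
  excludes exactly this case.\<close>

lemma mode_virasoro:
  assumes "symmetric_fun f" "j + q \<ge> 1"
  shows "mode j (virasoro q f) ks = virasoro q (mode j f) ks + (of_nat j - 1/2) * mode (j + q - 1) f ks"
proof (cases j)
  case 0 then show ?thesis using mult_var_virasoro[OF assms(1), of q ks] assms(2) by simp
next
  case (Suc k) then show ?thesis using virasoro_D[OF assms(1), of q k ks] by (simp add: algebra_simps)
qed

section \<open>The Virasoro relations\<close>

lemma pair_op_virasoro_Nil: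
  assumes f: "symmetric_fun f" and q: "q \<ge> 1"
  shows "pair_op p (virasoro q f) [] = (\<Sum>i<p - 1. virasoro q (D i (D (p - 2 - i) f)) [])
    + 2 * (\<Sum>i<p - 1. (of_nat i + 1/2) * f [i + q - 1, p - 2 - i])"
proof -
  let ?g = "\<lambda>i. (of_nat i + 1/2 :: complex) * f [i + q - 1, p - 2 - i]"
  have "virasoro q f [i, j] = virasoro q (D i (D j f)) [] + (of_nat i + 1/2) * f [i + q - 1, j]
      + (of_nat j + 1/2) * f [j + q - 1, i]" for i j
  proof -
    obtain r where q: "q = Suc r" using q by (cases q) auto
    have "virasoro q f [i, j] = virasoro q (D i f) [j] + (of_nat i + 1/2) * f [i + q - 1, j]"
      by (simp add: virasoro_D[OF f] q)
    also have "virasoro q (D i f) [j] = virasoro q (D j (D i f)) [] + (of_nat j + 1/2) * f [i, j + q - 1]"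
      using virasoro_D[OF sym_D[OF f], of q i j "[]"] by (simp add: q)
    also have "D j (D i f) = D i (D j f)" by (intro ext sym_swap f)
    also have "f [i, j + q - 1] = f [j + q - 1, i]" by (rule sym_swap[OF f])
    finally show ?thesis by simp
  qed
  then have "pair_op p (virasoro q f) [] = (\<Sum>i<p - 1. virasoro q (D i (D (p - 2 - i) f)) []) + (\<Sum>i<p - 1. ?g i)
     + (\<Sum>i<p - 1. (of_nat (p - 2 - i) + 1/2) * f [(p - 2 - i) + q - 1, i])"
    unfolding pair_op_def by (simp add: sum.distrib)
  also have "(\<Sum>i<p - 1. (of_nat (p - 2 - i) + 1/2) * f [(p - 2 - i) + q - 1, i]) = (\<Sum>i<p - 1. ?g i)"
  proof (rule sum.reindex_bij_witness[of _ "\<lambda>i. p - 2 - i" "\<lambda>i. p - 2 - i"])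
    fix a assume "a \<in> {..<p - 1}"
    then have a: "p - 2 - (p - 2 - a) = a" by auto
    show "?g (p - 2 - a) = (of_nat (p - 2 - a) + 1/2) * f [(p - 2 - a) + q - 1, a]" by (simp only: a)
  qed auto
  finally show ?thesis by simp
qed

lemma pair_op_comm: "symmetric_fun f \<Longrightarrow>
   (\<Sum>i<p - 1. pair_op q (D i (D (p - 2 - i) f)) []) = (\<Sum>j<q - 1. pair_op p (D j (D (q - 2 - j) f)) [])"
  unfolding pair_op_def by (subst sum.swap) (auto intro!: sum.cong symmetric_funD[of f] simp: add_mset_commute)

text \<open>Both sums run over pairs with i + j = p + q - 3. Since \<open>f\<close> is symmetric,
  the weights may be averaged over i and its mirror image j, and together they give the constant p -
  q.\<close>

lemma weighted_pair_sum:
  assumes f: "symmetric_fun f" and pq: "p \<ge> 1" "q \<ge> 1"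
  shows "2 * (\<Sum>i<p - 1. (of_nat i + 1/2) * f [i + q - 1, p - 2 - i])
       - 2 * (\<Sum>i<q - 1. (of_nat i + 1/2) * f [i + p - 1, q - 2 - i])
     = (of_nat p - of_nat q) * pair_op (p + q - 1) f []"
proof -
  define s where "s = p + q - 3"
  let ?h = "\<lambda>i. f [i, s - i]"
  have hs: "?h (s - i) = ?h i" if "i \<le> s" for i
    using that sym_swap[OF f, of "s - i" i] by simp
  have A: "(\<Sum>i<p - 1. (of_nat i + 1/2) * f [i + q - 1, p - 2 - i])
     = (\<Sum>i<p + q - 2. if q - 1 \<le> i then (of_nat i - of_nat q + 3/2) * ?h i else 0)" if "p \<ge> 1" "q \<ge> 1" "s = p + q - 3" for p q
  proof -
    have "(\<Sum>i<p + q - 2. if q - 1 \<le> i then (of_nat i - of_nat q + 3/2) * ?h i else 0)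
       = (\<Sum>i\<in>{q - 1..<p + q - 2}. (of_nat i - of_nat q + 3/2) * ?h i)"
      by (intro sum.mono_neutral_cong_right) auto
    also have "\<dots> = (\<Sum>i<p - 1. (of_nat i + 1/2) * f [i + q - 1, p - 2 - i])"
    proof (rule sum.reindex_bij_witness[of _ "\<lambda>i. i + q - 1" "\<lambda>i. i - (q - 1)"])
      fix a assume a: "a \<in> {q - 1..<p + q - 2}"
      have "a - (q - 1) + q - 1 = a" "p - 2 - (a - (q - 1)) = s - a"
        using a that by auto
      moreover have "complex_of_nat (a - (q - 1) + q) = of_nat (a + 1)" using a that by (intro arg_cong[of _ _ of_nat]) auto
      then have "complex_of_nat (a - (q - 1)) = of_nat a - of_nat q + 1" by (simp only: of_nat_add) (simp add: algebra_simps)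
      ultimately show "(of_nat (a - (q - 1)) + 1/2) * f [a - (q - 1) + q - 1, p - 2 - (a - (q - 1))] = (of_nat a - of_nat q + 3/2) * ?h a"
        by (simp only:) (simp add: algebra_simps)
    qed (use that in auto)
    finally show ?thesis by simp
  qed
  \<comment> \<open>Both sums are extended by zero to one range that is invariant under i -> s - i;
    the reflection turns each of the two cutoffs into the negation of the other.\<close>
  define g where "g i = (if q - 1 \<le> i then (of_nat i - of_nat q + 3/2) * ?h i else 0)
     - (if p - 1 \<le> i then (of_nat i - of_nat p + 3/2) * ?h i else 0)" for i
  have AB: "(\<Sum>i<p - 1. (of_nat i + 1/2) * f [i + q - 1, p - 2 - i])
       - (\<Sum>i<q - 1. (of_nat i + 1/2) * f [i + p - 1, q - 2 - i]) = (\<Sum>i<p + q - 2. g i)"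
    using A[of p q] A[of q p] pq unfolding g_def by (simp add: sum_subtractf s_def add.commute)
  have gg: "g i + g (s - i) = (of_nat p - of_nat q) * ?h i" if "i < p + q - 2" for i
  proof -
    have i: "i \<le> s" using that by (simp add: s_def)
    have e: "complex_of_nat (s - i) = of_nat p + of_nat q - 3 - of_nat i"
      using i that by (simp add: of_nat_diff s_def)
    have "q - 1 \<le> s - i \<longleftrightarrow> \<not> p - 1 \<le> i" "p - 1 \<le> s - i \<longleftrightarrow> \<not> q - 1 \<le> i"
      using that pq unfolding s_def by auto
    then show ?thesis unfolding g_def hs[OF i] e by (auto simp: algebra_simps)
  qed
  have refl_g: "(\<Sum>i<p + q - 2. g i) = (\<Sum>i<p + q - 2. g (s - i))"
    by (rule sum.reindex_bij_witness[of _ "\<lambda>i. s - i" "\<lambda>i. s - i"]) (auto simp: s_def)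
  from AB have G: "(\<Sum>i<p - 1. (of_nat i + 1/2) * f [i + q - 1, p - 2 - i])
       - (\<Sum>i<q - 1. (of_nat i + 1/2) * f [i + p - 1, q - 2 - i]) = (\<Sum>i<p + q - 2. g i)"
    by (simp only:)
  have "2 * (\<Sum>i<p + q - 2. g i) = (\<Sum>i<p + q - 2. g i + g (s - i))"
    by (simp only: sum.distrib mult_2 refl_g[symmetric])
  moreover have "(\<Sum>i<p + q - 2. g i + g (s - i)) = (\<Sum>i<p + q - 2. (of_nat p - of_nat q) * ?h i)"
    by (intro sum.cong refl gg) simp
  moreover have "pair_op (p + q - 1) f [] = (\<Sum>i<p + q - 2. ?h i)"
    unfolding pair_op_def using pq by (intro sum.cong) (auto simp: s_def intro!: arg_cong[of _ _ f])
  ultimately have "2 * (\<Sum>i<p + q - 2. g i) = (of_nat p - of_nat q) * pair_op (p + q - 1) f []"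
    by (simp only: sum_distrib_left)
  then show ?thesis unfolding G[symmetric] by (simp only: right_diff_distrib)
qed

text \<open>At the origin the outer operator contributes only through \<open>pair_op\<close> and the
  constant 1/16. The fourth-order terms commute, and the second-order terms are those of
  \<open>weighted_pair_sum\<close>.\<close>

lemma virasoro_comm_Nil_pos:
  assumes f: "symmetric_fun f" and pq: "p \<ge> 1" "q \<ge> 1"
  shows "virasoro p (virasoro q f) [] - virasoro q (virasoro p f) [] = (of_nat p - of_nat q) * virasoro (p + q - 1) f []"
proof -
  define S where "S p q = (\<Sum>i<p - 1. (of_nat i + 1/2) * f [i + q - 1, p - 2 - i])" for p q
  have V: "virasoro p (virasoro q f) [] = 1/16 * (\<Sum>i<p - 1. pair_op q (D i (D (p - 2 - i) f)) [])
      + (if q = 1 then pair_op p f [] / 64 else 0) + 1/2 * S p q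
      + (if p = 1 then (1/4 * pair_op q f [] + (if q = 1 then f [] / 16 else 0)) / 16 else 0)" if "q \<ge> 1" for p q
  proof -
    have "(\<Sum>i<p - 1. f [p - 2 - i, i]) = pair_op p f []"
      unfolding pair_op_def using sym_swap[OF f] by (intro sum.cong) auto
    then have "(\<Sum>i<p - 1. virasoro q (D i (D (p - 2 - i) f)) []) = 1/4 * (\<Sum>i<p - 1. pair_op q (D i (D (p - 2 - i) f)) [])
       + (if q = 1 then pair_op p f [] / 16 else 0)"
      by (simp add: virasoro_Nil sum.distrib sum_distrib_left sum_divide_distrib[symmetric])
    then show ?thesis
      unfolding virasoro_Nil[of p] pair_op_virasoro_Nil[OF f that] virasoro_Nil[of q f] S_def[symmetric]
      by (auto simp: field_simps)
  qed
  have S: "S p q = S q p + (of_nat p - of_nat q) * pair_op (p + q - 1) f [] / 2"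
    using weighted_pair_sum[OF f pq, folded S_def] by (simp add: field_simps)
  have "p + q - 1 = 1 \<Longrightarrow> p = 1 \<and> q = 1" using pq by auto
  then show ?thesis
    using pair_op_comm[OF f, of p q]
    unfolding V[OF pq(1)] V[OF pq(2)] S unfolding virasoro_Nil
    by (auto simp: field_simps simp del: One_nat_def)
qed

lemma virasoro_comm_Nil_0:
  assumes f: "symmetric_fun f" and p: "p \<ge> 1"
  shows "virasoro p (virasoro 0 f) [] - virasoro 0 (virasoro p f) [] = of_nat p * virasoro (p - 1) f []"
proof -
  have 0: "virasoro 0 g [] = 0" for g by (simp add: virasoro_Nil pair_op_def)
  have ij: "virasoro 0 f [i, j] = (if i = 0 then 0 else (of_nat i + 1/2) * f [i - 1, j])
     + (if j = 0 then 0 else (of_nat j + 1/2) * f [i, j - 1]) + (if i = 0 \<and> j = 0 then f [] / 2 else 0)" for i j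
    by (auto simp: virasoro_def pair_op_def field_simps)
  consider "p = 1" | "p = 2" | r where "p = Suc (Suc (Suc r))"
    using p by (metis One_nat_def Suc_1 not0_implies_Suc not_one_le_zero)
  then show ?thesis
  proof cases
    case 1 then show ?thesis by (simp add: 0 virasoro_Nil[of "Suc 0"] pair_op_def)
  next
    \<comment> \<open>This case fixes the constant of L_0: the commutator of L_1 and L_{-1} is
      \<open>f [] / 8\<close> at the origin, and it has to be 2 L_0.\<close>
    case 2 then show ?thesis by (simp add: 0 virasoro_Nil[of 2] virasoro_Nil[of "Suc 0"] pair_op_def ij)
  next
    case (3 r)
    have "pair_op p (virasoro 0 f) [] = (\<Sum>i<Suc (Suc r). (if i = 0 then 0 else (of_nat i + 1/2) * f [i - 1, Suc r - i])
       + (if i = Suc r then 0 else (of_nat (Suc r - i) + 1/2) * f [i, Suc r - i - 1]))"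
      unfolding pair_op_def 3 by (intro sum.cong) (auto simp: ij)
    also have "\<dots> = (\<Sum>i<Suc r. (of_nat i + 3/2) * f [i, r - i]) + (\<Sum>i<Suc r. (of_nat (Suc r - i) + 1/2) * f [i, r - i])"
      unfolding sum.distrib
    proof (rule arg_cong2[of _ _ _ _ "(+)"])
      show "(\<Sum>i<Suc (Suc r). if i = 0 then 0 else (of_nat i + 1/2) * f [i - 1, Suc r - i]) = (\<Sum>i<Suc r. (of_nat i + 3/2) * f [i, r - i])"
        unfolding sum.lessThan_Suc_shift[of _ "Suc r"] by (simp add: algebra_simps del: sum.lessThan_Suc)
      show "(\<Sum>i<Suc (Suc r). if i = Suc r then 0 else (of_nat (Suc r - i) + 1/2) * f [i, Suc r - i - 1])
        = (\<Sum>i<Suc r. (of_nat (Suc r - i) + 1/2) * f [i, r - i])"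
        unfolding sum.lessThan_Suc[of _ "Suc r"] by (auto intro!: sum.cong simp del: sum.lessThan_Suc)
    qed
    also have "\<dots> = (\<Sum>i<Suc r. of_nat p * f [i, r - i])"
      unfolding sum.distrib[symmetric] by (intro sum.cong) (auto simp: 3 of_nat_diff algebra_simps)
    also have "\<dots> = of_nat p * pair_op (p - 1) f []"
      by (simp add: pair_op_def 3 sum_distrib_left del: sum.lessThan_Suc)
    finally have "pair_op p (virasoro 0 f) [] = of_nat p * pair_op (p - 1) f []" .
    moreover have "virasoro p (virasoro 0 f) [] = 1/4 * pair_op p (virasoro 0 f) []"
      "virasoro (p - 1) f [] = 1/4 * pair_op (p - 1) f []"
      by (subst virasoro_Nil, simp add: 3)+
    ultimately show ?thesis by (simp only: 0) simp
  qed
qed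

lemma virasoro_comm_Nil:
  assumes f: "symmetric_fun f" and "p + q \<ge> 1"
  shows "virasoro p (virasoro q f) [] - virasoro q (virasoro p f) [] = (of_nat p - of_nat q) * virasoro (p + q - 1) f []"
proof (cases "p = 0 \<or> q = 0")
  case True
  then show ?thesis using virasoro_comm_Nil_0[OF f, of p] virasoro_comm_Nil_0[OF f, of q] assms(2)
    by (auto simp: algebra_simps)
next
  case False then show ?thesis using virasoro_comm_Nil_pos[OF f, of p q] by simp
qed

text \<open>By \<open>virasoro_D\<close> and \<open>mode_virasoro\<close> both sides have the same
  commutator with \<partial>_k (the Jacobi identity), so induction over the list reduces the claim
  to the origin. A central term is absent because all indices n = p - 1 are at least -1.\<close>

lemma virasoro_comm:
  assumes "symmetric_fun f" "p + q \<ge> 1"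
  shows "virasoro p (virasoro q f) ks - virasoro q (virasoro p f) ks = (of_nat p - of_nat q) * virasoro (p + q - 1) f ks"
  using assms(1)
proof (induction ks arbitrary: f)
  case Nil then show ?case using virasoro_comm_Nil assms(2) by blast
next
  case (Cons k ks)
  note f = Cons.prems
  let ?k = "complex_of_nat k + 1/2"
  have E: "virasoro p (virasoro q f) (k # ks) = virasoro p (virasoro q (D k f)) ks + ?k * virasoro p (mode (k + q) f) ks
     + ?k * (virasoro q (mode (k + p) f) ks + (of_nat (k + p) - 1/2) * mode (k + p + q - 1) f ks)"
    if "p + q \<ge> 1" for p q
  proof -
    have "virasoro p (virasoro q f) (k # ks) = virasoro p (D k (virasoro q f)) ks + ?k * mode (k + p) (virasoro q f) ks"
      by (rule virasoro_D[OF sym_virasoro[OF f]])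
    also have "D k (virasoro q f) = (\<lambda>ks. virasoro q (D k f) ks + ?k * mode (k + q) f ks)"
      by (intro ext virasoro_D f)
    also have "virasoro p \<dots> ks = virasoro p (virasoro q (D k f)) ks + ?k * virasoro p (mode (k + q) f) ks"
      by (simp add: virasoro_add virasoro_cmult)
    also have "mode (k + p) (virasoro q f) ks = virasoro q (mode (k + p) f) ks + (of_nat (k + p) - 1/2) * mode (k + p + q - 1) f ks"
      by (rule mode_virasoro[OF f]) (use that in auto)
    finally show ?thesis by simp
  qed
  have "k + p + q - 1 = k + (p + q - 1)" "k + q + p - 1 = k + (p + q - 1)" using assms(2) by auto
  moreover have "virasoro p (virasoro q (D k f)) ks
      = virasoro q (virasoro p (D k f)) ks + (of_nat p - of_nat q) * virasoro (p + q - 1) (D k f) ks"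
    using Cons.IH[OF sym_D[OF f], of k] by (simp add: algebra_simps)
  ultimately show ?case
    using assms(2)
    unfolding E[OF assms(2)] E[OF assms(2)[unfolded add.commute[of p q]]] virasoro_D[OF f]
    by (simp only:) (simp add: field_simps)
qed

section \<open>The partition function\<close>

text \<open>An index k counts k + 1, so that a bound on the weight limits the length of the list as
  well as its entries.\<close>

definition weight :: "nat list \<Rightarrow> nat" where
  "weight ks = (\<Sum>k\<leftarrow>ks. Suc k)"

lemma weight_simps [simp]: "weight [] = 0" "weight (k # ks) = Suc k + weight ks"
  by (simp_all add: weight_def)

text \<open>The bound is an integer because derivatives may push it below 0, and then the function
  vanishes identically.\<close>

definition bounded_by :: "int \<Rightarrow> list_fun \<Rightarrow> bool" where
  "bounded_by w f \<longleftrightarrow> (\<forall>ks. int (weight ks) > w \<longrightarrow> f ks = 0)"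

lemma bounded_byD: "bounded_by w f \<Longrightarrow> int (weight ks) > w \<Longrightarrow> f ks = 0"
  by (simp add: bounded_by_def)

lemma bounded_by_mono: "bounded_by w f \<Longrightarrow> w \<le> w' \<Longrightarrow> bounded_by w' f"
  by (auto simp: bounded_by_def)

lemma bounded_by_D: "bounded_by w f \<Longrightarrow> bounded_by (w - int k - 1) (D k f)"
  by (auto simp: bounded_by_def)

lemma bounded_by_D_eq_0: "bounded_by w f \<Longrightarrow> int k \<ge> w \<Longrightarrow> f (k # ks) = 0"
  by (auto simp: bounded_by_def)

lemma bounded_by_add: "bounded_by w f \<Longrightarrow> bounded_by w g \<Longrightarrow> bounded_by w (\<lambda>ks. f ks + g ks)"
  by (auto simp: bounded_by_def)

lemma bounded_by_cmult: "bounded_by w f \<Longrightarrow> bounded_by w (\<lambda>ks. c * f ks)"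
  by (auto simp: bounded_by_def)

lemma bounded_by_sum: "(\<And>i. i \<in> I \<Longrightarrow> bounded_by w (F i)) \<Longrightarrow> bounded_by w (\<lambda>ks. \<Sum>i\<in>I. F i ks)"
  by (auto simp: bounded_by_def intro!: sum.neutral)

lemma bounded_by_mult_var: "bounded_by w f \<Longrightarrow> bounded_by (w + int a + 1) (mult_var a f)"
  unfolding bounded_by_def[of "w + int a + 1"]
proof (intro allI impI)
  fix ks assume "bounded_by w f" "int (weight ks) > w + int a + 1"
  then show "mult_var a f ks = 0"
  proof (induction ks arbitrary: f w)
    case (Cons k ks)
    have "mult_var a (D k f) ks = 0"
      by (rule Cons.IH[OF bounded_by_D[OF Cons.prems(1)]]) (use Cons.prems in auto)
    then show ?case using Cons.prems by (auto intro: bounded_byD)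
  qed simp
qed

lemma bounded_by_euler_op: "bounded_by w f \<Longrightarrow> bounded_by (w + 1 - int p) (euler_op p f)"
  unfolding bounded_by_def[of "w + 1 - int p"]
proof (intro allI impI)
  fix ks assume "bounded_by w f" "int (weight ks) > w + 1 - int p"
  then show "euler_op p f ks = 0"
  proof (induction ks arbitrary: f w)
    case (Cons k ks)
    have "euler_op p (D k f) ks = 0"
      by (rule Cons.IH[OF bounded_by_D[OF Cons.prems(1)]]) (use Cons.prems in auto)
    then show ?case using Cons.prems by (auto intro!: bounded_byD[of w f])
  qed simp
qed

lemma bounded_by_pair_op: "bounded_by w f \<Longrightarrow> bounded_by (w - int p) (pair_op p f)"
  unfolding pair_op_def by (rule bounded_by_sum) (auto simp: bounded_by_def)

text \<open>The 2 is the weight of t_0^2 in \<open>virasoro 0\<close>. Together with the 1 for the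
  new index it accounts for the growth by 3 at each step of \<open>partition_fun\<close>.\<close>

lemma bounded_by_virasoro:
  assumes "bounded_by w f"
  shows "bounded_by (w + 2 - int p) (virasoro p f)"
proof -
  note * = bounded_byD[OF bounded_by_euler_op[OF assms]] bounded_byD[OF bounded_by_pair_op[OF assms]]
    bounded_byD[OF bounded_by_mult_var[OF bounded_by_mult_var[OF assms]]] bounded_byD[OF assms]
  show ?thesis
    unfolding bounded_by_def virasoro_def using assms by (auto simp: *)
qed

lemma virasoro_eq_0: "bounded_by w f \<Longrightarrow> int p > w + 2 \<Longrightarrow> virasoro p f ks = 0"
  using bounded_by_virasoro[of w f p] by (auto simp: bounded_by_def)

lemma virasoro_sum: "finite I \<Longrightarrow> virasoro p (\<lambda>ks. \<Sum>i\<in>I. F i ks) ks = (\<Sum>i\<in>I. virasoro p (F i) ks)"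
proof (induction I rule: finite_induct)
  case empty then show ?case using virasoro_cmult[of p 0 "\<lambda>_. 0" ks] by simp
next
  case (insert x I)
  then show ?case using virasoro_add[of p "F x" "\<lambda>ks. \<Sum>i\<in>I. F i ks" ks] by simp
qed

text \<open>The sum over \<open>m\<close> is infinite in principle; all terms beyond the cutoff vanish.\<close>
primrec partition_fun :: "(nat \<Rightarrow> complex) \<Rightarrow> nat \<Rightarrow> list_fun" where
  "partition_fun c 0 = (\<lambda>ks. if ks = [] then 1 else 0)"
| "partition_fun c (Suc N) = (\<lambda>ks. case ks of [] \<Rightarrow> 0
     | k # ks \<Rightarrow> -2 * (\<Sum>m<3 * N + 3. c m * virasoro (k + m) (partition_fun c N) ks))"

lemma bounded_by_partition_fun: "bounded_by (3 * int N) (partition_fun c N)"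
proof (induction N)
  case 0 then show ?case by (auto simp: bounded_by_def)
next
  case (Suc N)
  have "partition_fun c (Suc N) (k # ks) = 0" if "int (weight (k # ks)) > 3 * int (Suc N)" for k ks
    using that bounded_byD[OF bounded_by_virasoro[OF Suc], of "k + _" ks]
    by (auto intro!: sum.neutral)
  then have "partition_fun c (Suc N) ks = 0" if "int (weight ks) > 3 * int (Suc N)" for ks
    using that by (cases ks) auto
  then show ?case unfolding bounded_by_def by blast
qed

lemma partition_fun_Cons:
  assumes "K \<ge> 3 * N + 3"
  shows "partition_fun c (Suc N) (k # ks) = -2 * (\<Sum>m<K. c m * virasoro (k + m) (partition_fun c N) ks)"
proof -
  have "virasoro (k + m) (partition_fun c N) ks = 0" if "m \<ge> 3 * N + 3" for m
    using that by (intro virasoro_eq_0[OF bounded_by_partition_fun]) auto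
  then have "(\<Sum>m<3 * N + 3. c m * virasoro (k + m) (partition_fun c N) ks)
     = (\<Sum>m<K. c m * virasoro (k + m) (partition_fun c N) ks)"
    using assms by (intro sum.mono_neutral_left) auto
  then show ?thesis by simp
qed

text \<open>
  The commutation relations make the 1-form \<open>\<Sum>\<^sub>k Z\<^sub>N\<^sub>+\<^sub>1(k # \<hyphen>) dt\<^sub>k\<close> closed; this is the symmetry of the
  correlators.
\<close>
lemma partition_fun_swap:
  assumes symmetric_fun: "symmetric_fun (partition_fun c N)" "\<And>M. N = Suc M \<Longrightarrow> symmetric_fun (partition_fun c M)"
  shows "partition_fun c (Suc N) (k # j # ks) = partition_fun c (Suc N) (j # k # ks)"
proof (cases "j = k")
  \<comment> \<open>Distinct indices satisfy j + k \<ge> 1. Hence no index below is truncated, and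
    \<open>mode\<close> is always a derivative.\<close>
  case False
  define K where "K = 3 * N + 3"
  have E: "partition_fun c (Suc N) (k # j # ks) = -2 * (\<Sum>m<K. c m *
     (virasoro (k + m) (D j (partition_fun c N)) ks + (of_nat j + 1/2) * mode (j + k + m) (partition_fun c N) ks))" for j k
    by (subst partition_fun_Cons[of N K]) (simp_all add: K_def virasoro_D[OF symmetric_fun(1)] add.assoc)
  show ?thesis
  proof (cases N)
    case 0
    have "mode (j + k + m) (partition_fun c N) ks = 0" for m
      using False by (cases "j + k + m") (auto simp: 0)
    moreover have "virasoro p (D i (partition_fun c N)) ks = 0" for i p
      using virasoro_cmult[of p 0 "\<lambda>_. 0" ks] by (simp add: 0)
    ultimately show ?thesis unfolding E by (simp add: add.commute[of k j])
  next
    case (Suc M)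
    let ?Z = "partition_fun c M"
    have S: "symmetric_fun ?Z" by (rule symmetric_fun(2)[OF Suc])
    define V where "V a b = virasoro a (virasoro b ?Z) ks" for a b
    define T where "T a = virasoro a ?Z ks" for a
    have D: "D i (partition_fun c N) = (\<lambda>ks. \<Sum>r<K. (-2 * c r) * virasoro (i + r) ?Z ks)" for i
    proof
      fix ks
      have "partition_fun c (Suc M) (i # ks) = -2 * (\<Sum>r<K. c r * virasoro (i + r) ?Z ks)"
        by (rule partition_fun_Cons) (simp add: K_def Suc)
      then show "partition_fun c N (i # ks) = (\<Sum>r<K. (-2 * c r) * virasoro (i + r) ?Z ks)"
        unfolding Suc by (simp only: sum_distrib_left mult.assoc)
    qed
    have 1: "virasoro (k + m) (D j (partition_fun c N)) ks = (\<Sum>r<K. -2 * c r * V (k + m) (j + r))" for j k m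
      unfolding D by (simp only: virasoro_sum[OF finite_lessThan] virasoro_cmult V_def)
    have 2: "mode (j + k + m) (partition_fun c N) ks = (\<Sum>r<K. -2 * c r * T (j + k + m + r - 1))" if jk: "j + k \<ge> 1" for j k m
    proof -
      define i where "i = j + k + m - 1"
      have i: "j + k + m = Suc i" using jk by (simp add: i_def)
      then have "mode (j + k + m) (partition_fun c N) ks = D i (partition_fun c N) ks" by simp
      then show ?thesis using fun_cong[OF D[of i], of ks] by (simp add: T_def i)
    qed
    have E': "partition_fun c (Suc N) (k # j # ks) =
       4 * (\<Sum>m<K. \<Sum>r<K. c m * c r * V (k + m) (j + r))
       + 4 * (of_nat j + 1/2) * (\<Sum>m<K. \<Sum>r<K. c m * c r * T (j + k + m + r - 1))"  if "j + k \<ge> 1" for j k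
      unfolding E 1 2[OF that] by (simp add: sum_distrib_left sum.distrib algebra_simps)
    have jk: "j + k \<ge> 1" "k + j \<ge> 1" using False by auto
    have sw: "(\<Sum>m<K. \<Sum>r<K. c m * c r * V (j + m) (k + r)) = (\<Sum>m<K. \<Sum>r<K. c m * c r * V (j + r) (k + m))"
      by (subst sum.swap) (simp add: mult.commute)
    have anti: "(\<Sum>m<K. \<Sum>r<K. c m * c r * ((of_nat m - of_nat r) * T (j + k + m + r - 1))) = 0"
    proof -
      let ?A = "\<Sum>m<K. \<Sum>r<K. c m * c r * ((of_nat m - of_nat r) * T (j + k + m + r - 1))"
      have "?A = (\<Sum>m<K. \<Sum>r<K. c r * c m * ((of_nat r - of_nat m) * T (j + k + r + m - 1)))"
        by (rule sum.swap)
      also have "\<dots> = (\<Sum>m<K. \<Sum>r<K. - (c m * c r * ((of_nat m - of_nat r) * T (j + k + m + r - 1))))"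
        by (intro sum.cong refl) (simp add: add.assoc add.commute[of "_::nat" "_"] algebra_simps)
      also have "\<dots> = - ?A" by (simp add: sum_negf)
      finally show ?thesis by simp
    qed
    \<comment> \<open>The part m - r of the commutator cancels in the double sum by
      \<open>anti\<close>. The part k - j turns the weight j + 1/2 in \<open>E'\<close> into k +
      1/2, which is the weight for the exchanged indices.\<close>
    have "V (k + m) (j + r) = V (j + r) (k + m) + (of_nat m - of_nat r) * T (j + k + m + r - 1)
        + (of_nat k - of_nat j) * T (j + k + m + r - 1)" for m r
    proof -
      have "k + m + (j + r) - 1 = j + k + m + r - 1" by simp
      then show ?thesis
        using virasoro_comm[OF S, of "k + m" "j + r" ks] jk unfolding V_def T_def
        by (simp add: algebra_simps)
    qed
    then have X: "(\<Sum>m<K. \<Sum>r<K. c m * c r * V (k + m) (j + r)) = (\<Sum>m<K. \<Sum>r<K. c m * c r * V (j + r) (k + m))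
       + (\<Sum>m<K. \<Sum>r<K. c m * c r * ((of_nat m - of_nat r) * T (j + k + m + r - 1)))
       + (of_nat k - of_nat j) * (\<Sum>m<K. \<Sum>r<K. c m * c r * T (j + k + m + r - 1))"
      unfolding sum_distrib_left sum.distrib[symmetric] by (intro sum.cong refl) (simp only:, simp add: algebra_simps)
    show ?thesis
      unfolding E'[OF jk(1)] E'[OF jk(2)] sw X anti add.commute[of k j] by (simp add: algebra_simps)
  qed
qed simp

lemma sym_partition_fun: "symmetric_fun (partition_fun c N)"
proof (induction N rule: less_induct)
  case (less N)
  show ?case
  proof (cases N)
    case 0
    show ?thesis unfolding 0 by (rule symmetric_funI) auto
  next
    case (Suc M)
    show ?thesis unfolding Suc
    proof (rule sym_headI)
      fix k
      have "D k (partition_fun c (Suc M)) = (\<lambda>ks. -2 * (\<Sum>m<3 * M + 3. c m * virasoro (k + m) (partition_fun c M) ks))"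
        by simp
      then show "symmetric_fun (D k (partition_fun c (Suc M)))"
        using less[of M] Suc by (simp only:) (intro sym_cmult sym_sum sym_virasoro, simp)
    next
      fix i j ks
      show "partition_fun c (Suc M) (i # j # ks) = partition_fun c (Suc M) (j # i # ks)"
        by (rule partition_fun_swap) (use less Suc in auto)
    qed
  qed
qed

section \<open>Change of coordinates by a heat flow\<close>

lemma mult_var_sum: "finite I \<Longrightarrow> mult_var a (\<lambda>ks. \<Sum>i\<in>I. F i ks) ks = (\<Sum>i\<in>I. mult_var a (F i) ks)"
  by (induction I rule: finite_induct) (simp_all add: mult_var_zero mult_var_add)

definition laplace_op :: "nat \<Rightarrow> (nat \<Rightarrow> nat \<Rightarrow> complex) \<Rightarrow> list_fun \<Rightarrow> list_fun" where
  "laplace_op K \<beta> f ks = 1/2 * (\<Sum>i<K. \<Sum>j<K. \<beta> i j * f (i # j # ks))"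

text \<open>
  The heat flow is the full exponential series only on functions that are bounded by a weight below the
  cutoff \<open>K\<close>.
\<close>
definition heat_op :: "nat \<Rightarrow> (nat \<Rightarrow> nat \<Rightarrow> complex) \<Rightarrow> list_fun \<Rightarrow> list_fun" where
  "heat_op K \<beta> f ks = (\<Sum>r<K. (laplace_op K \<beta> ^^ r) f ks / fact r)"

text \<open>The commutator of the Laplacian with t_a. It has constant coefficients and thus commutes
  with the Laplacian, so the conjugation of t_a by the heat flow stops after one correction.\<close>

definition contract_var :: "nat \<Rightarrow> (nat \<Rightarrow> nat \<Rightarrow> complex) \<Rightarrow> nat \<Rightarrow> list_fun \<Rightarrow> list_fun" where
  "contract_var K \<beta> a f ks = (\<Sum>j<K. \<beta> a j * f (j # ks))"

lemma laplace_op_add: "laplace_op K \<beta> (\<lambda>ks. f ks + g ks) = (\<lambda>ks. laplace_op K \<beta> f ks + laplace_op K \<beta> g ks)"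
  by (simp add: laplace_op_def fun_eq_iff sum.distrib algebra_simps)

lemma laplace_op_cmult: "laplace_op K \<beta> (\<lambda>ks. c * f ks) = (\<lambda>ks. c * laplace_op K \<beta> f ks)"
  by (simp add: laplace_op_def fun_eq_iff sum_distrib_left mult_ac)

lemma laplace_op_sum: "finite I \<Longrightarrow> laplace_op K \<beta> (\<lambda>ks. \<Sum>i\<in>I. F i ks) = (\<lambda>ks. \<Sum>i\<in>I. laplace_op K \<beta> (F i) ks)"
proof (induction I rule: finite_induct)
  case empty then show ?case using laplace_op_cmult[of K \<beta> 0 "\<lambda>_. 0"] by simp
qed (simp add: laplace_op_add)

lemma laplace_op_D: "symmetric_fun f \<Longrightarrow> laplace_op K \<beta> (D k f) = D k (laplace_op K \<beta> f)"
  unfolding laplace_op_def fun_eq_iff by (simp add: sym_move[of f])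

lemma sym_laplace_op: "symmetric_fun f \<Longrightarrow> symmetric_fun (laplace_op K \<beta> f)"
  unfolding laplace_op_def by (intro sym_cmult sym_sum) (rule symmetric_funI, erule symmetric_funD, simp)

lemma bounded_by_laplace_op: "bounded_by w f \<Longrightarrow> bounded_by (w - 2) (laplace_op K \<beta> f)"
  unfolding laplace_op_def by (intro bounded_by_cmult bounded_by_sum) (auto simp: bounded_by_def)

lemma sym_laplace_iter: "symmetric_fun f \<Longrightarrow> symmetric_fun ((laplace_op K \<beta> ^^ r) f)"
  by (induction r) (simp_all add: sym_laplace_op)

lemma bounded_by_laplace_iter: "bounded_by w f \<Longrightarrow> bounded_by (w - 2 * int r) ((laplace_op K \<beta> ^^ r) f)"
proof (induction r)
  case (Suc r)
  then show ?case using bounded_by_laplace_op[of "w - 2 * int r"] by (simp add: algebra_simps)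
qed simp

lemma laplace_iter_add:
  "(laplace_op K \<beta> ^^ r) (\<lambda>ks. f ks + g ks) = (\<lambda>ks. (laplace_op K \<beta> ^^ r) f ks + (laplace_op K \<beta> ^^ r) g ks)"
  by (induction r) (simp_all add: laplace_op_add)

lemma laplace_iter_cmult:
  "(laplace_op K \<beta> ^^ r) (\<lambda>ks. c * f ks) = (\<lambda>ks. c * (laplace_op K \<beta> ^^ r) f ks)"
  by (induction r) (simp_all add: laplace_op_cmult)

lemma laplace_iter_D: "symmetric_fun f \<Longrightarrow> (laplace_op K \<beta> ^^ r) (D k f) = D k ((laplace_op K \<beta> ^^ r) f)"
  by (induction r) (simp_all add: laplace_op_D sym_laplace_iter)

lemma heat_op_add: "heat_op K \<beta> (\<lambda>ks. f ks + g ks) = (\<lambda>ks. heat_op K \<beta> f ks + heat_op K \<beta> g ks)"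
  by (simp add: heat_op_def fun_eq_iff laplace_iter_add sum.distrib add_divide_distrib)

lemma heat_op_cmult: "heat_op K \<beta> (\<lambda>ks. c * f ks) = (\<lambda>ks. c * heat_op K \<beta> f ks)"
  by (simp add: heat_op_def fun_eq_iff laplace_iter_cmult sum_distrib_left)

lemma heat_op_zero: "heat_op K \<beta> (\<lambda>ks. 0) = (\<lambda>ks. 0)"
  using heat_op_cmult[of K \<beta> 0 "\<lambda>_. 0"] by simp

lemma heat_op_sum: "finite I \<Longrightarrow> heat_op K \<beta> (\<lambda>ks. \<Sum>i\<in>I. F i ks) = (\<lambda>ks. \<Sum>i\<in>I. heat_op K \<beta> (F i) ks)"
  by (induction I rule: finite_induct) (simp_all add: heat_op_zero heat_op_add)

lemma heat_op_D: "symmetric_fun f \<Longrightarrow> heat_op K \<beta> (D k f) = D k (heat_op K \<beta> f)"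
  by (simp add: heat_op_def fun_eq_iff laplace_iter_D)

lemma sym_heat_op: "symmetric_fun f \<Longrightarrow> symmetric_fun (heat_op K \<beta> f)"
  unfolding heat_op_def divide_inverse by (subst mult.commute) (intro sym_sum sym_cmult sym_laplace_iter)

lemma bounded_by_heat_op: "bounded_by w f \<Longrightarrow> bounded_by w (heat_op K \<beta> f)"
  unfolding heat_op_def divide_inverse
  by (subst mult.commute, intro bounded_by_sum bounded_by_cmult)
    (rule bounded_by_mono[OF bounded_by_laplace_iter], auto)

lemma laplace_op_indep: "bounded_by w f \<Longrightarrow> w \<le> int K \<Longrightarrow> K \<le> K' \<Longrightarrow> laplace_op K \<beta> f = laplace_op K' \<beta> f"
proof
  fix ks assume *: "bounded_by w f" "w \<le> int K" "K \<le> K'"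
  have z: "f (i # j # ks) = 0" if "i \<ge> K \<or> j \<ge> K" for i j
    using that * by (intro bounded_byD[OF *(1)]) auto
  have "(\<Sum>i<K. \<Sum>j<K. \<beta> i j * f (i # j # ks)) = (\<Sum>i<K. \<Sum>j<K'. \<beta> i j * f (i # j # ks))"
    using * z by (intro sum.cong refl sum.mono_neutral_left) auto
  also have "\<dots> = (\<Sum>i<K'. \<Sum>j<K'. \<beta> i j * f (i # j # ks))"
    using * z by (intro sum.mono_neutral_left) (auto intro!: sum.neutral)
  finally show "laplace_op K \<beta> f ks = laplace_op K' \<beta> f ks" by (simp add: laplace_op_def)
qed

lemma heat_op_indep:
  assumes f: "bounded_by w f" and K: "w < int K" "2 \<le> K" "K \<le> K'"
  shows "heat_op K \<beta> f = heat_op K' \<beta> f"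
proof
  fix ks
  have it: "(laplace_op K \<beta> ^^ r) f = (laplace_op K' \<beta> ^^ r) f" for r
  proof (induction r)
    case (Suc r)
    have "laplace_op K \<beta> ((laplace_op K \<beta> ^^ r) f) = laplace_op K' \<beta> ((laplace_op K \<beta> ^^ r) f)"
      by (rule laplace_op_indep[OF bounded_by_laplace_iter[OF f]]) (use K in auto)
    then show ?case using Suc by simp
  qed simp
  have "(laplace_op K' \<beta> ^^ r) f ks = 0" if "r \<ge> K" for r
    by (rule bounded_byD[OF bounded_by_laplace_iter[OF f]]) (use K that in auto)
  then show "heat_op K \<beta> f ks = heat_op K' \<beta> f ks"
    unfolding heat_op_def it using K by (intro sum.mono_neutral_left) auto
qed

lemma laplace_op_mult_var:
  assumes "\<And>i j. \<beta> i j = \<beta> j i" "a < K"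
  shows "laplace_op K \<beta> (mult_var a f) ks = mult_var a (laplace_op K \<beta> f) ks + contract_var K \<beta> a f ks"
proof -
  have "(\<Sum>i<K. \<Sum>j<K. \<beta> i j * (if i = a then f (j # ks) else 0)) = (\<Sum>i<K. if i = a then contract_var K \<beta> a f ks else 0)"
    by (intro sum.cong) (auto simp: contract_var_def)
  then have 1: "(\<Sum>i<K. \<Sum>j<K. \<beta> i j * (if i = a then f (j # ks) else 0)) = contract_var K \<beta> a f ks"
    using assms(2) by simp
  have 2: "(\<Sum>i<K. \<Sum>j<K. \<beta> i j * (if j = a then f (i # ks) else 0)) = contract_var K \<beta> a f ks"
    unfolding 1[symmetric] by (subst sum.swap) (simp add: assms(1))
  have 3: "mult_var a (laplace_op K \<beta> f) ks = 1/2 * (\<Sum>i<K. \<Sum>j<K. \<beta> i j * mult_var a (D j (D i f)) ks)"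
    unfolding laplace_op_def by (simp only: mult_var_cmult mult_var_sum finite_lessThan)
  have "laplace_op K \<beta> (mult_var a f) ks = 1/2 * ((\<Sum>i<K. \<Sum>j<K. \<beta> i j * (if i = a then f (j # ks) else 0))
     + (\<Sum>i<K. \<Sum>j<K. \<beta> i j * (if j = a then f (i # ks) else 0))) + mult_var a (laplace_op K \<beta> f) ks"
    unfolding 3 unfolding laplace_op_def distrib_left[symmetric] sum.distrib[symmetric] by (simp add: algebra_simps)
  then show ?thesis unfolding 1 2 by simp
qed

lemma laplace_op_contract_var: "symmetric_fun f \<Longrightarrow> laplace_op K \<beta> (contract_var K \<beta> a f) = contract_var K \<beta> a (laplace_op K \<beta> f)"
proof
  fix ks assume f: "symmetric_fun f"
  have "laplace_op K \<beta> (contract_var K \<beta> a f) = laplace_op K \<beta> (\<lambda>ks. \<Sum>l<K. \<beta> a l * D l f ks)"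
    by (simp add: contract_var_def[abs_def])
  then have "laplace_op K \<beta> (contract_var K \<beta> a f) ks = (\<Sum>l<K. \<beta> a l * laplace_op K \<beta> (D l f) ks)"
    by (simp only: laplace_op_sum[OF finite_lessThan] laplace_op_cmult)
  then show "laplace_op K \<beta> (contract_var K \<beta> a f) ks = contract_var K \<beta> a (laplace_op K \<beta> f) ks"
    by (simp add: contract_var_def laplace_op_D[OF f])
qed

lemma laplace_iter_mult_var:
  assumes "\<And>i j. \<beta> i j = \<beta> j i" "a < K" "symmetric_fun f"
  shows "(laplace_op K \<beta> ^^ r) (mult_var a f)
    = (\<lambda>ks. mult_var a ((laplace_op K \<beta> ^^ r) f) ks + of_nat r * contract_var K \<beta> a ((laplace_op K \<beta> ^^ (r - 1)) f) ks)"
proof (induction r)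
  case (Suc r)
  have cr: "of_nat r * contract_var K \<beta> a (laplace_op K \<beta> ((laplace_op K \<beta> ^^ (r - 1)) f)) ks
     = of_nat r * contract_var K \<beta> a ((laplace_op K \<beta> ^^ r) f) ks" for ks
    by (cases r) auto
  have "(laplace_op K \<beta> ^^ Suc r) (mult_var a f) = (\<lambda>ks. laplace_op K \<beta> (mult_var a ((laplace_op K \<beta> ^^ r) f)) ks
      + of_nat r * contract_var K \<beta> a (laplace_op K \<beta> ((laplace_op K \<beta> ^^ (r - 1)) f)) ks)"
    using laplace_op_contract_var[OF sym_laplace_iter[OF assms(3)]]
    by (simp only: funpow.simps comp_apply Suc.IH laplace_op_add laplace_op_cmult)
  then show ?case
    unfolding cr laplace_op_mult_var[OF assms(1,2)] by (simp add: algebra_simps)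
qed simp

text \<open>The rule exp(L) t_a = (t_a + [L, t_a]) exp(L), valid because [L, t_a] commutes with
  L.\<close>

lemma heat_op_mult_var:
  assumes \<beta>: "\<And>i j. \<beta> i j = \<beta> j i" and a: "a < K" and f: "symmetric_fun f" "bounded_by w f" and K: "w < int K" "2 \<le> K"
  shows "heat_op K \<beta> (mult_var a f) = (\<lambda>ks. mult_var a (heat_op K \<beta> f) ks + contract_var K \<beta> a (heat_op K \<beta> f) ks)"
proof
  fix ks
  let ?L = "\<lambda>r. (laplace_op K \<beta> ^^ r) f"
  obtain K' where K': "K = Suc K'" using K(2) by (cases K) auto
  \<comment> \<open>The index shift below loses the power K - 1 of the Laplacian. It vanishes since
    2 (K - 1) > w, and this is where \<open>2 \<le> K\<close> enters.\<close>
  have "?L K' ks = 0" for ks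
    by (rule bounded_byD[OF bounded_by_laplace_iter[OF f(2)]]) (use K K' in auto)
  then have *: "contract_var K \<beta> a (?L K') ks = 0" by (simp add: contract_var_def)
  have "heat_op K \<beta> (mult_var a f) ks = (\<Sum>r<K. mult_var a (?L r) ks / fact r) + (\<Sum>r<K. of_nat r * contract_var K \<beta> a (?L (r - 1)) ks / fact r)"
    unfolding heat_op_def laplace_iter_mult_var[OF \<beta> a f(1)] by (simp add: sum.distrib add_divide_distrib)
  also have "(\<Sum>r<K. of_nat r * contract_var K \<beta> a (?L (r - 1)) ks / fact r) = (\<Sum>r<K'. contract_var K \<beta> a (?L r) ks / fact r)"
    unfolding K' sum.lessThan_Suc_shift
    by (auto intro!: sum.cong simp: field_simps simp del: of_nat_Suc)
  also have "\<dots> = (\<Sum>r<K. contract_var K \<beta> a (?L r) ks / fact r)"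
    using * by (simp add: K')
  also have "\<dots> = contract_var K \<beta> a (heat_op K \<beta> f) ks"
    unfolding contract_var_def heat_op_def sum_distrib_left sum_divide_distrib by (subst sum.swap) simp
  also have "(\<Sum>r<K. mult_var a (?L r) ks / fact r) = mult_var a (heat_op K \<beta> f) ks"
    unfolding heat_op_def using mult_var_sum[of "{..<K}" a "\<lambda>r ks. ?L r ks / fact r" ks]
      mult_var_cmult[of a "inverse (fact _)"]
    by (simp add: divide_inverse mult.commute)
  finally show "heat_op K \<beta> (mult_var a f) ks = mult_var a (heat_op K \<beta> f) ks + contract_var K \<beta> a (heat_op K \<beta> f) ks" .
qed

section \<open>Virasoro operators as normal-ordered squares of a field\<close>

lemma heat_op_pair_op: "symmetric_fun f \<Longrightarrow> heat_op K \<beta> (pair_op p f) = pair_op p (heat_op K \<beta> f)"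
proof
  fix ks assume f: "symmetric_fun f"
  have "pair_op p f = (\<lambda>ks. \<Sum>i<p - 1. D (p - 2 - i) (D i f) ks)"
    by (simp add: pair_op_def fun_eq_iff)
  then have "heat_op K \<beta> (pair_op p f) ks = (\<Sum>i<p - 1. heat_op K \<beta> (D (p - 2 - i) (D i f)) ks)"
    by (simp only: heat_op_sum finite_lessThan)
  then show "heat_op K \<beta> (pair_op p f) ks = pair_op p (heat_op K \<beta> f) ks"
    by (simp add: heat_op_D[OF f] heat_op_D[OF sym_D[OF f]] pair_op_def)
qed

text \<open>Writes the Euler operator as a sum of products of t_a with a derivative, so that the
  conjugation rule for t_a applies term by term.\<close>

lemma euler_op_eq_sum:
  assumes "symmetric_fun f" "bounded_by w f" "w < int K"
  shows "euler_op p f ks = (\<Sum>a<K. (2 * of_nat a + 1) * mult_var a (if a + p = 0 then (\<lambda>_. 0) else D (a + p - 1) f) ks)"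
  using assms
proof (induction ks arbitrary: f w)
  case (Cons k ks)
  let ?g = "\<lambda>f a. if a + p = 0 then (\<lambda>_. 0) else D (a + p - 1) f"
  have IH: "euler_op p (D k f) ks = (\<Sum>a<K. (2 * of_nat a + 1) * mult_var a (?g (D k f) a) ks)"
    by (rule Cons.IH[OF _ bounded_by_D[OF Cons.prems(2)]]) (use Cons.prems in auto)
  have sw: "(\<lambda>ks. ?g f a (k # ks)) = ?g (D k f) a" for a
    using sym_swap[OF Cons.prems(1)] by auto
  have "(2 * of_nat a + 1) * mult_var a (?g f a) (k # ks)
      = (if a = k then (2 * of_nat k + 1) * ?g f k ks else 0) + (2 * of_nat a + 1) * mult_var a (?g (D k f) a) ks" for a
    unfolding mult_var.simps(2) sw by (simp add: distrib_left)
  then have "(\<Sum>a<K. (2 * of_nat a + 1) * mult_var a (?g f a) (k # ks))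
      = (if k < K then (2 * of_nat k + 1) * ?g f k ks else 0) + euler_op p (D k f) ks"
    unfolding IH by (simp only: sum.distrib) simp
  moreover have "?g f k ks = 0" if "\<not> k < K"
    using that Cons.prems(3) by (auto intro!: bounded_byD[OF Cons.prems(2)])
  ultimately show ?case by (auto split: if_splits)
qed simp

text \<open>The coefficient of \<zeta>^(2a): a pole comes from the single derivative with k = -a-1,
  while for a \<ge> 0 every derivative contributes through its regular part \<open>b\<close>. The
  source is kept apart so that this operator is a derivation.\<close>

definition deriv_mode :: "nat \<Rightarrow> (nat \<Rightarrow> nat \<Rightarrow> complex) \<Rightarrow> int \<Rightarrow> list_fun \<Rightarrow> list_fun" where
  "deriv_mode K b a f ks = (if a < 0 then f (nat (- a - 1) # ks) else \<Sum>j<K. b j (nat a) * f (j # ks))"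

text \<open>
  The coefficient of \<open>\<zeta>\<^sup>2\<^sup>a d\<zeta>\<close> in the field: \<open>\<partial>\<^sub>k\<close> multiplies \<open>\<zeta>\<^bsup>-2k-2\<^esup> + \<Sum>\<^sub>a b k a \<zeta>\<^sup>2\<^sup>a\<close>, and the source \<open>t\<^sub>a\<close>
  multiplies \<open>(2a + 1) \<zeta>\<^sup>2\<^sup>a\<close>.
\<close>
definition field_mode :: "nat \<Rightarrow> (nat \<Rightarrow> nat \<Rightarrow> complex) \<Rightarrow> int \<Rightarrow> list_fun \<Rightarrow> list_fun" where
  "field_mode K b a f ks = deriv_mode K b a f ks + (if a < 0 then 0 else (2 * of_int a + 1) * mult_var (nat a) f ks)"

text \<open>Normal ordering: the smaller index acts first, so that a mode of negative index never
  differentiates the source in its partner.\<close>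

definition normal_pair :: "nat \<Rightarrow> (nat \<Rightarrow> nat \<Rightarrow> complex) \<Rightarrow> int \<Rightarrow> int \<Rightarrow> list_fun \<Rightarrow> list_fun" where
  "normal_pair K b a a' f = field_mode K b (max a a') (field_mode K b (min a a') f)"

lemma field_mode_neg: "field_mode K b (- 1 - int i) f = D i f"
  by (simp add: field_mode_def deriv_mode_def fun_eq_iff)

lemma field_mode_zero: "field_mode K b a (\<lambda>_. 0) ks = 0"
  by (simp add: field_mode_def deriv_mode_def mult_var_zero)

text \<open>Sort the pairs of indices with sum -p by sign: two negative indices give
  \<open>pair_op\<close>, a negative and a nonnegative one give each mixed term twice, and the pair
  (0, 0) occurs only for p = 0.\<close>

lemma normal_pair_sum:
  assumes f: "symmetric_fun f" "bounded_by w f" "w < int K"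
  shows "(\<Sum>a\<in>{- int K..<int K}. normal_pair K b a (- int p - a) f ks)
    = pair_op p f ks + 2 * (\<Sum>a<K. if a + p = 0 then 0 else field_mode K b (int a) (D (a + p - 1) f) ks)
      + (if p = 0 \<and> K > 0 then field_mode K b 0 (field_mode K b 0 f) ks else 0)"
proof -
  let ?N = "\<lambda>a. normal_pair K b a (- int p - a) f ks"
  let ?J = "\<lambda>a. if a + p = 0 then 0 else field_mode K b (int a) (D (a + p - 1) f) ks"
  have z: "D i f = (\<lambda>_. 0)" if "i \<ge> K - 1" for i
    using that f(3) by (intro ext bounded_byD[OF f(2)]) auto
  have "(\<Sum>a\<in>{- int K..<int K}. ?N a) = (\<Sum>a\<in>{- int K..<0}. ?N a) + (\<Sum>a\<in>{0..<int K}. ?N a)"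
    by (subst sum.union_disjoint[symmetric]) (auto intro!: sum.cong)
  also have "(\<Sum>a\<in>{0..<int K}. ?N a) = (\<Sum>i<K. ?N (int i))"
    by (rule sum.reindex_bij_witness[of _ int nat]) auto
  also have "(\<Sum>i<K. ?N (int i)) = (\<Sum>i<K. ?J i + (if i + p = 0 then field_mode K b 0 (field_mode K b 0 f) ks else 0))"
  proof (rule sum.cong[OF refl])
    fix i
    show "?N (int i) = ?J i + (if i + p = 0 then field_mode K b 0 (field_mode K b 0 f) ks else 0)"
    proof (cases "i + p = 0")
      case False
      then have "max (int i) (- int p - int i) = int i" "min (int i) (- int p - int i) = - 1 - int (i + p - 1)" by auto
      then show ?thesis using False unfolding normal_pair_def by (simp only: field_mode_neg) simp
    qed (simp add: normal_pair_def)
  qed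
  also have "\<dots> = (\<Sum>i<K. ?J i) + (if p = 0 \<and> K > 0 then field_mode K b 0 (field_mode K b 0 f) ks else 0)"
    by (cases "p = 0") (simp_all add: sum.distrib)
  also have "(\<Sum>a\<in>{- int K..<0}. ?N a) = (\<Sum>i<K. ?N (- 1 - int i))"
    by (rule sum.reindex_bij_witness[of _ "\<lambda>i. - 1 - int i" "\<lambda>a. nat (- 1 - a)"]) auto
  also have "\<dots> = (\<Sum>i<K. (if i < p - 1 then f (i # (p - 2 - i) # ks) else 0)
      + (if p \<le> i + 1 then field_mode K b (int (i + 1 - p)) (D i f) ks else 0))"
  proof (rule sum.cong[OF refl])
    fix i
    show "?N (- 1 - int i) = (if i < p - 1 then f (i # (p - 2 - i) # ks) else 0)
      + (if p \<le> i + 1 then field_mode K b (int (i + 1 - p)) (D i f) ks else 0)"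
    proof (cases "p \<le> i + 1")
      case True
      then have "max (- 1 - int i) (- int p - (- 1 - int i)) = int (i + 1 - p)"
        "min (- 1 - int i) (- int p - (- 1 - int i)) = - 1 - int i" by auto
      then show ?thesis using True unfolding normal_pair_def by (simp only: field_mode_neg) simp
    next
      case False
      then have e: "- int p - (- 1 - int i) = - 1 - int (p - 2 - i)" by auto
      have "?N (- 1 - int i) = f (i # (p - 2 - i) # ks)"
        unfolding normal_pair_def e max_def min_def using sym_swap[OF f(1)]
        by (auto simp only: field_mode_neg split: if_splits)
      then show ?thesis using False by simp
    qed
  qed
  also have "\<dots> = pair_op p f ks + (\<Sum>i<K. ?J i)"
    unfolding sum.distrib
  proof (rule arg_cong2[of _ _ _ _ "(+)"])
    have "(\<Sum>i<K. if i < p - 1 then f (i # (p - 2 - i) # ks) else 0) = (\<Sum>i<p - 1. if i < K then f (i # (p - 2 - i) # ks) else 0)"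
      unfolding sum.inter_filter[OF finite_lessThan, symmetric] by (intro sum.cong) auto
    also have "\<dots> = pair_op p f ks"
      unfolding pair_op_def using fun_cong[OF z] by (intro sum.cong) auto
    finally show "(\<Sum>i<K. if i < p - 1 then f (i # (p - 2 - i) # ks) else 0) = pair_op p f ks" .
    show "(\<Sum>i<K. if p \<le> i + 1 then field_mode K b (int (i + 1 - p)) (D i f) ks else 0) = (\<Sum>i<K. ?J i)"
    proof -
      let ?S = "{i\<in>{..<K}. p \<le> i + 1}" and ?T = "{a\<in>{..<K}. a + p \<noteq> 0}"
      have "(\<Sum>i\<in>?S. field_mode K b (int (i + 1 - p)) (D i f) ks) = (\<Sum>a\<in>?T. field_mode K b (int a) (D (a + p - 1) f) ks)"
        by (rule sum.reindex_bij_witness_not_neutral[of "{i\<in>?S. i \<ge> K - 1}" "{a\<in>?T. a + p - 1 \<ge> K - 1}" _ "\<lambda>a. a + p - 1" "\<lambda>i. i + 1 - p"])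
          (auto simp: z field_mode_zero)
      moreover have "(\<Sum>a\<in>?T. field_mode K b (int a) (D (a + p - 1) f) ks) = (\<Sum>i<K. ?J i)"
        unfolding sum.inter_filter[OF finite_lessThan] by (intro sum.cong) auto
      ultimately show ?thesis by (simp only: sum.inter_filter[OF finite_lessThan])
    qed
  qed
  finally show ?thesis by simp
qed

section \<open>Conjugation of the Virasoro operators by the heat flow\<close>

context
  fixes b \<beta> :: "nat \<Rightarrow> nat \<Rightarrow> complex"
  assumes \<beta>_def: "\<And>k a. \<beta> k a = b k a / (2 * of_nat a + 1)"
    and b_sym: "\<And>k a. b k a * (2 * of_nat k + 1) = b a k * (2 * of_nat a + 1)"
begin

lemma odd_nonzero: "2 * of_nat a + 1 \<noteq> (0 :: complex)"
proof -
  have "2 * of_nat a + 1 = (of_nat (2 * a + 1) :: complex)" by simp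
  then show ?thesis by (simp only: of_nat_eq_0_iff)
qed

lemma \<beta>_sym: "\<beta> i j = \<beta> j i"
  using b_sym[of i j] odd_nonzero[of i] odd_nonzero[of j] by (simp add: \<beta>_def field_simps)

text \<open>A nonnegative field mode is the bare source (2a + 1) t_a seen through the heat flow;
  this dictates the division by 2a + 1 in \<beta>.\<close>

lemma field_mode_heat:
  assumes "a < K" "symmetric_fun f" "bounded_by w f" "w < int K" "2 \<le> K"
  shows "field_mode K b (int a) (heat_op K \<beta> f) = (\<lambda>ks. (2 * of_nat a + 1) * heat_op K \<beta> (mult_var a f) ks)"
proof -
  have "b j a = (2 * of_nat a + 1) * \<beta> a j" for j
    using odd_nonzero[of a] \<beta>_sym[of a j] by (simp add: \<beta>_def)
  then show ?thesis
    unfolding heat_op_mult_var[OF \<beta>_sym assms]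
    by (simp add: field_mode_def deriv_mode_def contract_var_def fun_eq_iff sum_distrib_left algebra_simps)
qed

text \<open>The flow fixes derivatives and turns each source into a field mode, so the quadratic L_p
  becomes one quarter of a normal-ordered square. The bound w + 1 is that of t_0 f, on which the
  rule for t_0 is used a second time.\<close>

lemma heat_op_virasoro:
  assumes f: "symmetric_fun f" "bounded_by w f" and K: "w + 1 < int K" "2 \<le> K"
  shows "heat_op K \<beta> (virasoro p f) ks = 1/4 * (\<Sum>a\<in>{- int K..<int K}. normal_pair K b a (- int p - a) (heat_op K \<beta> f) ks)
    + (if p = 1 then heat_op K \<beta> f ks / 16 else 0)"
proof -
  let ?H = "heat_op K \<beta>"
  let ?g = "\<lambda>a. if a + p = 0 then (\<lambda>_. 0) else D (a + p - 1) f"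
  have H: "symmetric_fun (?H f)" "bounded_by w (?H f)" using f sym_heat_op bounded_by_heat_op by auto
  have eu: "euler_op p f = (\<lambda>ks. \<Sum>a<K. (2 * of_nat a + 1) * mult_var a (?g a) ks)"
    using euler_op_eq_sum[OF f, of K p] K by (intro ext) simp
  have "?H (euler_op p f) ks = (\<Sum>a<K. (2 * of_nat a + 1) * ?H (mult_var a (?g a)) ks)"
    unfolding eu by (simp only: heat_op_sum[OF finite_lessThan] heat_op_cmult)
  also have "\<dots> = (\<Sum>a<K. if a + p = 0 then 0 else field_mode K b (int a) (D (a + p - 1) (?H f)) ks)"
  proof (rule sum.cong[OF refl])
    fix a assume a: "a \<in> {..<K}"
    have 0: "mult_var a (\<lambda>_. 0) = (\<lambda>_. 0)" for a by (intro ext mult_var_zero)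
    have "field_mode K b (int a) (?H (D i f)) ks = (2 * of_nat a + 1) * ?H (mult_var a (D i f)) ks" for i
      using fun_cong[OF field_mode_heat[OF _ sym_D[OF f(1)] bounded_by_D[OF f(2)], of a K i], of ks] a K by auto
    then show "(2 * of_nat a + 1) * ?H (mult_var a (?g a)) ks = (if a + p = 0 then 0 else field_mode K b (int a) (D (a + p - 1) (?H f)) ks)"
      by (simp add: 0 heat_op_zero heat_op_D[OF f(1)])
  qed
  finally have 1: "?H (euler_op p f) ks = \<dots>" .
  have 2: "?H (mult_var 0 (mult_var 0 f)) = field_mode K b 0 (field_mode K b 0 (?H f))"
  proof -
    have "?H (mult_var 0 f) = field_mode K b 0 (?H f)"
      using field_mode_heat[of 0 K f w] f K by simp
    moreover have "?H (mult_var 0 (mult_var 0 f)) = field_mode K b 0 (?H (mult_var 0 f))"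
      using field_mode_heat[of 0 K "mult_var 0 f" "w + 1"] sym_mult_var[OF f(1)] bounded_by_mult_var[OF f(2), of 0] K by simp
    ultimately show ?thesis by simp
  qed
  have "?H (virasoro p f) ks = 1/2 * ?H (euler_op p f) ks + 1/4 * ?H (pair_op p f) ks
     + (if p = 0 then 1/4 * ?H (mult_var 0 (mult_var 0 f)) ks else 0) + (if p = 1 then ?H f ks / 16 else 0)"
  proof -
    have e: "virasoro p f = (\<lambda>ks. (1/2 * euler_op p f ks + 1/4 * pair_op p f ks)
      + ((if p = 0 then 1/4 else 0) * mult_var 0 (mult_var 0 f) ks + (if p = 1 then 1/16 else 0) * f ks))"
      by (auto simp: virasoro_def fun_eq_iff)
    show ?thesis unfolding e heat_op_add heat_op_cmult by auto
  qed
  then show ?thesis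
    unfolding normal_pair_sum[OF H, of K b p ks, OF order.strict_trans[OF _ K(1)], simplified] 1 2 heat_op_pair_op[OF f(1)]
    using K by (simp add: algebra_simps)
qed

text \<open>The cutoff exceeds the weight bound 3N, so this is the full heat flow. For the level N +
  1 it is 3N + 8, the bound on \<open>K\<close> in the recursion below.\<close>

definition partition_heat :: "(nat \<Rightarrow> complex) \<Rightarrow> nat \<Rightarrow> list_fun" where
  "partition_heat c N = heat_op (3 * N + 5) \<beta> (partition_fun c N)"

lemma sym_partition_heat: "symmetric_fun (partition_heat c N)"
  by (simp add: partition_heat_def sym_heat_op sym_partition_fun)

lemma bounded_by_partition_heat: "bounded_by (3 * int N) (partition_heat c N)"
  by (simp add: partition_heat_def bounded_by_heat_op bounded_by_partition_fun)

lemma partition_heat_eq: "K \<ge> 3 * N + 5 \<Longrightarrow> partition_heat c N = heat_op K \<beta> (partition_fun c N)"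
  unfolding partition_heat_def by (rule heat_op_indep[OF bounded_by_partition_fun]) auto

lemma partition_heat_0: "partition_heat c 0 = (\<lambda>ks. if ks = [] then 1 else 0)"
proof -
  have "(laplace_op 5 \<beta> ^^ r) (partition_fun c 0) = (\<lambda>ks. if r = 0 \<and> ks = [] then 1 else 0)" for r
  proof (induction r)
    case (Suc r) then show ?case by (simp add: laplace_op_def[abs_def] del: partition_fun.simps)
  qed simp
  then show ?thesis unfolding partition_heat_def heat_op_def by (simp add: fun_eq_iff lessThan_Suc numeral_eq_Suc)
qed

lemma partition_heat_Cons:
  assumes K: "K \<ge> 3 * N + 8"
  shows "partition_heat c (Suc N) (k # ks) = - 2 * (\<Sum>m<K. c m *
    (1/4 * (\<Sum>a\<in>{- int K..<int K}. normal_pair K b a (- int (k + m) - a) (partition_heat c N) ks)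
     + (if k + m = 1 then partition_heat c N ks / 16 else 0)))"
proof -
  have "partition_heat c (Suc N) (k # ks) = heat_op K \<beta> (D k (partition_fun c (Suc N))) ks"
    using K by (simp add: partition_heat_eq[of "Suc N" K] heat_op_D sym_partition_fun del: partition_fun.simps)
  also have "D k (partition_fun c (Suc N)) = (\<lambda>ks. - 2 * (\<Sum>m<K. c m * virasoro (k + m) (partition_fun c N) ks))"
    by (intro ext partition_fun_Cons) (use K in auto)
  also have "heat_op K \<beta> \<dots> ks = - 2 * (\<Sum>m<K. c m * heat_op K \<beta> (virasoro (k + m) (partition_fun c N)) ks)"
    by (simp only: heat_op_cmult heat_op_sum[OF finite_lessThan])
  also have "\<dots> = - 2 * (\<Sum>m<K. c m *
    (1/4 * (\<Sum>a\<in>{- int K..<int K}. normal_pair K b a (- int (k + m) - a) (partition_heat c N) ks)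
     + (if k + m = 1 then partition_heat c N ks / 16 else 0)))"
    using K by (simp only: heat_op_virasoro[OF sym_partition_fun bounded_by_partition_fun, of N K] partition_heat_eq[of N K])
  finally show ?thesis .
qed

end

section \<open>Connected functions\<close>

fun conv :: "('i list \<Rightarrow> 'r::comm_ring_1) \<Rightarrow> ('i list \<Rightarrow> 'r) \<Rightarrow> 'i list \<Rightarrow> 'r" where
  "conv f g [] = f [] * g []"
| "conv f g (k # ks) = conv (D k f) g ks + conv f (D k g) ks"

lemma conv_comm: "conv f g ks = conv g f ks"
  by (induction ks arbitrary: f g) (auto simp: mult.commute add.commute)

lemma conv_add_left: "conv (\<lambda>ks. f ks + f' ks) g ks = conv f g ks + conv f' g ks"
  by (induction ks arbitrary: f f' g) (auto simp: algebra_simps)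

lemma conv_cmult_left: "conv (\<lambda>ks. c * f ks) g ks = c * conv f g ks"
  by (induction ks arbitrary: f g) (auto simp: algebra_simps)

lemma conv_zero_left: "conv (\<lambda>ks. 0) g ks = 0"
  by (induction ks arbitrary: g) auto

lemma conv_add_right: "conv f (\<lambda>ks. g ks + g' ks) ks = conv f g ks + conv f g' ks"
  by (simp add: conv_comm[of f] conv_add_left)

lemma conv_zero_right: "conv f (\<lambda>ks. 0) ks = 0"
  by (simp add: conv_comm[of f] conv_zero_left)

lemma conv_diff_left: "conv (\<lambda>ks. f ks - f' ks) g ks = conv f g ks - conv f' g ks"
  using conv_add_left[of f "\<lambda>ks. - 1 * f' ks" g ks] conv_cmult_left[of "- 1" f' g ks] by simp

lemma conv_sum_left: "finite I \<Longrightarrow> conv (\<lambda>ks. \<Sum>i\<in>I. F i ks) g ks = (\<Sum>i\<in>I. conv (F i) g ks)"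
  by (induction I rule: finite_induct) (simp_all add: conv_zero_left conv_add_left)

lemma conv_assoc: "conv (conv f g) h ks = conv f (conv g h) ks"
proof (induction ks arbitrary: f g h)
  case (Cons k ks)
  then show ?case by (simp add: conv_add_left conv_add_right add.assoc)
qed (simp add: mult.assoc)

lemma conv_left_commute: "conv f (conv g h) ks = conv g (conv f h) ks"
proof -
  have "conv f g = conv g f" by (intro ext conv_comm)
  then show ?thesis by (simp add: conv_assoc[symmetric])
qed

lemma conv_unit: "conv (\<lambda>ks. if ks = [] then c else 0) g ks = c * g ks"
  by (induction ks arbitrary: g) (simp_all add: conv_zero_left)

lemma conv_nonzeroD: "conv f g ks \<noteq> 0 \<Longrightarrow> \<exists>ks1 ks2. f ks1 \<noteq> 0 \<and> g ks2 \<noteq> 0 \<and> length ks1 + length ks2 = length ks"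
proof (induction ks arbitrary: f g)
  case (Cons k ks)
  then consider "conv (D k f) g ks \<noteq> 0" | "conv f (D k g) ks \<noteq> 0" by fastforce
  then show ?case
  proof cases
    case 1 then show ?thesis using Cons.IH[OF 1] by (metis add_Suc length_Cons)
  next
    case 2 then show ?thesis using Cons.IH[OF 2] by (metis add_Suc_right length_Cons)
  qed
qed (auto intro!: exI[of _ "[]"])

lemma sym_conv:
  assumes "symmetric_fun f" "symmetric_fun g"
  shows "symmetric_fun (conv f g)"
proof -
  have "length ks = n \<Longrightarrow> mset ks = mset ks' \<Longrightarrow> conv f g ks = conv f g ks'" if "symmetric_fun f" "symmetric_fun g" for n ks ks' f g
    using that
  proof (induction n arbitrary: f g ks ks')
    case (Suc n)
    show ?case
    proof (rule sym_length_Suc[of n "conv f g"])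
      show "conv f g (k # us) = conv f g (k # us')" if "length us = n" "mset us = mset us'" for k us us'
        using Suc.IH[OF that, of "D k f" g] Suc.IH[OF that, of f "D k g"] Suc.prems by simp
      have sw: "(\<lambda>ks. f (i # j # ks)) = (\<lambda>ks. f (j # i # ks))" "(\<lambda>ks. g (i # j # ks)) = (\<lambda>ks. g (j # i # ks))" for i j
        by (intro ext sym_swap Suc.prems)+
      show "conv f g (i # j # us) = conv f g (j # i # us)" for i j us
        using sw[of i j] by (simp add: algebra_simps)
    qed (use Suc.prems in auto)
  qed auto
  then show ?thesis using assms unfolding symmetric_fun_def by blast
qed

lemma bounded_by_conv: "bounded_by w f \<Longrightarrow> bounded_by w' g \<Longrightarrow> bounded_by (w + w') (conv f g)"
  unfolding bounded_by_def[of "w + w'"]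
proof (intro allI impI)
  fix ks assume "bounded_by w f" "bounded_by w' g" "int (weight ks) > w + w'"
  then show "conv f g ks = 0"
  proof (induction ks arbitrary: f g w w')
    case Nil
    then show ?case using bounded_byD[of w f "[]"] bounded_byD[of w' g "[]"] by (cases "w < 0") auto
  next
    case (Cons k ks)
    then show ?case using Cons.IH[OF bounded_by_D[OF Cons.prems(1)], of w' g k]
       Cons.IH[OF _ bounded_by_D[OF Cons.prems(2)], of w f k] by auto
  qed
qed

text \<open>Writing t_a as a convolution factor makes it commute with all products, which the
  Leibniz rule for the field modes uses.\<close>

lemma mult_var_conv: "mult_var a f ks = conv (\<lambda>ks. if ks = [a] then 1 else 0) f ks"
proof (induction ks arbitrary: f)
  case (Cons k ks)
  have "(\<lambda>ks. if k # ks = [a] then 1 else 0 :: complex) = (\<lambda>ks. if ks = [] then if k = a then 1 else 0 else 0)" by auto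
  then show ?case using Cons by (simp add: conv_unit)
qed simp

section \<open>Products graded by the order\<close>

definition gconv :: "(nat \<Rightarrow> 'i list \<Rightarrow> 'r::comm_ring_1) \<Rightarrow> (nat \<Rightarrow> 'i list \<Rightarrow> 'r) \<Rightarrow> nat \<Rightarrow> 'i list \<Rightarrow> 'r" where
  "gconv f g N ks = (\<Sum>m\<le>N. conv (f m) (g (N - m)) ks)"

definition series :: "(nat \<Rightarrow> 'i list \<Rightarrow> 'r::comm_ring_1) \<Rightarrow> 'i list \<Rightarrow> 'r fps" where
  "series f ks = Abs_fps (\<lambda>N. f N ks)"

text \<open>With power series in the order variable as coefficient ring, \<open>conv\<close> becomes
  the graded product. Associativity and commutativity of \<open>gconv\<close> are thereby inherited,
  without manipulating double sums.\<close>

lemma conv_fps_nth: "conv f g ks $ N = gconv (\<lambda>m ks. f ks $ m) (\<lambda>m ks. g ks $ m) N ks"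
proof (induction ks arbitrary: f g)
  case Nil then show ?case by (simp add: gconv_def fps_mult_nth atLeast0AtMost)
next
  case (Cons k ks)
  then show ?case by (simp add: gconv_def sum.distrib)
qed

lemma conv_series: "conv (series f) (series g) = series (gconv f g)"
  by (intro ext fps_ext) (simp add: conv_fps_nth series_def)

lemma series_eq_iff: "series f = series g \<longleftrightarrow> f = g"
  by (auto simp: fun_eq_iff series_def fps_eq_iff)

lemma gconv_assoc: "gconv (gconv f g) h = gconv f (gconv g h)"
proof -
  have "series (gconv (gconv f g) h) = series (gconv f (gconv g h))"
    by (simp add: conv_series[symmetric] fun_eq_iff conv_assoc)
  then show ?thesis by (simp add: series_eq_iff)
qed

lemma gconv_comm: "gconv f g = gconv g f"
proof -
  have "series (gconv f g) = series (gconv g f)"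
    by (simp add: conv_series[symmetric] fun_eq_iff conv_comm)
  then show ?thesis by (simp add: series_eq_iff)
qed

lemma gconv_D: "gconv f g N (k # ks) = gconv (\<lambda>m. D k (f m)) g N ks + gconv f (\<lambda>m. D k (g m)) N ks"
  by (simp add: gconv_def sum.distrib)

lemma gconv_add_left: "gconv (\<lambda>m ks. f m ks + f' m ks) g N ks = gconv f g N ks + gconv f' g N ks"
  by (simp add: gconv_def conv_add_left sum.distrib)

lemma gconv_diff_left: "gconv (\<lambda>m ks. f m ks - f' m ks) g N ks = gconv f g N ks - gconv f' g N ks"
  by (simp add: gconv_def conv_diff_left sum_subtractf)

lemma gconv_cmult_left: "gconv (\<lambda>m ks. c * f m ks) g N ks = c * gconv f g N ks"
  by (simp add: gconv_def conv_cmult_left sum_distrib_left)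

lemma gconv_zero_left: "gconv (\<lambda>m ks. 0) g N ks = 0"
  by (simp add: gconv_def conv_zero_left)

lemma gconv_sum_left: "finite I \<Longrightarrow> gconv (\<lambda>m ks. \<Sum>i\<in>I. f i m ks) g N ks = (\<Sum>i\<in>I. gconv (f i) g N ks)"
  by (induction I rule: finite_induct) (simp_all add: gconv_zero_left gconv_add_left)

text \<open>\<open>Z\<close> starts with 1 and can be cancelled order by order. The statement stops
  at order N because an equation with a fixed cutoff is available only up to some order.\<close>

lemma gconv_cancel:
  assumes Z0: "Z 0 = (\<lambda>ks. if ks = [] then 1 else 0)"
    and 0: "\<And>n ks. n \<le> N \<Longrightarrow> gconv H Z n ks = 0"
  shows "n \<le> N \<Longrightarrow> H n ks = 0"
proof (induction n arbitrary: ks rule: less_induct)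
  case (less n)
  have "0 = gconv H Z n ks" using 0 less.prems by simp
  also have "\<dots> = conv (H n) (Z 0) ks + (\<Sum>m<n. conv (H m) (Z (n - m)) ks)"
    by (simp add: gconv_def lessThan_Suc_atMost[symmetric] add.commute)
  also have "(\<Sum>m<n. conv (H m) (Z (n - m)) ks) = 0"
  proof (rule sum.neutral, rule ballI)
    fix m assume "m \<in> {..<n}"
    then have "H m = (\<lambda>_. 0)" using less by (intro ext less.IH) auto
    then show "conv (H m) (Z (n - m)) ks = 0" by (simp add: conv_zero_left)
  qed
  also have "conv (H n) (Z 0) ks = H n ks"
    unfolding Z0 by (subst conv_comm) (simp add: conv_unit)
  finally show ?case by simp
qed

text \<open>The logarithm of Z: the equation N Z_N = \<Sum> m F_m Z_{N-m} solved for its term m =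
  N.\<close>

fun connected :: "(nat \<Rightarrow> list_fun) \<Rightarrow> nat \<Rightarrow> list_fun" where
  "connected Z N = (\<lambda>ks. if N = 0 then 0 else
     Z N ks - 1 / of_nat N * (\<Sum>m\<in>{1..<N}. of_nat m * conv (connected Z m) (Z (N - m)) ks))"

declare connected.simps [simp del]

lemma connected_0 [simp]: "connected Z 0 ks = 0"
  by (simp add: connected.simps)

lemma sym_connected:
  assumes "\<And>N. symmetric_fun (Z N)"
  shows "symmetric_fun (connected Z N)"
proof (induction N rule: less_induct)
  case (less N)
  have "symmetric_fun (\<lambda>ks. Z N ks + (- 1 / of_nat N) * (\<Sum>m\<in>{1..<N}. of_nat m * conv (connected Z m) (Z (N - m)) ks))"
    using less assms by (intro sym_add sym_cmult sym_sum sym_conv) auto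
  then show ?case by (cases "N = 0") (simp_all add: connected.simps[of Z N] sym_zero)
qed

lemma bounded_by_connected:
  assumes "\<And>N. bounded_by (3 * int N) (Z N)"
  shows "bounded_by (3 * int N) (connected Z N)"
proof (induction N rule: less_induct)
  case (less N)
  have "bounded_by (3 * int N) (conv (connected Z m) (Z (N - m)))" if "m \<in> {1..<N}" for m
    using bounded_by_conv[OF less[of m] assms[of "N - m"]] that by (simp add: of_nat_diff)
  then have "bounded_by (3 * int N) (\<lambda>ks. Z N ks + (- 1 / of_nat N) * (\<Sum>m\<in>{1..<N}. of_nat m * conv (connected Z m) (Z (N - m)) ks))"
    using assms by (intro bounded_by_add bounded_by_cmult bounded_by_sum) auto
  then show ?case by (cases "N = 0") (simp_all add: connected.simps[of Z N] bounded_by_def)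
qed

locale log_data =
  fixes Z :: "nat \<Rightarrow> list_fun"
  assumes Z0: "Z 0 = (\<lambda>ks. if ks = [] then 1 else 0)"
begin

abbreviation "F \<equiv> connected Z"

lemma of_nat_Z: "of_nat N * Z N ks = gconv (\<lambda>m ks. of_nat m * F m ks) Z N ks"
proof (cases N)
  case 0 then show ?thesis by (simp add: gconv_def conv_zero_left)
next
  case (Suc n)
  have "{..N} = insert 0 (insert N {1..<N})" using Suc by auto
  then have "gconv (\<lambda>m ks. of_nat m * F m ks) Z N ks
     = of_nat N * conv (F N) (Z 0) ks + (\<Sum>m\<in>{1..<N}. of_nat m * conv (F m) (Z (N - m)) ks)"
    using Suc by (simp add: gconv_def conv_cmult_left conv_zero_left)
  also have "conv (F N) (Z 0) ks = F N ks" unfolding Z0 by (subst conv_comm) (simp add: conv_unit)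
  also have "F N ks = Z N ks - 1 / of_nat N * (\<Sum>m\<in>{1..<N}. of_nat m * conv (F m) (Z (N - m)) ks)"
    using Suc by (subst connected.simps) auto
  finally show ?thesis using Suc by (simp add: field_simps del: of_nat_Suc)
qed

text \<open>
  \<open>Z = exp F\<close> is encoded by \<open>s \<partial>\<^sub>s Z = (s \<partial>\<^sub>s F) Z\<close>. Then \<open>G = \<partial>\<^sub>k Z - (\<partial>\<^sub>k F) Z\<close> solves the homogeneous
  equation \<open>s \<partial>\<^sub>s G = (s \<partial>\<^sub>s F) G\<close>, so it vanishes.
\<close>
lemma Z_Cons: "Z N (k # ks) = gconv (\<lambda>m. D k (F m)) Z N ks"
proof -
  define \<theta> :: "(nat \<Rightarrow> list_fun) \<Rightarrow> nat \<Rightarrow> list_fun" where "\<theta> f = (\<lambda>m ks. of_nat m * f m ks)" for f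
  define DF where "DF = (\<lambda>m. D k (F m))"
  define DZ where "DZ = (\<lambda>m. D k (Z m))"
  define G where "G = (\<lambda>N ks. DZ N ks - gconv DF Z N ks)"
  have \<theta>_gconv: "\<theta> (gconv f g) = (\<lambda>N ks. gconv (\<theta> f) g N ks + gconv f (\<theta> g) N ks)" for f g
  proof (intro ext)
    fix N ks
    have "\<theta> (gconv f g) N ks = (\<Sum>m\<le>N. of_nat m * conv (f m) (g (N - m)) ks + of_nat (N - m) * conv (f m) (g (N - m)) ks)"
      unfolding \<theta>_def gconv_def sum_distrib_left by (intro sum.cong) (auto simp: of_nat_diff algebra_simps)
    also have "\<dots> = gconv (\<theta> f) g N ks + gconv f (\<theta> g) N ks"
      by (simp add: \<theta>_def gconv_def sum.distrib conv_cmult_left conv_comm[of "f _"])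
    finally show "\<theta> (gconv f g) N ks = gconv (\<theta> f) g N ks + gconv f (\<theta> g) N ks" .
  qed
  have ZF: "\<theta> Z = gconv (\<theta> F) Z" using of_nat_Z by (simp add: \<theta>_def fun_eq_iff)
  have "\<theta> DZ = (\<lambda>N ks. gconv (\<theta> DF) Z N ks + gconv (\<theta> F) DZ N ks)"
  proof (intro ext)
    fix N ks
    have "\<theta> DZ N ks = \<theta> Z N (k # ks)" by (simp add: \<theta>_def DZ_def)
    then show "\<theta> DZ N ks = gconv (\<theta> DF) Z N ks + gconv (\<theta> F) DZ N ks"
      unfolding ZF gconv_D by (simp add: \<theta>_def DZ_def DF_def)
  qed
  moreover have "\<theta> (gconv DF Z) = (\<lambda>N ks. gconv (\<theta> DF) Z N ks + gconv (\<theta> F) (gconv DF Z) N ks)"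
    unfolding \<theta>_gconv ZF gconv_assoc[symmetric] by (simp only: gconv_comm[of DF "\<theta> F"])
  moreover have "\<theta> G = (\<lambda>N ks. \<theta> DZ N ks - \<theta> (gconv DF Z) N ks)"
    by (simp add: G_def \<theta>_def fun_eq_iff algebra_simps)
  ultimately have \<theta>G: "\<theta> G N ks = gconv (\<theta> F) G N ks" for N ks
    by (simp add: G_def gconv_comm[of "\<theta> F"] gconv_diff_left[of DZ "gconv DF Z", symmetric])
  have "G N ks = 0" for N ks
  proof (induction N arbitrary: ks rule: less_induct)
    case (less N)
    show ?case
    proof (cases N)
      case 0
      then show ?thesis by (simp add: G_def DZ_def DF_def Z0 gconv_def conv_zero_left)
    next
      case (Suc n)
      have "of_nat N * G N ks = (\<Sum>m\<le>N. conv (\<theta> F m) (G (N - m)) ks)"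
        using \<theta>G[of N ks] by (simp add: \<theta>_def gconv_def)
      also have "\<dots> = 0"
      proof (rule sum.neutral, rule ballI)
        fix m
        show "conv (\<theta> F m) (G (N - m)) ks = 0"
        proof (cases "m = 0")
          case True then show ?thesis by (simp add: \<theta>_def conv_zero_left)
        next
          case False
          then have "G (N - m) = (\<lambda>_. 0)" using Suc by (intro ext less.IH) auto
          then show ?thesis by (simp add: conv_zero_right)
        qed
      qed
      finally show ?thesis using Suc by (simp del: of_nat_Suc)
    qed
  qed
  then show ?thesis by (simp add: G_def DZ_def DF_def)
qed

text \<open>The field \<open>e\<^bsup>-F\<^esup> J e\<^bsup>F\<^esup>\<close> of a first-order operator \<open>J\<close>.\<close>
definition field_log :: "nat \<Rightarrow> (nat \<Rightarrow> nat \<Rightarrow> complex) \<Rightarrow> int \<Rightarrow> nat \<Rightarrow> list_fun" where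
  "field_log K b a m ks = deriv_mode K b a (F m) ks
     + (if m = 0 \<and> 0 \<le> a \<and> ks = [nat a] then 2 * of_int a + 1 else 0)"

lemma deriv_mode_conv: "deriv_mode K b a (conv f g) ks = conv (deriv_mode K b a f) g ks + conv f (deriv_mode K b a g) ks"
proof (cases "a < 0")
  case True then show ?thesis by (simp add: deriv_mode_def[abs_def])
next
  case False
  then show ?thesis
    by (simp add: deriv_mode_def[abs_def] conv_comm[of f] conv_sum_left conv_cmult_left sum.distrib algebra_simps)
qed

lemma deriv_mode_add: "deriv_mode K b a (\<lambda>ks. f ks + g ks) ks = deriv_mode K b a f ks + deriv_mode K b a g ks"
  by (simp add: deriv_mode_def sum.distrib algebra_simps)

lemma field_mode_add: "field_mode K b a (\<lambda>ks. f ks + g ks) ks = field_mode K b a f ks + field_mode K b a g ks"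
  by (simp add: field_mode_def deriv_mode_add mult_var_add algebra_simps)

lemma field_mode_conv: "field_mode K b a (conv f g) ks = conv (deriv_mode K b a f) g ks + conv f (field_mode K b a g) ks"
proof -
  have "mult_var i (conv f g) ks = conv f (mult_var i g) ks" for i
    by (simp add: mult_var_conv[abs_def] conv_left_commute)
  moreover have "conv f (\<lambda>ks. (2 * of_int a + 1) * mult_var (nat a) g ks) ks = (2 * of_int a + 1) * conv f (mult_var (nat a) g) ks"
    by (subst conv_comm) (simp add: conv_cmult_left conv_comm[of f])
  ultimately show ?thesis
    unfolding field_mode_def[of K b a "conv f g" ks] field_mode_def[of K b a g, abs_def] deriv_mode_conv
    by (simp add: conv_add_right conv_zero_right)
qed

lemma field_mode_gconv:
  "field_mode K b a (gconv f g N) ks = gconv (\<lambda>m. deriv_mode K b a (f m)) g N ks + gconv f (\<lambda>m. field_mode K b a (g m)) N ks"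
proof -
  have "field_mode K b a (\<lambda>ks. \<Sum>m\<in>I. h m ks) ks = (\<Sum>m\<in>I. field_mode K b a (h m) ks)" if "finite I" for I :: "nat set" and h
    using that by (induction I rule: finite_induct) (simp_all add: field_mode_zero field_mode_add)
  then show ?thesis by (simp add: gconv_def[abs_def] field_mode_conv sum.distrib)
qed

lemma field_mode_Z: "field_mode K b a (Z N) ks = gconv (field_log K b a) Z N ks"
proof -
  have "gconv (field_log K b a) Z N ks = gconv (\<lambda>m. deriv_mode K b a (F m)) Z N ks
     + gconv (\<lambda>m ks. if m = 0 \<and> 0 \<le> a \<and> ks = [nat a] then 2 * of_int a + 1 else 0) Z N ks"
    unfolding field_log_def[abs_def] by (rule gconv_add_left)
  also have "gconv (\<lambda>m. deriv_mode K b a (F m)) Z N ks = deriv_mode K b a (Z N) ks"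
  proof (cases "a < 0")
    case True then show ?thesis by (simp add: deriv_mode_def[abs_def] Z_Cons)
  next
    case False then show ?thesis
      by (simp add: deriv_mode_def[abs_def] Z_Cons gconv_sum_left gconv_cmult_left)
  qed
  also have "gconv (\<lambda>m ks. if m = 0 \<and> 0 \<le> a \<and> ks = [nat a] then 2 * of_int a + 1 else 0) Z N ks
     = conv (\<lambda>ks. if 0 \<le> a \<and> ks = [nat a] then 2 * of_int a + 1 else 0) (Z N) ks"
    unfolding gconv_def by (subst sum.atMost_shift) (simp add: conv_zero_left)
  also have "(\<lambda>ks. if 0 \<le> a \<and> ks = [nat a] then 2 * of_int a + 1 else 0 :: complex)
     = (\<lambda>ks. (if 0 \<le> a then 2 * of_int a + 1 else 0) * (if ks = [nat a] then 1 else 0))" by auto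
  finally show ?thesis by (auto simp: field_mode_def conv_cmult_left mult_var_conv)
qed

lemma deriv_mode_commute: "symmetric_fun f \<Longrightarrow> deriv_mode K b a (deriv_mode K b a' f) ks = deriv_mode K b a' (deriv_mode K b a f) ks"
proof -
  assume f: "symmetric_fun f"
  have "(\<Sum>i<K. x i * (\<Sum>j<K. y j * f (j # i # ks))) = (\<Sum>j<K. y j * (\<Sum>i<K. x i * f (i # j # ks)))" for x y :: "nat \<Rightarrow> complex"
    unfolding sum_distrib_left by (subst sum.swap) (simp add: sym_swap[OF f] mult.left_commute)
  note h = this
  show ?thesis
  proof (cases "a < 0"; cases "a' < 0")
    assume *: "a < 0" "a' < 0"
    then show ?thesis by (simp only: deriv_mode_def if_True) (rule sym_swap[OF f])
  next
    assume *: "a < 0" "\<not> a' < 0"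
    then show ?thesis by (simp add: deriv_mode_def sym_swap[OF f, of "nat (- a - 1)"])
  next
    assume *: "\<not> a < 0" "a' < 0"
    then show ?thesis by (simp add: deriv_mode_def sym_swap[OF f, of "nat (- a' - 1)"])
  next
    assume *: "\<not> a < 0" "\<not> a' < 0"
    show ?thesis unfolding deriv_mode_def if_not_P[OF *(1)] if_not_P[OF *(2)] by (rule h)
  qed
qed

text \<open>Two first-order operators on exp F produce the second derivative of F, the product of
  the two fields and a contraction. By normal ordering a contraction requires two nonnegative
  indices; as a + a' \<le> 0, both are 0, and the derivative \<partial>_0 with coefficient
  \<open>b 0 0\<close> meets the source t_0.\<close>

lemma normal_pair_Z:
  assumes "\<And>m. symmetric_fun (F m)" "a + a' \<le> 0" "0 < K"
  shows "normal_pair K b a a' (Z N) ks = gconv (\<lambda>m ks. deriv_mode K b a (deriv_mode K b a' (F m)) ks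
      + gconv (field_log K b a) (field_log K b a') m ks + (if m = 0 \<and> a = 0 \<and> a' = 0 \<and> ks = [] then b 0 0 else 0)) Z N ks"
proof -
  define a1 a2 where "a1 = min a a'" and "a2 = max a a'"
  have le: "a1 \<le> a2" "a1 + a2 \<le> 0" using assms(2) by (auto simp: a1_def a2_def)
  have eq: "field_mode K b a1 (Z N) = gconv (field_log K b a1) Z N" by (intro ext field_mode_Z)
  have "normal_pair K b a a' (Z N) ks = gconv (\<lambda>m. deriv_mode K b a2 (field_log K b a1 m)) Z N ks
      + gconv (field_log K b a1) (gconv (field_log K b a2) Z) N ks"
    unfolding normal_pair_def a1_def[symmetric] a2_def[symmetric] eq field_mode_gconv
    by (simp add: field_mode_Z[abs_def])
  also have "(\<lambda>m. deriv_mode K b a2 (field_log K b a1 m)) = (\<lambda>m ks. deriv_mode K b a (deriv_mode K b a' (F m)) ks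
      + (if m = 0 \<and> a = 0 \<and> a' = 0 \<and> ks = [] then b 0 0 else 0))"
  proof (intro ext)
    fix m :: nat and ks
    have "deriv_mode K b a2 (\<lambda>ks. if m = 0 \<and> 0 \<le> a1 \<and> ks = [nat a1] then 2 * of_int a1 + 1 else 0) ks
       = (if m = 0 \<and> a = 0 \<and> a' = 0 \<and> ks = [] then b 0 0 else 0)"
    proof (cases "0 \<le> a1")
      case True
      then have a12: "a1 = 0" "a2 = 0" using le by auto
      then have aa: "a = 0" "a' = 0" by (auto simp: a1_def a2_def min_def max_def split: if_splits)
      have "(\<Sum>j<K. b j 0 * (if m = 0 \<and> j = 0 \<and> ks = [] then 1 else 0)) = (\<Sum>j<K. if j = 0 then if m = 0 \<and> ks = [] then b 0 0 else 0 else 0)"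
        by (intro sum.cong) auto
      then show ?thesis unfolding a12 aa deriv_mode_def using assms(3) by (simp cong: if_cong)
    next
      case False
      then have "\<not> (a = 0 \<and> a' = 0)" by (auto simp: a1_def)
      then show ?thesis using False by (auto simp: deriv_mode_def)
    qed
    moreover have "deriv_mode K b a2 (deriv_mode K b a1 (F m)) ks = deriv_mode K b a (deriv_mode K b a' (F m)) ks"
      using deriv_mode_commute[OF assms(1), of K b a a' m ks] by (auto simp: a1_def a2_def min_def max_def)
    ultimately show "deriv_mode K b a2 (field_log K b a1 m) ks = deriv_mode K b a (deriv_mode K b a' (F m)) ks
      + (if m = 0 \<and> a = 0 \<and> a' = 0 \<and> ks = [] then b 0 0 else 0)"
      unfolding field_log_def[abs_def] deriv_mode_add by simp
  qed
  also have "gconv (field_log K b a1) (gconv (field_log K b a2) Z) N ks = gconv (gconv (field_log K b a) (field_log K b a')) Z N ks"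
    unfolding gconv_assoc[symmetric] by (auto simp: a1_def a2_def min_def max_def gconv_comm)
  finally show ?thesis unfolding gconv_add_left[symmetric] by (simp add: add_ac)
qed

end

section \<open>The loop equation for the logarithm\<close>

locale airy_data = log_data "partition_heat \<beta> c"
  for b \<beta> :: "nat \<Rightarrow> nat \<Rightarrow> complex" and c :: "nat \<Rightarrow> complex" +
  assumes \<beta>_def: "\<And>k a. \<beta> k a = b k a / (2 * of_nat a + 1)"
    and b_sym: "\<And>k a. b k a * (2 * of_nat k + 1) = b a k * (2 * of_nat a + 1)"
begin

abbreviation "Z \<equiv> partition_heat \<beta> c"

lemma sym_F: "symmetric_fun (F N)"
  by (intro sym_connected sym_partition_heat[OF \<beta>_def b_sym])

lemma bounded_by_F: "bounded_by (3 * int N) (F N)"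
  by (intro bounded_by_connected bounded_by_partition_heat[OF \<beta>_def b_sym])

text \<open>The right-hand side of the equation for Z, divided by Z. The factor -1/2 is -2 times the
  1/4 of the normal-ordered square, and the 1/4 at k + i = 1 is four times the 1/16 of L_0.\<close>

definition loop_rhs :: "nat \<Rightarrow> nat \<Rightarrow> nat \<Rightarrow> list_fun" where
  "loop_rhs K k m ks = - 1/2 * (\<Sum>i<K. c i * ((\<Sum>a\<in>{- int K..<int K}.
        deriv_mode K b a (deriv_mode K b (- int (k + i) - a) (F m)) ks
        + gconv (field_log K b a) (field_log K b (- int (k + i) - a)) m ks)
      + (if m = 0 \<and> ks = [] then (if k + i = 0 then b 0 0 else 0) + (if k + i = 1 then 1/4 else 0) else 0)))"

lemma Z_Cons_loop_rhs:
  assumes K: "K \<ge> 3 * N + 8"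
  shows "Z (Suc N) (k # ks) = gconv (loop_rhs K k) Z N ks"
proof -
  let ?t = "\<lambda>i a m ks. deriv_mode K b a (deriv_mode K b (- int (k + i) - a) (F m)) ks
        + gconv (field_log K b a) (field_log K b (- int (k + i) - a)) m ks"
  have u: "gconv (\<lambda>m ks. if m = 0 \<and> ks = [] then x else 0) Z N ks = x * Z N ks" for x
  proof -
    have "gconv (\<lambda>m ks. if m = 0 \<and> ks = [] then x else 0) Z N ks = conv (\<lambda>ks. if ks = [] then x else 0) (Z N) ks"
      unfolding gconv_def by (subst sum.atMost_shift) (simp add: conv_zero_left)
    then show ?thesis by (simp add: conv_unit)
  qed
  have *: "(\<Sum>a\<in>{- int K..<int K}. normal_pair K b a (- int (k + i) - a) (Z N) ks)
     = gconv (\<lambda>m ks. (\<Sum>a\<in>{- int K..<int K}. ?t i a m ks) + (if m = 0 \<and> ks = [] then (if k + i = 0 then b 0 0 else 0) else 0)) Z N ks" for i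
  proof -
    have "(\<Sum>a\<in>{- int K..<int K}. normal_pair K b a (- int (k + i) - a) (Z N) ks)
      = (\<Sum>a\<in>{- int K..<int K}. gconv (?t i a) Z N ks + (if a = 0 \<and> k + i = 0 then b 0 0 else 0) * Z N ks)"
    proof (rule sum.cong[OF refl])
      fix a
      have "normal_pair K b a (- int (k + i) - a) (Z N) ks = gconv (\<lambda>m ks. ?t i a m ks
         + (if m = 0 \<and> a = 0 \<and> - int (k + i) - a = 0 \<and> ks = [] then b 0 0 else 0)) Z N ks"
        by (rule normal_pair_Z) (use K sym_F in auto)
      also have "(\<lambda>m ks. ?t i a m ks + (if m = 0 \<and> a = 0 \<and> - int (k + i) - a = 0 \<and> ks = [] then b 0 0 else 0))
        = (\<lambda>m ks. ?t i a m ks + (if m = 0 \<and> ks = [] then (if a = 0 \<and> k + i = 0 then b 0 0 else 0) else 0))"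
        by (intro ext) auto
      finally show "normal_pair K b a (- int (k + i) - a) (Z N) ks
         = gconv (?t i a) Z N ks + (if a = 0 \<and> k + i = 0 then b 0 0 else 0) * Z N ks"
        unfolding gconv_add_left u .
    qed
    also have "\<dots> = (\<Sum>a\<in>{- int K..<int K}. gconv (?t i a) Z N ks) + (\<Sum>a\<in>{- int K..<int K}. if a = 0 then (if k + i = 0 then b 0 0 else 0) * Z N ks else 0)"
      unfolding sum.distrib by (intro arg_cong2[of _ _ _ _ "(+)"] sum.cong) auto
    also have "(\<Sum>a\<in>{- int K..<int K}. if a = 0 then (if k + i = 0 then b 0 0 else 0) * Z N ks else 0) = (if k + i = 0 then b 0 0 else 0) * Z N ks"
      using K by (subst sum.delta) auto
    also have "(\<Sum>a\<in>{- int K..<int K}. gconv (?t i a) Z N ks) = gconv (\<lambda>m ks. \<Sum>a\<in>{- int K..<int K}. ?t i a m ks) Z N ks"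
      by (rule gconv_sum_left[symmetric]) simp
    finally show ?thesis unfolding gconv_add_left u .
  qed
  have "Z (Suc N) (k # ks) = - 2 * (\<Sum>i<K. c i *
    (1/4 * (\<Sum>a\<in>{- int K..<int K}. normal_pair K b a (- int (k + i) - a) (Z N) ks)
     + (if k + i = 1 then Z N ks / 16 else 0)))"
    by (rule partition_heat_Cons[OF \<beta>_def b_sym K])
  also have "\<dots> = - 1/2 * (\<Sum>i<K. c i * ((\<Sum>a\<in>{- int K..<int K}. normal_pair K b a (- int (k + i) - a) (Z N) ks)
     + (if k + i = 1 then 1/4 else 0) * Z N ks))"
    by (simp add: sum_distrib_left algebra_simps) (auto intro!: sum.cong)
  also have "\<dots> = - 1/2 * (\<Sum>i<K. c i * gconv (\<lambda>m ks. (\<Sum>a\<in>{- int K..<int K}. ?t i a m ks)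
     + (if m = 0 \<and> ks = [] then (if k + i = 0 then b 0 0 else 0) + (if k + i = 1 then 1/4 else 0) else 0)) Z N ks)"
    unfolding * gconv_add_left u by (simp only: distrib_right add.assoc)
  also have "\<dots> = gconv (loop_rhs K k) Z N ks"
    unfolding loop_rhs_def[abs_def] gconv_cmult_left gconv_sum_left[OF finite_lessThan] ..
  finally show ?thesis .
qed

lemma F_Cons:
  assumes K: "K \<ge> 3 * N + 8"
  shows "F (Suc N) (k # ks) = loop_rhs K k N ks"
proof -
  have "gconv (\<lambda>m ks. F (Suc m) (k # ks) - loop_rhs K k m ks) Z n ks = 0" if "n \<le> N" for n ks
  proof -
    have "Z (Suc n) (k # ks) = gconv (\<lambda>m. D k (F m)) Z (Suc n) ks" by (rule Z_Cons)
    \<comment> \<open>Since F_0 = 0, the order can be lowered by one on both sides.\<close>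
    also have "\<dots> = gconv (\<lambda>m. D k (F (Suc m))) Z n ks"
      unfolding gconv_def by (subst sum.atMost_Suc_shift) (simp add: conv_zero_left)
    finally show ?thesis
      using Z_Cons_loop_rhs[of n K k ks] K that unfolding gconv_diff_left by simp
  qed
  then have "F (Suc N) (k # ks) - loop_rhs K k N ks = 0"
    using gconv_cancel[of Z N "\<lambda>m ks. F (Suc m) (k # ks) - loop_rhs K k m ks" N ks] Z0 by simp
  then show ?thesis by simp
qed

lemma deriv_mode_nonzeroD: "deriv_mode K b a f ks \<noteq> 0 \<Longrightarrow> \<exists>j. f (j # ks) \<noteq> 0"
  by (rule ccontr) (auto simp: deriv_mode_def split: if_splits)

text \<open>All terms of the loop equation respect N = 2g - 2 + n: a second derivative closes a
  handle and raises g by one, a product adds the genera of its factors, and the constants are of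
  type (1,1). Thus the order N and the number of arguments determine the genus.\<close>

lemma F_nonzeroD: "F N ks \<noteq> 0 \<Longrightarrow> ks \<noteq> [] \<Longrightarrow> \<exists>g. N + 2 = 2 * g + length ks"
proof (induction N arbitrary: ks rule: less_induct)
  case (less N)
  obtain M where N: "N = Suc M" using less.prems by (cases N) auto
  obtain k ks' where ks: "ks = k # ks'" using less.prems by (cases ks) auto
  define K where "K = 3 * M + 8"
  \<comment> \<open>The additional 1 counts the leg carried by the mode itself; the source term is
    then the form of type (0,2).\<close>
  have fl: "\<exists>g. m + 2 = 2 * g + length us + 1" if "field_log K b a m us \<noteq> 0" "m \<le> M" for a m us
  proof (cases "deriv_mode K b a (F m) us = 0")
    case True then show ?thesis using that by (auto simp: field_log_def split: if_splits)
  next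
    case False
    then obtain j where "F m (j # us) \<noteq> 0" using deriv_mode_nonzeroD by blast
    then show ?thesis using less.IH[of m "j # us"] that N by auto
  qed
  have "loop_rhs K k M ks' \<noteq> 0" using F_Cons[of M K k ks'] less.prems by (simp add: N ks K_def)
  then obtain i where i: "(\<Sum>a\<in>{- int K..<int K}.
        deriv_mode K b a (deriv_mode K b (- int (k + i) - a) (F M)) ks'
        + gconv (field_log K b a) (field_log K b (- int (k + i) - a)) M ks')
      + (if M = 0 \<and> ks' = [] then (if k + i = 0 then b 0 0 else 0) + (if k + i = 1 then 1/4 else 0) else 0) \<noteq> 0"
    unfolding loop_rhs_def by (metis (no_types, lifting) mult_zero_right sum.neutral)
  have "M = 0 \<and> ks' = [] \<or> (\<exists>a. deriv_mode K b a (deriv_mode K b (- int (k + i) - a) (F M)) ks' \<noteq> 0)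
    \<or> (\<exists>a. gconv (field_log K b a) (field_log K b (- int (k + i) - a)) M ks' \<noteq> 0)"
  proof (rule ccontr)
    assume "\<not> ?thesis"
    then have "\<not> (M = 0 \<and> ks' = [])" "deriv_mode K b a (deriv_mode K b (- int (k + i) - a) (F M)) ks' = 0"
      "gconv (field_log K b a) (field_log K b (- int (k + i) - a)) M ks' = 0" for a by blast+
    with i show False by (simp only: if_False) simp
  qed
  then consider "M = 0" "ks' = []" | a where "deriv_mode K b a (deriv_mode K b (- int (k + i) - a) (F M)) ks' \<noteq> 0"
    | a where "gconv (field_log K b a) (field_log K b (- int (k + i) - a)) M ks' \<noteq> 0"
    by blast
  then show ?case
  proof cases
    case 1 then show ?thesis by (intro exI[of _ 1]) (simp add: N ks)
  next
    case (2 a)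
    then obtain j j' where "F M (j # j' # ks') \<noteq> 0" using deriv_mode_nonzeroD by blast
    then obtain g where "M + 2 = 2 * g + length (j # j' # ks')" using less.IH[of M "j # j' # ks'"] N by auto
    then show ?thesis by (intro exI[of _ "g + 1"]) (simp add: N ks)
  next
    case (3 a)
    then obtain m where m: "m \<le> M" "conv (field_log K b a m) (field_log K b (- int (k + i) - a) (M - m)) ks' \<noteq> 0"
      unfolding gconv_def by (metis (no_types, lifting) sum.neutral atMost_iff)
    from conv_nonzeroD[OF m(2)] obtain us vs where us: "field_log K b a m us \<noteq> 0"
      "field_log K b (- int (k + i) - a) (M - m) vs \<noteq> 0" "length us + length vs = length ks'" by blast
    obtain g1 g2 where "m + 2 = 2 * g1 + length us + 1" "M - m + 2 = 2 * g2 + length vs + 1"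
      using fl[OF us(1)] fl[OF us(2)] m(1) by auto
    then show ?thesis using us(3) m(1) by (intro exI[of _ "g1 + g2"]) (simp add: N ks)
  qed
qed

end

lemma airy_data_exists:
  fixes b :: "nat \<Rightarrow> nat \<Rightarrow> complex"
  assumes "\<And>k a. b k a * (2 * of_nat k + 1) = b a k * (2 * of_nat a + 1)"
  shows "airy_data b (\<lambda>k a. b k a / (2 * of_nat a + 1)) c"
  by unfold_locales (use assms partition_heat_0[of "\<lambda>k a. b k a / (2 * of_nat a + 1)" b] in auto)

section \<open>Formal differential forms at the ramification point\<close>

unbundle no vec_syntax
unbundle fps_syntax

text \<open>A bound on the pole order which, unlike \<open>fls_subdegree\<close>, is inherited by
  sums and holds for the zero series.\<close>

definition low :: "int \<Rightarrow> complex fls \<Rightarrow> bool" where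
  "low L F \<longleftrightarrow> (\<forall>n<L. F $$ n = 0)"

lemma lowD: "low L F \<Longrightarrow> n < L \<Longrightarrow> F $$ n = 0"
  by (simp add: low_def)

lemma low_add: "low L F \<Longrightarrow> low L G \<Longrightarrow> low L (F + G)"
  by (simp add: low_def)

lemma low_zero: "low L 0"
  by (simp add: low_def)

lemma low_const_mult: "low L F \<Longrightarrow> low L (fls_const c * F)"
  by (simp add: low_def)

lemma low_sum: "(\<And>i. i \<in> I \<Longrightarrow> low L (F i)) \<Longrightarrow> low L (\<Sum>i\<in>I. F i)"
  by (simp add: low_def fls_nth_sum)

lemma low_mono: "low L F \<Longrightarrow> L' \<le> L \<Longrightarrow> low L' F"
  by (simp add: low_def)

lemma low_subdegree: "low (fls_subdegree F) F"
  by (simp add: low_def)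

lemma fls_mult_nth_low:
  assumes "low L F" "low M G"
  shows "(F * G) $$ n = (\<Sum>i\<in>{L..n - M}. F $$ i * G $$ (n - i))"
proof (cases "F = 0 \<or> G = 0")
  case False
  have "L \<le> fls_subdegree F" "M \<le> fls_subdegree G"
    using assms False by (meson lowD linorder_not_le nth_fls_subdegree_nonzero)+
  then have "(\<Sum>i\<in>{fls_subdegree F..n - fls_subdegree G}. F $$ i * G $$ (n - i)) = (\<Sum>i\<in>{L..n - M}. F $$ i * G $$ (n - i))"
    by (intro sum.mono_neutral_left) (auto simp: not_le)
  then show ?thesis by (simp add: fls_times_nth(2))
qed auto

lemma low_mult:
  assumes "low L F" "low M G"
  shows "low (L + M) (F * G)"
  unfolding low_def fls_mult_nth_low[OF assms] by auto

lemma low_fps: "low 0 (fps_to_fls f)"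
  by (simp add: low_def)

text \<open>The chain rule for Laurent series follows from that for power series once the pole is
  cleared by a power of \<open>fls_X\<close>.\<close>

lemma fls_compose_fps_deriv:
  fixes F :: "complex fls"
  assumes "H $ 0 = 0" "H \<noteq> 0"
  shows "fls_deriv (fls_compose_fps F H) = fls_compose_fps (fls_deriv F) H * fps_to_fls (fps_deriv H)"
proof -
  define m where "m = nat (- fls_subdegree F)"
  define P where "P = fls_regpart (F * fls_X ^ m)"
  have P: "F * fls_X ^ m = fps_to_fls P"
    unfolding P_def
  proof (rule fls_eqI)
    fix n show "(F * fls_X ^ m) $$ n = fps_to_fls (fls_regpart (F * fls_X ^ m)) $$ n"
      by (cases "n < 0") (auto simp: fls_X_power_times_conv_shift(2) m_def)
  qed
  let ?c = "\<lambda>F. fls_compose_fps F H" and ?h = "fps_to_fls H"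
  have h: "?h \<noteq> 0" "fls_deriv ?h = fps_to_fls (fps_deriv H)" using assms by (auto simp: fls_deriv_fps_to_fls)
  note cm = fls_compose_fps_mult[OF assms(2,1)] fls_compose_fps_add[OF assms(2,1)] fls_compose_fps_power[OF assms(2,1)]
    fls_compose_fps_to_fls[OF assms(2,1)]
  have 1: "?c F * ?h ^ m = fps_to_fls (fps_compose P H)"
    using arg_cong[OF P, of ?c] by (simp add: cm)
  have "fls_deriv (F * fls_X ^ m) = fps_to_fls (fps_deriv P)" unfolding P by (rule fls_deriv_fps_to_fls)
  then have "fls_deriv F * fls_X ^ m + F * (of_nat m * fls_X ^ (m - 1)) = fps_to_fls (fps_deriv P)"
    by (simp add: fls_deriv_power algebra_simps)
  from arg_cong[OF this, of ?c] have 2: "?c (fls_deriv F) * ?h ^ m + ?c F * (of_nat m * ?h ^ (m - 1)) = fps_to_fls (fps_compose (fps_deriv P) H)"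
    by (simp add: cm)
  have "fls_deriv (?c F * ?h ^ m) = fps_to_fls (fps_deriv (fps_compose P H))" unfolding 1 by (rule fls_deriv_fps_to_fls)
  also have "\<dots> = fps_to_fls (fps_compose (fps_deriv P) H) * fps_to_fls (fps_deriv H)"
    by (simp add: fps_compose_deriv[OF assms(1)] fls_times_fps_to_fls)
  finally have "fls_deriv (?c F) * ?h ^ m = ?c (fls_deriv F) * fps_to_fls (fps_deriv H) * ?h ^ m"
    unfolding 2[symmetric] by (simp add: fls_deriv_power h algebra_simps)
  then show ?thesis using h(1) by simp
qed

text \<open>Apart from its residue term, F is a derivative and remains one after the substitution.
  The residue term becomes a multiple of the logarithmic derivative of \<open>H\<close>, whose
  residue is the order of vanishing 1.\<close>

lemma fls_residue_compose:
  fixes F :: "complex fls"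
  assumes "H $ 0 = 0" "H $ 1 \<noteq> 0"
  shows "fls_residue (fls_compose_fps F H * fps_to_fls (fps_deriv H)) = fls_residue F"
proof -
  have H: "H \<noteq> 0" using assms by auto
  let ?r = "fls_residue F" and ?h = "fps_to_fls H"
  define G where "G = F - fls_const ?r * fls_X_inv"
  have "fls_residue G = 0" by (simp add: G_def)
  then have "fls_deriv (fls_integral G) = G" by (rule fls_deriv_fls_integral)
  then have "F = fls_const ?r * inverse fls_X + fls_deriv (fls_integral G)"
    by (simp add: G_def fls_inverse_X)
  then have "fls_compose_fps F H * fps_to_fls (fps_deriv H)
     = fls_const ?r * (fls_deriv ?h * inverse ?h) + fls_deriv (fls_compose_fps (fls_integral G) H)"
    using fls_compose_fps_add[OF H assms(1), of "fls_const ?r * inverse fls_X" "fls_deriv (fls_integral G)"]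
    by (simp add: fls_compose_fps_mult[OF H assms(1)] fls_compose_fps_inverse[OF H assms(1)] fls_compose_fps_deriv[OF assms(1) H]
       fls_deriv_fps_to_fls algebra_simps)
  moreover have "subdegree H = 1" using assms by (intro subdegreeI) auto
  ultimately show ?thesis
    by (simp add: fls_residue_add fls_residue_fls_const_times fls_residue_deriv fls_residue_deriv_times_inverse_eq_subdegree
       fls_subdegree_fls_to_fps del: fls_residue_def)
qed

text \<open>The substitution of -\<zeta> for \<zeta>, which is the involution in the local
  coordinate. It acts on coefficient functions; the sign of d(-\<zeta>) is accounted for
  elsewhere.\<close>

definition reflect :: "complex fls \<Rightarrow> complex fls" where
  "reflect F = fls_compose_fps F (fps_const (-1) * fps_X)"

lemma reflect_nth: "reflect F $$ n = (if even n then F $$ n else - F $$ n)"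
  unfolding reflect_def by (subst fls_nth_fls_compose_fps_linear) (auto simp: power_int_minus_left)

lemma reflect_mult: "reflect (F * G) = reflect F * reflect G"
  and reflect_power: "reflect (F ^ n) = reflect F ^ n"
  and reflect_inverse: "reflect (inverse F) = inverse (reflect F)"
  and reflect_diff: "reflect (F - G) = reflect F - reflect G"
  unfolding reflect_def
  by (simp_all add: fls_compose_fps_mult fls_compose_fps_power fls_compose_fps_inverse fls_compose_fps_diff)

lemma reflect_reflect: "reflect (reflect F) = F"
  by (rule fls_eqI) (simp add: reflect_nth)

lemma low_reflect: "low L F \<Longrightarrow> low L (reflect F)"
  by (simp add: low_def reflect_nth)

text \<open>
  \<open>\<psi>\<close> is the expansion of \<open>z\<close> in a local coordinate \<open>\<zeta>\<close>. The coefficient of \<open>\<zeta>\<^sup>j\<close> in \<open>1 / (w - \<psi>(\<zeta>))\<close> is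
  \<open>pole_fun \<psi> j w\<close>, and \<open>pole_form \<psi> j\<close> is the expansion of the form \<open>pole_fun \<psi> j z dz\<close>.
\<close>
definition pole_fun :: "complex fps \<Rightarrow> nat \<Rightarrow> complex \<Rightarrow> complex" where
  "pole_fun \<psi> j w = (\<Sum>q\<le>j. (\<psi> ^ q) $ j * inverse w ^ Suc q)"

definition pole_form :: "complex fps \<Rightarrow> nat \<Rightarrow> complex fls" where
  "pole_form \<psi> j = (\<Sum>q\<le>j. fls_const ((\<psi> ^ q) $ j) * inverse (fps_to_fls \<psi>) ^ Suc q) * fps_to_fls (fps_deriv \<psi>)"

section \<open>Pole forms of a local coordinate\<close>

locale uniformizer =
  fixes \<psi> :: "complex fps"
  assumes \<psi>0: "\<psi> $ 0 = 0" and \<psi>1: "\<psi> $ Suc 0 = 1"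
begin

abbreviation "h \<equiv> fps_to_fls \<psi>"

lemma \<psi>_nonzero: "\<psi> \<noteq> 0"
  using \<psi>1 by auto

lemma pole_form_eq: "pole_form \<psi> j = fls_compose_fps (\<Sum>q\<le>j. fls_const ((\<psi> ^ q) $ j) * fls_X_inv ^ Suc q) \<psi> * fps_to_fls (fps_deriv \<psi>)"
proof -
  note cm = fls_compose_fps_mult[OF \<psi>_nonzero \<psi>0] fls_compose_fps_add[OF \<psi>_nonzero \<psi>0] fls_compose_fps_power[OF \<psi>_nonzero \<psi>0]
    fls_compose_fps_inverse[OF \<psi>_nonzero \<psi>0] fls_inverse_X[symmetric]
  have "fls_compose_fps (\<Sum>q\<in>I. fls_const ((\<psi> ^ q) $ j) * fls_X_inv ^ Suc q) \<psi>
    = (\<Sum>q\<in>I. fls_const ((\<psi> ^ q) $ j) * inverse h ^ Suc q)" if "finite I" for I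
    using that by (induction I rule: finite_induct) (simp_all add: cm del: power_Suc)
  then show ?thesis by (simp add: pole_form_def del: power_Suc)
qed

text \<open>The coefficient is the residue of \<zeta>^i times the form. With \<open>Y\<close> the
  inverse series of \<psi>, this residue is computed in z, where it is the coefficient of \<zeta>^j
  in the composition of \<open>Y\<close>^i with \<psi>, which is \<zeta>^i.\<close>

lemma pole_form_nth_neg: "pole_form \<psi> j $$ (- 1 - int i) = (if i = j then 1 else 0)"
proof -
  define Y where "Y = fps_inv \<psi>"
  have Y: "Y oo \<psi> = fps_X" unfolding Y_def by (rule fps_inv) (simp_all add: \<psi>0 \<psi>1)
  note cm = fls_compose_fps_mult[OF \<psi>_nonzero \<psi>0] fls_compose_fps_power[OF \<psi>_nonzero \<psi>0]
    fls_compose_fps_inverse[OF \<psi>_nonzero \<psi>0] fls_compose_fps_to_fls[OF \<psi>_nonzero \<psi>0]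
  have Xi: "(Y ^ i) oo \<psi> = fps_X ^ i" using Y by (simp add: fps_compose_power[OF \<psi>0, symmetric])
  have "pole_form \<psi> j $$ (- 1 - int i) = fls_residue (fls_X ^ i * pole_form \<psi> j)"
    by (simp add: fls_X_power_times_conv_shift(1))
  also have "fls_X ^ i = fps_to_fls (fps_X ^ i)" by (simp add: fps_to_fls_power)
  also have "\<dots> = fls_compose_fps (fps_to_fls (Y ^ i)) \<psi>"
    by (simp only: cm(4) Xi)
  also have "fls_residue (\<dots> * pole_form \<psi> j) = fls_residue (fps_to_fls (Y ^ i) * (\<Sum>q\<le>j. fls_const ((\<psi> ^ q) $ j) * fls_X_inv ^ Suc q))"
    unfolding pole_form_eq mult.assoc[symmetric] cm(1)[symmetric] by (rule fls_residue_compose) (simp_all add: \<psi>0 \<psi>1)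
  also have "\<dots> = (\<Sum>q\<le>j. (\<psi> ^ q) $ j * (Y ^ i) $ q)"
  proof -
    have "(fps_to_fls (Y ^ i) * (fls_const c * fls_X_inv ^ Suc q)) $$ (-1) = c * (Y ^ i) $ q" for c q
    proof -
      have "fps_to_fls (Y ^ i) * (fls_const c * fls_X_inv ^ Suc q) = fls_const c * (fps_to_fls (Y ^ i) * fls_X_inv ^ Suc q)"
        by (simp only: mult_ac)
      then show ?thesis by (simp only: fls_X_inv_power_times_conv_shift(2)) simp
    qed
    then show ?thesis by (simp add: sum_distrib_left fls_nth_sum del: power_Suc)
  qed
  also have "\<dots> = ((Y ^ i) oo \<psi>) $ j"
    by (simp add: fps_compose_nth atLeast0AtMost mult.commute)
  finally show ?thesis by (simp add: Xi fps_X_power_nth)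
qed

lemma low_pole_form: "low (- int j - 1) (pole_form \<psi> j)"
proof -
  have "pole_form \<psi> j $$ n = 0" if "n < - int j - 1" for n
  proof -
    define i where "i = nat (- n - 1)"
    have n: "n = - 1 - int i" "i \<noteq> j" using that by (auto simp: i_def)
    then show ?thesis using pole_form_nth_neg[of j i] by simp
  qed
  then show ?thesis by (simp add: low_def)
qed

text \<open>A reciprocity law: let p be a primitive of \<open>pole_form \<psi> l\<close>. In z, both
  p and \<open>pole_form \<psi> j\<close> are polynomials in 1/z without constant term, so their
  product has residue 0. In \<zeta> the same residue is the difference of the two regular
  coefficients to be compared.\<close>

lemma pole_form_symmetric:
  assumes jl: "j \<ge> 1" "l \<ge> 1"
  shows "pole_form \<psi> j $$ (int l - 1) * of_nat j = pole_form \<psi> l $$ (int j - 1) * of_nat l"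
proof -
  define G where "G j = (\<Sum>q\<le>j. fls_const ((\<psi> ^ q) $ j) * fls_X_inv ^ Suc q)" for j
  have G_nth: "G j $$ n = (if n \<le> -2 \<and> nat (- n - 1) \<le> j then (\<psi> ^ nat (- n - 1)) $ j else 0)" if "j \<ge> 1" for j n
  proof -
    have "G j $$ n = (\<Sum>q\<le>j. if q = nat (- n - 1) \<and> n \<le> -1 then (\<psi> ^ q) $ j else 0)"
      unfolding G_def fls_nth_sum by (intro sum.cong) (auto simp del: power_Suc)
    also have "\<dots> = (if n \<le> -1 \<and> nat (- n - 1) \<le> j then (\<psi> ^ nat (- n - 1)) $ j else 0)"
      by (cases "n \<le> -1") (auto simp: sum.delta)
    finally show ?thesis using that by (cases "n = -1") auto
  qed
  define P where "P = fls_integral (G l)"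
  define p where "p = fls_compose_fps P \<psi>"
  \<comment> \<open>For l \<ge> 1 the term q = 0 of \<open>G l\<close> has coefficient 0, so there
    is no residue and a primitive exists.\<close>
  have dP: "fls_deriv P = G l" unfolding P_def by (rule fls_deriv_fls_integral) (use jl in \<open>simp add: G_nth\<close>)
  have dp: "fls_deriv p = pole_form \<psi> l"
    unfolding p_def pole_form_eq G_def[symmetric] using fls_compose_fps_deriv[OF \<psi>0 \<psi>_nonzero, of P] dP by simp
  have p_nth: "of_int n * p $$ n = pole_form \<psi> l $$ (n - 1)" for n
    using arg_cong[OF dp, of "\<lambda>F. F $$ (n - 1)"] by simp
  have p_neg: "p $$ n = (if n = - int l then - 1 / of_nat l else 0)" if "n < 0" for n
  proof -
    define i where "i = nat (- n)"
    have n: "n = - int i" "i > 0" using that by (auto simp: i_def)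
    have e: "- 1 - int i = - int i - 1" by simp
    have "of_int (- int i) * p $$ (- int i) = (if i = l then 1 else 0)"
      using p_nth[of "- int i"] pole_form_nth_neg[of l i, unfolded e] by simp
    then have "p $$ (- int i) = - (if i = l then 1 else 0) / of_nat i" using n(2) by (simp add: field_simps minus_equation_iff)
    then show ?thesis unfolding n(1) by auto
  qed
  have "fls_residue (p * pole_form \<psi> j) = fls_residue (P * G j)"
    unfolding p_def pole_form_eq G_def[symmetric] mult.assoc[symmetric] fls_compose_fps_mult[OF \<psi>_nonzero \<psi>0, symmetric]
    by (rule fls_residue_compose) (simp_all add: \<psi>0 \<psi>1)
  also have "\<dots> = 0"
  proof -
    have "low (- int l - 1) P" "low (- int j - 1) (G j)"
      using jl by (auto simp: low_def P_def G_nth)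
    from fls_mult_nth_low[OF this, of "-1"] show ?thesis
      using jl by (auto simp: P_def G_nth intro!: sum.neutral)
  qed
  finally have "(p * pole_form \<psi> j) $$ (-1) = 0" by simp
  moreover have "low (- int l) p"
    using p_neg by (auto simp: low_def)
  ultimately have "(\<Sum>i\<in>{- int l..int j}. p $$ i * pole_form \<psi> j $$ (-1 - i)) = 0"
    using fls_mult_nth_low[OF _ low_pole_form, of "- int l" p j "-1"] by simp
  also have "(\<Sum>i\<in>{- int l..int j}. p $$ i * pole_form \<psi> j $$ (-1 - i))
     = (\<Sum>i\<in>{- int l, int j}. p $$ i * pole_form \<psi> j $$ (-1 - i))"
  proof (intro sum.mono_neutral_right ballI)
    fix i assume i: "i \<in> {- int l..int j} - {- int l, int j}"
    show "p $$ i * pole_form \<psi> j $$ (- 1 - i) = 0"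
    proof (cases "i < 0")
      case True then show ?thesis using i p_neg[of i] by auto
    next
      case False
      then have "- 1 - i = - 1 - int (nat i)" "nat i \<noteq> j" using i by auto
      then show ?thesis using pole_form_nth_neg[of j "nat i"] by (simp only:) simp
    qed
  qed auto
  also have "\<dots> = - 1 / of_nat l * pole_form \<psi> j $$ (int l - 1) + p $$ int j"
  proof -
    have "- 1 - - int l = int l - 1" by auto
    then show ?thesis using jl p_neg[of "- int l"] pole_form_nth_neg[of j j] by simp
  qed
  finally have "pole_form \<psi> j $$ (int l - 1) = of_nat l * p $$ int j" using jl by (simp add: field_simps)
  then show ?thesis using p_nth[of "int j"] by (simp add: algebra_simps)
qed

text \<open>Only odd pole indices and even powers of \<zeta> survive the parity of the
  recursion.\<close>

definition b :: "nat \<Rightarrow> nat \<Rightarrow> complex" where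
  "b k a = pole_form \<psi> (Suc (2 * k)) $$ (2 * int a)"

lemma b_sym: "b k a * (2 * of_nat k + 1) = b a k * (2 * of_nat a + 1)"
  using pole_form_symmetric[of "Suc (2 * k)" "Suc (2 * a)"] by (simp add: b_def algebra_simps)

text \<open>The form dz dz'/(z - z')^2 at the two points \<zeta> and -\<zeta> of one fibre; it is
  the whole bracket of type (1,1).\<close>

definition diag_form :: "complex fls" where
  "diag_form = fps_to_fls (fps_deriv \<psi>) * reflect (fps_to_fls (fps_deriv \<psi>)) / (h - reflect h) ^ 2"

text \<open>Six times this is the Schwarzian derivative of \<open>\<psi>\<close> at 0.\<close>
lemma b00: "b 0 0 = \<psi> $ 3 - (\<psi> $ 2)\<^sup>2"
proof -
  define V where "V = fps_shift 1 \<psi>"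
  have V: "\<psi> = fps_X * V" unfolding V_def by (rule fps_ext) (simp add: \<psi>0 fps_X_mult_nth)
  have V_nth: "V $ 0 = 1" "V $ Suc 0 = \<psi> $ 2" "V $ Suc (Suc 0) = \<psi> $ 3"
    by (simp_all add: V_def \<psi>1 numeral_2_eq_2 numeral_3_eq_3)
  define U where "U = inverse V"
  have UV: "U * V = 1" unfolding U_def by (rule inverse_mult_eq_1) (simp add: V_nth)
  have hU: "h * (fls_X_inv * fps_to_fls U) = 1"
  proof -
    have "h * (fls_X_inv * fps_to_fls U) = (fls_X * fls_X_inv) * fps_to_fls (U * V)"
      unfolding V by (simp add: fls_times_fps_to_fls mult_ac)
    then show ?thesis using UV by (simp add: fls_inverse_X[symmetric])
  qed
  then have inv: "inverse h = fls_X_inv * fps_to_fls U"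
    by (metis inverse_unique)
  have h0: "h \<noteq> 0" using \<psi>_nonzero by simp
  have "fls_deriv (h * inverse h) = 0" using h0 by simp
  then have dh: "fps_to_fls (fps_deriv \<psi>) * inverse h = - (h * fls_deriv (inverse h))"
    by (simp add: fls_deriv_fps_to_fls add_eq_0_iff2 del: right_inverse)
  have "pole_form \<psi> 1 = (fps_to_fls (fps_deriv \<psi>) * inverse h) * inverse h"
    by (simp add: pole_form_def \<psi>1 power2_eq_square)
  also have "\<dots> = - fls_deriv (inverse h)"
    unfolding dh using h0 by simp
  finally have "b 0 0 = - (U $ 2)"
    unfolding inv by (simp add: b_def fls_X_inv_times_conv_shift)
  moreover have "U $ 0 = 1" "U $ Suc 0 = - (\<psi> $ 2)" "U $ 2 = - (U $ Suc 0 * \<psi> $ 2) - \<psi> $ 3"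
    using arg_cong[OF UV, of "\<lambda>f. f $ 0"] arg_cong[OF UV, of "\<lambda>f. f $ Suc 0"] arg_cong[OF UV, of "\<lambda>f. f $ 2"]
    by (simp_all add: fps_mult_nth V_nth numeral_2_eq_2 atLeast0_atMost_Suc eq_neg_iff_add_eq_0 algebra_simps)
  ultimately show ?thesis by (simp add: power2_eq_square)
qed

lemma diag_form_odd: "odd n \<Longrightarrow> diag_form $$ n = 0"
proof -
  assume n: "odd n"
  have "(reflect h - h) ^ 2 = (h - reflect h) ^ 2" by (rule power2_commute)
  then have "reflect diag_form = diag_form"
    by (simp add: diag_form_def divide_inverse reflect_mult reflect_power reflect_inverse reflect_diff reflect_reflect mult_ac)
  from arg_cong[OF this, of "\<lambda>F. F $$ n"] n show ?thesis by (simp add: reflect_nth)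
qed

text \<open>The difference of z at \<zeta> and at -\<zeta> is 2 \<zeta> times an even series, whence
  the leading 1/(4 \<zeta>^2). The next even coefficient is the Schwarzian expression of
  \<open>b00\<close>.\<close>

lemma diag_form_eq:
  obtains C where "diag_form = fls_const (1/4) * (fls_X_inv ^ 2 * fps_to_fls C)" "C $ 0 = 1" "C $ 2 = 4 * b 0 0"
proof -
  define A where "A = Abs_fps (\<lambda>n. if even n then \<psi> $ Suc n else 0)"
  define dr where "dr = Abs_fps (\<lambda>n. (if even n then 1 else - 1) * fps_deriv \<psi> $ n)"
  have A_nth: "A $ 0 = 1" "A $ Suc 0 = 0" "A $ Suc (Suc 0) = \<psi> $ 3" by (simp_all add: A_def \<psi>1 numeral_3_eq_3)
  have hA: "h - reflect h = fls_const 2 * (fls_X * fps_to_fls A)"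
  proof (rule fls_eqI)
    fix n
    consider "n < 0" | "n = 0" | m where "n = int (Suc m)"
      by (metis less_linear gr0_implies_Suc zero_less_imp_eq_int)
    moreover have e: "int (Suc m) - 1 = int m" for m by simp
    ultimately show "(h - reflect h) $$ n = (fls_const 2 * (fls_X * fps_to_fls A)) $$ n"
      by cases (auto simp: fls_X_times_conv_shift(1) reflect_nth A_def \<psi>0 e simp del: of_nat_Suc)
  qed
  have dr: "reflect (fps_to_fls (fps_deriv \<psi>)) = fps_to_fls dr"
    by (rule fls_eqI) (auto simp: reflect_nth dr_def even_nat_iff)
  define C where "C = fps_deriv \<psi> * dr * inverse (A ^ 2)"
  have "inverse (A ^ 2) * A ^ 2 = 1" by (rule inverse_mult_eq_1) (simp add: A_nth power2_eq_square)
  then have CA: "C * A ^ 2 = fps_deriv \<psi> * dr" by (simp add: C_def mult.assoc)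
  let ?D = "fls_const 2 * (fls_X * fps_to_fls A)"
  have D0: "?D \<noteq> 0" using A_nth by auto
  have D2: "?D ^ 2 = fls_const 4 * (fls_X ^ 2 * fps_to_fls (A ^ 2))"
    by (simp add: power_mult_distrib fps_to_fls_power fls_const_power[symmetric])
  have XX: "(fls_X_inv ^ 2 :: complex fls) * fls_X ^ 2 = 1"
    by (simp add: fls_inverse_X[symmetric] power_mult_distrib[symmetric])
  have "fls_const (1/4) * (fls_X_inv ^ 2 * fps_to_fls C) * ?D ^ 2
     = (fls_const (1/4) * fls_const 4) * (fls_X_inv ^ 2 * fls_X ^ 2) * fps_to_fls (C * A ^ 2)"
    unfolding D2 fls_times_fps_to_fls by (simp only: mult_ac)
  also have "\<dots> = fps_to_fls (C * A ^ 2)" unfolding XX by (simp only: fls_const_mult_const) simp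
  finally have "fls_const (1/4) * (fls_X_inv ^ 2 * fps_to_fls C) * ?D ^ 2 = fps_to_fls (fps_deriv \<psi>) * fps_to_fls dr"
    unfolding CA fls_times_fps_to_fls .
  then have eq: "diag_form = fls_const (1/4) * (fls_X_inv ^ 2 * fps_to_fls C)"
    unfolding diag_form_def hA dr using D0 by (simp add: field_simps)
  have nth: "(C * A ^ 2) $ n = (fps_deriv \<psi> * dr) $ n" for n by (simp only: CA)
  have A2: "(A ^ 2) $ 0 = 1" "(A ^ 2) $ Suc 0 = 0" "(A ^ 2) $ Suc (Suc 0) = 2 * \<psi> $ 3"
    by (simp_all add: power2_eq_square fps_mult_nth atLeast0_atMost_Suc A_nth)
  have d: "fps_deriv \<psi> $ 0 = 1" "fps_deriv \<psi> $ Suc 0 = 2 * \<psi> $ 2" "fps_deriv \<psi> $ Suc (Suc 0) = 3 * \<psi> $ 3"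
    by (simp_all add: \<psi>1 numeral_2_eq_2 numeral_3_eq_3)
  have "C $ 0 = 1" "C $ Suc 0 = 0"
    using nth[of 0] nth[of "Suc 0"] by (simp_all add: fps_mult_nth atLeast0_atMost_Suc A2 d dr_def del: fps_deriv_nth)
  moreover from this have "C $ Suc (Suc 0) = 4 * (\<psi> $ 3 - (\<psi> $ 2)\<^sup>2)"
    using nth[of "Suc (Suc 0)"] by (simp add: fps_mult_nth atLeast0_atMost_Suc A2 A_nth d dr_def algebra_simps power2_eq_square del: fps_deriv_nth)
  ultimately show ?thesis using that[OF eq] by (simp add: b00 numeral_2_eq_2)
qed

lemma low_diag_form: "low (- 2) diag_form"
  and diag_form_m2: "diag_form $$ (- 2) = 1/4"
  and diag_form_0: "diag_form $$ 0 = b 0 0"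
proof -
  obtain C where C: "diag_form = fls_const (1/4) * (fls_X_inv ^ 2 * fps_to_fls C)" "C $ 0 = 1" "C $ 2 = 4 * b 0 0"
    by (rule diag_form_eq)
  have nth: "diag_form $$ n = 1/4 * fps_to_fls C $$ (n + 2)" for n
    unfolding C(1) fls_X_inv_power_times_conv_shift(1) by simp
  show "low (- 2) diag_form" "diag_form $$ (- 2) = 1/4" "diag_form $$ 0 = b 0 0"
    using C(2,3) by (simp_all add: low_def nth)
qed

end

section \<open>The residue of the recursion bracket\<close>

fun eval_modes :: "(nat \<Rightarrow> complex \<Rightarrow> complex) \<Rightarrow> nat \<Rightarrow> list_fun \<Rightarrow> complex list \<Rightarrow> complex" where
  "eval_modes \<eta> K f [] = f []"
| "eval_modes \<eta> K f (z # zs) = (\<Sum>k<K. \<eta> k z * eval_modes \<eta> K (D k f) zs)"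

lemma eval_modes_add: "eval_modes \<eta> K (\<lambda>ks. f ks + g ks) zs = eval_modes \<eta> K f zs + eval_modes \<eta> K g zs"
  by (induction zs arbitrary: f g) (auto simp: sum.distrib algebra_simps)

lemma eval_modes_cmult: "eval_modes \<eta> K (\<lambda>ks. c * f ks) zs = c * eval_modes \<eta> K f zs"
  by (induction zs arbitrary: f) (auto simp: sum_distrib_left mult_ac)

lemma eval_modes_zero: "eval_modes \<eta> K (\<lambda>ks. 0) zs = 0"
  by (induction zs) auto

lemma eval_modes_sum: "finite I \<Longrightarrow> eval_modes \<eta> K (\<lambda>ks. \<Sum>i\<in>I. F i ks) zs = (\<Sum>i\<in>I. eval_modes \<eta> K (F i) zs)"
  by (induction I rule: finite_induct) (simp_all add: eval_modes_zero eval_modes_add)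

lemma eval_modes_unit: "eval_modes \<eta> K (\<lambda>ks. if ks = [] then x else 0) zs = (if zs = [] then x else 0)"
  by (cases zs) (auto simp: eval_modes_zero)

lemma eval_modes_single:
  assumes "a < K"
  shows "eval_modes \<eta> K (\<lambda>ks. if ks = [a] then x else 0) zs = (if length zs = 1 then x * \<eta> a (hd zs) else 0)"
proof (cases zs)
  case (Cons z us)
  have "(\<lambda>ks. if k # ks = [a] then x else 0) = (\<lambda>ks. if ks = [] then if k = a then x else 0 else 0)" for k by auto
  then have "eval_modes \<eta> K (\<lambda>ks. if ks = [a] then x else 0) zs = (\<Sum>k<K. \<eta> k z * (if us = [] then if k = a then x else 0 else 0))"
    unfolding Cons eval_modes.simps by (simp only: eval_modes_unit)
  also have "\<dots> = (\<Sum>k<K. if k = a then \<eta> a z * (if us = [] then x else 0) else 0)"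
    by (intro sum.cong) auto
  finally have "eval_modes \<eta> K (\<lambda>ks. if ks = [a] then x else 0) zs = (\<Sum>k<K. if k = a then \<eta> a z * (if us = [] then x else 0) else 0)" .
  then show ?thesis using assms Cons by (auto simp: mult.commute)
qed simp

text \<open>Under evaluation, distributing indices between two factors becomes distributing the
  points between them, as the recursion does.\<close>

lemma eval_modes_conv: "eval_modes \<eta> K (conv f g) zs = conv (eval_modes \<eta> K f) (eval_modes \<eta> K g) zs"
proof (induction zs arbitrary: f g)
  case (Cons z zs)
  have "conv f (\<lambda>zs. \<Sum>k<K. \<eta> k z * G k zs) zs = (\<Sum>k<K. \<eta> k z * conv f (G k) zs)" for f G
    by (simp add: conv_comm[of f] conv_sum_left conv_cmult_left)
  then show ?case
    by (simp add: eval_modes_add Cons.IH conv_sum_left conv_cmult_left sum.distrib distrib_left)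
qed simp

lemma sym_eval_modes:
  assumes "symmetric_fun f"
  shows "symmetric_fun (eval_modes \<eta> K f)"
proof -
  have "length zs = n \<Longrightarrow> mset zs = mset zs' \<Longrightarrow> eval_modes \<eta> K f zs = eval_modes \<eta> K f zs'" if "symmetric_fun f" for n zs zs' f
    using that
  proof (induction n arbitrary: f zs zs')
    case (Suc n)
    show ?case
    proof (rule sym_length_Suc[of n "eval_modes \<eta> K f"])
      show "eval_modes \<eta> K f (z # us) = eval_modes \<eta> K f (z # us')" if "length us = n" "mset us = mset us'" for z us us'
        unfolding eval_modes.simps
        by (intro sum.cong refl arg_cong2[of _ _ _ _ "(*)"] Suc.IH[OF that] sym_D Suc.prems)
      have sw: "(\<lambda>ks. f (i # j # ks)) = (\<lambda>ks. f (j # i # ks))" for i j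
        by (intro ext sym_swap Suc.prems)
      have E: "eval_modes \<eta> K f (z # w # us) = (\<Sum>k<K. \<Sum>l<K. \<eta> k z * (\<eta> l w * eval_modes \<eta> K (\<lambda>ks. f (k # l # ks)) us))" for z w us
        by (simp add: sum_distrib_left)
      show "eval_modes \<eta> K f (z # w # us) = eval_modes \<eta> K f (w # z # us)" for z w us
        unfolding E by (subst sum.swap) (simp add: sw mult.left_commute)
    qed (use Suc.prems in auto)
  qed auto
  then show ?thesis using assms unfolding symmetric_fun_def by blast
qed

lemma eval_modes_indep: "bounded_by w f \<Longrightarrow> w \<le> int K \<Longrightarrow> K \<le> K' \<Longrightarrow> eval_modes \<eta> K f zs = eval_modes \<eta> K' f zs"
proof (induction zs arbitrary: f w)
  case (Cons z zs)
  have "eval_modes \<eta> K f (z # zs) = (\<Sum>k<K. \<eta> k z * eval_modes \<eta> K' (D k f) zs)"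
    using Cons.IH[OF bounded_by_D[OF Cons.prems(1)]] Cons.prems by simp
  also have "\<dots> = (\<Sum>k<K'. \<eta> k z * eval_modes \<eta> K' (D k f) zs)"
  proof (intro sum.mono_neutral_left ballI)
    fix k assume "k \<in> {..<K'} - {..<K}"
    then have "D k f = (\<lambda>_. 0)" using Cons.prems by (intro ext bounded_by_D_eq_0[of w]) auto
    then show "\<eta> k z * eval_modes \<eta> K' (D k f) zs = 0" by (simp add: eval_modes_zero)
  qed (use Cons.prems in auto)
  finally show ?case by simp
qed simp

lemma low_conv: "(\<And>I. low L (f I)) \<Longrightarrow> (\<And>I. low M (g I)) \<Longrightarrow> low (L + M) (conv f g zs)"
  by (induction zs arbitrary: f g) (auto intro!: low_add low_mult)

lemma reflect_add: "reflect (F + G) = reflect F + reflect G"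
  by (rule fls_eqI) (simp add: reflect_nth)

lemma reflect_sum: "reflect (\<Sum>i\<in>I. F i) = (\<Sum>i\<in>I. reflect (F i))"
  by (rule fls_eqI) (simp add: reflect_nth fls_nth_sum sum_negf)

lemma reflect_const_mult: "reflect (fls_const c * F) = fls_const c * reflect F"
  by (rule fls_eqI) (simp add: reflect_nth)

lemma reflect_conv: "reflect (conv f g zs) = conv (\<lambda>I. reflect (f I)) (\<lambda>I. reflect (g I)) zs"
  by (induction zs arbitrary: f g) (auto simp: reflect_mult reflect_add)

section \<open>Parity of products of expansions\<close>

definition odd_regular :: "nat \<Rightarrow> complex fls \<Rightarrow> bool" where
  "odd_regular K F \<longleftrightarrow> low (2 - 2 * int K) F \<and> (\<forall>n<0. odd n \<longrightarrow> F $$ n = 0)"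

text \<open>Two odd exponents with sum -2p \<le> 0 include a negative one, at which the
  corresponding factor vanishes. So only even exponents contribute, and there the reflection does
  nothing.\<close>

lemma mult_reflect_nth:
  assumes F: "odd_regular K F" and G: "odd_regular K G"
  shows "(F * reflect G) $$ (- 2 * int p) = (\<Sum>a\<in>{- int K..<int K}. F $$ (2 * a) * G $$ (2 * (- int p - a)))"
proof -
  have lF: "low (2 - 2 * int K) F" and lG: "low (2 - 2 * int K) (reflect G)" "low (2 - 2 * int K) G"
    using F G by (auto simp: odd_regular_def low_reflect)
  let ?t = "\<lambda>i. F $$ i * reflect G $$ (- 2 * int p - i)"
  have "(F * reflect G) $$ (- 2 * int p) = (\<Sum>i\<in>{2 - 2 * int K..- 2 * int p - (2 - 2 * int K)}. ?t i)"
    by (rule fls_mult_nth_low[OF lF lG(1)])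
  also have "\<dots> = (\<Sum>i\<in>(*) 2 ` {- int K..<int K}. ?t i)"
  proof (rule sum.mono_neutral_cong)
    fix i assume i: "i \<in> {2 - 2 * int K..- 2 * int p - (2 - 2 * int K)} - (*) 2 ` {- int K..<int K}"
    have "odd i"
    proof
      assume "even i"
      then obtain a where "i = 2 * a" by (auto elim: evenE)
      then show False using i by auto
    qed
    show "?t i = 0"
    proof (cases "i < 0")
      case True then show ?thesis using F \<open>odd i\<close> by (simp add: odd_regular_def)
    next
      case False
      then have "- 2 * int p - i < 0" "odd (- 2 * int p - i)" using \<open>odd i\<close> by (cases "i = 0"; auto)+
      then have "G $$ (- 2 * int p - i) = 0" using G unfolding odd_regular_def by blast
      then show ?thesis by (simp add: reflect_nth)
    qed
  next
    fix i assume i: "i \<in> (*) 2 ` {- int K..<int K} - {2 - 2 * int K..- 2 * int p - (2 - 2 * int K)}"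
    then consider "i < 2 - 2 * int K" | "- 2 * int p - i < 2 - 2 * int K" by force
    then show "?t i = 0" by cases (auto simp: lowD[OF lF] lowD[OF lG(1)])
  qed auto
  also have "\<dots> = (\<Sum>a\<in>{- int K..<int K}. F $$ (2 * a) * G $$ (2 * (- int p - a)))"
    by (subst sum.reindex) (auto simp: inj_on_def reflect_nth algebra_simps)
  finally show ?thesis .
qed

lemma conv_reflect_nth:
  assumes "\<And>I. odd_regular K (f I)" "\<And>I. odd_regular K (g I)"
  shows "conv f (\<lambda>I. reflect (g I)) zs $$ (- 2 * int p)
    = (\<Sum>a\<in>{- int K..<int K}. conv (\<lambda>I. f I $$ (2 * a)) (\<lambda>I. g I $$ (2 * (- int p - a))) zs)"
  using assms
proof (induction zs arbitrary: f g)
  case Nil then show ?case using mult_reflect_nth by simp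
next
  case (Cons z zs)
  then show ?case by (simp add: sum.distrib)
qed

text \<open>
  \<open>q\<close> is the expansion of \<open>1 / (2 \<zeta> (y(z) - y(\<sigma> z)))\<close> in \<open>\<zeta>\<close>; the factor 4 in \<open>c\<close> makes \<open>c 0 = 1\<close>.
\<close>
locale recursion_data = uniformizer \<psi> for \<psi> +
  fixes q :: "complex fls"
  assumes q_low: "low (- 2) q" and q_odd: "\<And>n. odd n \<Longrightarrow> q $$ n = 0"
begin

definition c :: "nat \<Rightarrow> complex" where
  "c i = 4 * q $$ (2 * int i - 2)"

sublocale airy_data b "\<lambda>k a. b k a / (2 * of_nat a + 1)" c
  by (rule airy_data_exists) (rule b_sym)

definition \<eta> :: "nat \<Rightarrow> complex \<Rightarrow> complex" where
  "\<eta> k = pole_fun \<psi> (Suc (2 * k))"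

abbreviation "ev \<equiv> eval_modes \<eta>"
abbreviation "E k \<equiv> pole_form \<psi> (Suc (2 * k))"

text \<open>The expansion of dz/(z - w)^2, obtained as the derivative of 1/(w - \<psi>); the
  differentiation produces the factor 2a + 1 of the source modes.\<close>

definition source_form :: "complex \<Rightarrow> complex fls" where
  "source_form w = fps_to_fls (fps_deriv (Abs_fps (\<lambda>j. pole_fun \<psi> j w)))"

text \<open>The expansion of the form of order \<open>m\<close> in its first argument near the
  ramification point, the other arguments being \<open>I\<close>; the form of type (0,2) is the
  source term at m = 0.\<close>

definition field_form :: "nat \<Rightarrow> nat \<Rightarrow> complex list \<Rightarrow> complex fls" where
  "field_form K m I = (\<Sum>k<K. fls_const (ev K (D k (F m)) I) * E k)
     + (if m = 0 \<and> length I = 1 then source_form (hd I) else 0)"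

definition bracket_form :: "nat \<Rightarrow> nat \<Rightarrow> complex list \<Rightarrow> complex fls" where
  "bracket_form K N zs = (\<Sum>k<K. \<Sum>l<K. fls_const (ev K (\<lambda>ks. F N (k # l # ks)) zs) * (E k * reflect (E l)))
     + (if N = 0 \<and> zs = [] then diag_form else 0)
     + gconv (field_form K) (\<lambda>m I. reflect (field_form K m I)) N zs"

lemma E_nth_neg: "a < 0 \<Longrightarrow> E k $$ (2 * a) = (if int k = - a - 1 then 1 else 0)"
proof -
  assume "a < 0"
  then have "2 * a = - 1 - int (nat (- 2 * a - 1))" "nat (- 2 * a - 1) = Suc (2 * k) \<longleftrightarrow> int k = - a - 1" by auto
  then show ?thesis using pole_form_nth_neg[of "Suc (2 * k)" "nat (- 2 * a - 1)"] by (simp only:)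
qed

lemma E_nth_odd: "n < 0 \<Longrightarrow> odd n \<Longrightarrow> E k $$ n = 0"
proof -
  assume *: "n < 0" "odd n"
  then have "n = - 1 - int (nat (- n - 1))" by auto
  moreover have "nat (- n - 1) \<noteq> Suc (2 * k)"
  proof
    assume "nat (- n - 1) = Suc (2 * k)"
    then have "n = 2 * (- int k - 1)" using *(1) by auto
    then show False using *(2) by simp
  qed
  ultimately show ?thesis using pole_form_nth_neg[of "Suc (2 * k)" "nat (- n - 1)"] by (simp only: if_False)
qed

lemma low_E: "low (- 2 * int k - 2) (E k)"
  by (rule low_mono[OF low_pole_form]) simp

lemma deriv_mode_eq_sum:
  assumes "- int K \<le> a"
  shows "deriv_mode K b a f ks = (\<Sum>k<K. E k $$ (2 * a) * f (k # ks))"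
proof (cases "a < 0")
  case True
  have "(\<Sum>k<K. E k $$ (2 * a) * f (k # ks)) = (\<Sum>k<K. if k = nat (- a - 1) then f (k # ks) else 0)"
    using True by (intro sum.cong) (auto simp: E_nth_neg)
  also have "\<dots> = f (nat (- a - 1) # ks)" using True assms by (subst sum.delta) auto
  finally show ?thesis using True by (simp add: deriv_mode_def)
next
  case False then show ?thesis by (simp add: deriv_mode_def b_def)
qed

lemma F_D_zero: "k \<ge> 3 * m \<Longrightarrow> D k (F m) = (\<lambda>_. 0)"
  by (intro ext bounded_by_D_eq_0[OF bounded_by_F]) auto

lemma F_DD_zero: "k + l + 2 > 3 * m \<Longrightarrow> (\<lambda>ks. F m (k # l # ks)) = (\<lambda>_. 0)"
  by (intro ext bounded_byD[OF bounded_by_F]) auto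

lemma ev_deriv_mode:
  assumes "- int K \<le> a"
  shows "ev K (deriv_mode K b a f) I = (\<Sum>k<K. E k $$ (2 * a) * ev K (D k f) I)"
  unfolding deriv_mode_eq_sum[OF assms, abs_def] by (simp only: eval_modes_sum[OF finite_lessThan] eval_modes_cmult)

text \<open>The link between geometry and algebra: even coefficients of the expanded form are the
  modes of the algebraic field.\<close>

lemma field_form_even:
  assumes "- int K \<le> a" "a < int K"
  shows "field_form K m I $$ (2 * a) = ev K (field_log K b a m) I"
proof -
  have s: "source_form w $$ (2 * a) = (if a < 0 then 0 else (2 * of_int a + 1) * \<eta> (nat a) w)" for w
  proof (cases "a < 0")
    case False
    then obtain i where "a = int i" using zero_le_imp_eq_int[of a] by auto
    then show ?thesis by (simp add: source_form_def \<eta>_def nat_mult_distrib)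
  qed (simp add: source_form_def)
  have "ev K (\<lambda>ks. if m = 0 \<and> 0 \<le> a \<and> ks = [nat a] then 2 * of_int a + 1 else 0) I
     = (if m = 0 \<and> length I = 1 then source_form (hd I) $$ (2 * a) else 0)"
  proof (cases "m = 0 \<and> 0 \<le> a")
    case True
    then have "nat a < K" using assms by auto
    then show ?thesis using True eval_modes_single[of "nat a" K \<eta> "2 * of_int a + 1" I] by (simp add: s)
  next
    case False
    then have "(\<lambda>ks. if m = 0 \<and> 0 \<le> a \<and> ks = [nat a] then 2 * of_int a + 1 else 0) = (\<lambda>_. 0 :: complex)" by auto
    then show ?thesis using False by (auto simp: s eval_modes_zero)
  qed
  then show ?thesis
    unfolding field_log_def[abs_def] eval_modes_add ev_deriv_mode[OF assms(1)]
    by (simp add: field_form_def fls_nth_sum mult.commute)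
qed

lemma low_field_form: "low (- 6 * int m) (field_form K m I)"
proof -
  have "low (- 6 * int m) (fls_const (ev K (D k (F m)) I) * E k)" for k
  proof (cases "k \<ge> 3 * m")
    case True then show ?thesis using F_D_zero[OF True] by (simp add: eval_modes_zero low_zero)
  next
    case False then show ?thesis by (intro low_const_mult low_mono[OF low_E]) auto
  qed
  moreover have "low (- 6 * int m) (source_form w)" for w
    unfolding source_form_def by (rule low_mono[OF low_fps]) auto
  ultimately show ?thesis unfolding field_form_def by (auto intro!: low_add low_sum simp: low_zero)
qed

lemma odd_regular_field_form: "3 * m + 1 \<le> K \<Longrightarrow> odd_regular K (field_form K m I)"
  unfolding odd_regular_def
  using low_mono[OF low_field_form, of "2 - 2 * int K" m K I]
  by (auto simp: field_form_def fls_nth_sum E_nth_odd source_form_def intro!: sum.neutral)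

lemma odd_regular_E: "k + 2 \<le> K \<Longrightarrow> odd_regular K (E k)"
  unfolding odd_regular_def using low_mono[OF low_E, of "2 - 2 * int K" k] by (auto simp: E_nth_odd)

text \<open>The nonpositive even coefficients of the bracket are the summands of
  \<open>loop_rhs\<close>: second derivatives, products of fields, and the coefficients of
  \<open>diag_form\<close> at exponents 0 and -2.\<close>

lemma bracket_form_even_nth:
  assumes K: "K \<ge> 3 * N + 8"
  shows "bracket_form K N zs $$ (- 2 * int p) = ev K (\<lambda>ks. (\<Sum>a\<in>{- int K..<int K}.
        deriv_mode K b a (deriv_mode K b (- int p - a) (F N)) ks
        + gconv (field_log K b a) (field_log K b (- int p - a)) N ks)
      + (if N = 0 \<and> ks = [] then (if p = 0 then b 0 0 else 0) + (if p = 1 then 1/4 else 0) else 0)) zs"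
proof -
  let ?A = "{- int K..<int K}"
  let ?C = "\<lambda>k l. ev K (\<lambda>ks. F N (k # l # ks)) zs"
  \<comment> \<open>An index below -K stands for \<partial>_k with k \<ge> K, which annihilates F_m
    by the weight bound.\<close>
  have bd: "deriv_mode K b a (F m) = (\<lambda>_. 0)" if "a < - int K" "m \<le> N" for a m
    using that K F_D_zero[of m "nat (- a - 1)"] by (auto simp: deriv_mode_def fun_eq_iff)
  have 1: "(\<Sum>k<K. \<Sum>l<K. fls_const (?C k l) * (E k * reflect (E l))) $$ (- 2 * int p)
     = (\<Sum>a\<in>?A. ev K (deriv_mode K b a (deriv_mode K b (- int p - a) (F N))) zs)"
  proof -
    have Csym: "?C k l = ?C l k" for k l
      by (intro arg_cong[of _ _ "\<lambda>f. ev K f zs"] ext sym_swap sym_F)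
    have "?C k l * (E k * reflect (E l)) $$ (- 2 * int p) = ?C k l * (\<Sum>a\<in>?A. E k $$ (2 * a) * E l $$ (2 * (- int p - a)))" for k l
    proof (cases "k + l + 2 > 3 * N")
      case True then show ?thesis using F_DD_zero[OF True] by (simp add: eval_modes_zero)
    next
      case False then show ?thesis using K by (subst mult_reflect_nth[of K]) (auto intro!: odd_regular_E)
    qed
    then have "(\<Sum>k<K. \<Sum>l<K. fls_const (?C k l) * (E k * reflect (E l))) $$ (- 2 * int p)
      = (\<Sum>k<K. \<Sum>l<K. \<Sum>a\<in>?A. ?C k l * (E k $$ (2 * a) * E l $$ (2 * (- int p - a))))"
      by (simp add: fls_nth_sum sum_distrib_left)
    also have "\<dots> = (\<Sum>a\<in>?A. \<Sum>k<K. \<Sum>l<K. ?C k l * (E k $$ (2 * a) * E l $$ (2 * (- int p - a))))"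
    proof -
      let ?X = "\<lambda>k l a. ?C k l * (E k $$ (2 * a) * E l $$ (2 * (- int p - a)))"
      have "(\<Sum>k<K. \<Sum>l<K. \<Sum>a\<in>?A. ?X k l a) = (\<Sum>k<K. \<Sum>a\<in>?A. \<Sum>l<K. ?X k l a)"
        by (intro sum.cong refl sum.swap)
      also have "\<dots> = (\<Sum>a\<in>?A. \<Sum>k<K. \<Sum>l<K. ?X k l a)"
        by (rule sum.swap)
      finally show ?thesis .
    qed
    also have "\<dots> = (\<Sum>a\<in>?A. ev K (deriv_mode K b a (deriv_mode K b (- int p - a) (F N))) zs)"
    proof (rule sum.cong[OF refl])
      fix a assume a: "a \<in> ?A"
      show "(\<Sum>k<K. \<Sum>l<K. ?C k l * (E k $$ (2 * a) * E l $$ (2 * (- int p - a))))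
        = ev K (deriv_mode K b a (deriv_mode K b (- int p - a) (F N))) zs"
      proof (cases "- int p - a < - int K")
        case True
        then have "E l $$ (2 * (- int p - a)) = 0" if "l < K" for l
          using that by (subst E_nth_neg) auto
        moreover have "deriv_mode K b a (\<lambda>_. 0) = (\<lambda>_. 0)" by (simp add: deriv_mode_def fun_eq_iff)
        ultimately show ?thesis using bd[OF True] by (simp add: eval_modes_zero)
      next
        case False
        have dm: "deriv_mode K b (- int p - a) (F N) = (\<lambda>ks. \<Sum>k<K. E k $$ (2 * (- int p - a)) * F N (k # ks))"
          by (intro ext deriv_mode_eq_sum) (use False in simp)
        have "ev K (D k (deriv_mode K b (- int p - a) (F N))) zs = (\<Sum>l<K. E l $$ (2 * (- int p - a)) * ?C k l)" for k
          unfolding Csym[of k] dm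
          by (simp only: eval_modes_sum[OF finite_lessThan] eval_modes_cmult)
        then show ?thesis using a by (subst ev_deriv_mode) (auto simp: sum_distrib_left mult_ac)
      qed
    qed
    finally show ?thesis .
  qed
  have 2: "gconv (field_form K) (\<lambda>m I. reflect (field_form K m I)) N zs $$ (- 2 * int p)
     = (\<Sum>a\<in>?A. ev K (gconv (field_log K b a) (field_log K b (- int p - a)) N) zs)"
  proof -
    have "conv (field_form K m) (\<lambda>I. reflect (field_form K (N - m) I)) zs $$ (- 2 * int p)
      = (\<Sum>a\<in>?A. ev K (conv (field_log K b a m) (field_log K b (- int p - a) (N - m))) zs)" if "m \<le> N" for m
    proof -
      have "conv (field_form K m) (\<lambda>I. reflect (field_form K (N - m) I)) zs $$ (- 2 * int p)
        = (\<Sum>a\<in>?A. conv (\<lambda>I. field_form K m I $$ (2 * a)) (\<lambda>I. field_form K (N - m) I $$ (2 * (- int p - a))) zs)"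
        by (rule conv_reflect_nth) (use that K in \<open>auto intro!: odd_regular_field_form\<close>)
      also have "\<dots> = (\<Sum>a\<in>?A. ev K (conv (field_log K b a m) (field_log K b (- int p - a) (N - m))) zs)"
      proof (rule sum.cong[OF refl])
        fix a assume a: "a \<in> ?A"
        have e: "(\<lambda>I. field_form K m I $$ (2 * a)) = ev K (field_log K b a m)"
          using a by (intro ext field_form_even) auto
        \<comment> \<open>The index range is half-open. For a = -K and p = 0 the partner is K, where
          \<open>field_form_even\<close> does not apply; the first factor vanishes then.\<close>
        consider "- int p - a < - int K" | "a = - int K" | "- int K \<le> - int p - a" "- int p - a < int K"
          using a by force
        then show "conv (\<lambda>I. field_form K m I $$ (2 * a)) (\<lambda>I. field_form K (N - m) I $$ (2 * (- int p - a))) zs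
          = ev K (conv (field_log K b a m) (field_log K b (- int p - a) (N - m))) zs"
        proof cases
          case 1
          then have "field_log K b (- int p - a) (N - m) = (\<lambda>_. 0)"
            using bd[OF 1, of "N - m"] by (auto simp: field_log_def fun_eq_iff)
          moreover have "field_form K (N - m) I $$ (2 * (- int p - a)) = 0" for I
            using 1 K by (intro lowD[OF low_field_form]) auto
          ultimately show ?thesis by (simp add: conv_zero_right eval_modes_conv eval_modes_zero[abs_def])
        next
          case 2
          then have "field_log K b a m = (\<lambda>_. 0)"
            using F_D_zero[of m "nat (- a - 1)"] K that by (auto simp: field_log_def deriv_mode_def fun_eq_iff)
          then show ?thesis unfolding e by (simp add: conv_zero_left eval_modes_conv eval_modes_zero[abs_def])
        next
          case 3
          then have "(\<lambda>I. field_form K (N - m) I $$ (2 * (- int p - a))) = ev K (field_log K b (- int p - a) (N - m))"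
            using a by (intro ext field_form_even) auto
          then show ?thesis unfolding e by (simp add: eval_modes_conv)
        qed
      qed
      finally show ?thesis .
    qed
    then have "gconv (field_form K) (\<lambda>m I. reflect (field_form K m I)) N zs $$ (- 2 * int p)
      = (\<Sum>m\<le>N. \<Sum>a\<in>?A. ev K (conv (field_log K b a m) (field_log K b (- int p - a) (N - m))) zs)"
      by (simp add: gconv_def fls_nth_sum)
    also have "\<dots> = (\<Sum>a\<in>?A. \<Sum>m\<le>N. ev K (conv (field_log K b a m) (field_log K b (- int p - a) (N - m))) zs)"
      by (rule sum.swap)
    finally show ?thesis unfolding gconv_def[abs_def] by (simp add: eval_modes_sum)
  qed
  have 3: "(if N = 0 \<and> zs = [] then diag_form else 0) $$ (- 2 * int p)
    = ev K (\<lambda>ks. if N = 0 \<and> ks = [] then (if p = 0 then b 0 0 else 0) + (if p = 1 then 1/4 else 0) else 0) zs"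
  proof -
    have "diag_form $$ (- 2 * int p) = (if p = 0 then b 0 0 else 0) + (if p = 1 then 1/4 else 0)"
      using lowD[OF low_diag_form, of "- 2 * int p"] by (cases "p = 0"; cases "p = 1") (auto simp: diag_form_0 diag_form_m2)
    then show ?thesis
      using eval_modes_unit[of \<eta> K "(if p = 0 then b 0 0 else 0) + (if p = 1 then 1/4 else 0)" zs]
      by (cases "N = 0") (auto simp: eval_modes_zero)
  qed
  show ?thesis
    unfolding bracket_form_def fls_plus_nth 1 2 3 eval_modes_add eval_modes_sum[OF finite_atLeastLessThan_int] sum.distrib
    by simp
qed

text \<open>The bracket is symmetric in its two points, which the reflection exchanges.\<close>

lemma bracket_form_odd: "odd n \<Longrightarrow> bracket_form K N zs $$ n = 0"
proof -
  assume n: "odd n"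
  let ?C = "\<lambda>k l. ev K (\<lambda>ks. F N (k # l # ks)) zs"
  have Csym: "?C k l = ?C l k" for k l
    by (intro arg_cong[of _ _ "\<lambda>f. ev K f zs"] ext sym_swap sym_F)
  have 1: "reflect (\<Sum>k<K. \<Sum>l<K. fls_const (?C k l) * (E k * reflect (E l))) = (\<Sum>k<K. \<Sum>l<K. fls_const (?C k l) * (E k * reflect (E l)))"
    unfolding reflect_sum reflect_const_mult unfolding reflect_mult reflect_reflect
    by (subst sum.swap, intro sum.cong refl, subst Csym) (simp only: mult.commute)
  have 2: "reflect (gconv (field_form K) (\<lambda>m I. reflect (field_form K m I)) N zs) = gconv (field_form K) (\<lambda>m I. reflect (field_form K m I)) N zs"
    (is "?L = ?R")
  proof -
    have "?L = gconv (\<lambda>m I. reflect (field_form K m I)) (field_form K) N zs"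
      by (simp add: gconv_def reflect_sum reflect_conv reflect_reflect)
    then show ?thesis by (simp add: gconv_comm)
  qed
  have 3: "reflect (if N = 0 \<and> zs = [] then diag_form else 0) = (if N = 0 \<and> zs = [] then diag_form else 0)"
    by (rule fls_eqI) (auto simp: reflect_nth diag_form_odd)
  have "reflect (bracket_form K N zs) = bracket_form K N zs"
    unfolding bracket_form_def reflect_add 1 2 3 ..
  from arg_cong[OF this, of "\<lambda>F. F $$ n"] n show ?thesis by (simp add: reflect_nth)
qed

lemma low_bracket_form: "low (- 6 * int N - 2) (bracket_form K N zs)"
proof -
  have "low (- 6 * int N - 2) (fls_const (ev K (\<lambda>ks. F N (k # l # ks)) zs) * (E k * reflect (E l)))" for k l
  proof (cases "k + l + 2 > 3 * N")
    case True then show ?thesis using F_DD_zero[OF True] by (simp add: eval_modes_zero low_zero)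
  next
    case False
    have "low ((- 2 * int k - 2) + (- 2 * int l - 2)) (E k * reflect (E l))"
      by (intro low_mult low_reflect low_E)
    then show ?thesis using False by (intro low_const_mult) (erule low_mono, auto)
  qed
  moreover have "low (- 6 * int N - 2) (conv (field_form K m) (\<lambda>I. reflect (field_form K (N - m) I)) zs)" if "m \<le> N" for m
  proof -
    have "low (- 6 * int m + - 6 * int (N - m)) (conv (field_form K m) (\<lambda>I. reflect (field_form K (N - m) I)) zs)"
      by (intro low_conv low_reflect low_field_form)
    then show ?thesis by (rule low_mono) (use that in \<open>simp add: of_nat_diff\<close>)
  qed
  moreover have "low (- 6 * int N - 2) diag_form" by (rule low_mono[OF low_diag_form]) simp
  ultimately show ?thesis
    unfolding bracket_form_def gconv_def by (auto intro!: low_add low_sum simp: low_zero)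
qed

text \<open>Both \<open>q\<close> and the bracket are even, so the residue sees only the odd
  coefficients of the kernel \<open>n\<close>. Their factor -2 and the 1/4 hidden in the
  normalisation of \<open>c\<close> combine to the -1/2 of \<open>loop_rhs\<close>.\<close>

lemma residue_bracket_form:
  assumes K: "K \<ge> 3 * N + 8" and n: "\<And>k. n $ Suc (2 * k) = - 2 * \<eta> k z"
  shows "fls_residue (fps_to_fls n * (q * bracket_form K N zs)) = ev K (F (Suc N)) (z # zs)"
proof -
  let ?S = "bracket_form K N zs"
  have qS_low: "low (- 6 * int N - 4) (q * ?S)"
    by (rule low_mono[OF low_mult[OF q_low low_bracket_form]]) simp
  have qS_odd: "(q * ?S) $$ i = 0" if "odd i" for i
    unfolding fls_mult_nth_low[OF q_low low_bracket_form]
  proof (intro sum.neutral ballI)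
    fix j show "q $$ j * bracket_form K N zs $$ (i - j) = 0"
      using q_odd[of j] bracket_form_odd[of "i - j"] that by (cases "odd j") auto
  qed
  have qS: "(q * ?S) $$ (- 2 * int k - 2) = 1/4 * (\<Sum>i<K. c i * ?S $$ (- 2 * int (k + i)))" for k
  proof -
    let ?t = "\<lambda>i. q $$ i * ?S $$ (- 2 * int k - 2 - i)"
    have "(q * ?S) $$ (- 2 * int k - 2) = (\<Sum>i\<in>{- 2..- 2 * int k - 2 - (- 6 * int N - 2)}. ?t i)"
      by (rule fls_mult_nth_low[OF q_low low_bracket_form])
    also have "\<dots> = (\<Sum>i\<in>(\<lambda>i. 2 * int i - 2) ` {..<K}. ?t i)"
    proof (rule sum.mono_neutral_cong)
      fix i assume i: "i \<in> {- 2..- 2 * int k - 2 - (- 6 * int N - 2)} - (\<lambda>i. 2 * int i - 2) ` {..<K}"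
      have "odd i"
      proof
        assume "even i"
        then obtain a where a: "i = 2 * a" by (auto elim: evenE)
        then have "i = 2 * int (nat (a + 1)) - 2" "nat (a + 1) < K" using i K by auto
        then show False using i by blast
      qed
      then show "?t i = 0" using q_odd by simp
    next
      fix i assume "i \<in> (\<lambda>i. 2 * int i - 2) ` {..<K} - {- 2..- 2 * int k - 2 - (- 6 * int N - 2)}"
      then have "- 2 * int k - 2 - i < - 6 * int N - 2" by auto
      then show "?t i = 0" using lowD[OF low_bracket_form] by simp
    qed auto
    also have "\<dots> = (\<Sum>i<K. ?t (2 * int i - 2))"
      by (subst sum.reindex) (auto simp: inj_on_def)
    also have "\<dots> = 1/4 * (\<Sum>i<K. c i * ?S $$ (- 2 * int (k + i)))"
    proof -
      have "- 2 * int k - 2 - (2 * int i - 2) = - 2 * int (k + i)" for i by simp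
      then show ?thesis unfolding sum_distrib_left by (intro sum.cong refl) (simp only: c_def, simp)
    qed
    finally show ?thesis .
  qed
  have "fls_residue (fps_to_fls n * (q * ?S)) = (\<Sum>i\<in>{0..- 1 - (- 6 * int N - 4)}. fps_to_fls n $$ i * (q * ?S) $$ (- 1 - i))"
    using fls_mult_nth_low[OF low_fps qS_low, of n "-1"] by simp
  also have "\<dots> = (\<Sum>i\<in>(\<lambda>k. 2 * int k + 1) ` {..<K}. fps_to_fls n $$ i * (q * ?S) $$ (- 1 - i))"
  proof (rule sum.mono_neutral_cong)
    fix i assume i: "i \<in> {0..- 1 - (- 6 * int N - 4)} - (\<lambda>k. 2 * int k + 1) ` {..<K}"
    have "even i"
    proof (rule ccontr)
      assume "odd i"
      then obtain a where "i = 2 * a + 1" by (auto elim: oddE)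
      then have "i = 2 * int (nat a) + 1" "nat a < K" using i K by auto
      then show False using i by blast
    qed
    then show "fps_to_fls n $$ i * (q * ?S) $$ (- 1 - i) = 0" using qS_odd by simp
  next
    fix i assume "i \<in> (\<lambda>k. 2 * int k + 1) ` {..<K} - {0..- 1 - (- 6 * int N - 4)}"
    then have "- 1 - i < - 6 * int N - 4" by auto
    then show "fps_to_fls n $$ i * (q * ?S) $$ (- 1 - i) = 0" using lowD[OF qS_low] by simp
  qed auto
  also have "\<dots> = (\<Sum>k<K. fps_to_fls n $$ (2 * int k + 1) * (q * ?S) $$ (- 1 - (2 * int k + 1)))"
    by (subst sum.reindex) (auto simp: inj_on_def)
  also have "\<dots> = (\<Sum>k<K. \<eta> k z * (- 1/2 * (\<Sum>i<K. c i * ?S $$ (- 2 * int (k + i)))))"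
  proof (rule sum.cong[OF refl])
    fix k
    have "fps_to_fls n $$ (2 * int k + 1) = n $ Suc (2 * k)"
    proof -
      have "2 * int k + 1 = int (Suc (2 * k))" by simp
      show ?thesis unfolding \<open>2 * int k + 1 = int (Suc (2 * k))\<close> by (simp del: of_nat_Suc)
    qed
    moreover have "- 1 - (2 * int k + 1) = - 2 * int k - 2" by simp
    ultimately show "fps_to_fls n $$ (2 * int k + 1) * (q * ?S) $$ (- 1 - (2 * int k + 1)) = \<eta> k z * (- 1/2 * (\<Sum>i<K. c i * ?S $$ (- 2 * int (k + i))))"
      using n[of k] qS[of k] by (simp only:) simp
  qed
  also have "\<dots> = (\<Sum>k<K. \<eta> k z * ev K (D k (F (Suc N))) zs)"
  proof (rule sum.cong[OF refl])
    fix k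
    have "D k (F (Suc N)) = loop_rhs K k N" by (intro ext F_Cons K)
    then have "ev K (D k (F (Suc N))) zs = - 1/2 * (\<Sum>i<K. c i * ?S $$ (- 2 * int (k + i)))"
      unfolding bracket_form_even_nth[OF K] loop_rhs_def[abs_def]
      by (simp only: eval_modes_cmult eval_modes_sum[OF finite_lessThan])
    then show "\<eta> k z * (- 1/2 * (\<Sum>i<K. c i * ?S $$ (- 2 * int (k + i)))) = \<eta> k z * ev K (D k (F (Suc N))) zs" by simp
  qed
  finally show ?thesis by simp
qed

end

section \<open>Local coordinates on a spectral curve\<close>

lemma has_fps_expansion_imp_tendsto_nhds:
  fixes f :: "complex \<Rightarrow> complex"
  assumes "f has_fps_expansion F"
  shows "(f \<longlongrightarrow> f 0) (nhds 0)"
  unfolding tendsto_at_iff_tendsto_nhds[symmetric]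
  using has_fps_expansion_imp_continuous[OF assms, of UNIV] by (simp add: continuous_within)

text \<open>Write x = z^2 u with u(0) = 1. Then \<chi> = z sqrt(u) is a coordinate with \<chi>^2 =
  x, and \<psi> is its inverse. The points \<psi>(t) and \<psi>(-t) exhaust a fibre of two points,
  so the involution becomes t -> -t.\<close>

lemma local_uniformizer:
  assumes X: "x has_fps_expansion X" "X $ 0 = 0" "X $ Suc 0 = 0" "X $ 2 = 1"
    and card: "\<forall>z\<in>ball 0 1 - {0}. card {w \<in> ball 0 1. x w = x z} = 2"
  obtains \<psi> \<chi> P Q where "\<psi> has_fps_expansion P" "P $ 0 = 0" "P $ Suc 0 = 1"
    "\<chi> has_fps_expansion Q" "Q $ 0 = 0" "Q $ Suc 0 = 1"
    "\<forall>\<^sub>F z in nhds 0. \<psi> (\<chi> z) = z" "\<forall>\<^sub>F t in nhds 0. x (\<psi> t) = t\<^sup>2" "\<forall>\<^sub>F t in nhds 0. deck x (\<psi> t) = \<psi> (- t)"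
proof -
  define U where "U = fps_shift 2 X"
  define u where "u = eval_fps U"
  have u: "u has_fps_expansion U"
    unfolding u_def U_def using X(1) by (intro eval_fps_has_fps_expansion) (auto simp: has_fps_expansion_def)
  have XU: "X = fps_X ^ 2 * U"
  proof (rule fps_ext)
    fix n show "X $ n = (fps_X ^ 2 * U) $ n"
    proof (cases "n < 2")
      case True then show ?thesis unfolding fps_X_power_mult_nth using X by (auto dest!: less_2_cases)
    next
      case False
      then have "n - 2 + 2 = n" by simp
      then show ?thesis using False unfolding fps_X_power_mult_nth U_def fps_shift_nth by simp
    qed
  qed
  have xu: "\<forall>\<^sub>F z in nhds 0. x z = z\<^sup>2 * u z"
  proof -
    have "(\<lambda>z. z\<^sup>2 * u z) has_fps_expansion X" unfolding XU by (intro fps_expansion_intros u)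
    then have "\<forall>\<^sub>F z in nhds 0. eval_fps X z = z\<^sup>2 * u z" by (simp add: has_fps_expansion_def)
    moreover have "\<forall>\<^sub>F z in nhds 0. eval_fps X z = x z" using X(1) by (simp add: has_fps_expansion_def)
    ultimately show ?thesis by eventually_elim simp
  qed
  have u0: "u 0 = 1" using X(4) by (simp add: u_def U_def eval_fps_at_0 numeral_2_eq_2)
  \<comment> \<open>The value u(0) = 1 lies off the branch cut of the square root.\<close>
  have "(\<lambda>z. csqrt (u z)) analytic_on {0}"
    by (intro analytic_intros has_fps_expansion_imp_analytic_0[OF u]) (simp add: u0)
  then obtain V where V: "(\<lambda>z. csqrt (u z)) has_fps_expansion V"
    using analytic_at_imp_has_fps_expansion_0 by blast
  have V0: "V $ 0 = 1" using has_fps_expansion_imp_0_eq_fps_nth_0[OF V] by (simp add: u0)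
  define \<chi> where "\<chi> z = z * csqrt (u z)" for z
  define Q where "Q = fps_X * V"
  have Q: "\<chi> has_fps_expansion Q" "Q $ 0 = 0" "Q $ Suc 0 = 1"
  proof -
    show "\<chi> has_fps_expansion Q"
      unfolding \<chi>_def Q_def by (intro has_fps_expansion_mult has_fps_expansion_fps_X V)
  qed (simp_all add: Q_def V0)
  have \<chi>2: "\<chi> z ^ 2 = z\<^sup>2 * u z" for z by (simp add: \<chi>_def power_mult_distrib)
  obtain S where S: "open S" "0 \<in> S" "\<chi> holomorphic_on S"
    by (rule has_fps_expansion_imp_holomorphic[OF Q(1)]) (rule that; assumption)
  have d\<chi>: "deriv \<chi> 0 \<noteq> 0"
    using has_fps_expansion_imp_0_eq_fps_nth_0[OF has_fps_expansion_deriv[OF Q(1)]] Q(3) by simp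
  obtain r where r: "r > 0" "ball 0 r \<subseteq> S" "inj_on \<chi> (ball 0 r)"
    by (rule has_complex_derivative_locally_injective[OF S(3,2,1) d\<chi>])
  have hol: "\<chi> holomorphic_on ball 0 r" using S(3) r(2) holomorphic_on_subset by blast
  obtain \<psi> where \<psi>: "\<psi> holomorphic_on (\<chi> ` ball 0 r)" "\<And>z. z \<in> ball 0 r \<Longrightarrow> \<psi> (\<chi> z) = z"
    by (rule holomorphic_has_inverse[OF hol open_ball r(3)], rule that, assumption, blast)
  have op: "open (\<chi> ` ball 0 r)" by (rule open_mapping_thm3[OF hol open_ball r(3)])
  have \<chi>0: "\<chi> 0 = 0" by (simp add: \<chi>_def)
  have in0: "0 \<in> \<chi> ` ball 0 r" using \<chi>0 r(1) by (metis centre_in_ball imageI)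
  have \<psi>0: "\<psi> 0 = 0" using \<psi>(2)[of 0] \<chi>0 r(1) by simp
  have "\<psi> analytic_on {0}" using \<psi>(1) op in0 analytic_at by blast
  then obtain P where P: "\<psi> has_fps_expansion P" using analytic_at_imp_has_fps_expansion_0 by blast
  have P0: "P $ 0 = 0" using has_fps_expansion_imp_0_eq_fps_nth_0[OF P] \<psi>0 by simp
  have ev\<psi>\<chi>: "\<forall>\<^sub>F z in nhds 0. \<psi> (\<chi> z) = z"
    using eventually_nhds_in_open[OF open_ball, of 0 0 r] r(1) by (auto elim!: eventually_mono simp: \<psi>(2))
  have comp: "(\<psi> \<circ> \<chi>) has_fps_expansion fps_compose P Q" by (intro has_fps_expansion_compose P Q)
  have "\<forall>\<^sub>F z in nhds 0. (\<psi> \<circ> \<chi>) z = z" using ev\<psi>\<chi> by (simp add: o_def)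
  from iffD1[OF has_fps_expansion_cong[OF this refl] comp]
  have "(\<lambda>z. z) has_fps_expansion fps_compose P Q" .
  then have "fps_compose P Q = fps_X" by (rule fps_expansion_unique_complex) (rule has_fps_expansion_fps_X)
  then have P1: "P $ Suc 0 = 1"
  proof -
    have "(P oo Q) $ Suc 0 = 1" using \<open>P oo Q = fps_X\<close> by simp
    then show ?thesis by (simp add: fps_compose_nth atLeast0_atMost_Suc P0 Q(3))
  qed
  have lim: "(\<psi> \<longlongrightarrow> 0) (nhds 0)"
    using has_fps_expansion_imp_tendsto_nhds[OF P] \<psi>0 by simp
  have mlim: "((\<lambda>t :: complex. - t) \<longlongrightarrow> 0) (nhds 0)"
    using tendsto_minus[OF filterlim_ident[of "nhds (0 :: complex)"]] by simp
  have ev\<chi>\<psi>: "\<forall>\<^sub>F t in nhds 0. \<chi> (\<psi> t) = t"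
    using eventually_nhds_in_open[OF op in0] by eventually_elim (use \<psi>(2) in auto)
  have evx: "\<forall>\<^sub>F t in nhds 0. x (\<psi> t) = t\<^sup>2"
    using eventually_compose_filterlim[OF xu lim] ev\<chi>\<psi> by eventually_elim (metis \<chi>2)
  have evb: "\<forall>\<^sub>F t in nhds 0. \<psi> t \<in> ball 0 1"
    using eventually_compose_filterlim[OF eventually_nhds_in_open[OF open_ball, of 0 0 1] lim] by simp
  note m = eventually_compose_filterlim[OF _ mlim]
  have "\<forall>\<^sub>F t in nhds 0. deck x (\<psi> t) = \<psi> (- t)"
    using evx m[OF evx] evb m[OF evb] ev\<chi>\<psi> m[OF ev\<chi>\<psi>]
  proof eventually_elim
    case (elim t)
    show ?case
    proof (cases "t = 0")
      case False
      let ?A = "{w \<in> ball 0 1. x w = x (\<psi> t)}"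
      have ne: "\<psi> t \<noteq> 0" using elim(5) False \<chi>0 by auto
      have ne2: "\<psi> (- t) \<noteq> \<psi> t"
      proof
        assume "\<psi> (- t) = \<psi> t"
        then have "t + t = 0" using elim(5,6) by simp
        then show False using False by (simp add: mult_2[symmetric])
      qed
      have "card ?A = 2" using card elim(3) ne by auto
      moreover have "{\<psi> t, \<psi> (- t)} \<subseteq> ?A" using elim by auto
      moreover have "finite ?A" using \<open>card ?A = 2\<close> by (intro card_ge_0_finite) simp
      ultimately have A: "?A = {\<psi> t, \<psi> (- t)}"
        using ne2 by (intro card_subset_eq[symmetric]) auto
      have "(THE w. w \<in> ball 0 1 \<and> w \<noteq> \<psi> t \<and> x w = x (\<psi> t)) = \<psi> (- t)"
        using A ne2 by (intro the_equality) auto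
      then show ?thesis using ne by (simp add: deck_def)
    qed (simp add: \<psi>0 deck_def)
  qed
  with that[OF P P0 P1 Q ev\<psi>\<chi> evx] show ?thesis .
qed

lemma deck_in_ball:
  assumes card: "\<forall>z\<in>ball 0 1 - {0}. card {w \<in> ball 0 1. x w = x z} = 2" and z: "z \<in> ball 0 1"
  shows "deck x z \<in> ball 0 1"
proof (cases "z = 0")
  case False
  then have "card {w \<in> ball 0 1. x w = x z} = 2" using card z by auto
  then obtain a b where ab: "{w \<in> ball 0 1. x w = x z} = {a, b}" "a \<noteq> b"
    unfolding card_2_iff by blast
  define w where "w = (if z = a then b else a)"
  have mem: "v \<in> ball 0 1 \<and> x v = x z \<longleftrightarrow> v = a \<or> v = b" for v
    using ab(1) by (auto simp: set_eq_iff)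
  then have w: "w \<in> ball 0 1" "w \<noteq> z" "x w = x z" "\<And>v. v \<in> ball 0 1 \<Longrightarrow> x v = x z \<Longrightarrow> v = w \<or> v = z"
    using ab(2) mem[of w] mem[of z] z by (auto simp: w_def split: if_splits)
  then have "(THE w. w \<in> ball 0 1 \<and> w \<noteq> z \<and> x w = x z) = w"
    by (intro the_equality) auto
  then show ?thesis using False w(1) by (simp add: deck_def)
qed (simp add: deck_def)

text \<open>Composing the pulled-back Laurent series with \<chi> recovers that of \<open>f\<close>
  without changing the residue, and small circles around an isolated singularity compute the
  residue.\<close>

lemma contour_integral_pullback:
  assumes \<psi>: "\<psi> has_fps_expansion P" "P $ 0 = 0" and \<chi>: "\<chi> has_fps_expansion Q" "Q $ 0 = 0" "Q $ Suc 0 = 1"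
    and inv: "\<forall>\<^sub>F z in nhds 0. \<psi> (\<chi> z) = z"
    and G: "(\<lambda>t. f (\<psi> t) * deriv \<psi> t) has_laurent_expansion G"
  shows "\<forall>\<^sub>F \<rho> in at_right 0. (f has_contour_integral 2 * pi * \<i> * fls_residue G) (circlepath 0 \<rho>)"
proof -
  define F where "F = fls_compose_fps G Q * fps_to_fls (fps_deriv Q)"
  have Q0: "Q \<noteq> 0" using \<chi>(3) by auto
  have "((\<lambda>t. f (\<psi> t) * deriv \<psi> t) \<circ> \<chi>) has_laurent_expansion fls_compose_fps G Q"
    by (intro has_laurent_expansion_compose G has_laurent_expansion_fps \<chi> Q0)
  then have "(\<lambda>z. ((\<lambda>t. f (\<psi> t) * deriv \<psi> t) \<circ> \<chi>) z * deriv \<chi> z) has_laurent_expansion F"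
    unfolding F_def by (intro has_laurent_expansion_mult has_laurent_expansion_fps has_fps_expansion_deriv \<chi>)
  moreover have "\<forall>\<^sub>F z in at 0. ((\<lambda>t. f (\<psi> t) * deriv \<psi> t) \<circ> \<chi>) z * deriv \<chi> z = f z"
  proof -
    have \<chi>0: "\<chi> 0 = 0" using has_fps_expansion_imp_0_eq_fps_nth_0[OF \<chi>(1)] \<chi>(2) by simp
    obtain S where S: "open S" "0 \<in> S" "\<chi> holomorphic_on S"
      by (rule has_fps_expansion_imp_holomorphic[OF \<chi>(1)]) (rule that; assumption)
    obtain T where T: "open T" "0 \<in> T" "\<psi> holomorphic_on T"
      by (rule has_fps_expansion_imp_holomorphic[OF \<psi>(1)]) (rule that; assumption)
    have lim: "(\<chi> \<longlongrightarrow> 0) (nhds 0)"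
      using has_fps_expansion_imp_tendsto_nhds[OF \<chi>(1)] \<chi>0 by simp
    have "\<forall>\<^sub>F z in nhds 0. \<forall>\<^sub>F z in nhds z. \<psi> (\<chi> z) = z" using inv by (simp add: eventually_eventually)
    moreover have "\<forall>\<^sub>F z in nhds 0. z \<in> S" using S by (intro eventually_nhds_in_open)
    moreover have "\<forall>\<^sub>F z in nhds 0. \<chi> z \<in> T"
      using eventually_compose_filterlim[OF eventually_nhds_in_open[OF T(1,2)] lim] .
    ultimately have "\<forall>\<^sub>F z in nhds 0. ((\<lambda>t. f (\<psi> t) * deriv \<psi> t) \<circ> \<chi>) z * deriv \<chi> z = f z"
    proof eventually_elim
      case (elim z)
      have d\<chi>: "(\<chi> has_field_derivative deriv \<chi> z) (at z)" using holomorphic_derivI[OF S(3,1) elim(2)] .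
      have d\<psi>: "(\<psi> has_field_derivative deriv \<psi> (\<chi> z)) (at (\<chi> z))" using holomorphic_derivI[OF T(3,1) elim(3)] .
      have "(\<psi> \<circ> \<chi> has_field_derivative deriv \<psi> (\<chi> z) * deriv \<chi> z) (at z)" by (rule DERIV_chain[OF d\<psi> d\<chi>])
      moreover have "(\<psi> \<circ> \<chi> has_field_derivative 1) (at z)"
        using elim(1) by (subst DERIV_cong_ev[OF refl _ refl, of _ "\<lambda>z. z"]) auto
      ultimately have "deriv \<psi> (\<chi> z) * deriv \<chi> z = 1" by (rule DERIV_unique)
      then show ?case using eventually_nhds_x_imp_x[OF elim(1)] by (simp add: mult.assoc)
    qed
    then show ?thesis by (simp add: eventually_at_filter eventually_mono)
  qed
  ultimately have F: "f has_laurent_expansion F"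
    by (subst (asm) has_laurent_expansion_cong[OF _ refl])
  have res: "residue f 0 = fls_residue G"
    using has_laurent_expansion_residue_0[OF F] fls_residue_compose[of Q G] \<chi> by (simp add: F_def)
  obtain r where r: "r > 0" "f holomorphic_on ball 0 r - {0}"
    using has_laurent_expansion_isolated_0[OF F] unfolding isolated_singularity_at_def
    by (meson analytic_imp_holomorphic)
  have "\<forall>\<^sub>F \<rho> in at_right 0. 0 < \<rho> \<and> \<rho> < r"
    using r(1) by (auto simp: eventually_at_right_field)
  then show ?thesis
  proof eventually_elim
    case (elim \<rho>)
    then have "cball 0 \<rho> \<subseteq> ball (0 :: complex) r" by (simp add: cball_subset_ball_iff)
    then show ?case using base_residue[of "ball 0 r" 0 \<rho> f] r res elim by simp
  qed
qed

lemma has_laurent_expansion_reflect: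
  assumes "f has_laurent_expansion F"
  shows "(\<lambda>t. f (- t)) has_laurent_expansion reflect F"
proof -
  have "(\<lambda>t. (- 1) * t :: complex) has_fps_expansion fps_const (- 1) * fps_X"
    by (intro has_fps_expansion_cmult_left has_fps_expansion_fps_X)
  moreover have "fps_const (- 1) * fps_X \<noteq> (0 :: complex fps)" by simp
  ultimately have "(f \<circ> (\<lambda>t. (- 1) * t)) has_laurent_expansion reflect F"
    unfolding reflect_def by (intro has_laurent_expansion_compose assms has_laurent_expansion_fps) auto
  then show ?thesis by (simp add: o_def)
qed

text \<open>From here on the formal series is \<open>P\<close>, and \<open>\<psi>\<close> is a
  holomorphic function with this expansion; the inherited facts \<open>\<psi>0\<close> and
  \<open>\<psi>1\<close> speak of \<open>P\<close>.\<close>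

locale local_curve = recursion_data P q for P q +
  fixes \<psi> :: "complex \<Rightarrow> complex"
  assumes \<psi>: "\<psi> has_fps_expansion P"
begin

lemma \<psi>_laurent: "\<psi> has_laurent_expansion fps_to_fls P" "deriv \<psi> has_laurent_expansion fps_to_fls (fps_deriv P)"
  by (intro has_laurent_expansion_fps has_fps_expansion_deriv \<psi>)+

lemma pole_fun_laurent: "(\<lambda>t. pole_fun P j (\<psi> t) * deriv \<psi> t) has_laurent_expansion pole_form P j"
  unfolding pole_fun_def pole_form_def
  by (intro has_laurent_expansion_mult has_laurent_expansion_sum has_laurent_expansion_const has_laurent_expansion_power
      has_laurent_expansion_inverse \<psi>_laurent)

text \<open>The geometric series of 1/(w - X), composed with \<open>P\<close>.\<close>

lemma cauchy_fps:
  assumes w: "w \<noteq> 0"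
  shows "(\<lambda>t. inverse (w - \<psi> t)) has_fps_expansion Abs_fps (\<lambda>j. pole_fun P j w)"
proof -
  define G where "G = Abs_fps (\<lambda>q. inverse w ^ Suc q)"
  have "(fps_const w - fps_X) * G = 1"
  proof (rule fps_ext)
    fix n show "((fps_const w - fps_X) * G) $ n = 1 $ n"
      using w by (cases n) (simp_all add: algebra_simps G_def)
  qed
  then have "((fps_const w - fps_X) * G) oo P = 1" by simp
  then have "(fps_const w - P) * (G oo P) = 1"
    by (simp add: fps_compose_mult_distrib[OF \<psi>0] fps_compose_sub_distrib \<psi>0)
  then have "inverse (fps_const w - P) = G oo P"
    by (intro fps_inverse_unique)
  also have "G oo P = Abs_fps (\<lambda>j. pole_fun P j w)"
    by (rule fps_ext) (simp add: fps_compose_nth G_def pole_fun_def atLeast0AtMost mult.commute)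
  finally show ?thesis
    using has_fps_expansion_inverse[OF has_fps_expansion_diff[OF has_fps_expansion_const[of w] \<psi>]] w \<psi>0 by simp
qed

lemma source_laurent:
  assumes w: "w \<noteq> 0"
  shows "(\<lambda>t. 1 / (\<psi> t - w)\<^sup>2 * deriv \<psi> t) has_laurent_expansion source_form w"
proof -
  have "deriv (\<lambda>t. inverse (w - \<psi> t)) has_laurent_expansion source_form w"
    unfolding source_form_def by (intro has_laurent_expansion_fps has_fps_expansion_deriv cauchy_fps w)
  moreover have "\<forall>\<^sub>F t in at 0. deriv (\<lambda>t. inverse (w - \<psi> t)) t = 1 / (\<psi> t - w)\<^sup>2 * deriv \<psi> t"
  proof -
    obtain T where T: "open T" "0 \<in> T" "\<psi> holomorphic_on T"
      by (rule has_fps_expansion_imp_holomorphic[OF \<psi>]) (rule that; assumption)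
    have \<psi>z: "\<psi> 0 = 0" using has_fps_expansion_imp_0_eq_fps_nth_0[OF \<psi>] \<psi>0 by simp
    have "\<forall>\<^sub>F t in nhds 0. \<psi> t \<in> - {w}"
      using eventually_compose_filterlim[OF eventually_nhds_in_open[of "- {w}" 0] has_fps_expansion_imp_tendsto_nhds[OF \<psi>, unfolded \<psi>z]]
      w by auto
    moreover have "\<forall>\<^sub>F t in nhds 0. t \<in> T" using T by (intro eventually_nhds_in_open)
    ultimately have "\<forall>\<^sub>F t in nhds 0. deriv (\<lambda>t. inverse (w - \<psi> t)) t = 1 / (\<psi> t - w)\<^sup>2 * deriv \<psi> t"
    proof eventually_elim
      case (elim t)
      have "(\<psi> has_field_derivative deriv \<psi> t) (at t)" using holomorphic_derivI[OF T(3,1) elim(2)] .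
      then have "((\<lambda>t. inverse (w - \<psi> t)) has_field_derivative 1 / (\<psi> t - w)\<^sup>2 * deriv \<psi> t) (at t)"
        using elim(1) by (auto intro!: derivative_eq_intros simp: field_simps power2_eq_square)
      then show ?case by (rule DERIV_imp_deriv)
    qed
    then show ?thesis by (simp add: eventually_at_filter eventually_mono)
  qed
  ultimately show ?thesis by (subst (asm) has_laurent_expansion_cong[OF _ refl])
qed

lemma diag_laurent: "(\<lambda>t. 1 / (\<psi> t - \<psi> (- t))\<^sup>2 * (deriv \<psi> t * deriv \<psi> (- t))) has_laurent_expansion diag_form"
proof -
  have "(\<lambda>t. deriv \<psi> t * deriv \<psi> (- t) / (\<psi> t - \<psi> (- t))\<^sup>2) has_laurent_expansion diag_form"
    unfolding diag_form_def
    by (intro has_laurent_expansion_divide has_laurent_expansion_mult has_laurent_expansion_power has_laurent_expansion_diff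
       \<psi>_laurent has_laurent_expansion_reflect)
  then show ?thesis by (simp add: mult.commute)
qed

definition field :: "nat \<Rightarrow> nat \<Rightarrow> complex \<Rightarrow> complex list \<Rightarrow> complex" where
  "field K m z I = ev K (F m) (z # I) + (if m = 0 \<and> length I = 1 then 1 / (z - hd I)\<^sup>2 else 0)"

lemma field_laurent:
  assumes "0 \<notin> set I"
  shows "(\<lambda>t. field K m (\<psi> t) I * deriv \<psi> t) has_laurent_expansion field_form K m I"
proof -
  have 1: "(\<lambda>t. \<Sum>k<K. ev K (D k (F m)) I * (pole_fun P (Suc (2 * k)) (\<psi> t) * deriv \<psi> t))
     has_laurent_expansion (\<Sum>k<K. fls_const (ev K (D k (F m)) I) * E k)"
    by (intro has_laurent_expansion_sum has_laurent_expansion_mult has_laurent_expansion_const pole_fun_laurent)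
  have 2: "(\<lambda>t. (if m = 0 \<and> length I = 1 then 1 / (\<psi> t - hd I)\<^sup>2 * deriv \<psi> t else 0))
     has_laurent_expansion (if m = 0 \<and> length I = 1 then source_form (hd I) else 0)"
  proof (cases "m = 0 \<and> length I = 1")
    case True
    then have "hd I \<in> set I" by (cases I) auto
    then have "hd I \<noteq> 0" using assms by auto
    then show ?thesis using source_laurent True by simp
  qed auto
  have "ev K (F m) (\<psi> t # I) * deriv \<psi> t = (\<Sum>k<K. ev K (D k (F m)) I * (pole_fun P (Suc (2 * k)) (\<psi> t) * deriv \<psi> t))" for t
    by (simp add: \<eta>_def sum_distrib_left sum_distrib_right mult_ac)
  then have "(\<lambda>t. field K m (\<psi> t) I * deriv \<psi> t) = (\<lambda>t. (\<Sum>k<K. ev K (D k (F m)) I * (pole_fun P (Suc (2 * k)) (\<psi> t) * deriv \<psi> t))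
     + (if m = 0 \<and> length I = 1 then 1 / (\<psi> t - hd I)\<^sup>2 * deriv \<psi> t else 0))"
    unfolding field_def distrib_right by auto
  then show ?thesis unfolding field_form_def using has_laurent_expansion_add[OF 1 2] by simp
qed

lemma conv_laurent:
  assumes "\<And>I. set I \<subseteq> X \<Longrightarrow> (\<lambda>t. f t I) has_laurent_expansion f' I"
    and "\<And>I. set I \<subseteq> X \<Longrightarrow> (\<lambda>t. g t I) has_laurent_expansion g' I"
    and "set zs \<subseteq> X"
  shows "(\<lambda>t. conv (f t) (g t) zs) has_laurent_expansion conv f' g' zs"
  using assms
proof (induction zs arbitrary: f g f' g')
  case Nil then show ?case by (auto intro!: has_laurent_expansion_mult)
next
  case (Cons z zs)
  show ?case unfolding conv.simps using Cons.prems
    by (intro has_laurent_expansion_add Cons.IH) auto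
qed

text \<open>The bracket at a fixed order N: the products run over all orders m \<le> N instead of
  the genera, which is the shape of the graded product.\<close>

definition full_bracket :: "nat \<Rightarrow> nat \<Rightarrow> complex \<Rightarrow> complex \<Rightarrow> complex list \<Rightarrow> complex" where
  "full_bracket K N z s zs = ev K (F N) (z # s # zs) + (if N = 0 \<and> zs = [] then 1 / (z - s)\<^sup>2 else 0)
     + gconv (\<lambda>m. field K m z) (\<lambda>m. field K m s) N zs"

lemma full_bracket_laurent:
  assumes "0 \<notin> set zs"
  shows "(\<lambda>t. full_bracket K N (\<psi> t) (\<psi> (- t)) zs * (deriv \<psi> t * deriv \<psi> (- t))) has_laurent_expansion bracket_form K N zs"
proof -
  have 1: "(\<lambda>t. \<Sum>k<K. \<Sum>l<K. ev K (\<lambda>ks. F N (k # l # ks)) zs *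
      ((pole_fun P (Suc (2 * k)) (\<psi> t) * deriv \<psi> t) * (pole_fun P (Suc (2 * l)) (\<psi> (- t)) * deriv \<psi> (- t))))
    has_laurent_expansion (\<Sum>k<K. \<Sum>l<K. fls_const (ev K (\<lambda>ks. F N (k # l # ks)) zs) * (E k * reflect (E l)))"
    by (intro has_laurent_expansion_sum has_laurent_expansion_mult has_laurent_expansion_const pole_fun_laurent
       has_laurent_expansion_reflect[OF pole_fun_laurent])
  have 2: "(\<lambda>t. if N = 0 \<and> zs = [] then 1 / (\<psi> t - \<psi> (- t))\<^sup>2 * (deriv \<psi> t * deriv \<psi> (- t)) else 0)
    has_laurent_expansion (if N = 0 \<and> zs = [] then diag_form else 0)"
    using diag_laurent by auto
  have 3: "(\<lambda>t. \<Sum>m\<le>N. conv (\<lambda>I. field K m (\<psi> t) I * deriv \<psi> t) (\<lambda>I. field K (N - m) (\<psi> (- t)) I * deriv \<psi> (- t)) zs)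
    has_laurent_expansion gconv (field_form K) (\<lambda>m I. reflect (field_form K m I)) N zs"
    unfolding gconv_def using assms
    by (intro has_laurent_expansion_sum conv_laurent[of "- {0}"] field_laurent has_laurent_expansion_reflect[OF field_laurent]) auto
  have "conv (\<lambda>I. f I * x) (\<lambda>I. g I * y) zs = conv f g zs * (x * y)" for f g :: "complex list \<Rightarrow> complex" and x y
  proof -
    have "conv (\<lambda>I. x * f I) (\<lambda>I. y * g I) zs = x * (y * conv f g zs)"
      unfolding conv_cmult_left by (subst conv_comm) (simp add: conv_cmult_left conv_comm[of f])
    then show ?thesis by (simp add: mult_ac)
  qed
  then have c: "gconv (\<lambda>m. field K m z) (\<lambda>m. field K m s) N zs * (x * y)
     = (\<Sum>m\<le>N. conv (\<lambda>I. field K m z I * x) (\<lambda>I. field K (N - m) s I * y) zs)" for z s x y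
    by (simp add: gconv_def sum_distrib_right)
  have a: "ev K (F N) (z # s # zs) * (x * y) = (\<Sum>k<K. \<Sum>l<K. ev K (\<lambda>ks. F N (k # l # ks)) zs *
      ((pole_fun P (Suc (2 * k)) z * x) * (pole_fun P (Suc (2 * l)) s * y)))" for z s x y
    by (simp add: \<eta>_def sum_distrib_right sum_distrib_left mult_ac)
  have "(\<lambda>t. full_bracket K N (\<psi> t) (\<psi> (- t)) zs * (deriv \<psi> t * deriv \<psi> (- t))) =
    (\<lambda>t. (\<Sum>k<K. \<Sum>l<K. ev K (\<lambda>ks. F N (k # l # ks)) zs *
      ((pole_fun P (Suc (2 * k)) (\<psi> t) * deriv \<psi> t) * (pole_fun P (Suc (2 * l)) (\<psi> (- t)) * deriv \<psi> (- t))))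
     + (if N = 0 \<and> zs = [] then 1 / (\<psi> t - \<psi> (- t))\<^sup>2 * (deriv \<psi> t * deriv \<psi> (- t)) else 0)
     + (\<Sum>m\<le>N. conv (\<lambda>I. field K m (\<psi> t) I * deriv \<psi> t) (\<lambda>I. field K (N - m) (\<psi> (- t)) I * deriv \<psi> (- t)) zs))"
    unfolding full_bracket_def distrib_right a c by auto
  then show ?thesis
    unfolding bracket_form_def using has_laurent_expansion_add[OF has_laurent_expansion_add[OF 1 2] 3] by simp
qed

lemma residue_full_bracket:
  assumes Q: "Q has_laurent_expansion q" and K: "K \<ge> 3 * N + 8" and nz: "z1 \<noteq> 0" "0 \<notin> set zs"
  shows "\<exists>G. (\<lambda>t. cauchy_kernel w (\<psi> (- t)) (\<psi> t) z1 * (Q t *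
      (full_bracket K N (\<psi> t) (\<psi> (- t)) zs * (deriv \<psi> t * deriv \<psi> (- t))))) has_laurent_expansion G
     \<and> fls_residue G = ev K (F (Suc N)) (z1 # zs)"
proof -
  define A where "A = Abs_fps (\<lambda>j. pole_fun P j z1)"
  define n where "n = (A oo (fps_const (- 1) * fps_X)) - A + fps_const (w z1)"
  have A: "(\<lambda>t. inverse (z1 - \<psi> t)) has_fps_expansion A" unfolding A_def by (rule cauchy_fps[OF nz(1)])
  have "((\<lambda>t. inverse (z1 - \<psi> t)) \<circ> (\<lambda>t. (- 1) * t)) has_fps_expansion (A oo (fps_const (- 1) * fps_X))"
    by (intro has_fps_expansion_compose A has_fps_expansion_cmult_left has_fps_expansion_fps_X) simp
  then have "(\<lambda>t. inverse (z1 - \<psi> (- t)) - inverse (z1 - \<psi> t) + w z1) has_fps_expansion n"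
    unfolding n_def by (intro has_fps_expansion_add has_fps_expansion_diff A has_fps_expansion_const) (simp add: o_def)
  then have "(\<lambda>t. cauchy_kernel w (\<psi> (- t)) (\<psi> t) z1) has_laurent_expansion fps_to_fls n"
    by (intro has_laurent_expansion_fps) (simp add: cauchy_kernel_def divide_inverse)
  then have "(\<lambda>t. cauchy_kernel w (\<psi> (- t)) (\<psi> t) z1 * (Q t *
      (full_bracket K N (\<psi> t) (\<psi> (- t)) zs * (deriv \<psi> t * deriv \<psi> (- t))))) has_laurent_expansion
      fps_to_fls n * (q * bracket_form K N zs)"
    by (intro has_laurent_expansion_mult Q full_bracket_laurent nz(2))
  \<comment> \<open>Reflection changes the sign of the odd coefficients of \<open>A\<close>, and the
    holomorphic part of the kernel enters \<open>n\<close> only as a constant.\<close>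
  moreover have "n $ Suc (2 * k) = - 2 * \<eta> k z1" for k
    by (simp add: n_def fps_compose_linear A_def \<eta>_def)
  ultimately show ?thesis using residue_bracket_form[OF K, of n z1 zs] by blast
qed

end

section \<open>Correlators of a local curve\<close>

text \<open>Subsets of positions are sorted by whether they contain the first position, which
  matches the two terms of the Leibniz rule.\<close>

lemma conv_nths:
  "conv f g zs = (\<Sum>I\<in>Pow {..<length zs}. f (nths zs I) * g (nths zs ({..<length zs} - I)))"
proof (induction zs arbitrary: f g)
  case (Cons z zs)
  let ?n = "length zs"
  have inj: "inj_on (\<lambda>I. insert 0 (Suc ` I)) (Pow {..<?n})" "inj_on (\<lambda>I. Suc ` I) (Pow {..<?n})"
    by (auto simp: inj_on_def inj_image_eq_iff insert_ident)
  have Pow: "Pow {..<Suc ?n} = (\<lambda>I. insert 0 (Suc ` I)) ` Pow {..<?n} \<union> (\<lambda>I. Suc ` I) ` Pow {..<?n}" (is "?L = ?R")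
  proof
    show "?L \<subseteq> ?R"
    proof
      fix I assume "I \<in> ?L"
      then have I: "I \<subseteq> {..<Suc ?n}" by simp
      define J where "J = {j. Suc j \<in> I}"
      have J: "J \<in> Pow {..<?n}" using I by (auto simp: J_def)
      have "I = (if 0 \<in> I then insert 0 (Suc ` J) else Suc ` J)"
        unfolding J_def by (auto simp: image_iff) (metis not0_implies_Suc)+
      then show "I \<in> ?R" using J by (metis UnI1 UnI2 imageI)
    qed
  qed auto
  have 1: "nths (z # zs) (insert 0 (Suc ` I)) = z # nths zs I" "nths (z # zs) (Suc ` I) = nths zs I" for I
    by (simp_all add: nths_Cons inj_image_mem_iff)
  have 2: "{..<Suc ?n} - insert 0 (Suc ` I) = Suc ` ({..<?n} - I)" "{..<Suc ?n} - Suc ` I = insert 0 (Suc ` ({..<?n} - I))" if "I \<subseteq> {..<?n}" for I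
    by (auto simp: lessThan_Suc_eq_insert_0)
  have "(\<Sum>I\<in>Pow {..<Suc ?n}. f (nths (z # zs) I) * g (nths (z # zs) ({..<Suc ?n} - I)))
     = (\<Sum>I\<in>Pow {..<?n}. f (z # nths zs I) * g (nths zs ({..<?n} - I)))
     + (\<Sum>I\<in>Pow {..<?n}. f (nths zs I) * g (z # nths zs ({..<?n} - I)))"
    unfolding Pow
    by (subst sum.union_disjoint) (auto simp: sum.reindex inj 1 2 intro!: arg_cong2[of _ _ _ _ "(+)"] sum.cong)
  then show ?case by (simp add: Cons.IH)
qed simp

lemma eval_modes_zero_length:
  "(\<And>ks. length ks = length zs \<Longrightarrow> f ks = 0) \<Longrightarrow> eval_modes \<eta> K f zs = 0"
  by (induction zs arbitrary: f) (auto intro!: sum.neutral)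

context local_curve
begin

definition correlator :: "nat \<Rightarrow> complex list \<Rightarrow> complex" where
  "correlator g zs = (if g = 0 \<and> length zs = 2 then 1 / (zs ! 0 - zs ! 1)\<^sup>2
     else if stable g (length zs) then ev (3 * (2 * g + length zs - 2)) (F (2 * g + length zs - 2)) zs else 0)"

lemma ev_indep: "3 * N \<le> K \<Longrightarrow> ev (3 * N) (F N) zs = ev K (F N) zs"
  by (rule eval_modes_indep[OF bounded_by_F]) auto

lemma stable_iff: "stable g n \<longleftrightarrow> n \<ge> 1 \<and> 2 * g + n \<ge> 3"
  unfolding stable_def by auto

lemma correlator_field:
  assumes "2 * g + length I \<ge> 1" "K \<ge> 3 * (2 * g + length I - 1)"
  shows "correlator g (z # I) = field K (2 * g + length I - 1) z I"
proof (cases "g = 0 \<and> length I = 1")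
  case True
  then obtain w where "I = [w]" by (cases I) auto
  then show ?thesis using True by (simp add: correlator_def field_def eval_modes_zero)
next
  case False
  then have st: "stable g (length (z # I))" and ne: "\<not> (g = 0 \<and> length (z # I) = 2)"
    using assms(1) by (cases g; auto simp: stable_iff)+
  have e: "2 * g + length (z # I) - 2 = 2 * g + length I - 1" by simp
  have "correlator g (z # I) = ev (3 * (2 * g + length I - 1)) (F (2 * g + length I - 1)) (z # I)"
    unfolding correlator_def e if_not_P[OF ne] using st by (simp del: eval_modes.simps)
  also have "\<dots> = ev K (F (2 * g + length I - 1)) (z # I)" by (rule ev_indep[OF assms(2)])
  finally show ?thesis using False assms(1) unfolding field_def
    by (cases "2 * g + length I - 1 = 0") (auto simp del: eval_modes.simps)
qed

lemma field_nonzeroD: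
  assumes "field K m z I \<noteq> 0"
  shows "\<exists>g. m + 1 = 2 * g + length I"
proof (cases "m = 0 \<and> length I = 1")
  case True then show ?thesis by auto
next
  case False
  then have "ev K (F m) (z # I) \<noteq> 0" using assms by (auto simp: field_def)
  then obtain ks where "length ks = length (z # I)" "F m ks \<noteq> 0"
    using eval_modes_zero_length[of "z # I" "F m" \<eta> K] by blast
  then show ?thesis using F_nonzeroD[of m ks] by (cases ks) auto
qed

text \<open>For a fixed subset I the genus g1 belongs to the order m = 2 g1 + |I| - 1, and
  \<open>field_nonzeroD\<close> removes the orders of the other parity. The excluded terms of type
  (0,1) would be m = -1 and m = N + 1, outside the range of the sum.\<close>

lemma bracket_eq_full_bracket:
  assumes st: "2 * g + length zs \<ge> 2" and N: "N = 2 * g + length zs - 2" and K: "K \<ge> 3 * N"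
  shows "bracket correlator g z s zs = full_bracket K N z s zs"
proof -
  let ?n = "length zs"
  have 1: "(if g = 0 then 0 else correlator (g - 1) (z # s # zs)) = ev K (F N) (z # s # zs) + (if N = 0 \<and> zs = [] then 1 / (z - s)\<^sup>2 else 0)"
  proof (cases g)
    case 0
    \<comment> \<open>Two more arguments at the same order would require genus -1.\<close>
    have "F N ks = 0" if "length ks = length (z # s # zs)" for ks
      using F_nonzeroD[of N ks] that 0 N st by (cases "F N ks = 0"; cases ks) auto
    then have "ev K (F N) (z # s # zs) = 0" by (rule eval_modes_zero_length)
    then show ?thesis using 0 st by auto
  next
    case (Suc g')
    have "correlator g' (z # s # zs) = field K (2 * g' + length (s # zs) - 1) z (s # zs)"
      by (rule correlator_field) (use N K Suc in auto)
    moreover have "2 * g' + length (s # zs) - 1 = N" using N Suc by simp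
    ultimately show ?thesis using Suc by (auto simp: field_def simp del: eval_modes.simps)
  qed
  have 2: "(\<Sum>g1 | g1 \<le> g \<and> \<not> (g1 = 0 \<and> I = {}) \<and> \<not> (g - g1 = 0 \<and> {..<?n} - I = {}).
       correlator g1 (z # nths zs I) * correlator (g - g1) (s # nths zs ({..<?n} - I)))
     = (\<Sum>m\<le>N. field K m z (nths zs I) * field K (N - m) s (nths zs ({..<?n} - I)))"
    if I: "I \<subseteq> {..<?n}" for I
  proof -
    define i j where "i = length (nths zs I)" and "j = length (nths zs ({..<?n} - I))"
    have ci: "i = card I" and cj: "j = card ({..<?n} - I)"
      unfolding i_def j_def length_nths using I by (auto intro!: arg_cong[of _ _ card])
    have fin: "finite I" using I finite_subset by blast
    have ij: "i + j = ?n" using I fin unfolding ci cj using card_mono[OF finite_lessThan I] by (simp add: card_Diff_subset)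
    have i0: "I = {} \<longleftrightarrow> i = 0" and j0: "{..<?n} - I = {} \<longleftrightarrow> j = 0" using fin unfolding ci cj by auto
    let ?S = "{g1. g1 \<le> g \<and> \<not> (g1 = 0 \<and> I = {}) \<and> \<not> (g - g1 = 0 \<and> {..<?n} - I = {})}"
    let ?f = "\<lambda>g1. correlator g1 (z # nths zs I) * correlator (g - g1) (s # nths zs ({..<?n} - I))"
    let ?h = "\<lambda>m. field K m z (nths zs I) * field K (N - m) s (nths zs ({..<?n} - I))"
    have fS: "finite ?S" by (rule finite_subset[of _ "{..g}"]) auto
    have eq: "?h (2 * g1 + i - 1) = ?f g1" and le: "2 * g1 + i - 1 \<le> N" "2 * g1 + i \<ge> 1" if "g1 \<in> ?S" for g1
    proof -
      have *: "g1 \<le> g" "2 * g1 + i \<ge> 1" "2 * (g - g1) + j \<ge> 1" using that i0 j0 by auto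
      show "2 * g1 + i - 1 \<le> N" "2 * g1 + i \<ge> 1" using * ij N st by auto
      have "N - (2 * g1 + i - 1) = 2 * (g - g1) + j - 1" using * ij N st by auto
      then show "?h (2 * g1 + i - 1) = ?f g1"
        using correlator_field[of g1 "nths zs I" K z] correlator_field[of "g - g1" "nths zs ({..<?n} - I)" K s] * ij N K
        unfolding i_def[symmetric] j_def[symmetric] by simp
    qed
    show ?thesis
    proof (rule sum.reindex_bij_witness_not_neutral[of "{g1\<in>?S. ?f g1 = 0}" "{m\<in>{..N}. ?h m = 0}" _ "\<lambda>m. (m + 1 - i) div 2" "\<lambda>g1. 2 * g1 + i - 1"])
      show "finite {g1\<in>?S. ?f g1 = 0}" using fS by simp
    next
      fix g1 assume g1: "g1 \<in> ?S - {g1\<in>?S. ?f g1 = 0}"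
      then show "(2 * g1 + i - 1 + 1 - i) div 2 = g1" using le[of g1] by auto
      show "2 * g1 + i - 1 \<in> {..N} - {m\<in>{..N}. ?h m = 0}" using g1 le[of g1] eq[of g1] by auto
    next
      fix m assume "m \<in> {..N} - {m\<in>{..N}. ?h m = 0}"
      then have m: "m \<le> N" "field K m z (nths zs I) \<noteq> 0" "field K (N - m) s (nths zs ({..<?n} - I)) \<noteq> 0" by auto
      from field_nonzeroD[OF m(2)] obtain g1 where g1: "m + 1 = 2 * g1 + i" unfolding i_def by blast
      from field_nonzeroD[OF m(3)] obtain g2 where g2: "N - m + 1 = 2 * g2 + j" unfolding j_def by blast
      have w: "(m + 1 - i) div 2 = g1" using g1 by simp
      have gg: "g = g1 + g2" using g1 g2 m(1) N st ij by auto
      show "2 * ((m + 1 - i) div 2) + i - 1 = m" unfolding w using g1 by simp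
      then have hm: "?h (2 * g1 + i - 1) = ?h m" unfolding w by simp
      have S: "g1 \<in> ?S" using gg g1 g2 i0 j0 by auto
      have "?f g1 \<noteq> 0" using eq[OF S] hm m by simp
      then show "(m + 1 - i) div 2 \<in> ?S - {g1\<in>?S. ?f g1 = 0}" unfolding w using S by simp
    qed (use eq in auto)
  qed
  have "splittings g ?n = (\<Union>I\<in>Pow {..<?n}. (\<lambda>g1. (g1, I)) ` {g1. g1 \<le> g \<and> \<not> (g1 = 0 \<and> I = {}) \<and> \<not> (g - g1 = 0 \<and> {..<?n} - I = {})})"
    by (auto simp: splittings_def)
  then have "(\<Sum>(g1, I)\<in>splittings g ?n. correlator g1 (z # nths zs I) * correlator (g - g1) (s # nths zs ({..<?n} - I)))
    = (\<Sum>I\<in>Pow {..<?n}. \<Sum>g1 | g1 \<le> g \<and> \<not> (g1 = 0 \<and> I = {}) \<and> \<not> (g - g1 = 0 \<and> {..<?n} - I = {}).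
        correlator g1 (z # nths zs I) * correlator (g - g1) (s # nths zs ({..<?n} - I)))"
    by (simp only:) (subst sum.UNION_disjoint; auto simp: sum.reindex inj_on_def)
  also have "\<dots> = (\<Sum>I\<in>Pow {..<?n}. \<Sum>m\<le>N. field K m z (nths zs I) * field K (N - m) s (nths zs ({..<?n} - I)))"
    by (intro sum.cong refl 2) auto
  also have "\<dots> = gconv (\<lambda>m. field K m z) (\<lambda>m. field K m s) N zs"
    unfolding gconv_def conv_nths by (rule sum.swap)
  finally show ?thesis unfolding bracket_def full_bracket_def 1 by simp
qed

lemma correlator_02: "correlator 0 [z1, z2] = 1 / (z1 - z2)\<^sup>2"
  by (simp add: correlator_def)

lemma correlator_stable:
  assumes "stable g (length zs)"
  shows "correlator g zs = ev (3 * (2 * g + length zs - 2)) (F (2 * g + length zs - 2)) zs"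
  using assms by (auto simp: correlator_def stable_iff)

lemma correlator_symmetric: "mset zs = mset zs' \<Longrightarrow> correlator g zs = correlator g zs'"
proof -
  assume m: "mset zs = mset zs'"
  have len: "length zs = length zs'" using mset_eq_length[OF m] .
  show ?thesis
  proof (cases "g = 0 \<and> length zs = 2")
    case True
    then obtain a b a' b' where z: "zs = [a, b]" "zs' = [a', b']"
      using len by (auto simp: length_Suc_conv numeral_2_eq_2)
    then have "(a' = a \<and> b' = b) \<or> (a' = b \<and> b' = a)" using m by (auto simp: add_eq_conv_ex)
    then show ?thesis using z True by (auto simp: correlator_def power2_commute)
  next
    case False
    have "symmetric_fun (ev K (F N))" for K N by (intro sym_eval_modes sym_F)
    then have "ev K (F N) zs = ev K (F N) zs'" for K N using symmetric_funD[OF _ m] by blast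
    then show ?thesis unfolding correlator_def len if_not_P[OF False[unfolded len]] by simp
  qed
qed

end

text \<open>The function t (y(\<psi>(t)) - y(\<psi>(-t))) is even and vanishes to second order, so
  its inverse satisfies the conditions on \<open>q\<close>.\<close>

lemma curve_exists:
  assumes x: "\<forall>z\<in>ball 0 1. (\<lambda>k. a (k + 3) * z ^ (k + 3)) sums (x z - z ^ 2)"
    and y: "\<forall>z\<in>ball 0 1. (\<lambda>k. d (k + 2) * z ^ (k + 2)) sums (y z - z)"
    and card: "\<forall>z\<in>ball 0 1 - {0}. card {w \<in> ball 0 1. x w = x z} = 2"
  obtains P q \<psi> \<chi> Q where "local_curve P q \<psi>" "\<chi> has_fps_expansion Q" "Q $ 0 = 0" "Q $ Suc 0 = 1"
    "\<forall>\<^sub>F z in nhds 0. \<psi> (\<chi> z) = z" "\<forall>\<^sub>F t in nhds 0. x (\<psi> t) = t\<^sup>2" "\<forall>\<^sub>F t in nhds 0. deck x (\<psi> t) = \<psi> (- t)"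
    "(\<lambda>t. inverse (2 * t * (y (\<psi> t) - y (\<psi> (- t))))) has_laurent_expansion q"
    "\<exists>X. x has_fps_expansion X"
proof -
  have bn: "\<forall>\<^sub>F z in nhds 0. z \<in> ball (0 :: complex) 1" by (rule eventually_nhds_in_open) auto
  define X where "X = Abs_fps (\<lambda>n. if n < 2 then 0 else if n = 2 then 1 else a n)"
  define Y where "Y = Abs_fps (\<lambda>n. if n = 0 then 0 else if n = 1 then 1 else d n)"
  have X: "x has_fps_expansion X"
  proof (rule has_fps_expansionI, use bn in eventually_elim)
    case (elim z)
    then have "(\<lambda>k. X $ (k + 3) * z ^ (k + 3)) sums (x z - (\<Sum>i<3. X $ i * z ^ i))"
      using x by (simp add: X_def eval_nat_numeral)
    then show ?case by (subst (asm) sums_iff_shift')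
  qed
  have Y: "y has_fps_expansion Y"
  proof (rule has_fps_expansionI, use bn in eventually_elim)
    case (elim z)
    then have "(\<lambda>k. Y $ (k + 2) * z ^ (k + 2)) sums (y z - (\<Sum>i<2. Y $ i * z ^ i))"
      using y by (simp add: Y_def eval_nat_numeral)
    then show ?case by (subst (asm) sums_iff_shift')
  qed
  have X': "X $ 0 = 0" "X $ Suc 0 = 0" "X $ 2 = 1" by (simp_all add: X_def)
  obtain \<psi> \<chi> P Q where u: "\<psi> has_fps_expansion P" "P $ 0 = 0" "P $ Suc 0 = 1"
    "\<chi> has_fps_expansion Q" "Q $ 0 = 0" "Q $ Suc 0 = 1"
    "\<forall>\<^sub>F z in nhds 0. \<psi> (\<chi> z) = z" "\<forall>\<^sub>F t in nhds 0. x (\<psi> t) = t\<^sup>2" "\<forall>\<^sub>F t in nhds 0. deck x (\<psi> t) = \<psi> (- t)"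
    by (rule local_uniformizer[OF X X' card])
  define Yf where "Yf = fps_to_fls (Y oo P)"
  have "(y \<circ> \<psi>) has_fps_expansion (Y oo P)" by (intro has_fps_expansion_compose Y u)
  then have Yf: "(\<lambda>t. y (\<psi> t)) has_laurent_expansion Yf"
    unfolding Yf_def by (intro has_laurent_expansion_fps) (simp add: o_def)
  define R where "R = fls_const 2 * (fls_X * (Yf - reflect Yf))"
  have "(\<lambda>t. 2 * (t * (y (\<psi> t) - y (\<psi> (- t))))) has_laurent_expansion R"
    unfolding R_def by (intro has_laurent_expansion_mult has_laurent_expansion_diff Yf has_laurent_expansion_reflect[OF Yf]
      has_laurent_expansion_const has_laurent_expansion_fps_X)
  then have q: "(\<lambda>t. inverse (2 * t * (y (\<psi> t) - y (\<psi> (- t))))) has_laurent_expansion inverse R"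
    by (intro has_laurent_expansion_inverse) (simp add: mult.assoc)
  have "(Y oo P) $ Suc 0 = 1" "(Y oo P) $ 0 = 0" by (simp_all add: fps_compose_nth Y_def u(3) atLeast0_atMost_Suc)
  \<comment> \<open>The leading coefficient 4 makes \<open>q\<close> start with 1/(4 \<zeta>^2),
    that is, \<open>c 0 = 1\<close>.\<close>
  then have R2: "R $$ 2 = 4" and R0: "\<And>n. n < 2 \<Longrightarrow> R $$ n = 0"
    by (auto simp: R_def fls_X_times_conv_shift(1) reflect_nth Yf_def)
  have "fls_subdegree R = 2" by (rule fls_subdegree_eqI) (use R2 R0 in auto)
  then have "low (- 2) (inverse R)" using low_subdegree[of "inverse R"] by simp
  moreover have "inverse R $$ n = 0" if "odd n" for n
  proof -
    have "reflect fls_X = - fls_X" by (rule fls_eqI) (auto simp: reflect_nth)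
    then have "reflect R = R"
      unfolding R_def reflect_const_mult unfolding reflect_mult reflect_diff reflect_reflect by (simp add: algebra_simps)
    then have "reflect (inverse R) = inverse R" by (simp add: reflect_inverse)
    from arg_cong[OF this, of "\<lambda>F. F $$ n"] show ?thesis using that by (simp add: reflect_nth)
  qed
  ultimately have "local_curve P (inverse R) \<psi>"
    using u by unfold_locales auto
  from that[OF this u(4-9) q] X show ?thesis by blast
qed

text \<open>Pulled back along \<psi>, where x is t^2 and the involution is t -> -t, the integrand is
  a product of series with known residue. The residue does not depend on the coordinate.\<close>

lemma topological_recursion_disc:
  assumes lc: "local_curve P q \<psi>" and \<chi>: "\<chi> has_fps_expansion Q" "Q $ 0 = 0" "Q $ Suc 0 = 1"
    and inv: "\<forall>\<^sub>F z in nhds 0. \<psi> (\<chi> z) = z" and x\<psi>: "\<forall>\<^sub>F t in nhds 0. x \<alpha> (\<psi> t) = t\<^sup>2"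
    and deck: "\<forall>\<^sub>F t in nhds 0. deck (x \<alpha>) (\<psi> t) = \<psi> (- t)"
    and q: "(\<lambda>t. inverse (2 * t * (y \<alpha> (\<psi> t) - y \<alpha> (\<psi> (- t))))) has_laurent_expansion q"
    and X: "x \<alpha> has_fps_expansion X"
    and st: "stable g (Suc (length zs))" and nz: "z1 \<noteq> 0" "0 \<notin> set zs"
  shows "\<forall>\<^sub>F \<rho> in at_right 0.
     ((\<lambda>z. recursion_kernel x y h \<alpha> \<alpha> z z1 * (bracket (local_curve.correlator P q) g z (deck (x \<alpha>) z) zs * deriv (deck (x \<alpha>)) z))
       has_contour_integral 2 * pi * \<i> * local_curve.correlator P q g (z1 # zs)) (circlepath 0 \<rho>)"
proof -
  interpret local_curve P q \<psi> by (rule lc)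
  define N where "N = 2 * g + length zs - 2"
  define K where "K = 3 * N + 8"
  have st': "2 * g + length zs \<ge> 2" using st by (simp add: stable_iff)
  let ?B = "\<lambda>t. full_bracket K N (\<psi> t) (\<psi> (- t)) zs"
  let ?Q = "\<lambda>t. inverse (2 * t * (y \<alpha> (\<psi> t) - y \<alpha> (\<psi> (- t))))"
  let ?f = "\<lambda>z. recursion_kernel x y h \<alpha> \<alpha> z z1 * (bracket correlator g z (deck (x \<alpha>) z) zs * deriv (deck (x \<alpha>)) z)"
  obtain G where G: "(\<lambda>t. cauchy_kernel (h \<alpha>) (\<psi> (- t)) (\<psi> t) z1 * (?Q t * (?B t * (deriv \<psi> t * deriv \<psi> (- t))))) has_laurent_expansion G"
    "fls_residue G = ev K (F (Suc N)) (z1 # zs)"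
    using residue_full_bracket[OF q _ nz, of N K "h \<alpha>"] by (auto simp: K_def)
  have res: "fls_residue G = correlator g (z1 # zs)"
  proof -
    have "2 * g + length (z1 # zs) - 2 = Suc N" using st' by (simp add: N_def)
    then have "correlator g (z1 # zs) = ev (3 * Suc N) (F (Suc N)) (z1 # zs)"
      using correlator_stable[of g "z1 # zs"] st by simp
    also have "\<dots> = ev K (F (Suc N)) (z1 # zs)" by (rule ev_indep) (simp add: K_def)
    finally show ?thesis using G(2) by simp
  qed
  obtain T where T: "open T" "0 \<in> T" "\<psi> holomorphic_on T"
    by (rule has_fps_expansion_imp_holomorphic[OF \<psi>]) (rule that; assumption)
  obtain S where S: "open S" "0 \<in> S" "\<chi> holomorphic_on S"
    by (rule has_fps_expansion_imp_holomorphic[OF \<chi>(1)]) (rule that; assumption)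
  obtain V where V: "open V" "0 \<in> V" "x \<alpha> holomorphic_on V"
    by (rule has_fps_expansion_imp_holomorphic[OF X]) (rule that; assumption)
  have \<psi>z: "\<psi> 0 = 0" and \<chi>z: "\<chi> 0 = 0" and d\<psi>z: "deriv \<psi> 0 = 1"
    using has_fps_expansion_imp_0_eq_fps_nth_0[OF \<psi>] \<psi>0 has_fps_expansion_imp_0_eq_fps_nth_0[OF \<chi>(1)] \<chi>(2)
      has_fps_expansion_imp_0_eq_fps_nth_0[OF has_fps_expansion_deriv[OF \<psi>]] \<psi>1 by auto
  have lim\<psi>: "(\<psi> \<longlongrightarrow> 0) (nhds 0)" using has_fps_expansion_imp_tendsto_nhds[OF \<psi>] \<psi>z by simp
  have lim\<chi>: "(\<chi> \<longlongrightarrow> 0) (nhds 0)" using has_fps_expansion_imp_tendsto_nhds[OF \<chi>(1)] \<chi>z by simp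
  have limd: "(deriv \<psi> \<longlongrightarrow> 1) (nhds 0)"
    using has_fps_expansion_imp_tendsto_nhds[OF has_fps_expansion_deriv[OF \<psi>]] d\<psi>z by simp
  have limm: "((\<lambda>z. - \<chi> z) \<longlongrightarrow> 0) (nhds 0)" using tendsto_minus[OF lim\<chi>] by simp
  have deck_eq: "\<forall>\<^sub>F z in nhds 0. deck (x \<alpha>) z = \<psi> (- \<chi> z)"
    using eventually_compose_filterlim[OF deck lim\<chi>] inv by eventually_elim simp
  \<comment> \<open>The identities are needed on whole neighbourhoods of the points, since they are
    differentiated below.\<close>
  have 1: "\<forall>\<^sub>F t in nhds 0. \<forall>\<^sub>F z in nhds (\<psi> t). deck (x \<alpha>) z = \<psi> (- \<chi> z)"
    using eventually_compose_filterlim[OF _ lim\<psi>] deck_eq eventually_eventually by blast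
  have 2: "\<forall>\<^sub>F t in nhds 0. \<psi> t \<in> S \<and> \<psi> t \<in> V \<and> - \<chi> (\<psi> t) \<in> T"
    by (intro eventually_conj eventually_compose_filterlim[OF _ lim\<psi>] eventually_compose_filterlim[OF _ limm]
        eventually_nhds_in_open S V T)
  have 3: "\<forall>\<^sub>F t in nhds 0. t \<in> T \<and> deriv \<psi> t \<in> - {0}"
    using eventually_compose_filterlim[OF eventually_nhds_in_open[of "- {0}" 1] limd] eventually_nhds_in_open[OF T(1,2)]
    by (auto intro: eventually_conj simp: open_Compl)
  have 4: "\<forall>\<^sub>F t in nhds 0. - t \<in> T"
    using eventually_compose_filterlim[OF eventually_nhds_in_open[OF T(1,2)], of uminus "nhds 0"]
      tendsto_minus[OF filterlim_ident[of "nhds (0 :: complex)"]] by simp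
  have 5: "\<forall>\<^sub>F t in nhds 0. \<forall>\<^sub>F s in nhds t. x \<alpha> (\<psi> s) = s\<^sup>2 \<and> deck (x \<alpha>) (\<psi> s) = \<psi> (- s)"
    using x\<psi> deck by (auto simp: eventually_eventually intro: eventually_conj)
  have "\<forall>\<^sub>F t in nhds 0. t \<noteq> 0 \<longrightarrow> cauchy_kernel (h \<alpha>) (\<psi> (- t)) (\<psi> t) z1 * (?Q t * (?B t * (deriv \<psi> t * deriv \<psi> (- t)))) = ?f (\<psi> t) * deriv \<psi> t"
    using 1 2 3 4 5
  proof eventually_elim
    case (elim t)
    have d\<psi>: "(\<psi> has_field_derivative deriv \<psi> t) (at t)" using holomorphic_derivI[OF T(3,1)] elim(3) by blast
    have d\<psi>m: "(\<psi> has_field_derivative deriv \<psi> (- t)) (at (- t))" using holomorphic_derivI[OF T(3,1) elim(4)] .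
    have dx: "(x \<alpha> has_field_derivative deriv (x \<alpha>) (\<psi> t)) (at (\<psi> t))" using holomorphic_derivI[OF V(3,1)] elim(2) by blast
    have ev1: "\<forall>\<^sub>F s in nhds t. x \<alpha> (\<psi> s) = s\<^sup>2" and ev2: "\<forall>\<^sub>F s in nhds t. deck (x \<alpha>) (\<psi> s) = \<psi> (- s)"
      using elim(5) by (auto elim: eventually_mono)
    have "((\<lambda>s. x \<alpha> (\<psi> s)) has_field_derivative deriv (x \<alpha>) (\<psi> t) * deriv \<psi> t) (at t)"
      by (rule DERIV_chain2[OF dx d\<psi>])
    moreover have "((\<lambda>s. x \<alpha> (\<psi> s)) has_field_derivative 2 * t) (at t)"
      using ev1 by (subst DERIV_cong_ev[OF refl _ refl, of _ "\<lambda>s. s\<^sup>2"]) (auto intro!: derivative_eq_intros)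
    ultimately have x': "deriv (x \<alpha>) (\<psi> t) * deriv \<psi> t = 2 * t" by (rule DERIV_unique)
    have "((\<lambda>z. \<psi> (- \<chi> z)) has_field_derivative deriv \<psi> (- \<chi> (\<psi> t)) * (- deriv \<chi> (\<psi> t))) (at (\<psi> t))"
      by (rule DERIV_chain2[of \<psi>], use holomorphic_derivI[OF T(3,1)] elim(2) in blast,
          intro DERIV_minus holomorphic_derivI[OF S(3,1)], use elim(2) in blast)
    then have "(deck (x \<alpha>) has_field_derivative deriv \<psi> (- \<chi> (\<psi> t)) * (- deriv \<chi> (\<psi> t))) (at (\<psi> t))"
      by (subst DERIV_cong_ev[OF refl elim(1) refl])
    then have dd: "(deck (x \<alpha>) has_field_derivative deriv (deck (x \<alpha>)) (\<psi> t)) (at (\<psi> t))"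
      by (simp add: DERIV_imp_deriv)
    have "((\<lambda>s. deck (x \<alpha>) (\<psi> s)) has_field_derivative deriv (deck (x \<alpha>)) (\<psi> t) * deriv \<psi> t) (at t)"
      by (rule DERIV_chain2[OF dd d\<psi>])
    moreover have "((\<lambda>s. deck (x \<alpha>) (\<psi> s)) has_field_derivative deriv \<psi> (- t) * (- 1)) (at t)"
      using DERIV_chain2[of \<psi> "deriv \<psi> (- t)" uminus t "- 1" UNIV] d\<psi>m DERIV_minus[OF DERIV_ident[of "at t"]]
      by (subst DERIV_cong_ev[OF refl ev2 refl]) (auto intro!: derivative_eq_intros)
    ultimately have deck': "deriv (deck (x \<alpha>)) (\<psi> t) * deriv \<psi> t = - deriv \<psi> (- t)"
      using DERIV_unique by fastforce
    have dk: "deck (x \<alpha>) (\<psi> t) = \<psi> (- t)" using eventually_nhds_x_imp_x[OF ev2] .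
    have B: "bracket correlator g (\<psi> t) (\<psi> (- t)) zs = ?B t"
      by (rule bracket_eq_full_bracket[OF st' N_def]) (simp add: K_def)
    show ?case
    proof
      assume t: "t \<noteq> 0"
      let ?d = "deriv \<psi> t" and ?Y = "y \<alpha> (\<psi> t) - y \<alpha> (\<psi> (- t))" and ?k = "cauchy_kernel (h \<alpha>) (\<psi> (- t)) (\<psi> t) z1"
      have d: "?d \<noteq> 0" using elim(3) by simp
      have e1: "deriv (x \<alpha>) (\<psi> t) = 2 * t / ?d" using x' d by (simp add: field_simps)
      have e2: "deriv (deck (x \<alpha>)) (\<psi> t) = - deriv \<psi> (- t) / ?d" using deck' d by (simp add: field_simps)
      \<comment> \<open>Two signs cancel: y(\<sigma> z) - y(z) is the negative of \<open>?Y\<close>,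
        and the derivative of the involution contains that of t -> -t.\<close>
      have "?f (\<psi> t) * ?d = ?k / ((- ?Y) * (2 * t / ?d)) * (?B t * (- deriv \<psi> (- t) / ?d)) * ?d"
        by (simp add: recursion_kernel_def dk B e1 e2)
      \<comment> \<open>Should \<open>?Y\<close> vanish, both sides are 0 by the convention for
        division.\<close>
      also have "\<dots> = ?k * (inverse (2 * t * ?Y) * (?B t * (?d * deriv \<psi> (- t))))"
        using d t by (cases "?Y = 0") (auto simp: field_simps)
      finally show "?k * (?Q t * (?B t * (?d * deriv \<psi> (- t)))) = ?f (\<psi> t) * ?d" by (rule sym)
    qed
  qed
  then have "\<forall>\<^sub>F t in at 0. cauchy_kernel (h \<alpha>) (\<psi> (- t)) (\<psi> t) z1 * (?Q t * (?B t * (deriv \<psi> t * deriv \<psi> (- t)))) = ?f (\<psi> t) * deriv \<psi> t"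
    by (auto simp: eventually_at_filter)
  then have "(\<lambda>t. ?f (\<psi> t) * deriv \<psi> t) has_laurent_expansion G"
    using G(1) by (subst (asm) has_laurent_expansion_cong[OF _ refl])
  from contour_integral_pullback[OF \<psi> \<psi>0 \<chi> inv this] show ?thesis unfolding res .
qed

section \<open>Meromorphic functions on polydiscs\<close>

lemma polydisc_iff: "q \<in> polydisc p e \<longleftrightarrow> length q = length p \<and> (\<forall>i<length p. dist (p ! i) (q ! i) < e)"
  by (auto simp: polydisc_def list_all2_conv_all_nth)

lemma polydisc_self: "e > 0 \<Longrightarrow> p \<in> polydisc p e"
  by (simp add: polydisc_iff)

lemma polydisc_mono: "e \<le> e' \<Longrightarrow> polydisc p e \<subseteq> polydisc p e'"
  by (fastforce simp: polydisc_iff)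

lemma polydisc_update: "q \<in> polydisc p e \<Longrightarrow> i < length p \<Longrightarrow> dist (p ! i) t < e \<Longrightarrow> q[i := t] \<in> polydisc p e"
  by (auto simp: polydisc_iff nth_list_update)

lemma polydisc_open:
  assumes "q \<in> polydisc p e"
  obtains d where "d > 0" "polydisc q d \<subseteq> polydisc p e"
proof -
  define d where "d = Min (insert 1 ((\<lambda>i. e - dist (p ! i) (q ! i)) ` {..<length p}))"
  have "d > 0" unfolding d_def using assms by (subst Min_gr_iff) (auto simp: polydisc_iff)
  moreover have "polydisc q d \<subseteq> polydisc p e"
  proof
    fix r assume r: "r \<in> polydisc q d"
    have len: "length q = length p" "length r = length p" using assms r by (auto simp: polydisc_iff)
    have "dist (p ! i) (r ! i) < e" if "i < length p" for i
    proof -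
      have "d \<le> e - dist (p ! i) (q ! i)" unfolding d_def using that by (intro Min_le) auto
      moreover have "dist (q ! i) (r ! i) < d" using r that len by (auto simp: polydisc_iff)
      ultimately show ?thesis using dist_triangle[of "p ! i" "r ! i" "q ! i"] by linarith
    qed
    then show "r \<in> polydisc p e" using len by (simp add: polydisc_iff)
  qed
  ultimately show ?thesis using that by blast
qed

lemma holomorphic_several_mono: "holomorphic_several f p e \<Longrightarrow> e' \<le> e \<Longrightarrow> holomorphic_several f p e'"
  using polydisc_mono unfolding holomorphic_several_def by blast

lemma coeff_holomorphic_mono: "coeff_holomorphic emb f p e \<Longrightarrow> e' \<le> e \<Longrightarrow> coeff_holomorphic emb f p e'"
  using polydisc_mono holomorphic_several_mono unfolding coeff_holomorphic_def by (smt (verit) subsetD)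

lemma holomorphic_several_cong:
  assumes f: "holomorphic_several f p e" and eq: "\<And>q. q \<in> polydisc p e \<Longrightarrow> f q = g q"
  shows "holomorphic_several g p e"
  unfolding holomorphic_several_def
proof (intro conjI ballI allI impI)
  fix q and d :: real assume q: "q \<in> polydisc p e" and d: "d > 0"
  obtain c where c: "c > 0" "\<forall>q'\<in>polydisc q c. dist (f q') (f q) < d"
    using f q d unfolding holomorphic_several_def by blast
  obtain c' where c': "c' > 0" "polydisc q c' \<subseteq> polydisc p e" by (rule polydisc_open[OF q])
  have "\<forall>q'\<in>polydisc q (min c c'). dist (g q') (g q) < d"
  proof
    fix q' assume "q' \<in> polydisc q (min c c')"
    then have "q' \<in> polydisc q c" "q' \<in> polydisc p e"
      using polydisc_mono[of "min c c'" c q] polydisc_mono[of "min c c'" c' q] c'(2) by auto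
    then have "dist (f q') (f q) < d" "f q' = g q'" "f q = g q" using c(2) eq q by auto
    then show "dist (g q') (g q) < d" by simp
  qed
  then show "\<exists>c>0. \<forall>q'\<in>polydisc q c. dist (g q') (g q) < d" using c(1) c'(1) by (intro exI[of _ "min c c'"]) auto
next
  fix q i assume q: "q \<in> polydisc p e" and i: "i < length q"
  have len: "length q = length p" using q by (simp add: polydisc_iff)
  have fd: "(\<lambda>t. f (q[i := t])) field_differentiable at (q ! i)"
    using f q i unfolding holomorphic_several_def by blast
  have "\<forall>\<^sub>F t in nhds (q ! i). t \<in> ball (p ! i) e"
    using q i len by (intro eventually_nhds_in_open) (auto simp: polydisc_iff)
  then have "\<forall>\<^sub>F t in nhds (q ! i). f (q[i := t]) = g (q[i := t])"
    by eventually_elim (use q i len in \<open>auto intro!: eq polydisc_update\<close>)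
  note ev = this
  obtain D where "((\<lambda>t. f (q[i := t])) has_field_derivative D) (at (q ! i))"
    using fd unfolding field_differentiable_def by blast
  then have "((\<lambda>t. g (q[i := t])) has_field_derivative D) (at (q ! i))"
    using DERIV_cong_ev[OF refl ev refl] by blast
  then show "(\<lambda>t. g (q[i := t])) field_differentiable at (q ! i)"
    unfolding field_differentiable_def by blast
qed

lemma holomorphic_several_const: "holomorphic_several (\<lambda>_. c) p e"
  unfolding holomorphic_several_def by (auto intro: exI[of _ 1])

lemma holomorphic_several_add:
  assumes "holomorphic_several f p e" "holomorphic_several g p e"
  shows "holomorphic_several (\<lambda>q. f q + g q) p e"
  unfolding holomorphic_several_def
proof (intro conjI ballI allI impI)
  fix q and d :: real assume q: "q \<in> polydisc p e" and d: "d > 0"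
  obtain c where c: "c > 0" "\<forall>q'\<in>polydisc q c. dist (f q') (f q) < d / 2"
    using assms(1) q d unfolding holomorphic_several_def by (meson half_gt_zero)
  obtain c' where c': "c' > 0" "\<forall>q'\<in>polydisc q c'. dist (g q') (g q) < d / 2"
    using assms(2) q d unfolding holomorphic_several_def by (meson half_gt_zero)
  have "dist (f q' + g q') (f q + g q) < d" if "q' \<in> polydisc q (min c c')" for q'
  proof -
    have "q' \<in> polydisc q c" "q' \<in> polydisc q c'"
      using that polydisc_mono[of "min c c'" c q] polydisc_mono[of "min c c'" c' q] by auto
    then have "dist (f q') (f q) < d / 2" "dist (g q') (g q) < d / 2" using c c' by auto
    then show ?thesis using dist_triangle_add[of "f q'" "g q'" "f q" "g q"] by linarith
  qed
  then show "\<exists>c>0. \<forall>q'\<in>polydisc q c. dist (f q' + g q') (f q + g q) < d" using c(1) c'(1) by (intro exI[of _ "min c c'"]) auto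
qed (use assms in \<open>auto simp: holomorphic_several_def intro: field_differentiable_add\<close>)

lemma holomorphic_several_mult:
  assumes "holomorphic_several f p e" "holomorphic_several g p e"
  shows "holomorphic_several (\<lambda>q. f q * g q) p e"
  unfolding holomorphic_several_def
proof (intro conjI ballI allI impI)
  fix q and d :: real assume q: "q \<in> polydisc p e" and d: "d > 0"
  have "isCont (\<lambda>w :: complex \<times> complex. fst w * snd w) (f q, g q)" by (intro continuous_intros)
  then obtain s where s: "s > 0" "\<And>w. dist w (f q, g q) < s \<Longrightarrow> dist (fst w * snd w) (f q * g q) < d"
    using d unfolding continuous_at_eps_delta by force
  obtain c where c: "c > 0" "\<forall>q'\<in>polydisc q c. dist (f q') (f q) < s / 2"
    using assms(1) q s(1) unfolding holomorphic_several_def by (meson half_gt_zero)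
  obtain c' where c': "c' > 0" "\<forall>q'\<in>polydisc q c'. dist (g q') (g q) < s / 2"
    using assms(2) q s(1) unfolding holomorphic_several_def by (meson half_gt_zero)
  have "dist (f q' * g q') (f q * g q) < d" if "q' \<in> polydisc q (min c c')" for q'
  proof -
    have "q' \<in> polydisc q c" "q' \<in> polydisc q c'"
      using that polydisc_mono[of "min c c'" c q] polydisc_mono[of "min c c'" c' q] by auto
    then have "dist (f q') (f q) < s / 2" "dist (g q') (g q) < s / 2" using c c' by auto
    then have "dist (f q', g q') (f q, g q) < s"
      using sqrt_sum_squares_le_sum[of "dist (f q') (f q)" "dist (g q') (g q)"] unfolding dist_Pair_Pair by auto
    then show ?thesis using s(2)[of "(f q', g q')"] by simp
  qed
  then show "\<exists>c>0. \<forall>q'\<in>polydisc q c. dist (f q' * g q') (f q * g q) < d" using c(1) c'(1) by (intro exI[of _ "min c c'"]) auto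
qed (use assms in \<open>auto simp: holomorphic_several_def intro: field_differentiable_mult\<close>)

lemma holomorphic_several_sum:
  "finite I \<Longrightarrow> (\<And>i. i \<in> I \<Longrightarrow> holomorphic_several (f i) p e) \<Longrightarrow> holomorphic_several (\<lambda>q. \<Sum>i\<in>I. f i q) p e"
  by (induction I rule: finite_induct) (auto intro: holomorphic_several_const holomorphic_several_add)

lemma holomorphic_several_nth:
  assumes "i < length p" "\<And>t. t \<in> ball (p ! i) e \<Longrightarrow> u field_differentiable at t"
  shows "holomorphic_several (\<lambda>q. u (q ! i)) p e"
  unfolding holomorphic_several_def
proof (intro conjI ballI allI impI)
  fix q and d :: real assume q: "q \<in> polydisc p e" and d: "d > 0"
  then have "u field_differentiable at (q ! i)" using assms by (auto simp: polydisc_iff)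
  then have "isCont u (q ! i)" by (rule field_differentiable_imp_continuous_at)
  then obtain c where "c > 0" "\<And>t. dist t (q ! i) < c \<Longrightarrow> dist (u t) (u (q ! i)) < d"
    using d unfolding continuous_at_eps_delta by blast
  then show "\<exists>c>0. \<forall>q'\<in>polydisc q c. dist (u (q' ! i)) (u (q ! i)) < d"
    using q assms(1) by (intro exI[of _ c]) (auto simp: polydisc_iff dist_commute)
next
  fix q j assume q: "q \<in> polydisc p e" and j: "j < length q"
  show "(\<lambda>t. u (q[j := t] ! i)) field_differentiable at (q ! j)"
  proof (cases "i = j")
    case True then show ?thesis using q j assms by (auto simp: polydisc_iff)
  qed auto
qed

lemma holomorphic_several_tl:
  assumes "holomorphic_several f (tl p) e" "p \<noteq> []"
  shows "holomorphic_several (\<lambda>q. f (tl q)) p e"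
  unfolding holomorphic_several_def
proof (intro conjI ballI allI impI)
  have tl: "tl q' \<in> polydisc (tl q) c" if "q' \<in> polydisc q c" for q q' :: "complex list" and c
    using that by (cases q; cases q') (auto simp: polydisc_def)
  fix q and d :: real assume q: "q \<in> polydisc p e" and d: "d > 0"
  obtain c where "c > 0" "\<forall>q'\<in>polydisc (tl q) c. dist (f q') (f (tl q)) < d"
    using assms tl[OF q] d unfolding holomorphic_several_def by blast
  then show "\<exists>c>0. \<forall>q'\<in>polydisc q c. dist (f (tl q')) (f (tl q)) < d" using tl by blast
next
  fix q i assume q: "q \<in> polydisc p e" and i: "i < length q"
  have tl: "tl q \<in> polydisc (tl p) e"
    using q by (cases q; cases p) (auto simp: polydisc_def)
  obtain z zs where z: "q = z # zs" using i by (cases q) auto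
  show "(\<lambda>t. f (tl (q[i := t]))) field_differentiable at (q ! i)"
  proof (cases i)
    case (Suc j)
    have "(\<lambda>t. f ((tl q)[j := t])) field_differentiable at (tl q ! j)"
      using assms(1) tl i Suc z unfolding holomorphic_several_def by auto
    then show ?thesis by (simp add: z Suc)
  qed (simp add: z)
qed

section \<open>Correlators as normalised meromorphic functions\<close>

lemma holomorphic_several_eval_modes:
  assumes "\<And>k t. k < K \<Longrightarrow> t \<in> (\<Union>w\<in>set p. ball w e) \<Longrightarrow> \<eta> k field_differentiable at t"
  shows "holomorphic_several (eval_modes \<eta> K f) p e"
  using assms
proof (induction p arbitrary: f)
  case Nil
  show ?case by (rule holomorphic_several_cong[OF holomorphic_several_const[of "f []"]]) (auto simp: polydisc_iff)
next
  case (Cons w p)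
  have "holomorphic_several (\<lambda>q. \<Sum>k<K. \<eta> k (q ! 0) * eval_modes \<eta> K (D k f) (tl q)) (w # p) e"
    by (intro holomorphic_several_sum holomorphic_several_mult holomorphic_several_nth holomorphic_several_tl)
      (use Cons in auto)
  then show ?case
  proof (rule holomorphic_several_cong)
    fix q assume "q \<in> polydisc (w # p) e"
    then obtain z zs where "q = z # zs" by (cases q) (auto simp: polydisc_iff)
    then show "(\<Sum>k<K. \<eta> k (q ! 0) * eval_modes \<eta> K (D k f) (tl q)) = eval_modes \<eta> K f q" by simp
  qed
qed

lemma coeff_holomorphic_id: "coeff_holomorphic (\<lambda>c. c) f p e \<longleftrightarrow> holomorphic_several f p e"
proof
  assume "coeff_holomorphic (\<lambda>c. c) f p e"
  then obtain m a c where *: "\<forall>j<m. holomorphic_several (a j) p e" "\<forall>q\<in>polydisc p e. f q = (\<Sum>j<(m::nat). a j q * c j)"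
    unfolding coeff_holomorphic_def by blast
  have "holomorphic_several (\<lambda>q. \<Sum>j<m. a j q * c j) p e"
    using *(1) by (intro holomorphic_several_sum holomorphic_several_mult holomorphic_several_const) auto
  then show "holomorphic_several f p e" by (rule holomorphic_several_cong) (use *(2) in simp)
next
  assume "holomorphic_several f p e"
  then show "coeff_holomorphic (\<lambda>c. c) f p e"
    unfolding coeff_holomorphic_def by (intro exI[of _ 1] exI[of _ "\<lambda>_. f"] exI[of _ "\<lambda>_. 1"]) auto
qed

text \<open>In each single variable the function is a polynomial in 1/t without constant term,
  because every mode is.\<close>

lemma eval_modes_update:
  assumes \<eta>: "\<And>k z. k < K \<Longrightarrow> \<eta> k z = (\<Sum>r<M. cf k r * inverse z ^ Suc r)"
  shows "i < length q \<Longrightarrow> \<exists>A. \<forall>t. eval_modes \<eta> K f (q[i := t]) = (\<Sum>r<M. A r * inverse t ^ Suc r)"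
proof (induction q arbitrary: i f)
  case (Cons z zs)
  show ?case
  proof (cases i)
    case 0
    have "eval_modes \<eta> K f ((z # zs)[i := t]) = (\<Sum>r<M. (\<Sum>k<K. cf k r * eval_modes \<eta> K (D k f) zs) * inverse t ^ Suc r)" for t
      unfolding 0 list_update.simps nat.case eval_modes.simps sum_distrib_right
      by (subst sum.swap) (simp add: \<eta> sum_distrib_left sum_distrib_right mult_ac)
    then show ?thesis by (intro exI allI)
  next
    case (Suc j)
    have "\<forall>k. \<exists>A. \<forall>t. eval_modes \<eta> K (D k f) (zs[j := t]) = (\<Sum>r<M. A r * inverse t ^ Suc r)"
      using Cons Suc by auto
    then obtain A where A: "\<And>k t. eval_modes \<eta> K (D k f) (zs[j := t]) = (\<Sum>r<M. A k r * inverse t ^ Suc r)"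
      by metis
    have "eval_modes \<eta> K f ((z # zs)[i := t]) = (\<Sum>r<M. (\<Sum>k<K. \<eta> k z * A k r) * inverse t ^ Suc r)" for t
      unfolding Suc list_update.simps nat.case eval_modes.simps A sum_distrib_right sum_distrib_left
      by (subst sum.swap) (simp add: mult_ac)
    then show ?thesis by (intro exI allI)
  qed
qed simp

lemma principal_part_extends_imp_zero:
  assumes C: "C holomorphic_on ball 0 d" and d: "d > 0"
    and eq: "\<And>t. t \<in> ball 0 d \<Longrightarrow> t \<noteq> 0 \<Longrightarrow> (\<Sum>r<M. A r * inverse t ^ Suc r) = C t"
    and r: "r < M"
  shows "A r = 0"
proof -
  have "C analytic_on {0}" using C d analytic_at[of C 0] by (auto intro!: exI[of _ "ball 0 d"])
  then obtain P where "C has_fps_expansion P" using analytic_at_imp_has_fps_expansion_0 by blast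
  then have 1: "C has_laurent_expansion fps_to_fls P" by (rule has_laurent_expansion_fps)
  have 2: "(\<lambda>t. \<Sum>r<M. A r * inverse t ^ Suc r) has_laurent_expansion (\<Sum>r<M. fls_const (A r) * inverse fls_X ^ Suc r)"
    by (intro has_laurent_expansion_sum has_laurent_expansion_mult has_laurent_expansion_const has_laurent_expansion_power
       has_laurent_expansion_inverse has_laurent_expansion_fps_X)
  have "\<forall>\<^sub>F t in at 0. (\<Sum>r<M. A r * inverse t ^ Suc r) = C t"
  proof -
    have "\<forall>\<^sub>F t in at 0. t \<in> ball 0 d - {0}" using d by (intro eventually_at_in_open) auto
    then show ?thesis by eventually_elim (intro eq; simp)
  qed
  then have "(\<lambda>t. \<Sum>r<M. A r * inverse t ^ Suc r) has_laurent_expansion fps_to_fls P"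
    using 1 by (subst has_laurent_expansion_cong[OF _ refl])
  then have "(\<Sum>r<M. fls_const (A r) * inverse fls_X ^ Suc r) = fps_to_fls P"
    using has_laurent_expansion_unique[OF 2] by blast
  then have "(\<Sum>s<M. fls_const (A s) * inverse fls_X ^ Suc s) $$ (- int (Suc r)) = 0"
    by (simp del: of_nat_Suc)
  moreover have "(\<Sum>s<M. fls_const (A s) * inverse fls_X ^ Suc s) $$ (- int (Suc r)) = (\<Sum>s<M. if s = r then A s else 0)"
    unfolding fls_nth_sum fls_inverse_X by (intro sum.cong) (auto simp del: power_Suc of_nat_Suc)
  ultimately show ?thesis using r by simp
qed

text \<open>The denominator is the product of all z_i^M. Where a coordinate is 0 the value is 0,
  since \<open>inverse 0 = 0\<close>, and this is the normalised value: if a holomorphic extension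
  exists, every slice in that coordinate is a polynomial in 1/t without constant term that extends,
  hence 0, and the function is zero near the point.\<close>

lemma meromorphic_eval_modes:
  assumes \<eta>: "\<And>k z. k < K \<Longrightarrow> \<eta> k z = (\<Sum>r<M. cf k r * inverse z ^ Suc r)" and M: "M > 0"
  shows "meromorphic_several (\<lambda>c. c) n (eval_modes \<eta> K f)"
  unfolding meromorphic_several_def
proof
  fix p assume p: "p \<in> disc_power n"
  \<comment> \<open>The denominator is written with a single mode so that its holomorphy comes from
    the same lemma as that of the numerator.\<close>
  define b where "b = eval_modes (\<lambda>_ z. z ^ M) 1 (\<lambda>_. 1)"
  define a where "a = eval_modes (\<lambda>k z. \<Sum>r<M. cf k r * z ^ (M - Suc r)) K f"
  have b_simps: "b [] = 1" "b (z # zs) = z ^ M * b zs" for z zs by (simp_all add: b_def)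
  have b0: "b q \<noteq> 0 \<longleftrightarrow> 0 \<notin> set q" for q using M by (induction q) (auto simp: b_simps)
  have ab: "b q * eval_modes \<eta> K f q = a q" if "0 \<notin> set q" for q
    using that unfolding a_def
  proof (induction q arbitrary: f)
    case (Cons z zs)
    have "z ^ M * \<eta> k z = (\<Sum>r<M. cf k r * z ^ (M - Suc r))" if k: "k < K" for k
      unfolding \<eta>[OF k] sum_distrib_left
    proof (intro sum.cong refl)
      fix r assume "r \<in> {..<M}"
      then have "z ^ M = z ^ (M - Suc r) * z ^ Suc r" by (simp add: power_add[symmetric] del: power_Suc)
      then show "z ^ M * (cf k r * inverse z ^ Suc r) = cf k r * z ^ (M - Suc r)"
        using Cons.prems by (simp add: power_inverse field_simps)
    qed
    note eta = this
    have "b (z # zs) * eval_modes \<eta> K f (z # zs) = (\<Sum>k<K. (\<Sum>r<M. cf k r * z ^ (M - Suc r)) * (b zs * eval_modes \<eta> K (D k f) zs))"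
      unfolding b_simps eval_modes.simps sum_distrib_left
    proof (intro sum.cong refl)
      fix k assume "k \<in> {..<K}"
      then have ek: "z ^ M * \<eta> k z = (\<Sum>r<M. cf k r * z ^ (M - Suc r))" using eta by simp
      then show "z ^ M * b zs * (\<eta> k z * eval_modes \<eta> K (D k f) zs) = (\<Sum>r<M. cf k r * z ^ (M - Suc r)) * (b zs * eval_modes \<eta> K (D k f) zs)"
        unfolding ek[symmetric] by (simp only: mult_ac)
    qed
    then show ?case using Cons by simp
  qed (simp add: b_simps)
  have hb: "holomorphic_several b p e" for e
    unfolding b_def by (intro holomorphic_several_eval_modes) (auto intro!: derivative_intros field_differentiable_power)
  have ha: "holomorphic_several a p e" for e
    unfolding a_def
  proof (intro holomorphic_several_eval_modes)
    fix k t
    have "(\<lambda>z. \<Sum>r<M. cf k r * z ^ (M - Suc r)) holomorphic_on UNIV" by (intro holomorphic_intros)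
    then show "(\<lambda>z. \<Sum>r<M. cf k r * z ^ (M - Suc r)) field_differentiable at t"
      using holomorphic_on_imp_differentiable_at open_UNIV by blast
  qed
  let ?q = "map (\<lambda>w. if w = 0 then 1/2 else w) p"
  have "?q \<in> polydisc p 1" "b ?q \<noteq> 0" unfolding b0 by (auto simp: polydisc_iff)
  have norm: "(\<exists>d>0. coeff_holomorphic (\<lambda>c. c) (eval_modes \<eta> K f) p d) \<or>
         eval_modes \<eta> K f p = 0 \<and> \<not> (\<exists>d>0. \<exists>c. coeff_holomorphic (\<lambda>c. c) c p d \<and>
                         (\<forall>q\<in>polydisc p d. b q \<noteq> 0 \<longrightarrow> eval_modes \<eta> K f q = c q))"
    unfolding coeff_holomorphic_id
  proof (cases "0 \<in> set p")
    case False
    define d where "d = Min (insert 1 (norm ` set p))"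
    have d: "d > 0" unfolding d_def using False by (subst Min_gr_iff) auto
    have nz: "t \<noteq> 0" if t: "t \<in> (\<Union>w\<in>set p. ball w d)" for t
    proof
      assume "t = 0"
      then obtain w where w: "w \<in> set p" "norm w < d" using t by auto
      then have "d \<le> norm w" unfolding d_def by (intro Min_le) auto
      then show False using w by simp
    qed
    have "holomorphic_several (eval_modes \<eta> K f) p d"
    proof (rule holomorphic_several_eval_modes)
      fix k t assume k: "k < K" and "t \<in> (\<Union>w\<in>set p. ball w d)"
      then have "t \<noteq> 0" by (intro nz)
      have "(\<lambda>z. \<Sum>r<M. cf k r * inverse z ^ Suc r) holomorphic_on (- {0})" by (intro holomorphic_intros) auto
      then show "\<eta> k field_differentiable at t"
        unfolding \<eta>[OF k, abs_def] using holomorphic_on_imp_differentiable_at[of _ "- {0}" t] \<open>t \<noteq> 0\<close> by (simp add: open_Compl)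
    qed
    then show "(\<exists>d>0. holomorphic_several (eval_modes \<eta> K f) p d) \<or>
         eval_modes \<eta> K f p = 0 \<and> \<not> (\<exists>d>0. \<exists>c. holomorphic_several c p d \<and>
                         (\<forall>q\<in>polydisc p d. b q \<noteq> 0 \<longrightarrow> eval_modes \<eta> K f q = c q))" using d by blast
  next
    case True
    have z: "eval_modes \<eta> K f q = 0" if "0 \<in> set q" for q
      using that
    proof (induction q arbitrary: f)
      case (Cons w ws) then show ?case by (cases "w = 0") (auto simp: \<eta> intro!: sum.neutral)
    qed simp
    have "\<exists>d>0. holomorphic_several (eval_modes \<eta> K f) p d" if d: "d > 0" and c: "holomorphic_several c p d"
      and eq: "\<forall>q\<in>polydisc p d. b q \<noteq> 0 \<longrightarrow> eval_modes \<eta> K f q = c q" for d c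
    proof -
      obtain i where i: "i < length p" "p ! i = 0" using True by (auto simp: in_set_conv_nth)
      have "0 = eval_modes \<eta> K f q" if q: "q \<in> polydisc p d" for q
      proof (cases "0 \<in> set q")
        case True then show ?thesis by (simp add: z)
      next
        case False
        have len: "length q = length p" using q by (simp add: polydisc_iff)
        obtain A where A: "\<And>t. eval_modes \<eta> K f (q[i := t]) = (\<Sum>r<M. A r * inverse t ^ Suc r)"
          using eval_modes_update[where \<eta> = \<eta> and K = K and i = i and q = q and f = f, OF \<eta>] i len by auto
        have mem: "q[i := t] \<in> polydisc p d" if "t \<in> ball 0 d" for t
          using polydisc_update[OF q i(1)] i(2) that by simp
        have "(\<lambda>t. c (q[i := t])) field_differentiable at t" if "t \<in> ball 0 d" for t
          using c mem[OF that] i(1) len unfolding holomorphic_several_def by force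
        then have hol: "(\<lambda>t. c (q[i := t])) holomorphic_on ball 0 d"
          by (auto simp: holomorphic_on_def intro: field_differentiable_at_within)
        have "(\<Sum>r<M. A r * inverse t ^ Suc r) = c (q[i := t])" if "t \<in> ball 0 d" "t \<noteq> 0" for t
        proof -
          have "set (q[i := t]) \<subseteq> insert t (set q)" by (rule set_update_subset_insert)
          then have "b (q[i := t]) \<noteq> 0" using False that(2) b0 by blast
          then show ?thesis using eq mem[OF that(1)] A[of t] by simp
        qed
        then have "A r = 0" if "r < M" for r
          by (rule principal_part_extends_imp_zero[OF hol d]) (use that in auto)
        then have "eval_modes \<eta> K f (q[i := q ! i]) = 0" unfolding A by simp
        then show ?thesis unfolding list_update_id by simp
      qed
      then have "holomorphic_several (eval_modes \<eta> K f) p d"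
        by (rule holomorphic_several_cong[OF holomorphic_several_const[of 0]])
      then show ?thesis using d by blast
    qed
    then show "(\<exists>d>0. holomorphic_several (eval_modes \<eta> K f) p d) \<or>
         eval_modes \<eta> K f p = 0 \<and> \<not> (\<exists>d>0. \<exists>c. holomorphic_several c p d \<and>
                         (\<forall>q\<in>polydisc p d. b q \<noteq> 0 \<longrightarrow> eval_modes \<eta> K f q = c q))"
      using z[OF True] by blast
  qed
  show "\<exists>e>0. \<exists>a b. coeff_holomorphic (\<lambda>c. c) a p e \<and> holomorphic_several b p e \<and>
        (\<exists>q\<in>polydisc p e. b q \<noteq> 0) \<and> (\<forall>q\<in>polydisc p e. b q \<noteq> 0 \<longrightarrow> b q * eval_modes \<eta> K f q = a q) \<and>
        ((\<exists>d>0. coeff_holomorphic (\<lambda>c. c) (eval_modes \<eta> K f) p d) \<or>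
         eval_modes \<eta> K f p = 0 \<and> \<not> (\<exists>d>0. \<exists>c. coeff_holomorphic (\<lambda>c. c) c p d \<and>
                         (\<forall>q\<in>polydisc p d. b q \<noteq> 0 \<longrightarrow> eval_modes \<eta> K f q = c q)))"
  proof (rule exI[of _ "1 :: real"], rule conjI[OF zero_less_one], rule exI[of _ a], rule exI[of _ b], intro conjI)
    show "\<exists>q\<in>polydisc p 1. b q \<noteq> 0" using \<open>?q \<in> polydisc p 1\<close> \<open>b ?q \<noteq> 0\<close> by blast
    show "\<forall>q\<in>polydisc p 1. b q \<noteq> 0 \<longrightarrow> b q * eval_modes \<eta> K f q = a q" using ab b0 by blast
  qed (use ha hb norm in \<open>auto simp: coeff_holomorphic_id\<close>)
qed

text \<open>On the diagonal \<open>1 / 0 = 0\<close> is the normalised value: a holomorphic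
  extension, multiplied by the square of the difference, would be continuous with value 0 on the
  diagonal and 1 off it.\<close>

lemma meromorphic_inverse_square_diff:
  "meromorphic_several (\<lambda>c. c) 2 (\<lambda>zs. 1 / (zs ! 0 - zs ! 1)\<^sup>2)"
  unfolding meromorphic_several_def
proof
  fix p :: "complex list" assume p: "p \<in> disc_power 2"
  then have len: "length p = 2" by (simp add: disc_power_def)
  let ?f = "\<lambda>zs :: complex list. 1 / (zs ! 0 - zs ! 1)\<^sup>2"
  define b :: "complex list \<Rightarrow> complex" where "b zs = (zs ! 0 + - 1 * zs ! 1) * (zs ! 0 + - 1 * zs ! 1)" for zs
  have b: "b zs = (zs ! 0 - zs ! 1)\<^sup>2" for zs by (simp add: b_def power2_eq_square)
  have nth: "holomorphic_several (\<lambda>zs. zs ! i) p e" if "i < 2" for i e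
    using holomorphic_several_nth[of i p e "\<lambda>z. z"] that len by simp
  have hb: "holomorphic_several b p e" for e
    unfolding b_def by (intro holomorphic_several_mult holomorphic_several_add holomorphic_several_const nth) auto
  have norm: "(\<exists>d>0. holomorphic_several ?f p d) \<or> ?f p = 0 \<and> \<not> (\<exists>d>0. \<exists>c. holomorphic_several c p d \<and>
                         (\<forall>q\<in>polydisc p d. b q \<noteq> 0 \<longrightarrow> ?f q = c q))"
  proof (cases "p ! 0 = p ! 1")
    case False
    define d where "d = dist (p ! 0) (p ! 1) / 2"
    have d: "d > 0" using False by (simp add: d_def)
    have ne: "q ! 0 \<noteq> q ! 1" if "q \<in> polydisc p d" for q
    proof
      assume "q ! 0 = q ! 1"
      have "dist (p ! 0) (q ! 0) < d" "dist (p ! 1) (q ! 1) < d" using that len by (auto simp: polydisc_iff)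
      with \<open>q ! 0 = q ! 1\<close> show False using dist_triangle_half_r[of "q ! 0" "p ! 0" "2 * d" "p ! 1"] unfolding d_def by (simp add: dist_commute)
    qed
    have "holomorphic_several ?f p d"
      unfolding holomorphic_several_def
    proof (intro conjI ballI allI impI)
      fix q and s :: real assume q: "q \<in> polydisc p d" and s: "s > 0"
      have "isCont (\<lambda>w :: complex \<times> complex. 1 / (fst w - snd w)\<^sup>2) (q ! 0, q ! 1)"
        using ne[OF q] by (intro continuous_intros) auto
      then obtain t where t: "t > 0" "\<And>w. dist w (q ! 0, q ! 1) < t \<Longrightarrow> dist (1 / (fst w - snd w)\<^sup>2) (?f q) < s"
        using s unfolding continuous_at_eps_delta by force
      have "dist (?f q') (?f q) < s" if "q' \<in> polydisc q (t / 2)" for q'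
      proof -
        have "dist (q' ! 0) (q ! 0) < t / 2" "dist (q' ! 1) (q ! 1) < t / 2"
          using that q len by (auto simp: polydisc_iff dist_commute)
        then have "dist (q' ! 0, q' ! 1) (q ! 0, q ! 1) < t"
          using sqrt_sum_squares_le_sum[of "dist (q' ! 0) (q ! 0)" "dist (q' ! 1) (q ! 1)"] unfolding dist_Pair_Pair by auto
        then show ?thesis using t(2)[of "(q' ! 0, q' ! 1)"] by simp
      qed
      then show "\<exists>c>0. \<forall>q'\<in>polydisc q c. dist (?f q') (?f q) < s" using t(1) by (intro exI[of _ "t / 2"]) auto
    next
      fix q i assume q: "q \<in> polydisc p d" and i: "i < length q"
      have lq: "length q = 2" using q len by (simp add: polydisc_iff)
      have "(\<lambda>t. 1 / (t - w)\<^sup>2) holomorphic_on - {w}" "(\<lambda>t. 1 / (w - t)\<^sup>2) holomorphic_on - {w}" for w :: complex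
        by (intro holomorphic_intros; auto)+
      then have "(\<lambda>t. 1 / (t - w)\<^sup>2) field_differentiable at v" "(\<lambda>t. 1 / (w - t)\<^sup>2) field_differentiable at v" if "v \<noteq> w" for v w :: complex
        using that holomorphic_on_imp_differentiable_at[of _ "- {w}" v] by (auto simp: open_Compl)
      moreover have "i = 0 \<or> i = 1" using i lq by auto
      ultimately show "(\<lambda>t. ?f (q[i := t])) field_differentiable at (q ! i)"
        using ne[OF q] lq by auto
    qed
    then show ?thesis using d by blast
  next
    case True
    have False if d: "d > 0" and c: "holomorphic_several c p d" and eq: "\<forall>q\<in>polydisc p d. b q \<noteq> 0 \<longrightarrow> ?f q = c q" for d c
    proof -
      have mem: "p[0 := t] \<in> polydisc p d" if "t \<in> ball (p ! 0) d" for t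
        by (rule polydisc_update) (use polydisc_self[OF d] len that in auto)
      have "(\<lambda>t. c (p[0 := t])) field_differentiable at (p ! 0)"
        using c polydisc_self[OF d] len unfolding holomorphic_several_def by auto
      then have "isCont (\<lambda>t. c (p[0 := t]) * (t - p ! 1)\<^sup>2) (p ! 0)"
        by (intro continuous_intros field_differentiable_imp_continuous_at)
      then have "((\<lambda>t. c (p[0 := t]) * (t - p ! 1)\<^sup>2) \<longlongrightarrow> 0) (at (p ! 0))"
        using True by (simp add: isCont_def)
      moreover have "\<forall>\<^sub>F t in at (p ! 0). c (p[0 := t]) * (t - p ! 1)\<^sup>2 = 1"
      proof -
        have "\<forall>\<^sub>F t in at (p ! 0). t \<in> ball (p ! 0) d - {p ! 0}" using d by (intro eventually_at_in_open) auto
        then show ?thesis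
        proof eventually_elim
          case (elim t)
          have t0: "p[0 := t] ! 0 = t" using len by simp
          have "t - p ! 1 \<noteq> 0" using elim True by auto
          moreover have "b (p[0 := t]) \<noteq> 0" using \<open>t - p ! 1 \<noteq> 0\<close> t0 by (simp add: b)
          then have "c (p[0 := t]) = 1 / (t - p ! 1)\<^sup>2" using eq mem[of t] elim t0 by auto
          ultimately show ?case by simp
        qed
      qed
      ultimately have "((\<lambda>t. 1 :: complex) \<longlongrightarrow> 0) (at (p ! 0))" by (rule Lim_transform_eventually)
      then have "1 = (0 :: complex)" by (rule LIM_const_eq)
      then show False by simp
    qed
    moreover have "?f p = 0" using True by simp
    ultimately show ?thesis by blast
  qed
  have "p[0 := p ! 1 + of_real (1/2)] \<in> polydisc p 1 \<or> p ! 0 \<noteq> p ! 1"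
    using len by (auto simp: polydisc_iff nth_list_update dist_norm)
  then have ex: "\<exists>q\<in>polydisc p 1. b q \<noteq> 0"
  proof
    assume "p[0 := p ! 1 + of_real (1/2)] \<in> polydisc p 1"
    then show ?thesis using len by (intro bexI[of _ "p[0 := p ! 1 + of_real (1/2)]"]) (auto simp: b)
  next
    assume "p ! 0 \<noteq> p ! 1"
    then show ?thesis by (intro bexI[of _ p]) (auto simp: b polydisc_self)
  qed
  show "\<exists>e>0. \<exists>a b. coeff_holomorphic (\<lambda>c. c) a p e \<and> holomorphic_several b p e \<and>
        (\<exists>q\<in>polydisc p e. b q \<noteq> 0) \<and> (\<forall>q\<in>polydisc p e. b q \<noteq> 0 \<longrightarrow> b q * ?f q = a q) \<and>
        ((\<exists>d>0. coeff_holomorphic (\<lambda>c. c) ?f p d) \<or>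
         ?f p = 0 \<and> \<not> (\<exists>d>0. \<exists>c. coeff_holomorphic (\<lambda>c. c) c p d \<and>
                         (\<forall>q\<in>polydisc p d. b q \<noteq> 0 \<longrightarrow> ?f q = c q)))"
    unfolding coeff_holomorphic_id
  proof (rule exI[of _ "1 :: real"], rule conjI[OF zero_less_one], rule exI[of _ "\<lambda>_. 1"], rule exI[of _ b], intro conjI)
    show "\<forall>q\<in>polydisc p 1. b q \<noteq> 0 \<longrightarrow> b q * ?f q = 1" by (simp add: b)
  qed (use ex hb norm holomorphic_several_const in blast)+
qed

section \<open>Uniqueness\<close>

lemma is_ring_homD:
  assumes "is_ring_hom f"
  shows "f 1 = 1" "f (x + y) = f x + f y" "f (x * y) = f x * f y" "f 0 = 0" "f (- x) = - f x" "f (x - y) = f x - f y"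
proof -
  show 1: "f 1 = 1" and 2: "\<And>x y. f (x + y) = f x + f y" "f (x * y) = f x * f y" using assms by (auto simp: is_ring_hom_def)
  show 0: "f 0 = 0" using 2(1)[of 0 0] by simp
  show 3: "f (- x) = - f x" for x using 2(1)[of x "- x"] 0 by (simp add: eq_neg_iff_add_eq_0 add.commute)
  show "f (x - y) = f x - f y" using 2(1)[of x "- y"] 3 by simp
qed

lemma is_ring_hom_sum: "is_ring_hom f \<Longrightarrow> f (sum g I) = (\<Sum>i\<in>I. f (g i))"
  by (induction I rule: infinite_finite_induct) (auto simp: is_ring_homD)

abbreviation coeff_functional :: "(complex \<Rightarrow> 'l::comm_ring_1) \<Rightarrow> ('l \<Rightarrow> complex) \<Rightarrow> bool" where
  "coeff_functional emb \<equiv> Vector_Spaces.linear (\<lambda>c l. emb c * l) (*)"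

lemma coeff_functionalD:
  assumes "coeff_functional emb \<phi>"
  shows "\<phi> (u + v) = \<phi> u + \<phi> v" "\<phi> (emb c * v) = c * \<phi> v" "\<phi> 0 = 0" "\<phi> (u - v) = \<phi> u - \<phi> v"
    "\<phi> (sum f I) = (\<Sum>i\<in>I. \<phi> (f i))"
proof -
  interpret l: Vector_Spaces.linear "\<lambda>c l. emb c * l" "(*)" \<phi> by (rule assms)
  show "\<phi> (u + v) = \<phi> u + \<phi> v" "\<phi> (emb c * v) = c * \<phi> v" "\<phi> 0 = 0" "\<phi> (u - v) = \<phi> u - \<phi> v"
    "\<phi> (sum f I) = (\<Sum>i\<in>I. \<phi> (f i))"
    by (auto simp: l.add l.scale l.zero l.diff l.sum)
qed

lemma ring_hom_vector_space: "is_ring_hom emb \<Longrightarrow> vector_space (\<lambda>c l. emb c * l)" for emb :: "'k :: field \<Rightarrow> 'l :: comm_ring_1"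
  by unfold_locales (auto simp: is_ring_homD algebra_simps)

text \<open>Through \<open>emb\<close> the ring is a complex vector space, and a single nonzero
  element is linearly independent, so a functional can be prescribed on it.\<close>

lemma coeff_functional_exists:
  fixes l :: "'l :: comm_ring_1"
  assumes emb: "is_ring_hom emb" and l: "l \<noteq> 0"
  obtains \<phi> where "coeff_functional emb \<phi>" "\<phi> l = 1"
proof -
  interpret vector_space_pair "\<lambda>c l. emb c * (l :: 'l)" "(*) :: complex \<Rightarrow> complex \<Rightarrow> complex"
    using ring_hom_vector_space[OF emb] vector_space_over_itself.vector_space_axioms by (intro vector_space_pair.intro)
  have "vs1.independent {l}" using l by simp
  from linear_independent_extend[OF this, of "\<lambda>_. 1"] show ?thesis using that by blast
qed

lemma coeff_holomorphic_functional:
  assumes "coeff_holomorphic emb f p e" "coeff_functional emb \<phi>"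
  shows "holomorphic_several (\<lambda>q. \<phi> (f q)) p e"
proof -
  obtain m a c where *: "\<forall>j<m. holomorphic_several (a j) p e" "\<forall>q\<in>polydisc p e. f q = (\<Sum>j<(m::nat). emb (a j q) * c j)"
    using assms(1) unfolding coeff_holomorphic_def by blast
  have "holomorphic_several (\<lambda>q. \<Sum>j<m. a j q * \<phi> (c j)) p e"
    using *(1) by (intro holomorphic_several_sum holomorphic_several_mult holomorphic_several_const) auto
  then show ?thesis
    by (rule holomorphic_several_cong) (simp add: *(2) coeff_functionalD[OF assms(2)])
qed

lemma coeff_holomorphic_scale:
  assumes emb: "is_ring_hom emb" and b: "holomorphic_several b p e" and f: "coeff_holomorphic emb f p e"
  shows "coeff_holomorphic emb (\<lambda>q. emb (b q) * f q) p e"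
proof -
  obtain m a c where *: "\<forall>j<m. holomorphic_several (a j) p e" "\<forall>q\<in>polydisc p e. f q = (\<Sum>j<(m::nat). emb (a j q) * c j)"
    using f unfolding coeff_holomorphic_def by blast
  have "\<forall>j<m. holomorphic_several (\<lambda>q. b q * a j q) p e" using * b by (auto intro: holomorphic_several_mult)
  moreover have "\<forall>q\<in>polydisc p e. emb (b q) * f q = (\<Sum>j<m. emb (b q * a j q) * c j)"
    using *(2) by (simp add: sum_distrib_left is_ring_homD[OF emb] mult_ac)
  ultimately show ?thesis unfolding coeff_holomorphic_def
    by (intro exI[of _ m] exI[of _ "\<lambda>j q. b q * a j q"] exI[of _ c]) blast
qed

lemma coeff_holomorphic_const_mult:
  assumes "holomorphic_several f p e"
  shows "coeff_holomorphic emb (\<lambda>q. emb (f q) * k) p e"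
  unfolding coeff_holomorphic_def
  by (intro exI[of _ 1] exI[of _ "\<lambda>_. f"] exI[of _ "\<lambda>_. k"]) (use assms in auto)

text \<open>A functional that separates the two values reduces the claim to continuity of complex
  functions.\<close>

lemma coeff_holomorphic_eqI:
  assumes emb: "is_ring_hom emb" and F: "coeff_holomorphic emb F p e" and G: "coeff_holomorphic emb G p e"
    and q: "q \<in> polydisc p e" and eq: "\<And>d. d > 0 \<Longrightarrow> \<exists>q'\<in>polydisc q d. F q' = G q'"
  shows "F q = G q"
proof (rule ccontr)
  assume "F q \<noteq> G q"
  then obtain \<phi> where \<phi>: "coeff_functional emb \<phi>" "\<phi> (F q - G q) = 1"
    using coeff_functional_exists[OF emb, of "F q - G q"] by auto
  obtain c1 where c1: "c1 > 0" "\<forall>q'\<in>polydisc q c1. dist (\<phi> (F q')) (\<phi> (F q)) < 1 / 2"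
    using coeff_holomorphic_functional[OF F \<phi>(1)] q unfolding holomorphic_several_def by (meson half_gt_zero_iff zero_less_one)
  obtain c2 where c2: "c2 > 0" "\<forall>q'\<in>polydisc q c2. dist (\<phi> (G q')) (\<phi> (G q)) < 1 / 2"
    using coeff_holomorphic_functional[OF G \<phi>(1)] q unfolding holomorphic_several_def by (meson half_gt_zero_iff zero_less_one)
  obtain q' where q': "q' \<in> polydisc q (min c1 c2)" "F q' = G q'" using eq[of "min c1 c2"] c1 c2 by auto
  have "q' \<in> polydisc q c1" "q' \<in> polydisc q c2"
    using q'(1) polydisc_mono[of "min c1 c2" c1 q] polydisc_mono[of "min c1 c2" c2 q] by auto
  then have "dist (\<phi> (F q')) (\<phi> (F q)) < 1 / 2" "dist (\<phi> (F q')) (\<phi> (G q)) < 1 / 2" using c1 c2 q'(2) by auto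
  then have "dist (\<phi> (F q)) (\<phi> (G q)) < 1" using dist_triangle_half_r[of "\<phi> (F q')" "\<phi> (F q)" 1 "\<phi> (G q)"] by simp
  then show False using \<phi>(2) by (simp add: dist_norm coeff_functionalD[OF \<phi>(1)])
qed

section \<open>Identities on dense open sets\<close>

lemma generically_mono:
  assumes "generically n P" "\<And>zs. zs \<in> disc_power n \<Longrightarrow> P zs \<Longrightarrow> Q zs"
  shows "generically n Q"
proof -
  obtain D where D: "D \<subseteq> disc_power n" "\<forall>p\<in>D. \<exists>e>0. polydisc p e \<subseteq> D"
    "\<forall>p\<in>disc_power n. \<forall>e>0. polydisc p e \<inter> D \<noteq> {}" "\<forall>p\<in>D. P p" using assms(1) unfolding generically_def by blast
  then have "\<forall>p\<in>D. Q p" using assms(2) by blast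
  with D(1-3) show ?thesis unfolding generically_def by (intro exI[of _ D] conjI)
qed

lemma generically_dense: "generically n P \<Longrightarrow> p \<in> disc_power n \<Longrightarrow> e > 0 \<Longrightarrow> \<exists>q\<in>polydisc p e. P q"
  unfolding generically_def by blast

text \<open>The intersection is dense because one set is open: a small polydisc inside it still
  meets the other.\<close>

lemma generically_conj:
  assumes "generically n P" "generically n Q"
  shows "generically n (\<lambda>zs. P zs \<and> Q zs)"
proof -
  obtain C where C: "C \<subseteq> disc_power n" "\<forall>p\<in>C. \<exists>e>0. polydisc p e \<subseteq> C"
    "\<forall>p\<in>disc_power n. \<forall>e>0. polydisc p e \<inter> C \<noteq> {}" "\<forall>p\<in>C. P p" using assms(1) unfolding generically_def by blast
  obtain D where D: "D \<subseteq> disc_power n" "\<forall>p\<in>D. \<exists>e>0. polydisc p e \<subseteq> D"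
    "\<forall>p\<in>disc_power n. \<forall>e>0. polydisc p e \<inter> D \<noteq> {}" "\<forall>p\<in>D. Q p" using assms(2) unfolding generically_def by blast
  have op: "\<exists>e>0. polydisc p e \<subseteq> C \<inter> D" if "p \<in> C \<inter> D" for p
  proof -
    have "p \<in> C" "p \<in> D" using that by auto
    obtain e where "e > 0" "polydisc p e \<subseteq> C" using bspec[OF C(2) \<open>p \<in> C\<close>] by (elim exE conjE)
    moreover obtain e' where "e' > 0" "polydisc p e' \<subseteq> D" using bspec[OF D(2) \<open>p \<in> D\<close>] by (elim exE conjE)
    ultimately show ?thesis using polydisc_mono[of "min e e'" e p] polydisc_mono[of "min e e'" e' p]
      by (intro exI[of _ "min e e'"]) auto
  qed
  have dense: "polydisc p e \<inter> (C \<inter> D) \<noteq> {}" if p: "p \<in> disc_power n" and e: "e > 0" for p e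
  proof -
    obtain q where q: "q \<in> polydisc p e" "q \<in> C" using C(3) p e by blast
    obtain d where d: "d > 0" "polydisc q d \<subseteq> polydisc p e" by (rule polydisc_open[OF q(1)])
    obtain d' where d': "d' > 0" "polydisc q d' \<subseteq> C" using C(2) q by blast
    obtain w where w: "w \<in> polydisc q (min d d')" "w \<in> D" using D(3) C(1) q(2) d d'
      by (metis Int_emptyI min_less_iff_conj subsetD)
    have "w \<in> polydisc q d" "w \<in> polydisc q d'"
      using w(1) polydisc_mono[of "min d d'" d q] polydisc_mono[of "min d d'" d' q] by auto
    then show ?thesis using w d d' by blast
  qed
  show ?thesis unfolding generically_def
    using op dense C(1,4) D(4) by (intro exI[of _ "C \<inter> D"]) blast
qed

lemma polydisc_subset_disc_power:
  assumes "p \<in> disc_power n"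
  obtains e where "e > 0" "polydisc p e \<subseteq> disc_power n"
proof -
  define e where "e = Min (insert 1 ((\<lambda>w. 1 - norm w) ` set p))"
  have "e > 0" unfolding e_def using assms by (subst Min_gr_iff) (auto simp: disc_power_def)
  moreover have "polydisc p e \<subseteq> disc_power n"
  proof
    fix q assume q: "q \<in> polydisc p e"
    have "norm (q ! i) < 1" if "i < length p" for i
    proof -
      have "e \<le> 1 - norm (p ! i)" unfolding e_def using that by (intro Min_le) auto
      moreover have "dist (p ! i) (q ! i) < e" using q that by (simp add: polydisc_iff)
      ultimately show ?thesis using norm_triangle_sub[of "q ! i" "p ! i"] by (simp add: dist_norm norm_minus_commute)
    qed
    then show "q \<in> disc_power n" using q assms by (auto simp: disc_power_def polydisc_iff in_set_conv_nth)
  qed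
  ultimately show ?thesis using that by blast
qed

text \<open>Near a point with b nonzero the holomorphic functions \<open>emb b * f\<close> and
  \<open>a\<close> agree at points of a dense set, hence at that point by continuity.\<close>

lemma extension_unique:
  assumes emb: "is_ring_hom emb" and n: "p \<in> disc_power n" and eq: "generically n (\<lambda>zs. f zs = g zs)"
    and f: "coeff_holomorphic emb f p e'" "e' > 0"
    and a: "coeff_holomorphic emb a p e" "holomorphic_several b p e" "e > 0"
    and ab: "\<forall>q\<in>polydisc p e. b q \<noteq> 0 \<longrightarrow> emb (b q) * g q = a q"
  shows "\<exists>d>0. \<forall>q\<in>polydisc p d. b q \<noteq> 0 \<longrightarrow> g q = f q"
proof -
  obtain e0 where e0: "e0 > 0" "polydisc p e0 \<subseteq> disc_power n" by (rule polydisc_subset_disc_power[OF n])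
  define d where "d = min e0 (min e e')"
  have le: "d \<le> e0" "d \<le> e" "d \<le> e'" and d: "d > 0" using e0 a f by (auto simp: d_def)
  have sub: "polydisc p d \<subseteq> disc_power n" "polydisc p d \<subseteq> polydisc p e"
    using polydisc_mono[OF le(1), of p] polydisc_mono[OF le(2), of p] e0 by auto
  have "g q = f q" if q: "q \<in> polydisc p d" and bq: "b q \<noteq> 0" for q
  proof -
    have "emb (b q) * f q = a q"
    proof (rule coeff_holomorphic_eqI[OF emb coeff_holomorphic_scale[OF emb] _ q])
      show "holomorphic_several b p d" "coeff_holomorphic emb f p d" "coeff_holomorphic emb a p d"
        using le a f holomorphic_several_mono coeff_holomorphic_mono by blast+
      fix s :: real assume s: "s > 0"
      obtain s1 where s1: "s1 > 0" "polydisc q s1 \<subseteq> polydisc p d" by (rule polydisc_open[OF q])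
      obtain s2 where s2: "s2 > 0" "\<forall>q'\<in>polydisc q s2. dist (b q') (b q) < norm (b q)"
        using a(2) q sub(2) bq unfolding holomorphic_several_def by (meson subsetD zero_less_norm_iff)
      define t where "t = min s (min s1 s2)"
      have t: "t > 0" "t \<le> s" "t \<le> s1" "t \<le> s2" using s s1 s2 by (auto simp: t_def)
      obtain q' where q': "q' \<in> polydisc q t" "f q' = g q'" using generically_dense[OF eq, of q t] q sub t by blast
      have mem: "q' \<in> polydisc q s" "q' \<in> polydisc q s1" "q' \<in> polydisc q s2"
        using q'(1) polydisc_mono[OF t(2), of q] polydisc_mono[OF t(3), of q] polydisc_mono[OF t(4), of q] by auto
      have "b q' \<noteq> 0" using s2 mem(3) by (force simp: dist_norm)
      then have "emb (b q') * f q' = a q'" using ab mem(2) s1 sub q'(2) by auto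
      then show "\<exists>q'\<in>polydisc q s. emb (b q') * f q' = a q'" using mem(1) by blast
    qed
    moreover have "emb (b q) * g q = a q" using ab sub q bq by blast
    \<comment> \<open>A nonzero complex number becomes a unit of the coefficient ring, so it can be
      cancelled even in the presence of zero divisors.\<close>
    moreover have "emb (inverse (b q)) * (emb (b q) * v) = v" for v
      using bq by (simp add: mult.assoc[symmetric] is_ring_homD(3)[OF emb, symmetric] is_ring_homD(1)[OF emb])
    ultimately show ?thesis by metis
  qed
  then show ?thesis using d by blast
qed

text \<open>The normalisation of values is what makes this pointwise: if one function is holomorphic
  at \<open>p\<close>, the other extends holomorphically and is therefore holomorphic there too, so
  continuity applies; otherwise both values are 0.\<close>

lemma meromorphic_several_eqI:
  assumes emb: "is_ring_hom emb" and f: "meromorphic_several emb n f" and g: "meromorphic_several emb n g"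
    and eq: "generically n (\<lambda>zs. f zs = g zs)" and p: "p \<in> disc_power n"
  shows "f p = g p"
proof -
  have one: "f p = g p" if f: "meromorphic_several emb n f" and g: "meromorphic_several emb n g"
    and eq: "generically n (\<lambda>zs. f zs = g zs)" and d: "coeff_holomorphic emb f p d" "d > 0" for f g d
  proof -
    obtain e a b where e: "e > 0" and ab: "coeff_holomorphic emb a p e" "holomorphic_several b p e"
        "\<forall>q\<in>polydisc p e. b q \<noteq> 0 \<longrightarrow> emb (b q) * g q = a q"
      and norm: "(\<exists>d>0. coeff_holomorphic emb g p d) \<or>
         g p = 0 \<and> \<not> (\<exists>d>0. \<exists>c. coeff_holomorphic emb c p d \<and> (\<forall>q\<in>polydisc p d. b q \<noteq> 0 \<longrightarrow> g q = c q))"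
      using g[unfolded meromorphic_several_def, rule_format, OF p] by (elim exE conjE) rule
    obtain d0 where d0: "d0 > 0" "\<forall>q\<in>polydisc p d0. b q \<noteq> 0 \<longrightarrow> g q = f q"
      using extension_unique[OF emb p eq d ab(1,2) e ab(3)] by blast
    have "coeff_holomorphic emb f p (min d d0)" "\<forall>q\<in>polydisc p (min d d0). b q \<noteq> 0 \<longrightarrow> g q = f q"
      using d coeff_holomorphic_mono[of emb f p d "min d d0"] d0 polydisc_mono[of "min d d0" d0 p] by auto
    then have "\<exists>d>0. \<exists>c. coeff_holomorphic emb c p d \<and> (\<forall>q\<in>polydisc p d. b q \<noteq> 0 \<longrightarrow> g q = c q)"
      using d(2) d0(1) by (metis min_less_iff_conj)
    then obtain d' where d': "d' > 0" "coeff_holomorphic emb g p d'" using norm by blast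
    show ?thesis
    proof (rule coeff_holomorphic_eqI[OF emb, of f p "min d d'"])
      show "coeff_holomorphic emb f p (min d d')" "coeff_holomorphic emb g p (min d d')"
        using d d' coeff_holomorphic_mono[of emb f p d "min d d'"] coeff_holomorphic_mono[of emb g p d' "min d d'"] by auto
      show "p \<in> polydisc p (min d d')" using d d' by (intro polydisc_self) auto
    qed (use generically_dense[OF eq p] in blast)
  qed
  show ?thesis
  proof (cases "(\<exists>d>0. coeff_holomorphic emb f p d) \<or> (\<exists>d>0. coeff_holomorphic emb g p d)")
    case True
    then show ?thesis
    proof (elim disjE exE conjE)
      fix d :: real assume "d > 0" "coeff_holomorphic emb f p d"
      then show ?thesis using one[OF f g eq] by blast
    next
      fix d :: real assume *: "d > 0" "coeff_holomorphic emb g p d"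
      have "generically n (\<lambda>zs. g zs = f zs)" using eq by (rule generically_mono) auto
      then have "g p = f p" using one[OF g f] * by blast
      then show ?thesis by simp
    qed
  next
    case False
    have "f p = 0" "g p = 0"
      using f[unfolded meromorphic_several_def, rule_format, OF p] g[unfolded meromorphic_several_def, rule_format, OF p] False by blast+
    then show ?thesis by simp
  qed
qed

text \<open>The delicate point is the value at poles. A functional with value 1 at \<open>k\<close>
  recovers f from the product, so an extension of the product would extend f. For
  \<open>k = 0\<close> the product is holomorphic everywhere.\<close>

lemma meromorphic_several_const_mult:
  assumes emb: "is_ring_hom emb" and f: "meromorphic_several (\<lambda>c. c) n f"
  shows "meromorphic_several emb n (\<lambda>zs. emb (f zs) * k)"
  unfolding meromorphic_several_def
proof
  fix p assume p: "p \<in> disc_power n"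
  let ?g = "\<lambda>zs. emb (f zs) * k"
  obtain e a b where e: "e > 0" and ab: "holomorphic_several a p e" "holomorphic_several b p e" "\<exists>q\<in>polydisc p e. b q \<noteq> 0"
        "\<forall>q\<in>polydisc p e. b q \<noteq> 0 \<longrightarrow> b q * f q = a q"
      and norm: "(\<exists>d>0. holomorphic_several f p d) \<or>
         f p = 0 \<and> \<not> (\<exists>d>0. \<exists>c. holomorphic_several c p d \<and> (\<forall>q\<in>polydisc p d. b q \<noteq> 0 \<longrightarrow> f q = c q))"
    using f[unfolded meromorphic_several_def coeff_holomorphic_id, rule_format, OF p] by (elim exE conjE) rule
  have "(\<exists>d>0. coeff_holomorphic emb ?g p d) \<or>
         ?g p = 0 \<and> \<not> (\<exists>d>0. \<exists>c. coeff_holomorphic emb c p d \<and> (\<forall>q\<in>polydisc p d. b q \<noteq> 0 \<longrightarrow> ?g q = c q))"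
  proof (cases "\<exists>d>0. holomorphic_several f p d")
    case True then show ?thesis using coeff_holomorphic_const_mult by blast
  next
    case nh: False
    show ?thesis
    proof (cases "k = 0")
      case True
      have "coeff_holomorphic emb ?g p 1" unfolding True coeff_holomorphic_def by (intro exI[of _ 0]) simp
      then show ?thesis using zero_less_one by blast
    next
      case False
      then obtain \<phi> where \<phi>: "coeff_functional emb \<phi>" "\<phi> k = 1" using coeff_functional_exists[OF emb] by blast
      have "False" if d: "d > 0" and c: "coeff_holomorphic emb c p d" "\<forall>q\<in>polydisc p d. b q \<noteq> 0 \<longrightarrow> ?g q = c q" for d c
      proof -
        have "\<forall>q\<in>polydisc p d. b q \<noteq> 0 \<longrightarrow> f q = \<phi> (c q)"
        proof (intro ballI impI)
          fix q assume "q \<in> polydisc p d" "b q \<noteq> 0"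
          then have "\<phi> (c q) = \<phi> (?g q)" using c(2) by simp
          also have "\<dots> = f q" by (simp add: coeff_functionalD[OF \<phi>(1)] \<phi>(2))
          finally show "f q = \<phi> (c q)" by simp
        qed
        then show False using norm nh coeff_holomorphic_functional[OF c(1) \<phi>(1)] d by blast
      qed
      moreover have "?g p = 0" using norm nh by (simp add: is_ring_homD[OF emb])
      ultimately show ?thesis by blast
    qed
  qed
  moreover have "\<forall>q\<in>polydisc p e. b q \<noteq> 0 \<longrightarrow> emb (b q) * ?g q = emb (a q) * k"
    using ab(4) by (metis is_ring_homD(3)[OF emb] mult.assoc)
  ultimately show "\<exists>e>0. \<exists>a b. coeff_holomorphic emb a p e \<and> holomorphic_several b p e \<and>
      (\<exists>q\<in>polydisc p e. b q \<noteq> 0) \<and> (\<forall>q\<in>polydisc p e. b q \<noteq> 0 \<longrightarrow> emb (b q) * ?g q = a q) \<and>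
      ((\<exists>d>0. coeff_holomorphic emb ?g p d) \<or>
         ?g p = 0 \<and> \<not> (\<exists>d>0. \<exists>c. coeff_holomorphic emb c p d \<and> (\<forall>q\<in>polydisc p d. b q \<noteq> 0 \<longrightarrow> ?g q = c q)))"
    using e ab(2,3) coeff_holomorphic_const_mult[OF ab(1), of emb k]
    by (intro exI[of _ e] conjI exI[of _ "\<lambda>q. emb (a q) * k"] exI[of _ b])
qed

lemma has_coeff_contour_integral_unique:
  assumes emb: "is_ring_hom emb" and "has_coeff_contour_integral emb F I \<gamma>" "has_coeff_contour_integral emb F J \<gamma>"
  shows "I = J"
proof (rule ccontr)
  assume "I \<noteq> J"
  then obtain \<phi> where \<phi>: "coeff_functional emb \<phi>" "\<phi> (I - J) = 1" using coeff_functional_exists[OF emb, of "I - J"] by auto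
  then have "\<phi> I = \<phi> J" using assms(2,3) unfolding has_coeff_contour_integral_def by (metis has_contour_integral_unique)
  then show False using \<phi> by (simp add: coeff_functionalD[OF \<phi>(1)])
qed

lemma has_coeff_contour_integral_cong:
  assumes "has_coeff_contour_integral emb F I \<gamma>" "\<And>z. z \<in> path_image \<gamma> \<Longrightarrow> F z = G z"
  shows "has_coeff_contour_integral emb G I \<gamma>"
  using assms unfolding has_coeff_contour_integral_def by (metis has_contour_integral_eq)

text \<open>Excluding type (0,1) makes the recursion well-founded: each factor is stable or of type
  (0,2) and has a smaller value of 2g + n. The last claim has the form in which
  \<open>length_nths\<close> counts.\<close>

lemma stable_splitting:
  assumes "(g1, I) \<in> splittings g m"
  shows "stable g1 (Suc (card I)) \<or> (g1, Suc (card I)) = (0, 2)"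
    "2 * g1 + card I < 2 * g + m" "g1 \<le> g" "I \<subseteq> {..<m}" "(g - g1, {..<m} - I) \<in> splittings g m"
    "card {i. i < m \<and> i \<in> I} = card I"
proof -
  have I: "g1 \<le> g" "I \<subseteq> {..<m}" "\<not> (g1 = 0 \<and> I = {})" "\<not> (g - g1 = 0 \<and> {..<m} - I = {})"
    using assms by (auto simp: splittings_def)
  have fin: "finite I" using I(2) finite_subset by blast
  show "g1 \<le> g" "I \<subseteq> {..<m}" by fact+
  show "stable g1 (Suc (card I)) \<or> (g1, Suc (card I)) = (0, 2)"
  proof (cases "g1 = 0")
    case True
    then have "card I \<noteq> 0" using I(3) fin by auto
    then show ?thesis using True by (auto simp: stable_def)
  qed (auto simp: stable_def)
  have "card I \<le> m" using card_mono[OF _ I(2)] by simp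
  moreover have "card I < m" if "g1 = g"
    using psubset_card_mono[of "{..<m}" I] I that by auto
  ultimately show "2 * g1 + card I < 2 * g + m" using I(1) by (cases "g1 = g") auto
  show "(g - g1, {..<m} - I) \<in> splittings g m" using I by (auto simp: splittings_def)
  have "{i. i < m \<and> i \<in> I} = I" using I(2) by auto
  then show "card {i. i < m \<and> i \<in> I} = card I" by simp
qed

lemma twisted_bracket_cong:
  assumes eq: "\<And>g' zs' vs'. stable g' (length zs') \<or> (g', length zs') = (0, 2) \<Longrightarrow> 2 * g' + length zs' < 2 * g + Suc (length zs) \<Longrightarrow>
      set zs' \<subseteq> U \<Longrightarrow> length vs' = length zs' \<Longrightarrow> W g' zs' vs' = W' g' zs' vs'"
    and zs: "set zs \<subseteq> U" "z \<in> U" "s \<in> U" and len: "length vs = length zs"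
  shows "twisted_bracket W g z s zs a b vs = twisted_bracket W' g z s zs a b vs"
proof -
  have sub: "set (nths zs I) \<subseteq> U" for I using zs set_nths_subset[of zs I] by auto
  have "W (g - 1) (z # s # zs) (a # b # vs) = W' (g - 1) (z # s # zs) (a # b # vs)" if "g \<noteq> 0"
  proof (rule eq)
    show "stable (g - 1) (length (z # s # zs)) \<or> (g - 1, length (z # s # zs)) = (0, 2)"
      using that by (cases g; cases zs) (auto simp: stable_def)
  qed (use that zs len in auto)
  moreover have "W g1 (z # nths zs I) (a # nths vs I) = W' g1 (z # nths zs I) (a # nths vs I)"
    "W (g - g1) (s # nths zs ({..<length zs} - I)) (b # nths vs ({..<length zs} - I)) =
     W' (g - g1) (s # nths zs ({..<length zs} - I)) (b # nths vs ({..<length zs} - I))"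
    if I: "(g1, I) \<in> splittings g (length zs)" for g1 I
  proof -
    note * = stable_splitting[OF I] stable_splitting[OF stable_splitting(5)[OF I]]
    show "W g1 (z # nths zs I) (a # nths vs I) = W' g1 (z # nths zs I) (a # nths vs I)"
      using * zs sub by (intro eq) (auto simp: length_nths len)
    show "W (g - g1) (s # nths zs ({..<length zs} - I)) (b # nths vs ({..<length zs} - I)) =
     W' (g - g1) (s # nths zs ({..<length zs} - I)) (b # nths vs ({..<length zs} - I))"
      using * zs sub by (intro eq) (auto simp: length_nths len simp del: Diff_iff)
  qed
  ultimately show ?thesis unfolding twisted_bracket_def by (auto intro!: arg_cong2[where f = "(+)"] sum.cong)
qed

lemma twisted_topological_recursion_unique:
  fixes smul :: "'k::field \<Rightarrow> 'a::comm_ring_1 \<Rightarrow> 'a" and emb :: "complex \<Rightarrow> 'l::comm_ring_1"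
  assumes emb: "is_ring_hom emb" and sc: "spectral_curve r x y h"
    and W: "twisted_topological_recursion smul B eps emb \<iota> r x y h W"
    and W': "twisted_topological_recursion smul B eps emb \<iota> r x y h W'"
    and init: "\<And>\<alpha> zs vs. \<alpha> \<in> {1..r} \<Longrightarrow> zs \<in> disc_power 2 \<Longrightarrow> length vs = 2 \<Longrightarrow> W 0 \<alpha> zs vs = W' 0 \<alpha> zs vs"
  shows "stable g n \<Longrightarrow> \<beta> \<in> {1..r} \<Longrightarrow> zs \<in> disc_power n \<Longrightarrow> length vs = n \<Longrightarrow> W g \<beta> zs vs = W' g \<beta> zs vs"
proof (induction "2 * g + n" arbitrary: g n \<beta> zs vs rule: less_induct)
  case less
  let ?K = "\<lambda>W vs zs \<alpha> z. \<Sum>a\<in>B. \<Sum>b\<in>B. \<Sum>k\<in>B. \<Sum>l\<in>B.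
                  emb (recursion_kernel x y h \<alpha> \<beta> z (hd zs)) *
                  \<iota> (frob_form eps (k * l) (hd vs) * frob_inv B eps k a * frob_inv B eps l b) *
                  (twisted_bracket (\<lambda>g. W g \<alpha>) g z (deck (x \<alpha>) z) (tl zs) a b (tl vs) *
                   emb (deriv (deck (x \<alpha>)) z))"
  let ?R = "\<lambda>W zs. \<exists>I. (\<forall>\<alpha>\<in>{1..r}. \<forall>\<^sub>F \<rho> in at_right 0. has_coeff_contour_integral emb (?K W vs zs \<alpha>) (I \<alpha>) (circlepath 0 \<rho>)) \<and>
          W g \<beta> zs vs = emb (1 / (2 * pi * \<i>)) * (\<Sum>\<alpha>\<in>{1..r}. I \<alpha>)"
  have "n \<ge> 1" using less.prems(1) by (simp add: stable_def)
  note def = twisted_topological_recursion_def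
  have gen: "generically n (?R W)" "generically n (?R W')"
    by (rule W[unfolded def, THEN conjunct2, rule_format, OF less.prems(2,1,4)],
        rule W'[unfolded def, THEN conjunct2, rule_format, OF less.prems(2,1,4)])
  have "generically n (\<lambda>zs. W g \<beta> zs vs = W' g \<beta> zs vs)"
  proof (rule generically_mono[OF generically_conj[OF gen]], elim conjE exE)
    fix zs I J
    assume zs: "zs \<in> disc_power n"
      and I: "\<forall>\<alpha>\<in>{1..r}. \<forall>\<^sub>F \<rho> in at_right 0. has_coeff_contour_integral emb (?K W vs zs \<alpha>) (I \<alpha>) (circlepath 0 \<rho>)"
        "W g \<beta> zs vs = emb (1 / (2 * pi * \<i>)) * (\<Sum>\<alpha>\<in>{1..r}. I \<alpha>)"
      and J: "\<forall>\<alpha>\<in>{1..r}. \<forall>\<^sub>F \<rho> in at_right 0. has_coeff_contour_integral emb (?K W' vs zs \<alpha>) (J \<alpha>) (circlepath 0 \<rho>)"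
        "W' g \<beta> zs vs = emb (1 / (2 * pi * \<i>)) * (\<Sum>\<alpha>\<in>{1..r}. J \<alpha>)"
    have "I \<alpha> = J \<alpha>" if \<alpha>: "\<alpha> \<in> {1..r}" for \<alpha>
    proof -
      \<comment> \<open>A common radius below 1 keeps the circle inside the disc, where the
        induction hypothesis applies to z and to its image under the involution.\<close>
      have "\<forall>\<^sub>F \<rho> in at_right 0. \<rho> \<in> {0<..<1 :: real}" by (rule eventually_at_right_real) simp
      moreover note bspec[OF I(1) \<alpha>] bspec[OF J(1) \<alpha>]
      ultimately have "\<forall>\<^sub>F \<rho> in at_right 0. \<rho> \<in> {0<..<1 :: real} \<and> has_coeff_contour_integral emb (?K W vs zs \<alpha>) (I \<alpha>) (circlepath 0 \<rho>)
          \<and> has_coeff_contour_integral emb (?K W' vs zs \<alpha>) (J \<alpha>) (circlepath 0 \<rho>)"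
        by eventually_elim blast
      from eventually_happens'[OF trivial_limit_at_right_real this] obtain \<rho> where \<rho>: "0 < \<rho>" "\<rho> < 1" and IJ: "has_coeff_contour_integral emb (?K W vs zs \<alpha>) (I \<alpha>) (circlepath 0 \<rho>)"
         "has_coeff_contour_integral emb (?K W' vs zs \<alpha>) (J \<alpha>) (circlepath 0 \<rho>)" by auto
      have "?K W vs zs \<alpha> z = ?K W' vs zs \<alpha> z" if z: "z \<in> path_image (circlepath 0 \<rho>)" for z
      proof -
        have zb: "z \<in> ball 0 1" using z \<rho> by auto
        have "deck (x \<alpha>) z \<in> ball 0 1"
          by (rule deck_in_ball[OF _ zb]) (use sc \<alpha> in \<open>auto simp: spectral_curve_def\<close>)
        then have "twisted_bracket (\<lambda>g. W g \<alpha>) g z (deck (x \<alpha>) z) (tl zs) a b (tl vs)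
            = twisted_bracket (\<lambda>g. W' g \<alpha>) g z (deck (x \<alpha>) z) (tl zs) a b (tl vs)" for a b
        proof (intro twisted_bracket_cong[where U = "ball 0 1"] zb)
          show "set (tl zs) \<subseteq> ball 0 1" using zs list.set_sel(2)[of zs] by (cases zs) (auto simp: disc_power_def)
          show "length (tl vs) = length (tl zs)" using zs less.prems by (simp add: disc_power_def)
          fix g' and zs' :: "complex list" and vs' :: "'a list"
          assume st: "stable g' (length zs') \<or> (g', length zs') = (0, 2)" and lt: "2 * g' + length zs' < 2 * g + Suc (length (tl zs))"
            and sub: "set zs' \<subseteq> ball 0 1" and len: "length vs' = length zs'"
          have "Suc (length (tl zs)) = n" using zs \<open>n \<ge> 1\<close> by (simp add: disc_power_def)
          then show "W g' \<alpha> zs' vs' = W' g' \<alpha> zs' vs'"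
            using st lt sub len \<alpha> less.hyps[of g' "length zs'" \<alpha> zs' vs'] init[of \<alpha> zs' vs']
            by (auto simp: disc_power_def)
        qed
        then show ?thesis by simp
      qed
      then have "has_coeff_contour_integral emb (?K W' vs zs \<alpha>) (I \<alpha>) (circlepath 0 \<rho>)"
        by (rule has_coeff_contour_integral_cong[OF IJ(1)])
      then show ?thesis using has_coeff_contour_integral_unique[OF emb] IJ(2) by blast
    qed
    then show "W g \<beta> zs vs = W' g \<beta> zs vs" using I(2) J(2) by (metis (mono_tags, lifting) sum.cong)
  qed
  moreover have "meromorphic_several emb n (\<lambda>zs. W g \<beta> zs vs)" "meromorphic_several emb n (\<lambda>zs. W' g \<beta> zs vs)"
    using W[unfolded def, THEN conjunct1, rule_format, OF less.prems(2)] W'[unfolded def, THEN conjunct1, rule_format, OF less.prems(2)]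
      less.prems by blast+
  ultimately show ?case using meromorphic_several_eqI[OF emb] less.prems by blast
qed

section \<open>The two-dimensional TQFT\<close>

lemma prod_list_update:
  fixes vs :: "'a::comm_monoid_mult list"
  shows "i < length vs \<Longrightarrow> \<exists>R. \<forall>v. prod_list (vs[i := v]) = v * R"
proof (induction vs arbitrary: i)
  case (Cons w vs)
  show ?case
  proof (cases i)
    case (Suc j)
    then obtain R where "\<forall>v. prod_list (vs[j := v]) = v * R" using Cons by auto
    then show ?thesis unfolding Suc by (intro exI[of _ "w * R"]) (simp add: mult.left_commute)
  qed auto
qed simp

lemma prod_list_nths:
  fixes vs :: "'a::comm_monoid_mult list"
  shows "prod_list (nths vs I) * prod_list (nths vs ({..<length vs} - I)) = prod_list vs"
proof (induction vs arbitrary: I)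
  case (Cons v vs)
  have *: "{j. Suc j \<in> {..<length (v # vs)} - I} = {..<length vs} - {j. Suc j \<in> I}" by auto
  show ?case unfolding nths_Cons * using Cons[of "{j. Suc j \<in> I}", symmetric]
    by (auto simp: mult_ac)
qed simp

context frobenius_algebra
begin

section \<open>Dual bases and contractions\<close>

lemma mult_smul: "u * smul c v = smul c (u * v)" "smul c u * v = smul c (u * v)"
  using smul_mult_left[of c v u] smul_mult_left[of c u v] by (simp_all add: mult.commute)

lemma eps_simps: "eps (u + v) = eps u + eps v" "eps (smul c v) = c * eps v" "eps 0 = 0" "eps (u - v) = eps u - eps v"
  "eps (sum f I) = (\<Sum>i\<in>I. eps (f i))"
proof -
  interpret l: Vector_Spaces.linear smul "(*)" eps by (rule linear_eps)
  show "eps (u + v) = eps u + eps v" "eps (smul c v) = c * eps v" "eps 0 = 0" "eps (u - v) = eps u - eps v"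
    "eps (sum f I) = (\<Sum>i\<in>I. eps (f i))" by (auto simp: l.add l.scale l.zero l.diff l.sum)
qed

lemma in_span_basis: obtains r where "v = (\<Sum>b\<in>B. smul (r b) b)"
proof -
  have "v \<in> span B" using span_Basis by simp
  then show ?thesis using that unfolding span_finite[OF finite_Basis] by blast
qed

lemma eps_eqI:
  assumes "\<And>b. b \<in> B \<Longrightarrow> eps (u * b) = eps (v * b)"
  shows "u = v"
proof -
  have "eps ((u - v) * w) = 0" for w
  proof -
    obtain r where "w = (\<Sum>b\<in>B. smul (r b) b)" by (rule in_span_basis)
    then show ?thesis using assms by (simp add: sum_distrib_left mult_smul eps_simps left_diff_distrib)
  qed
  then show ?thesis using nondegenerate[of "u - v"] by simp
qed

lemma basis_coefficients:
  assumes "(\<Sum>b\<in>B. smul (r b) b) = (\<Sum>b\<in>B. smul (s b) b)" "b \<in> B"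
  shows "r b = s b"
proof -
  have "(\<Sum>b\<in>B. smul (r b - s b) b) = 0" using assms(1) by (simp add: scale_left_diff_distrib sum_subtractf)
  then have "r b - s b = 0" using independentD[OF independent_Basis finite_Basis subset_refl, where u = "\<lambda>b. r b - s b" and v = b] assms(2) by blast
  then show ?thesis by simp
qed

text \<open>The linear map \<open>T\<close> is injective by nondegeneracy, hence surjective in
  finite dimension. Preimages of the basis vectors form the dual basis, and their coordinates are
  the entries of the inverse matrix.\<close>

lemma gram_inverse_exists: "\<exists>M. \<forall>a\<in>B. \<forall>b\<in>B. (\<Sum>c\<in>B. frob_form eps a c * M c b) = (if a = b then 1 else 0)"
proof -
  define T where "T u = (\<Sum>a\<in>B. smul (eps (a * u)) a)" for u
  have lin: "Vector_Spaces.linear smul smul T"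
    unfolding T_def Vector_Spaces.linear_iff
    by (auto simp: vector_space_axioms distrib_left eps_simps scale_left_distrib sum.distrib mult_smul scale_sum_right)
  have "u = v" if "T u = T v" for u v
    using basis_coefficients[OF that[unfolded T_def]] by (intro eps_eqI) (simp add: mult.commute)
  then have "surj T" by (intro linear_inj_imp_surj[OF lin] injI)
  then have "\<forall>b. \<exists>u. T u = b" by (metis surjD)
  then obtain D where D: "\<And>b. T (D b) = b" by metis
  have eps_D: "eps (a * D b) = (if a = b then 1 else 0)" if "a \<in> B" "b \<in> B" for a b
  proof (rule basis_coefficients[of "\<lambda>a. eps (a * D b)"])
    have "(\<Sum>a\<in>B. smul (if a = b then 1 else 0) a) = (\<Sum>a\<in>B. if a = b then a else 0)" by (intro sum.cong) auto
    also have "\<dots> = b" using that finite_Basis by simp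
    finally show "(\<Sum>a\<in>B. smul (eps (a * D b)) a) = (\<Sum>a\<in>B. smul (if a = b then 1 else 0) a)"
      using D[of b] by (simp add: T_def)
  qed (rule that)
  have "\<forall>b. \<exists>r. D b = (\<Sum>c\<in>B. smul (r c) c)" using in_span_basis by metis
  then obtain M where M: "\<And>b. D b = (\<Sum>c\<in>B. smul (M b c) c)" by metis
  have "(\<Sum>c\<in>B. frob_form eps a c * M b c) = eps (a * D b)" for a b
    unfolding M by (simp add: frob_form_def sum_distrib_left mult_smul eps_simps mult.commute)
  then show ?thesis using eps_D by (intro exI[of _ "\<lambda>c b. M b c"]) simp
qed

definition dual_basis :: "'a \<Rightarrow> 'a" where
  "dual_basis b = (\<Sum>c\<in>B. smul (frob_inv B eps c b) c)"

lemma eps_dual_basis: "a \<in> B \<Longrightarrow> b \<in> B \<Longrightarrow> eps (a * dual_basis b) = (if a = b then 1 else 0)"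
  using someI_ex[OF gram_inverse_exists, folded frob_inv_def]
  by (auto simp: dual_basis_def sum_distrib_left mult_smul eps_simps frob_form_def mult.commute)

lemma dual_basis_expansion: "(\<Sum>b\<in>B. smul (eps (v * b)) (dual_basis b)) = v"
proof (rule eps_eqI)
  fix a assume a: "a \<in> B"
  have "eps ((\<Sum>b\<in>B. smul (eps (v * b)) (dual_basis b)) * a) = (\<Sum>b\<in>B. eps (v * b) * eps (dual_basis b * a))"
    by (simp add: sum_distrib_right mult_smul eps_simps)
  also have "\<dots> = (\<Sum>b\<in>B. if a = b then eps (v * a) else 0)" using a by (intro sum.cong) (auto simp: eps_dual_basis mult.commute[of "dual_basis _" a])
  also have "\<dots> = eps (v * a)" using a finite_Basis by simp
  finally show "eps ((\<Sum>b\<in>B. smul (eps (v * b)) (dual_basis b)) * a) = eps (v * a)" .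
qed

lemma eps_dual_sum: "(\<Sum>b\<in>B. eps (u * dual_basis b) * eps (v * b)) = eps (u * v)"
  by (subst (2) dual_basis_expansion[of v, symmetric]) (simp add: sum_distrib_left mult_smul eps_simps mult.commute)

lemma frob_inv_sum: "(\<Sum>a\<in>B. \<Sum>b\<in>B. frob_inv B eps a b * (eps (u * a) * eps (v * b))) = eps (u * v)"
proof -
  have "(\<Sum>a\<in>B. \<Sum>b\<in>B. frob_inv B eps a b * (eps (u * a) * eps (v * b))) = (\<Sum>b\<in>B. eps (u * dual_basis b) * eps (v * b))"
    by (subst sum.swap) (simp add: dual_basis_def sum_distrib_left sum_distrib_right mult_smul eps_simps mult.assoc)
  then show ?thesis by (simp add: eps_dual_sum)
qed

definition handle :: 'a where
  "handle = (\<Sum>b\<in>B. dual_basis b * b)"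

lemma handle_sum: "(\<Sum>a\<in>B. \<Sum>b\<in>B. eps (u * (a * b)) * frob_inv B eps a b) = eps (u * handle)"
  unfolding handle_def dual_basis_def
  by (subst sum.swap) (simp add: sum_distrib_left sum_distrib_right mult_smul eps_simps mult_ac)

text \<open>Raising both indices of \<eta>(e_k e_l, v) replaces the two basis vectors by dual
  ones.\<close>

lemma structure_sum:
  "(\<Sum>k\<in>B. \<Sum>l\<in>B. frob_form eps (k * l) v * frob_inv B eps k a * frob_inv B eps l b) = eps (dual_basis a * dual_basis b * v)"
  unfolding dual_basis_def sum_product unfolding sum_distrib_right by (simp add: eps_simps mult_smul frob_form_def mult_ac)

text \<open>Summation over b contracts a dual pair and leaves products of a with its dual, whose sum
  is the handle element. This is the algebraic factor of the genus-lowering term.\<close>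

lemma handle_gluing: "(\<Sum>a\<in>B. \<Sum>b\<in>B. eps (dual_basis a * dual_basis b * v) * eps (u * (a * b))) = eps (v * u * handle)"
proof -
  have "(\<Sum>b\<in>B. eps (dual_basis a * dual_basis b * v) * eps (u * (a * b))) = eps (v * u * (dual_basis a * a))" for a
    using eps_dual_sum[of "dual_basis a * v" "u * a"] by (simp add: mult_ac)
  then show ?thesis by (simp add: handle_def sum_distrib_left eps_simps)
qed

text \<open>Two successive contractions merge the factors of a product term; no handle
  arises.\<close>

lemma split_gluing: "(\<Sum>a\<in>B. \<Sum>b\<in>B. eps (dual_basis a * dual_basis b * v) * (eps (u * a) * eps (w * b))) = eps (v * (u * w))"
proof -
  have "(\<Sum>b\<in>B. eps (dual_basis a * dual_basis b * v) * (eps (u * a) * eps (w * b))) = eps (v * w * dual_basis a) * eps (u * a)" for a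
  proof -
    have "(\<Sum>b\<in>B. eps (dual_basis a * dual_basis b * v) * (eps (u * a) * eps (w * b))) =
        eps (u * a) * (\<Sum>b\<in>B. eps ((dual_basis a * v) * dual_basis b) * eps (w * b))"
      by (simp add: sum_distrib_left mult_ac)
    then show ?thesis unfolding eps_dual_sum by (simp add: mult_ac)
  qed
  then show ?thesis using eps_dual_sum[of "v * w" u] by (simp add: mult.assoc mult.commute[of w])
qed

section \<open>The TQFT and the factorisation of the twisted bracket\<close>

definition tqft_form :: "nat \<Rightarrow> 'a list \<Rightarrow> 'k" where
  "tqft_form g vs = eps (prod_list vs * handle ^ g)"

lemma multilinear_tqft_form: "multilinear_form smul (*) n (tqft_form g)"
  unfolding multilinear_form_def
proof (intro allI impI)
  fix vs :: "'a list" and i assume "length vs = n" "i < n"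
  then obtain R where R: "\<And>v. prod_list (vs[i := v]) = v * R" using prod_list_update[of i vs] by auto
  show "Vector_Spaces.linear smul (*) (\<lambda>v. tqft_form g (vs[i := v]))"
    unfolding Vector_Spaces.linear_iff
    using vector_space_axioms vector_space_over_itself.vector_space_axioms
    by (auto simp: tqft_form_def R distrib_right eps_simps mult_smul)
qed

lemma tqft_tqft_form: "tqft smul B eps tqft_form"
  unfolding tqft_def
proof (intro conjI allI impI)
  fix g :: nat and us vs :: "'a list" assume "mset us = mset vs"
  then show "tqft_form g us = tqft_form g vs" unfolding tqft_form_def by (metis prod_mset_prod_list)
next
  fix g :: nat and vs :: "'a list" assume "g \<ge> 1"
  then obtain h where h: "g = Suc h" by (cases g) auto
  show "tqft_form g vs = (\<Sum>a\<in>B. \<Sum>b\<in>B. tqft_form (g - 1) (vs @ [a, b]) * frob_inv B eps a b)"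
    using handle_sum[of "prod_list vs * handle ^ h"] by (simp add: tqft_form_def h mult_ac)
next
  fix g1 g2 and us vs :: "'a list"
  show "tqft_form (g1 + g2) (us @ vs) = (\<Sum>a\<in>B. \<Sum>b\<in>B. frob_inv B eps a b * tqft_form g1 (us @ [a]) * tqft_form g2 (vs @ [b]))"
    using frob_inv_sum[of "prod_list us * handle ^ g1" "prod_list vs * handle ^ g2"]
    by (simp add: tqft_form_def power_add mult_ac)
qed (auto simp: multilinear_tqft_form tqft_form_def frob_form_def mult_ac)

lemma twisted_bracket_tqft_form:
  assumes emb: "is_ring_hom emb" and \<iota>: "is_ring_hom \<iota>" and len: "length vs = length zs"
  shows "(\<Sum>a\<in>B. \<Sum>b\<in>B. \<Sum>k\<in>B. \<Sum>l\<in>B. \<iota> (frob_form eps (k * l) v * frob_inv B eps k a * frob_inv B eps l b) *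
      twisted_bracket (\<lambda>g zs vs. emb (W g zs) * \<iota> (tqft_form g vs)) g z s zs a b vs)
    = emb (bracket W g z s zs) * \<iota> (tqft_form g (v # vs))"
proof -
  let ?e = "\<lambda>a b. eps (dual_basis a * dual_basis b * v)"
  let ?t = "\<lambda>a b. twisted_bracket (\<lambda>g zs vs. emb (W g zs) * \<iota> (tqft_form g vs)) g z s zs a b vs"
  \<comment> \<open>Separates the analytic from the algebraic factor in each term. For g = 0 the
    first algebraic factor is a dummy, multiplied by 0.\<close>
  have tb: "?t a b = emb (if g = 0 then 0 else W (g - 1) (z # s # zs)) * \<iota> (tqft_form (g - 1) (a # b # vs)) +
     (\<Sum>(g1, I)\<in>splittings g (length zs).
        emb (W g1 (z # nths zs I) * W (g - g1) (s # nths zs ({..<length zs} - I))) *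
        \<iota> (tqft_form g1 (a # nths vs I) * tqft_form (g - g1) (b # nths vs ({..<length zs} - I))))" for a b
    unfolding twisted_bracket_def
    by (auto simp: is_ring_homD[OF emb] is_ring_homD[OF \<iota>] mult_ac intro!: sum.cong)
  have A: "(\<Sum>a\<in>B. \<Sum>b\<in>B. ?e a b * tqft_form (g - 1) (a # b # vs)) = tqft_form g (v # vs)" if g: "g \<noteq> 0"
  proof -
    obtain h where h: "g = Suc h" using g by (cases g) auto
    show ?thesis using handle_gluing[of v "prod_list vs * handle ^ h"] by (simp add: tqft_form_def h mult_ac)
  qed
  have S: "(\<Sum>a\<in>B. \<Sum>b\<in>B. ?e a b * (tqft_form g1 (a # nths vs I) * tqft_form (g - g1) (b # nths vs ({..<length zs} - I)))) = tqft_form g (v # vs)"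
    if "(g1, I) \<in> splittings g (length zs)" for g1 I
  proof -
    have "g = g1 + (g - g1)" using stable_splitting(3)[OF that] by simp
    then have "handle ^ g = handle ^ g1 * handle ^ (g - g1)" by (metis power_add)
    then show ?thesis
      using split_gluing[of v "prod_list (nths vs I) * handle ^ g1" "prod_list (nths vs ({..<length zs} - I)) * handle ^ (g - g1)"]
        prod_list_nths[of vs I, symmetric] by (simp add: tqft_form_def len mult_ac)
  qed
  have "(\<Sum>a\<in>B. \<Sum>b\<in>B. \<Sum>k\<in>B. \<Sum>l\<in>B. \<iota> (frob_form eps (k * l) v * frob_inv B eps k a * frob_inv B eps l b) * ?t a b)
      = (\<Sum>a\<in>B. \<Sum>b\<in>B. \<iota> (?e a b) * ?t a b)"
    by (simp add: structure_sum[symmetric] is_ring_hom_sum[OF \<iota>] sum_distrib_right)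
  also have "\<dots> = emb (if g = 0 then 0 else W (g - 1) (z # s # zs)) * \<iota> (\<Sum>a\<in>B. \<Sum>b\<in>B. ?e a b * tqft_form (g - 1) (a # b # vs)) +
     (\<Sum>(g1, I)\<in>splittings g (length zs). emb (W g1 (z # nths zs I) * W (g - g1) (s # nths zs ({..<length zs} - I))) *
       \<iota> (\<Sum>a\<in>B. \<Sum>b\<in>B. ?e a b * (tqft_form g1 (a # nths vs I) * tqft_form (g - g1) (b # nths vs ({..<length zs} - I)))))"
  proof -
    have swap: "(\<Sum>a\<in>B. \<Sum>b\<in>B. \<Sum>x\<in>X. f a b x) = (\<Sum>x\<in>X. \<Sum>a\<in>B. \<Sum>b\<in>B. f a b x)" for X and f :: "_ \<Rightarrow> _ \<Rightarrow> _ \<Rightarrow> 'b"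
    proof -
      have "(\<Sum>b\<in>B. \<Sum>x\<in>X. f a b x) = (\<Sum>x\<in>X. \<Sum>b\<in>B. f a b x)" for a by (rule sum.swap)
      then show ?thesis by (simp only: sum.swap[of _ X B])
    qed
    show ?thesis unfolding tb distrib_left sum.distrib sum_distrib_left swap
      by (intro arg_cong2[where f = "(+)"] sum.cong refl)
        (auto simp: is_ring_hom_sum[OF \<iota>] is_ring_homD[OF \<iota>] sum_distrib_left mult_ac)
  qed
  also have "\<dots> = emb (if g = 0 then 0 else W (g - 1) (z # s # zs)) * \<iota> (tqft_form g (v # vs)) +
     (\<Sum>(g1, I)\<in>splittings g (length zs). emb (W g1 (z # nths zs I) * W (g - g1) (s # nths zs ({..<length zs} - I))) * \<iota> (tqft_form g (v # vs)))"
    using A S by (auto simp: is_ring_homD[OF emb] intro!: arg_cong2[where f = "(+)"] sum.cong)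
  also have "\<dots> = emb (bracket W g z s zs) * \<iota> (tqft_form g (v # vs))"
    unfolding bracket_def by (simp add: is_ring_homD[OF emb] is_ring_hom_sum[OF emb] sum_distrib_right distrib_right case_prod_unfold)
  finally show ?thesis .
qed

lemma multilinear_scaled_tqft_form:
  assumes \<iota>: "is_ring_hom \<iota>"
  shows "multilinear_form smul (\<lambda>c l. \<iota> c * l) n (\<lambda>vs. c * \<iota> (tqft_form g vs))"
  unfolding multilinear_form_def
proof (intro allI impI)
  fix vs :: "'a list" and i assume "length vs = n" "i < n"
  then have "Vector_Spaces.linear smul (*) (\<lambda>v. tqft_form g (vs[i := v]))"
    using multilinear_tqft_form unfolding multilinear_form_def by blast
  then show "Vector_Spaces.linear smul (\<lambda>c l. \<iota> c * l) (\<lambda>v. c * \<iota> (tqft_form g (vs[i := v])))"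
    unfolding Vector_Spaces.linear_iff
    using vector_space_axioms ring_hom_vector_space[OF \<iota>] by (auto simp: is_ring_homD[OF \<iota>] distrib_left mult.left_commute)
qed

end

section \<open>Existence\<close>

lemma meromorphic_several_cong:
  assumes f: "meromorphic_several emb n f" and eq: "\<And>q. length q = n \<Longrightarrow> f q = g q"
  shows "meromorphic_several emb n g"
  unfolding meromorphic_several_def
proof
  fix p assume p: "p \<in> disc_power n"
  have fg: "f q = g q" if "q \<in> polydisc p d" for q d
    using that p by (intro eq) (simp add: polydisc_iff disc_power_def)
  have h: "coeff_holomorphic emb f p d \<longleftrightarrow> coeff_holomorphic emb g p d" for d
    unfolding coeff_holomorphic_def by (simp add: fg cong: ball_cong)
  have "f p = g p" using eq p by (simp add: disc_power_def)
  with f[unfolded meromorphic_several_def, rule_format, OF p]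
  show "\<exists>e>0. \<exists>a b. coeff_holomorphic emb a p e \<and> holomorphic_several b p e \<and>
        (\<exists>q\<in>polydisc p e. b q \<noteq> 0) \<and> (\<forall>q\<in>polydisc p e. b q \<noteq> 0 \<longrightarrow> emb (b q) * g q = a q) \<and>
        ((\<exists>d>0. coeff_holomorphic emb g p d) \<or>
         g p = 0 \<and> \<not> (\<exists>d>0. \<exists>c. coeff_holomorphic emb c p d \<and> (\<forall>q\<in>polydisc p d. b q \<noteq> 0 \<longrightarrow> g q = c q)))"
    by (simp add: fg h cong: ball_cong)
qed

lemma generically_nonzero: "generically n (\<lambda>zs. 0 \<notin> set zs)"
  unfolding generically_def
proof (intro exI[of _ "{zs \<in> disc_power n. 0 \<notin> set zs}"] conjI ballI allI impI)
  fix p assume p: "p \<in> {zs \<in> disc_power n. 0 \<notin> set zs}"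
  then obtain e where e: "e > 0" "polydisc p e \<subseteq> disc_power n" using polydisc_subset_disc_power by blast
  define d where "d = Min (insert e (norm ` set p))"
  have d: "d > 0" "d \<le> e" unfolding d_def using p e by auto
  have "0 \<notin> set q" if q: "q \<in> polydisc p d" for q
  proof
    assume "0 \<in> set q"
    then obtain i where i: "i < length p" "q ! i = 0" using q by (auto simp: in_set_conv_nth polydisc_iff)
    then have "norm (p ! i) < d" using q by (auto simp: polydisc_iff dist_norm)
    moreover have "d \<le> norm (p ! i)" unfolding d_def using i by (intro Min_le) auto
    ultimately show False by simp
  qed
  then show "\<exists>e>0. polydisc p e \<subseteq> {zs \<in> disc_power n. 0 \<notin> set zs}"
    using d e polydisc_mono[OF d(2), of p] by (intro exI[of _ d]) auto
next
  fix p and e :: real assume p: "p \<in> disc_power n" and e: "e > 0"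
  define c where "c = min (e / 2) (1 / 2)"
  have c: "0 < c" "c < e" "c < 1" using e by (auto simp: c_def min_def)
  have "map (\<lambda>w. if w = 0 then of_real c else w) p \<in> polydisc p e \<inter> {zs \<in> disc_power n. 0 \<notin> set zs}"
    using p c e by (auto simp: polydisc_iff disc_power_def dist_norm)
  then show "polydisc p e \<inter> {zs \<in> disc_power n. 0 \<notin> set zs} \<noteq> {}" by blast
qed auto

lemma generically_off_diagonal: "generically 2 (\<lambda>zs. zs ! 0 \<noteq> zs ! 1)"
  unfolding generically_def
proof (intro exI[of _ "{zs \<in> disc_power 2. zs ! 0 \<noteq> zs ! 1}"] conjI ballI allI impI)
  fix p assume p: "p \<in> {zs \<in> disc_power 2. zs ! 0 \<noteq> zs ! 1}"
  then have len: "length p = 2" by (simp add: disc_power_def)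
  obtain e where e: "e > 0" "polydisc p e \<subseteq> disc_power 2" using p polydisc_subset_disc_power by blast
  define d where "d = min e (dist (p ! 0) (p ! 1) / 2)"
  have d: "d > 0" "d \<le> e" "d \<le> dist (p ! 0) (p ! 1) / 2" unfolding d_def using p e by auto
  have "q ! 0 \<noteq> q ! 1" if q: "q \<in> polydisc p d" for q
  proof
    assume eq: "q ! 0 = q ! 1"
    have "dist (p ! 0) (q ! 0) < d" "dist (p ! 1) (q ! 1) < d" using q len by (auto simp: polydisc_iff)
    then show False using eq d(3) dist_triangle2[of "p ! 0" "p ! 1" "q ! 0"] by simp
  qed
  then show "\<exists>e>0. polydisc p e \<subseteq> {zs \<in> disc_power 2. zs ! 0 \<noteq> zs ! 1}"
    using d e polydisc_mono[OF d(2), of p] by (intro exI[of _ d]) auto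
next
  fix p and e :: real assume p: "p \<in> disc_power 2" and e: "e > 0"
  then obtain a b where ab: "p = [a, b]" "norm a < 1" "norm b < 1" by (auto simp: disc_power_def length_Suc_conv numeral_2_eq_2)
  define c where "c = min (e / 2) ((1 - norm a) / 2)"
  have c: "0 < c" "c < e" "c < 1 - norm a" using e ab by (auto simp: c_def min_def)
  have n: "norm (a + of_real c) < 1" using norm_triangle_ineq[of a "of_real c"] c by simp
  have "- a - of_real c = - (a + of_real c)" by simp
  then have n': "norm (- a - of_real c) < 1" using n by (metis norm_minus_cancel)
  have "(if a = b then [a + of_real c, b] else p) \<in> polydisc p e \<inter> {zs \<in> disc_power 2. zs ! 0 \<noteq> zs ! 1}"
    using p c e ab n n' by (auto simp: disc_power_def polydisc_def dist_norm)
  then show "polydisc p e \<inter> {zs \<in> disc_power 2. zs ! 0 \<noteq> zs ! 1} \<noteq> {}" by blast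
qed auto

lemma W02_eq: "z1 \<noteq> z2 \<Longrightarrow> W02 h b z1 z2 = 1 / (z1 - z2)\<^sup>2"
  unfolding W02_def cauchy_kernel_def
  by (rule DERIV_imp_deriv) (auto intro!: derivative_eq_intros simp: power2_eq_square field_simps)

lemma (in local_curve) meromorphic_correlator:
  assumes "stable g n \<or> (g, n) = (0, 2)"
  shows "meromorphic_several (\<lambda>c. c) n (correlator g)"
proof (cases "(g, n) = (0, 2)")
  case True
  have "correlator g q = 1 / (q ! 0 - q ! 1)\<^sup>2" if "length q = n" for q
    using that True by (auto simp: length_Suc_conv numeral_2_eq_2 correlator_def)
  then show ?thesis using meromorphic_several_cong[OF meromorphic_inverse_square_diff] True by (metis Pair_inject)
next
  case False
  then have st: "stable g n" using assms by blast
  let ?K = "3 * (2 * g + n - 2)"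
  \<comment> \<open>Zero coefficients pad all modes below the cutoff to a common number of powers of
    1/z.\<close>
  have "\<eta> k z = (\<Sum>r<2 * ?K + 1. (if r \<le> Suc (2 * k) then (P ^ r) $ Suc (2 * k) else 0) * inverse z ^ Suc r)" if "k < ?K" for k z
  proof -
    have "(\<Sum>r\<le>Suc (2 * k). (P ^ r) $ Suc (2 * k) * inverse z ^ Suc r) =
        (\<Sum>r<2 * ?K + 1. (if r \<le> Suc (2 * k) then (P ^ r) $ Suc (2 * k) else 0) * inverse z ^ Suc r)"
      by (rule sum.mono_neutral_cong_left) (use that in auto)
    then show ?thesis unfolding \<eta>_def pole_fun_def .
  qed
  then have "meromorphic_several (\<lambda>c. c) n (ev ?K (F (2 * g + n - 2)))"
    by (rule meromorphic_eval_modes) simp_all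
  then show ?thesis by (rule meromorphic_several_cong) (use st correlator_stable in auto)
qed

text \<open>Hides the local coordinate, which varies with the disc, so that solutions on all discs
  can be chosen at once.\<close>

definition disc_solution ::
    "(nat \<Rightarrow> complex \<Rightarrow> complex) \<Rightarrow> (nat \<Rightarrow> complex \<Rightarrow> complex) \<Rightarrow> (nat \<Rightarrow> complex \<Rightarrow> complex) \<Rightarrow> nat
      \<Rightarrow> (nat \<Rightarrow> complex list \<Rightarrow> complex) \<Rightarrow> bool" where
  "disc_solution x y h \<alpha> W \<longleftrightarrow>
    (\<forall>g n. stable g n \<or> (g, n) = (0, 2) \<longrightarrow> meromorphic_several (\<lambda>c. c) n (W g)) \<and>
    (\<forall>g zs zs'. mset zs = mset zs' \<longrightarrow> W g zs = W g zs') \<and>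
    (\<forall>z1 z2. W 0 [z1, z2] = 1 / (z1 - z2)\<^sup>2) \<and>
    (\<forall>g z1 zs. stable g (Suc (length zs)) \<longrightarrow> z1 \<noteq> 0 \<longrightarrow> 0 \<notin> set zs \<longrightarrow> (\<forall>\<^sub>F \<rho> in at_right 0.
     ((\<lambda>z. recursion_kernel x y h \<alpha> \<alpha> z z1 * (bracket W g z (deck (x \<alpha>) z) zs * deriv (deck (x \<alpha>)) z))
        has_contour_integral 2 * pi * \<i> * W g (z1 # zs)) (circlepath 0 \<rho>)))"

lemma disc_solution_exists:
  assumes sc: "spectral_curve r x y h" and \<alpha>: "\<alpha> \<in> {1..r}"
  shows "\<exists>W. disc_solution x y h \<alpha> W"
proof -
  obtain a b where "\<forall>z\<in>ball 0 1. (\<lambda>k. a (k + 3) * z ^ (k + 3)) sums (x \<alpha> z - z ^ 2)"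
    "\<forall>z\<in>ball 0 1. (\<lambda>k. b (k + 2) * z ^ (k + 2)) sums (y \<alpha> z - z)"
    "\<forall>z\<in>ball 0 1 - {0}. card {w \<in> ball 0 1. x \<alpha> w = x \<alpha> z} = 2"
    using sc \<alpha> unfolding spectral_curve_def by blast
  then obtain P q \<psi> \<chi> Q where c: "local_curve P q \<psi>" "\<chi> has_fps_expansion Q" "Q $ 0 = 0" "Q $ Suc 0 = 1"
    "\<forall>\<^sub>F z in nhds 0. \<psi> (\<chi> z) = z" "\<forall>\<^sub>F t in nhds 0. x \<alpha> (\<psi> t) = t\<^sup>2" "\<forall>\<^sub>F t in nhds 0. deck (x \<alpha>) (\<psi> t) = \<psi> (- t)"
    "(\<lambda>t. inverse (2 * t * (y \<alpha> (\<psi> t) - y \<alpha> (\<psi> (- t))))) has_laurent_expansion q"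
    and X: "\<exists>X. x \<alpha> has_fps_expansion X"
    by (rule curve_exists)
  obtain X where X: "x \<alpha> has_fps_expansion X" using X by blast
  note tr = topological_recursion_disc[where x = x and y = y and h = h and \<alpha> = \<alpha>, OF c X]
  note correlator = local_curve.meromorphic_correlator[OF c(1)] local_curve.correlator_symmetric[OF c(1)] local_curve.correlator_02[OF c(1)]
  have "disc_solution x y h \<alpha> (local_curve.correlator P q)"
    unfolding disc_solution_def by (intro conjI allI impI) (rule correlator tr; assumption)+
  then show ?thesis by blast
qed

lemma topological_recursion_exists:
  assumes sc: "spectral_curve r x y h"
  obtains W where "topological_recursion r x y h W" "symmetric_forms r W"
    "\<And>\<alpha> z1 z2. \<alpha> \<in> {1..r} \<Longrightarrow> W 0 \<alpha> [z1, z2] = 1 / (z1 - z2)\<^sup>2"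
proof -
  have "\<forall>\<alpha>\<in>{1..r}. \<exists>W. disc_solution x y h \<alpha> W" using disc_solution_exists[OF sc] by blast
  from bchoice[OF this] obtain V where *: "\<And>\<alpha>. \<alpha> \<in> {1..r} \<Longrightarrow> disc_solution x y h \<alpha> (V \<alpha>)" by blast
  have V:
    "\<And>\<alpha> g n. \<alpha> \<in> {1..r} \<Longrightarrow> stable g n \<or> (g, n) = (0, 2) \<Longrightarrow> meromorphic_several (\<lambda>c. c) n (V \<alpha> g)"
    "\<And>\<alpha> g zs zs'. \<alpha> \<in> {1..r} \<Longrightarrow> mset zs = mset zs' \<Longrightarrow> V \<alpha> g zs = V \<alpha> g zs'"
    "\<And>\<alpha> z1 z2. \<alpha> \<in> {1..r} \<Longrightarrow> V \<alpha> 0 [z1, z2] = 1 / (z1 - z2)\<^sup>2"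
    "\<And>\<alpha> g z1 zs. \<alpha> \<in> {1..r} \<Longrightarrow> stable g (Suc (length zs)) \<Longrightarrow> z1 \<noteq> 0 \<Longrightarrow> 0 \<notin> set zs \<Longrightarrow> \<forall>\<^sub>F \<rho> in at_right 0.
     ((\<lambda>z. recursion_kernel x y h \<alpha> \<alpha> z z1 * (bracket (V \<alpha>) g z (deck (x \<alpha>) z) zs * deriv (deck (x \<alpha>)) z))
        has_contour_integral 2 * pi * \<i> * V \<alpha> g (z1 # zs)) (circlepath 0 \<rho>)"
    by (rule *[unfolded disc_solution_def, THEN conjunct1, rule_format]
          *[unfolded disc_solution_def, THEN conjunct2, THEN conjunct1, rule_format]
          *[unfolded disc_solution_def, THEN conjunct2, THEN conjunct2, THEN conjunct1, rule_format]
          *[unfolded disc_solution_def, THEN conjunct2, THEN conjunct2, THEN conjunct2, rule_format]; assumption)+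
  define W where "W g \<alpha> = V \<alpha> g" for g \<alpha>
  have "topological_recursion r x y h W"
    unfolding topological_recursion_def
  proof (intro conjI allI ballI impI)
    fix g n \<beta> assume "\<beta> \<in> {1..r}" "stable g n \<or> (g, n) = (0, 2)"
    then show "meromorphic_several (\<lambda>c. c) n (W g \<beta>)" unfolding W_def by (rule V)
  next
    fix g n \<beta> assume \<beta>: "\<beta> \<in> {1..r}" and st: "stable g n"
    show "generically n (\<lambda>zs. \<exists>I. (\<forall>\<alpha>\<in>{1..r}. \<forall>\<^sub>F \<rho> in at_right 0.
             ((\<lambda>z. recursion_kernel x y h \<alpha> \<beta> z (hd zs) *
                    (bracket (\<lambda>g. W g \<alpha>) g z (deck (x \<alpha>) z) (tl zs) * deriv (deck (x \<alpha>)) z))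
               has_contour_integral I \<alpha>) (circlepath 0 \<rho>)) \<and>
          W g \<beta> zs = 1 / (2 * pi * \<i>) * (\<Sum>\<alpha>\<in>{1..r}. I \<alpha>))"
    proof (rule generically_mono[OF generically_nonzero])
      fix zs :: "complex list" assume zs: "zs \<in> disc_power n" "0 \<notin> set zs"
      obtain z1 zs' where z: "zs = z1 # zs'" using zs st by (cases zs) (auto simp: disc_power_def stable_def)
      have st': "stable g (Suc (length zs'))" using st zs z by (simp add: disc_power_def)
      \<comment> \<open>The kernel vanishes for \<alpha> \<noteq> \<beta>, so the integral on the
        disc \<beta> carries the whole value.\<close>
      let ?I = "\<lambda>\<alpha>. if \<alpha> = \<beta> then 2 * pi * \<i> * W g \<beta> zs else 0"
      have "\<forall>\<^sub>F \<rho> in at_right 0. ((\<lambda>z. recursion_kernel x y h \<alpha> \<beta> z (hd zs) *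
                    (bracket (\<lambda>g. W g \<alpha>) g z (deck (x \<alpha>) z) (tl zs) * deriv (deck (x \<alpha>)) z))
               has_contour_integral ?I \<alpha>) (circlepath 0 \<rho>)" if "\<alpha> \<in> {1..r}" for \<alpha>
      proof (cases "\<alpha> = \<beta>")
        case True
        then show ?thesis using V(4)[OF \<beta> st', of z1] zs by (simp add: z W_def)
      next
        case False
        then show ?thesis by (simp add: recursion_kernel_def has_contour_integral_0)
      qed
      moreover have "W g \<beta> zs = 1 / (2 * pi * \<i>) * (\<Sum>\<alpha>\<in>{1..r}. ?I \<alpha>)" using \<beta> by simp
      ultimately show "\<exists>I. (\<forall>\<alpha>\<in>{1..r}. \<forall>\<^sub>F \<rho> in at_right 0.
             ((\<lambda>z. recursion_kernel x y h \<alpha> \<beta> z (hd zs) *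
                    (bracket (\<lambda>g. W g \<alpha>) g z (deck (x \<alpha>) z) (tl zs) * deriv (deck (x \<alpha>)) z))
               has_contour_integral I \<alpha>) (circlepath 0 \<rho>)) \<and>
          W g \<beta> zs = 1 / (2 * pi * \<i>) * (\<Sum>\<alpha>\<in>{1..r}. I \<alpha>)" by (intro exI[of _ ?I] conjI ballI)
    qed
  qed
  moreover have "symmetric_forms r W" unfolding symmetric_forms_def W_def using V(2) by blast
  moreover have "W 0 \<alpha> [z1, z2] = 1 / (z1 - z2)\<^sup>2" if "\<alpha> \<in> {1..r}" for \<alpha> z1 z2
    using V(3)[OF that] by (simp add: W_def)
  ultimately show ?thesis using that by blast
qed

lemma has_coeff_contour_integral_const_mult:
  assumes "(f has_contour_integral I) \<gamma>"
  shows "has_coeff_contour_integral emb (\<lambda>z. emb (f z) * k) (emb I * k) \<gamma>"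
  unfolding has_coeff_contour_integral_def
  by (auto simp: coeff_functionalD intro: has_contour_integral_rmul[OF assms])

lemma (in frobenius_algebra) twisted_topological_recursion_tqft_form:
  assumes emb: "is_ring_hom emb" and \<iota>: "is_ring_hom \<iota>" and W: "topological_recursion r x y h W"
  shows "twisted_topological_recursion smul B eps emb \<iota> r x y h (\<lambda>g \<alpha> zs vs. emb (W g \<alpha> zs) * \<iota> (tqft_form g vs))"
  unfolding twisted_topological_recursion_def
proof (intro conjI allI ballI impI)
  fix g n \<beta> and vs :: "'a list" assume "\<beta> \<in> {1..r}" "stable g n \<or> (g, n) = (0, 2)"
  then have "meromorphic_several (\<lambda>c. c) n (W g \<beta>)" using W unfolding topological_recursion_def by blast
  then show "meromorphic_several emb n (\<lambda>zs. emb (W g \<beta> zs) * \<iota> (tqft_form g vs))"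
    by (rule meromorphic_several_const_mult[OF emb])
next
  fix g n \<beta> zs
  show "multilinear_form smul (\<lambda>c l. \<iota> c * l) n (\<lambda>vs. emb (W g \<beta> zs) * \<iota> (tqft_form g vs))"
    by (rule multilinear_scaled_tqft_form[OF \<iota>])
next
  fix g n \<beta> and vs :: "'a list" assume \<beta>: "\<beta> \<in> {1..r}" and st: "stable g n" and len: "length vs = n"
  let ?f = "\<lambda>zs \<alpha> z. recursion_kernel x y h \<alpha> \<beta> z (hd zs) *
                    (bracket (\<lambda>g. W g \<alpha>) g z (deck (x \<alpha>) z) (tl zs) * deriv (deck (x \<alpha>)) z)"
  let ?F = "\<lambda>zs \<alpha> z. \<Sum>a\<in>B. \<Sum>b\<in>B. \<Sum>k\<in>B. \<Sum>l\<in>B.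
                  emb (recursion_kernel x y h \<alpha> \<beta> z (hd zs)) *
                  \<iota> (frob_form eps (k * l) (hd vs) * frob_inv B eps k a * frob_inv B eps l b) *
                  (twisted_bracket (\<lambda>g zs vs. emb (W g \<alpha> zs) * \<iota> (tqft_form g vs)) g z (deck (x \<alpha>) z) (tl zs) a b (tl vs) *
                   emb (deriv (deck (x \<alpha>)) z))"
  obtain v vs' where vs: "vs = v # vs'" using len st by (cases vs) (auto simp: stable_def)
  have "generically n (\<lambda>zs. \<exists>I. (\<forall>\<alpha>\<in>{1..r}. \<forall>\<^sub>F \<rho> in at_right 0. (?f zs \<alpha> has_contour_integral I \<alpha>) (circlepath 0 \<rho>)) \<and>
          W g \<beta> zs = 1 / (2 * pi * \<i>) * (\<Sum>\<alpha>\<in>{1..r}. I \<alpha>))"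
    using W \<beta> st unfolding topological_recursion_def by blast
  then show "generically n (\<lambda>zs. \<exists>I. (\<forall>\<alpha>\<in>{1..r}. \<forall>\<^sub>F \<rho> in at_right 0. has_coeff_contour_integral emb (?F zs \<alpha>) (I \<alpha>) (circlepath 0 \<rho>)) \<and>
          emb (W g \<beta> zs) * \<iota> (tqft_form g vs) = emb (1 / (2 * pi * \<i>)) * (\<Sum>\<alpha>\<in>{1..r}. I \<alpha>))"
  proof (rule generically_mono, elim exE conjE)
    fix zs I assume zs: "zs \<in> disc_power n"
      and I: "\<forall>\<alpha>\<in>{1..r}. \<forall>\<^sub>F \<rho> in at_right 0. (?f zs \<alpha> has_contour_integral I \<alpha>) (circlepath 0 \<rho>)"
      and Wz: "W g \<beta> zs = 1 / (2 * pi * \<i>) * (\<Sum>\<alpha>\<in>{1..r}. I \<alpha>)"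
    have l: "length vs' = length (tl zs)" using zs len vs by (simp add: disc_power_def)
    \<comment> \<open>After contraction the integrand is the scalar one times a fixed element of the
      coefficient ring, so the integral reduces to a complex one.\<close>
    have F: "?F zs \<alpha> z = emb (?f zs \<alpha> z) * \<iota> (tqft_form g vs)" for \<alpha> z
    proof -
      let ?tb = "twisted_bracket (\<lambda>g zs vs. emb (W g \<alpha> zs) * \<iota> (tqft_form g vs)) g z (deck (x \<alpha>) z) (tl zs)"
      have "?F zs \<alpha> z = emb (recursion_kernel x y h \<alpha> \<beta> z (hd zs)) * emb (deriv (deck (x \<alpha>)) z) *
          (\<Sum>a\<in>B. \<Sum>b\<in>B. \<Sum>k\<in>B. \<Sum>l\<in>B. \<iota> (frob_form eps (k * l) v * frob_inv B eps k a * frob_inv B eps l b) * ?tb a b vs')"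
        unfolding sum_distrib_left vs list.sel by (intro sum.cong refl) (simp only: mult_ac)
      also have "\<dots> = emb (?f zs \<alpha> z) * \<iota> (tqft_form g vs)"
        unfolding twisted_bracket_tqft_form[OF emb \<iota> l, of v "\<lambda>g. W g \<alpha>"] by (simp add: is_ring_homD[OF emb] vs mult_ac)
      finally show ?thesis .
    qed
    have "\<forall>\<^sub>F \<rho> in at_right 0. has_coeff_contour_integral emb (?F zs \<alpha>) (emb (I \<alpha>) * \<iota> (tqft_form g vs)) (circlepath 0 \<rho>)"
      if "\<alpha> \<in> {1..r}" for \<alpha>
      using bspec[OF I that] unfolding F by eventually_elim (rule has_coeff_contour_integral_const_mult)
    moreover have "emb (W g \<beta> zs) * \<iota> (tqft_form g vs) = emb (1 / (2 * pi * \<i>)) * (\<Sum>\<alpha>\<in>{1..r}. emb (I \<alpha>) * \<iota> (tqft_form g vs))"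
      unfolding Wz by (simp only: is_ring_homD[OF emb] is_ring_hom_sum[OF emb] sum_distrib_right mult.assoc)
    ultimately show "\<exists>I. (\<forall>\<alpha>\<in>{1..r}. \<forall>\<^sub>F \<rho> in at_right 0. has_coeff_contour_integral emb (?F zs \<alpha>) (I \<alpha>) (circlepath 0 \<rho>)) \<and>
          emb (W g \<beta> zs) * \<iota> (tqft_form g vs) = emb (1 / (2 * pi * \<i>)) * (\<Sum>\<alpha>\<in>{1..r}. I \<alpha>)"
      by (intro exI[of _ "\<lambda>\<alpha>. emb (I \<alpha>) * \<iota> (tqft_form g vs)"] conjI ballI)
  qed
qed

theorem theorem6p3:
  fixes smul :: "'k::field_char_0 \<Rightarrow> 'a::comm_ring_1 \<Rightarrow> 'a"
    and B :: "'a set"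
    and eps :: "'a \<Rightarrow> 'k"
    and emb :: "complex \<Rightarrow> 'l::comm_ring_1"
    and \<iota> :: "'k \<Rightarrow> 'l"
    and r :: nat
    and x y h :: "nat \<Rightarrow> complex \<Rightarrow> complex"
  assumes "frobenius_algebra smul B eps"
    and "is_ring_hom emb" and "is_ring_hom \<iota>"
    and "spectral_curve r x y h"
  shows
    "(\<forall>\<W> \<W>'. twisted_topological_recursion smul B eps emb \<iota> r x y h \<W> \<longrightarrow>
        twisted_topological_recursion smul B eps emb \<iota> r x y h \<W>' \<longrightarrow>
        (\<forall>\<alpha>\<in>{1..r}. \<forall>zs\<in>disc_power 2. \<forall>vs. length vs = 2 \<longrightarrow> \<W> 0 \<alpha> zs vs = \<W>' 0 \<alpha> zs vs) \<longrightarrow>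
        (\<forall>g n. stable g n \<longrightarrow>
           (\<forall>\<alpha>\<in>{1..r}. \<forall>zs\<in>disc_power n. \<forall>vs. length vs = n \<longrightarrow> \<W> g \<alpha> zs vs = \<W>' g \<alpha> zs vs)))
     \<and>
     (\<exists>W \<omega>.
        topological_recursion r x y h W \<and> symmetric_forms r W \<and>
        (\<forall>\<alpha>\<in>{1..r}. \<forall>b\<in>ball 0 1. \<forall>z1\<in>ball 0 1. \<forall>z2\<in>ball 0 1. z1 \<noteq> z2 \<longrightarrow>
           W 0 \<alpha> [z1, z2] = W02 (h \<alpha>) b z1 z2) \<and>
        tqft smul B eps \<omega> \<and>
        twisted_topological_recursion smul B eps emb \<iota> r x y h
          (\<lambda>g \<alpha> zs vs. emb (W g \<alpha> zs) * \<iota> (\<omega> g vs)) \<and>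
        (\<forall>\<W>. twisted_topological_recursion smul B eps emb \<iota> r x y h \<W> \<longrightarrow>
           (\<forall>\<alpha>\<in>{1..r}. \<forall>b\<in>ball 0 1. \<forall>z1\<in>ball 0 1. \<forall>z2\<in>ball 0 1. z1 \<noteq> z2 \<longrightarrow> (\<forall>v1 v2.
              \<W> 0 \<alpha> [z1, z2] [v1, v2] = emb (W02 (h \<alpha>) b z1 z2) * \<iota> (frob_form eps v1 v2))) \<longrightarrow>
           (\<forall>g n. stable g n \<or> (g, n) = (0, 2) \<longrightarrow>
              (\<forall>\<alpha>\<in>{1..r}. \<forall>zs\<in>disc_power n. \<forall>vs. length vs = n \<longrightarrow>
                 \<W> g \<alpha> zs vs = emb (W g \<alpha> zs) * \<iota> (\<omega> g vs)))))"
proof -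
  interpret frobenius_algebra smul B eps by (rule assms(1))
  note emb = assms(2) and \<iota> = assms(3) and sc = assms(4)
  obtain W where W: "topological_recursion r x y h W" "symmetric_forms r W"
    and W0: "\<And>\<alpha> z1 z2. \<alpha> \<in> {1..r} \<Longrightarrow> W 0 \<alpha> [z1, z2] = 1 / (z1 - z2)\<^sup>2"
    using topological_recursion_exists[OF sc] by blast
  let ?U = "\<lambda>g \<alpha> zs vs. emb (W g \<alpha> zs) * \<iota> (tqft_form g vs)"
  have U: "twisted_topological_recursion smul B eps emb \<iota> r x y h ?U"
    by (rule twisted_topological_recursion_tqft_form[OF emb \<iota> W(1)])
  have W02: "W 0 \<alpha> [z1, z2] = W02 (h \<alpha>) b z1 z2" if "\<alpha> \<in> {1..r}" "z1 \<noteq> z2" for \<alpha> z1 z2 b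
    using W0[OF that(1)] W02_eq[OF that(2)] by simp
  have T: "\<W> g \<alpha> zs vs = ?U g \<alpha> zs vs"
    if \<W>: "twisted_topological_recursion smul B eps emb \<iota> r x y h \<W>"
      and init: "\<forall>\<alpha>\<in>{1..r}. \<forall>b\<in>ball 0 1. \<forall>z1\<in>ball 0 1. \<forall>z2\<in>ball 0 1. z1 \<noteq> z2 \<longrightarrow> (\<forall>v1 v2.
              \<W> 0 \<alpha> [z1, z2] [v1, v2] = emb (W02 (h \<alpha>) b z1 z2) * \<iota> (frob_form eps v1 v2))"
      and st: "stable g n \<or> (g, n) = (0, 2)" and zs: "\<alpha> \<in> {1..r}" "zs \<in> disc_power n" "length vs = n"
    for \<W> g n \<alpha> zs vs
  proof -
    \<comment> \<open>The initial data are prescribed off the diagonal; the values on it follow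
      because normalised meromorphic functions that agree generically are equal.\<close>
    have eq02: "\<W> 0 \<alpha> zs vs = ?U 0 \<alpha> zs vs" if \<alpha>: "\<alpha> \<in> {1..r}" and zs: "zs \<in> disc_power 2" and vs: "length vs = 2" for \<alpha> zs vs
    proof (rule meromorphic_several_eqI[OF emb _ _ _ zs])
      show "meromorphic_several emb 2 (\<lambda>zs. \<W> 0 \<alpha> zs vs)"
        using \<W> \<alpha> vs unfolding twisted_topological_recursion_def by blast
      show "meromorphic_several emb 2 (\<lambda>zs. ?U 0 \<alpha> zs vs)"
        using U \<alpha> vs unfolding twisted_topological_recursion_def by blast
      obtain v1 v2 where v: "vs = [v1, v2]" using vs by (auto simp: length_Suc_conv numeral_2_eq_2)
      show "generically 2 (\<lambda>zs. \<W> 0 \<alpha> zs vs = ?U 0 \<alpha> zs vs)"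
      proof (rule generically_mono[OF generically_off_diagonal])
        fix zs :: "complex list" assume zs: "zs \<in> disc_power 2" "zs ! 0 \<noteq> zs ! 1"
        then obtain z1 z2 where z: "zs = [z1, z2]" "z1 \<in> ball 0 1" "z2 \<in> ball 0 1" "z1 \<noteq> z2"
          by (auto simp: disc_power_def length_Suc_conv numeral_2_eq_2)
        have "(0 :: complex) \<in> ball 0 1" by simp
        then have "\<W> 0 \<alpha> zs vs = emb (W02 (h \<alpha>) 0 z1 z2) * \<iota> (frob_form eps v1 v2)" using init \<alpha> z v by blast
        also have "\<dots> = ?U 0 \<alpha> zs vs" using W02[OF \<alpha> z(4), of 0] by (simp add: z v tqft_form_def frob_form_def)
        finally show "\<W> 0 \<alpha> zs vs = ?U 0 \<alpha> zs vs" .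
      qed
    qed
    from st show ?thesis
    proof
      assume st: "stable g n"
      show ?thesis by (rule twisted_topological_recursion_unique[OF emb sc \<W> U eq02 st zs])
    next
      assume "(g, n) = (0, 2)" then show ?thesis using eq02 zs by simp
    qed
  qed
  show ?thesis
  proof (intro conjI)
    show "\<forall>\<W> \<W>'. twisted_topological_recursion smul B eps emb \<iota> r x y h \<W> \<longrightarrow>
        twisted_topological_recursion smul B eps emb \<iota> r x y h \<W>' \<longrightarrow>
        (\<forall>\<alpha>\<in>{1..r}. \<forall>zs\<in>disc_power 2. \<forall>vs. length vs = 2 \<longrightarrow> \<W> 0 \<alpha> zs vs = \<W>' 0 \<alpha> zs vs) \<longrightarrow>
        (\<forall>g n. stable g n \<longrightarrow>
           (\<forall>\<alpha>\<in>{1..r}. \<forall>zs\<in>disc_power n. \<forall>vs. length vs = n \<longrightarrow> \<W> g \<alpha> zs vs = \<W>' g \<alpha> zs vs))"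
    proof (intro allI impI ballI)
      fix \<W> \<W>' g n \<alpha> zs and vs :: "'a list"
      assume "twisted_topological_recursion smul B eps emb \<iota> r x y h \<W>" "twisted_topological_recursion smul B eps emb \<iota> r x y h \<W>'"
        and init: "\<forall>\<alpha>\<in>{1..r}. \<forall>zs\<in>disc_power 2. \<forall>vs. length vs = 2 \<longrightarrow> \<W> 0 \<alpha> zs vs = \<W>' 0 \<alpha> zs vs"
        and "stable g n" "\<alpha> \<in> {1..r}" "zs \<in> disc_power n" "length vs = n"
      then show "\<W> g \<alpha> zs vs = \<W>' g \<alpha> zs vs"
        using twisted_topological_recursion_unique[OF emb sc, of smul B eps \<iota> \<W> \<W>' g n \<alpha> zs vs] by blast
    qed
  next
    show "\<exists>W \<omega>. topological_recursion r x y h W \<and> symmetric_forms r W \<and>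
        (\<forall>\<alpha>\<in>{1..r}. \<forall>b\<in>ball 0 1. \<forall>z1\<in>ball 0 1. \<forall>z2\<in>ball 0 1. z1 \<noteq> z2 \<longrightarrow>
           W 0 \<alpha> [z1, z2] = W02 (h \<alpha>) b z1 z2) \<and>
        tqft smul B eps \<omega> \<and>
        twisted_topological_recursion smul B eps emb \<iota> r x y h
          (\<lambda>g \<alpha> zs vs. emb (W g \<alpha> zs) * \<iota> (\<omega> g vs)) \<and>
        (\<forall>\<W>. twisted_topological_recursion smul B eps emb \<iota> r x y h \<W> \<longrightarrow>
           (\<forall>\<alpha>\<in>{1..r}. \<forall>b\<in>ball 0 1. \<forall>z1\<in>ball 0 1. \<forall>z2\<in>ball 0 1. z1 \<noteq> z2 \<longrightarrow> (\<forall>v1 v2.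
              \<W> 0 \<alpha> [z1, z2] [v1, v2] = emb (W02 (h \<alpha>) b z1 z2) * \<iota> (frob_form eps v1 v2))) \<longrightarrow>
           (\<forall>g n. stable g n \<or> (g, n) = (0, 2) \<longrightarrow>
              (\<forall>\<alpha>\<in>{1..r}. \<forall>zs\<in>disc_power n. \<forall>vs. length vs = n \<longrightarrow>
                 \<W> g \<alpha> zs vs = emb (W g \<alpha> zs) * \<iota> (\<omega> g vs))))"
      using W U W02 tqft_tqft_form T by (intro exI[of _ W] exI[of _ tqft_form] conjI ballI allI impI) blast+
  qed
qed

end
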